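(* Let $\Gamma$ be a locally finite, connected graph and let $H\le\mathrm{Aut}(\Gamma)$ be closed, non-discrete and locally semiprimitive. Then: (i) $H^{(\infty)}$ is minimal closed normal cocompact in $H$; (ii) $\mathrm{QZ}(H)$ is maximal discrete normal, and non-cocompact, in $H$; (iii) $H^{(\infty)}/\mathrm{QZ}(H^{(\infty)})=H^{(\infty)}/(\mathrm{QZ}(H)\cap H^{(\infty)})$ admits minimal non-trivial closed normal subgroups; they are finite in number, $H$-conjugate and topologically simple. If $\Gamma$ is a tree and, in addition, $H$ is locally primitive, then (iv) $H^{(\infty)}/\mathrm{QZ}(H^{(\infty)})$ is a direct product of topologically simple groups.
   Context: Graphs are in the sense of Serre: $\Gamma=(V,E)$ has a vertex set $V$, a set $E$ of oriented edges with a fixed-point-free involution $e\mapsto\overline{e}$, and origin and terminus maps $o,t:E\to V$ with $o(\overline e)=t(e)$, $t(\overline e)=o(e)$. For $x\in V$, $E(x)=\{e\in E\mid o(e)=x\}$. The group $\mathrm{Aut}(\Gamma)$ carries the permutation topology for its action on $V\cup E$ (basic open sets $\{h\mid h(x_i)=y_i,\ 1\le i\le n\}$ for finitely many $x_i,y_i\in V\cup E$), for which it is totally disconnected and locally compact. For $H\le\mathrm{Aut}(\Gamma)$ and $x\in V$, let $H_x^{(1)}\le\mathrm{Sym}(E(x))$ be the permutation group induced by the stabilizer $H_x$ on $E(x)$; $H$ is locally "X" if $H_x^{(1)}$ has property "X" for every $x\in V$. A permutation group is semiprimitive if it is transitive and each of its normal subgroups is either transitive or semiregular (all point stabilizers trivial);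 it is primitive if it is transitive and preserves no non-trivial partition. For a totally disconnected locally compact group $H$, put $H^{(\infty)}:=\bigcap\{N\unlhd H\mid N\text{ closed and cocompact in }H\}$, and let $\mathrm{QZ}(H):=\{h\in H\mid Z_H(h)\text{ is open in }H\}$ be the quasi-center of $H$; both are topologically characteristic subgroups of $H$. "Minimal closed normal cocompact in $H$" means minimal among the closed normal cocompact subgroups of $H$, and "maximal discrete normal" means maximal among the discrete normal subgroups of $H$. *)

theory Defs
  imports
    "HOL-Analysis.Analysis"
    "HOL-Algebra.Group_Action"
    "HOL-Algebra.Product_Groups"
    "Graph_Theory.Graph_Theory"
begin

section \<open>Groups carrying a topology\<close>

record 'a topgroup = "'a monoid" +
  topo :: "'a topology"

definition topological_group :: "('a, 'b) topgroup_scheme \<Rightarrow> bool" where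
  "topological_group G \<longleftrightarrow>
     group G \<and> topspace (topo G) = carrier G \<and>
     continuous_map (prod_topology (topo G) (topo G)) (topo G) (\<lambda>(x, y). x \<otimes>\<^bsub>G\<^esub> y) \<and>
     continuous_map (topo G) (topo G) (m_inv G)"

definition top_subgroup :: "('a, 'b) topgroup_scheme \<Rightarrow> 'a set \<Rightarrow> ('a, 'b) topgroup_scheme" where
  "top_subgroup G N = G\<lparr>carrier := N, topo := subtopology (topo G) N\<rparr>"

text \<open>The quotient topology for the projection \<open>g \<mapsto> N #> g\<close> from \<open>G\<close> to \<open>rcosets N\<close>.\<close>

definition coset_topology :: "('a, 'b) topgroup_scheme \<Rightarrow> 'a set \<Rightarrow> 'a set topology" where
  "coset_topology G N = topology (\<lambda>U. U \<subseteq> rcosets\<^bsub>G\<^esub> N \<and>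
     openin (topo G) {g \<in> carrier G. N #>\<^bsub>G\<^esub> g \<in> U})"

lemma openin_coset_topology:
  assumes "topspace (topo G) = carrier G"
  shows "openin (coset_topology G N) U \<longleftrightarrow>
     U \<subseteq> rcosets\<^bsub>G\<^esub> N \<and> openin (topo G) {g \<in> carrier G. N #>\<^bsub>G\<^esub> g \<in> U}"
proof -
  let ?P = "\<lambda>U. U \<subseteq> rcosets\<^bsub>G\<^esub> N \<and> openin (topo G) {g \<in> carrier G. N #>\<^bsub>G\<^esub> g \<in> U}"
  have "istopology ?P"
    unfolding istopology_def
  proof (intro conjI allI impI)
    fix S T assume ST: "?P S" "?P T"
    have "{g \<in> carrier G. N #>\<^bsub>G\<^esub> g \<in> S \<inter> T} =
        {g \<in> carrier G. N #>\<^bsub>G\<^esub> g \<in> S} \<inter> {g \<in> carrier G. N #>\<^bsub>G\<^esub> g \<in> T}" by blast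
    with ST show "openin (topo G) {g \<in> carrier G. N #>\<^bsub>G\<^esub> g \<in> S \<inter> T}" by auto
    from ST show "S \<inter> T \<subseteq> rcosets\<^bsub>G\<^esub> N" by blast
  next
    fix \<K> assume K: "\<forall>S\<in>\<K>. ?P S"
    have "{g \<in> carrier G. N #>\<^bsub>G\<^esub> g \<in> \<Union>\<K>} = (\<Union>S\<in>\<K>. {g \<in> carrier G. N #>\<^bsub>G\<^esub> g \<in> S})" by blast
    with K show "openin (topo G) {g \<in> carrier G. N #>\<^bsub>G\<^esub> g \<in> \<Union>\<K>}" by auto
    from K show "\<Union>\<K> \<subseteq> rcosets\<^bsub>G\<^esub> N" by blast
  qed
  then show ?thesis
    by (simp add: coset_topology_def topology_inverse')
qed

definition top_quotient :: "('a, 'b) topgroup_scheme \<Rightarrow> 'a set \<Rightarrow> 'a set topgroup" where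
  "top_quotient G N =
     \<lparr>carrier = carrier (G Mod N), mult = mult (G Mod N), one = one (G Mod N),
      topo = coset_topology G N\<rparr>"

definition top_product :: "'i set \<Rightarrow> ('i \<Rightarrow> 'a topgroup) \<Rightarrow> ('i \<Rightarrow> 'a) topgroup" where
  "top_product I L =
     \<lparr>carrier = carrier (product_group I L), mult = mult (product_group I L),
      one = one (product_group I L), topo = product_topology (\<lambda>i. topo (L i)) I\<rparr>"

definition top_isomorphic :: "('a, 'c) topgroup_scheme \<Rightarrow> ('b, 'd) topgroup_scheme \<Rightarrow> bool" where
  "top_isomorphic G K \<longleftrightarrow> (\<exists>\<phi>\<in>iso G K. homeomorphic_map (topo G) (topo K) \<phi>)"

definition cocompact_in :: "('a, 'b) topgroup_scheme \<Rightarrow> 'a set \<Rightarrow> bool" where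
  "cocompact_in G N \<longleftrightarrow> compact_space (coset_topology G N)"

definition discrete_in :: "('a, 'b) topgroup_scheme \<Rightarrow> 'a set \<Rightarrow> bool" where
  "discrete_in G N \<longleftrightarrow> subtopology (topo G) N = discrete_topology N"

definition closed_normal_cocompact :: "('a, 'b) topgroup_scheme \<Rightarrow> 'a set set" where
  "closed_normal_cocompact G = {N. N \<lhd> G \<and> closedin (topo G) N \<and> cocompact_in G N}"

definition discrete_normal :: "('a, 'b) topgroup_scheme \<Rightarrow> 'a set set" where
  "discrete_normal G = {N. N \<lhd> G \<and> discrete_in G N}"

definition nontrivial_closed_normal :: "('a, 'b) topgroup_scheme \<Rightarrow> 'a set set" where
  "nontrivial_closed_normal G = {N. N \<lhd> G \<and> closedin (topo G) N \<and> N \<noteq> {\<one>\<^bsub>G\<^esub>}}"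

definition minimal_in :: "'a set set \<Rightarrow> 'a set \<Rightarrow> bool" where
  "minimal_in \<A> M \<longleftrightarrow> M \<in> \<A> \<and> (\<forall>N\<in>\<A>. N \<subseteq> M \<longrightarrow> N = M)"

definition maximal_in :: "'a set set \<Rightarrow> 'a set \<Rightarrow> bool" where
  "maximal_in \<A> M \<longleftrightarrow> M \<in> \<A> \<and> (\<forall>N\<in>\<A>. M \<subseteq> N \<longrightarrow> N = M)"

text \<open>The group \<open>G\<^sup>(\<^sup>\<infinity>\<^sup>)\<close>.\<close>

definition cocompact_core :: "('a, 'b) topgroup_scheme \<Rightarrow> 'a set" where
  "cocompact_core G = \<Inter>(closed_normal_cocompact G)"

definition quasi_center :: "('a, 'b) topgroup_scheme \<Rightarrow> 'a set" where
  "quasi_center G =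
     {h \<in> carrier G. openin (topo G) {g \<in> carrier G. g \<otimes>\<^bsub>G\<^esub> h = h \<otimes>\<^bsub>G\<^esub> g}}"

definition topologically_simple :: "('a, 'b) topgroup_scheme \<Rightarrow> bool" where
  "topologically_simple G \<longleftrightarrow>
     topological_group G \<and> carrier G \<noteq> {\<one>\<^bsub>G\<^esub>} \<and>
     (\<forall>N. N \<lhd> G \<and> closedin (topo G) N \<longrightarrow> N = {\<one>\<^bsub>G\<^esub>} \<or> N = carrier G)"

text \<open>The index type and the element type of the factors lose no generality: the factors of a
  topological direct product decomposition of \<open>Q\<close> are isomorphic to their images in \<open>Q\<close>, and
  non-trivial factors can be indexed by these images.\<close>

definition product_of_topologically_simple :: "'a topgroup \<Rightarrow> bool" where
  "product_of_topologically_simple Q \<longleftrightarrow>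
     (\<exists>(I :: 'a set set) (L :: 'a set \<Rightarrow> 'a topgroup).
        (\<forall>i\<in>I. topologically_simple (L i)) \<and> top_isomorphic Q (top_product I L))"

section \<open>Permutation groups\<close>

definition perm_group :: "'a set \<Rightarrow> ('a \<Rightarrow> 'a) set \<Rightarrow> ('a \<Rightarrow> 'a) monoid" where
  "perm_group X P = (BijGroup X)\<lparr>carrier := P\<rparr>"

definition transitive_perms :: "'a set \<Rightarrow> ('a \<Rightarrow> 'a) set \<Rightarrow> bool" where
  "transitive_perms X P \<longleftrightarrow> transitive_action (perm_group X P) X (\<lambda>p. p)"

definition semiregular_perms :: "'a set \<Rightarrow> ('a \<Rightarrow> 'a) set \<Rightarrow> bool" where
  "semiregular_perms X P \<longleftrightarrow>
     (\<forall>x\<in>X. stabilizer (perm_group X P) (\<lambda>p. p) x = {\<one>\<^bsub>perm_group X P\<^esub>})"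

definition semiprimitive_perms :: "'a set \<Rightarrow> ('a \<Rightarrow> 'a) set \<Rightarrow> bool" where
  "semiprimitive_perms X P \<longleftrightarrow>
     transitive_perms X P \<and>
     (\<forall>N. N \<lhd> perm_group X P \<longrightarrow> transitive_perms X N \<or> semiregular_perms X N)"

definition primitive_perms :: "'a set \<Rightarrow> ('a \<Rightarrow> 'a) set \<Rightarrow> bool" where
  "primitive_perms X P \<longleftrightarrow>
     transitive_perms X P \<and>
     (\<forall>\<B>. partition_on X \<B> \<and> (\<forall>p\<in>P. \<forall>B\<in>\<B>. p ` B \<in> \<B>) \<longrightarrow>
        \<B> = {X} \<or> \<B> = (\<lambda>x. {x}) ` X)"

section \<open>Graphs in the sense of Serre and their automorphisms\<close>

text \<open>A graph in the sense of Serre is a \<^const>\<open>bidirected_digraph\<close> \<open>G\<close> together with the edge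
  inversion \<open>bar\<close>; \<^const>\<open>tail\<close> and \<^const>\<open>head\<close> are origin and terminus. Loops and multiple edges
  are allowed.

  \<^const>\<open>tree\<close> from the graph library is not usable here, as it counts the walk \<open>[e, bar e]\<close> as a
  cycle. A circuit of a graph in the sense of Serre is a cycle without backtracking; it may have
  length \<open>1\<close> (a loop) or \<open>2\<close> (a pair of parallel edges).\<close>

definition circuit :: "('v, 'e) pre_digraph \<Rightarrow> ('e \<Rightarrow> 'e) \<Rightarrow> 'e list \<Rightarrow> bool" where
  "circuit G bar p \<longleftrightarrow>
     pre_digraph.cycle G p \<and> (\<forall>i. Suc i < length p \<longrightarrow> p ! Suc i \<noteq> bar (p ! i))"

definition serre_tree :: "('v, 'e) pre_digraph \<Rightarrow> ('e \<Rightarrow> 'e) \<Rightarrow> bool" where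
  "serre_tree G bar \<longleftrightarrow>
     bidirected_digraph G bar \<and> Digraph_Component.connected G \<and> (\<nexists>p. circuit G bar p)"

definition locally_finite_graph :: "('v, 'e) pre_digraph \<Rightarrow> bool" where
  "locally_finite_graph G \<longleftrightarrow> (\<forall>x\<in>verts G. finite (out_arcs G x))"

text \<open>An automorphism is a permutation of the disjoint union of the vertex set and the edge set;
  like all elements of \<^const>\<open>Bij\<close> it is \<^const>\<open>undefined\<close> off this set.\<close>

definition vert_map :: "('v + 'e \<Rightarrow> 'v + 'e) \<Rightarrow> 'v \<Rightarrow> 'v" where
  "vert_map h x = projl (h (Inl x))"

definition arc_map :: "('v + 'e \<Rightarrow> 'v + 'e) \<Rightarrow> 'e \<Rightarrow> 'e" where
  "arc_map h e = projr (h (Inr e))"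

definition graph_auts :: "('v, 'e) pre_digraph \<Rightarrow> ('e \<Rightarrow> 'e) \<Rightarrow> ('v + 'e \<Rightarrow> 'v + 'e) set" where
  "graph_auts G bar =
     {h \<in> Bij (verts G <+> arcs G).
        h ` Inl ` verts G = Inl ` verts G \<and> h ` Inr ` arcs G = Inr ` arcs G \<and>
        (\<forall>e\<in>arcs G.
           tail G (arc_map h e) = vert_map h (tail G e) \<and>
           head G (arc_map h e) = vert_map h (head G e) \<and>
           arc_map h (bar e) = bar (arc_map h e))}"

definition permutation_topology :: "'a set \<Rightarrow> ('a \<Rightarrow> 'a) set \<Rightarrow> ('a \<Rightarrow> 'a) topology" where
  "permutation_topology X A =
     topology_generated_by {{h \<in> A. \<forall>(x, y)\<in>F. h x = y} | F. finite F \<and> F \<subseteq> X \<times> X}"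

definition Aut_graph :: "('v, 'e) pre_digraph \<Rightarrow> ('e \<Rightarrow> 'e) \<Rightarrow> ('v + 'e \<Rightarrow> 'v + 'e) topgroup" where
  "Aut_graph G bar =
     \<lparr>carrier = graph_auts G bar,
      mult = mult (BijGroup (verts G <+> arcs G)), one = one (BijGroup (verts G <+> arcs G)),
      topo = permutation_topology (verts G <+> arcs G) (graph_auts G bar)\<rparr>"

definition local_action ::
    "('v, 'e) pre_digraph \<Rightarrow> ('v + 'e \<Rightarrow> 'v + 'e) set \<Rightarrow> 'v \<Rightarrow> ('e \<Rightarrow> 'e) set" where
  "local_action G H x = (\<lambda>h. restrict (arc_map h) (out_arcs G x)) ` {h \<in> H. vert_map h x = x}"

definition locally_semiprimitive ::
    "('v, 'e) pre_digraph \<Rightarrow> ('v + 'e \<Rightarrow> 'v + 'e) set \<Rightarrow> bool" where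
  "locally_semiprimitive G H \<longleftrightarrow>
     (\<forall>x\<in>verts G. semiprimitive_perms (out_arcs G x) (local_action G H x))"

definition locally_primitive ::
    "('v, 'e) pre_digraph \<Rightarrow> ('v + 'e \<Rightarrow> 'v + 'e) set \<Rightarrow> bool" where
  "locally_primitive G H \<longleftrightarrow>
     (\<forall>x\<in>verts G. primitive_perms (out_arcs G x) (local_action G H x))"

end

theory Submission
  imports Defs
begin

text \<open>
  The group \<open>H\<close> is studied through the set \<open>\<Phi>\<close> (\<open>nonfree\<close>) of those elements that fix an arc and move
  another arc with the same origin. A subgroup that misses \<open>\<Phi>\<close> acts freely on the arcs: an element fixing
  an arc fixes the star of its origin, and connectedness spreads this to the whole graph. As arc
  stabilizers are open, such a subgroup is discrete. If a normal subgroup \<open>N\<close> meets \<open>\<Phi>\<close>, its local action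
  at some vertex is not semiregular, hence transitive by semiprimitivity; translates of a single star by
  \<open>N\<close> then cover the graph, and since vertex stabilizers are compact, \<open>N\<close> is cocompact. A cocompact normal
  subgroup in turn conjugates \<open>\<Phi>\<close> into a compact subset of \<open>\<Phi>\<close>, and it contains a finite set whose
  centralizer meets some neighborhood of the identity trivially. These four facts are the essential axioms
  of the locale \<open>locally_compact_dichotomy\<close>; all assertions on general \<open>\<Gamma>\<close> follow from them without further
  reference to the graph.

  First, an element of the quasi-center commutes with a neighborhood of the identity, so a cocompact
  normal subgroup inside the quasi-center would make the group discrete. Hence normal subgroups are
  either discrete or cocompact and never both, and the quasi-center is the largest discrete one. Two
  closed normal cocompact subgroups have a cocompact intersection, because a discrete intersection
  contains all their commutators. A compact set into which \<open>\<Phi>\<close> can be conjugated meets all of them, so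
  by the finite intersection property it meets their intersection \<open>L\<close>, the core, which is therefore
  itself cocompact (\<open>cocompact_core_closed_normal_cocompact\<close>).

  Secondly, put \<open>D = QZ(L) = QZ(H) \<inter> L\<close>. In \<open>Q = L/D\<close> there is a compact set that does not contain the
  identity and meets every non-trivial closed normal subgroup; the centre of \<open>Q\<close> is trivial; and a
  non-trivial closed normal subgroup invariant under \<open>H\<close> is all of \<open>Q\<close>, by minimality of \<open>L\<close>. The locale
  \<open>closed_normal_structure\<close> draws the conclusions: compactness feeds Zorn's lemma and yields minimal closed
  normal subgroups; distinct ones commute, so an orbit under \<open>H\<close> cannot be avoided by any of them, an
  infinite number of them would produce a non-trivial element centralizing all of them, and a closed
  normal subgroup of one of them is normal in \<open>Q\<close>.

  Thirdly, let \<open>\<Gamma>\<close> be a tree and \<open>H\<close> locally primitive, and let \<open>\<M>\<close> be the finite set of preimages in \<open>L\<close>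
  of the minimal closed normal subgroups of \<open>Q\<close>. Primitivity forces \<open>D\<close> to act freely on vertices, so
  for distinct \<open>M\<close>, \<open>M'\<close> in \<open>\<M>\<close> the stabilizers of a vertex in \<open>M\<close> and in \<open>M'\<close> commute exactly, and not
  merely modulo \<open>D\<close>. Arcs \<open>a\<close> and \<open>b\<close> with the same origin are of the same type if they have the same
  stabilizer in each \<open>M\<close>; by primitivity, the arcs at a vertex are either all of the same type, or
  pairwise of different types. Let \<open>N\<close> be generated by the stabilizers in the members of \<open>\<M>\<close> of the
  vertices of the second kind. A ping-pong argument on the tree shows that the stabilizer in \<open>N\<close> of an arc
  at such a vertex is generated by the stabilizers of this arc in the members of \<open>\<M>\<close>
  (\<open>split_part_arc_stab\<close>). It is thus a product of finitely many commuting compact groups, so \<open>N\<close> is closed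
  and contains \<open>L\<close>. Consequently the members of \<open>\<M>\<close> generate \<open>L\<close>, and an open compact subgroup of \<open>Q\<close>
  splits as a product of subgroups of the minimal closed normal subgroups. That makes the projections of
  \<open>Q\<close> onto the latter continuous (\<open>projection_continuous\<close>), and \<open>Q\<close> their topological direct product.
\<close>

section \<open>Topological groups\<close>

locale top_group =
  fixes G :: "('a, 'b) topgroup_scheme" (structure)
  assumes topological_group: "topological_group G"

sublocale top_group \<subseteq> group G
  using topological_group by (simp add: topological_group_def)

lemma top_subgroup_simps [simp]:
  "carrier (top_subgroup G N) = N" "mult (top_subgroup G N) = mult G" "one (top_subgroup G N) = one G"
  "topo (top_subgroup G N) = subtopology (topo G) N"
  by (simp_all add: top_subgroup_def)

lemma top_quotient_simps [simp]:
  "carrier (top_quotient G N) = rcosets\<^bsub>G\<^esub> N" "mult (top_quotient G N) = set_mult G"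
  "one (top_quotient G N) = N" "topo (top_quotient G N) = coset_topology G N"
  by (simp_all add: top_quotient_def FactGroup_def)

lemma (in group) mult_inv_cancel [simp]:
  assumes "g \<in> carrier G" "x \<in> carrier G"
  shows "g \<otimes> (inv g \<otimes> x) = x" "inv g \<otimes> (g \<otimes> x) = x"
  using assms by (simp_all add: m_assoc[symmetric])

lemma (in group) commute_mult:
  assumes "a \<in> carrier G" "b \<in> carrier G" "h \<in> carrier G" "a \<otimes> h = h \<otimes> a" "b \<otimes> h = h \<otimes> b"
  shows "a \<otimes> b \<otimes> h = h \<otimes> (a \<otimes> b)"
proof -
  have "a \<otimes> b \<otimes> h = a \<otimes> (b \<otimes> h)" using assms(1-3) by (rule m_assoc)
  also have "\<dots> = a \<otimes> h \<otimes> b" unfolding assms(5) using assms(1-3) by (simp add: m_assoc)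
  also have "\<dots> = h \<otimes> (a \<otimes> b)" unfolding assms(4) using assms(1-3) by (simp add: m_assoc)
  finally show ?thesis .
qed

lemma (in group) commute_inv:
  assumes "a \<in> carrier G" "h \<in> carrier G" "a \<otimes> h = h \<otimes> a"
  shows "inv a \<otimes> h = h \<otimes> inv a"
proof -
  have "inv a \<otimes> (a \<otimes> h) \<otimes> inv a = inv a \<otimes> (h \<otimes> a) \<otimes> inv a" by (simp only: assms(3))
  then show ?thesis using assms(1,2) by (simp add: m_assoc)
qed

context top_group
begin

lemma topspace_eq [simp]: "topspace (topo G) = carrier G"
  using topological_group by (simp add: topological_group_def)

lemma continuous_mult:
  assumes "continuous_map X (topo G) f" "continuous_map X (topo G) g"
  shows "continuous_map X (topo G) (\<lambda>x. f x \<otimes> g x)"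
proof -
  have "continuous_map X (topo G) ((\<lambda>(x, y). x \<otimes> y) \<circ> (\<lambda>x. (f x, g x)))"
    using topological_group assms
    by (intro continuous_map_compose[where X' = "prod_topology (topo G) (topo G)"])
       (auto simp: topological_group_def continuous_map_paired)
  then show ?thesis by (simp add: o_def)
qed

lemma continuous_inv:
  assumes "continuous_map X (topo G) f"
  shows "continuous_map X (topo G) (\<lambda>x. inv (f x))"
  using continuous_map_compose[OF assms, of "topo G" "m_inv G"] topological_group
  by (simp add: o_def topological_group_def)

lemma continuous_const:
  "g \<in> carrier G \<Longrightarrow> continuous_map X (topo G) (\<lambda>x. g)"
  by simp

lemmas continuous_group = continuous_mult continuous_inv continuous_const continuous_map_id[unfolded id_def]

lemma continuous_conj:
  assumes "g \<in> carrier G"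
  shows "continuous_map (topo G) (topo G) (\<lambda>x. g \<otimes> x \<otimes> inv g)"
  using assms by (intro continuous_group) auto

lemma openin_translate:
  assumes "g \<in> carrier G" "openin (topo G) U"
  shows "openin (topo G) {x \<in> carrier G. g \<otimes> x \<in> U}"
proof -
  have "continuous_map (topo G) (topo G) (\<lambda>x. g \<otimes> x)"
    using assms by (intro continuous_group) auto
  from openin_continuous_map_preimage[OF this assms(2)] show ?thesis by simp
qed

text \<open>
  \<open>H\<close> is the union of the translates of \<open>U \<inter> L\<close> by its own elements.
\<close>

lemma open_subgroup_if_neighborhood:
  assumes H: "subgroup H G" and U: "openin (topo G) U" "\<one> \<in> U" and sub: "U \<inter> L \<subseteq> H"
    and L: "subgroup L G" "H \<subseteq> L"
  shows "openin (subtopology (topo G) L) H"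
proof (subst openin_subopen, intro ballI)
  fix h assume h: "h \<in> H"
  have hG: "h \<in> carrier G" using H h by (rule subgroup.mem_carrier)
  let ?V = "{x \<in> carrier G. inv h \<otimes> x \<in> U}"
  have "openin (topo G) ?V"
    using openin_translate[of "inv h" U] hG U by simp
  then have "openin (subtopology (topo G) L) (?V \<inter> L)"
    by (auto simp: openin_subtopology)
  moreover have "h \<in> ?V \<inter> L" using hG U h L by auto
  moreover have "?V \<inter> L \<subseteq> H"
  proof
    fix x assume x: "x \<in> ?V \<inter> L"
    have "inv h \<otimes> x \<in> L" using x h L by (auto intro!: subgroup.m_closed subgroup.m_inv_closed)
    then have "inv h \<otimes> x \<in> H" using x sub by blast
    then have "h \<otimes> (inv h \<otimes> x) \<in> H" using h H by (simp add: subgroup.m_closed)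
    then show "x \<in> H" using hG x by simp
  qed
  ultimately show "\<exists>T. openin (subtopology (topo G) L) T \<and> h \<in> T \<and> T \<subseteq> H" by blast
qed

lemma discrete_in_iff:
  assumes N: "subgroup N G"
  shows "discrete_in G N \<longleftrightarrow> (\<exists>U. openin (topo G) U \<and> U \<inter> N = {\<one>})"
proof
  assume "discrete_in G N"
  then have "openin (subtopology (topo G) N) {\<one>}"
    using N by (simp add: discrete_in_def subgroup.one_closed)
  then show "\<exists>U. openin (topo G) U \<and> U \<inter> N = {\<one>}"
    by (auto simp: openin_subtopology)
next
  assume "\<exists>U. openin (topo G) U \<and> U \<inter> N = {\<one>}"
  then obtain U where U: "openin (topo G) U" "U \<inter> N = {\<one>}" by blast
  have NG: "N \<subseteq> carrier G" using N subgroup.subset by blast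
  have "openin (subtopology (topo G) N) {x}" if x: "x \<in> N" for x
  proof -
    have xG: "x \<in> carrier G" using x NG by blast
    let ?V = "{y \<in> carrier G. inv x \<otimes> y \<in> U}"
    have "openin (topo G) ?V"
      using openin_translate[of "inv x" U] xG U by simp
    moreover have "?V \<inter> N = {x}"
    proof
      have "\<one> \<in> U \<inter> N" using U(2) by simp
      then show "{x} \<subseteq> ?V \<inter> N" using x xG by simp
      show "?V \<inter> N \<subseteq> {x}"
      proof
        fix y assume y: "y \<in> ?V \<inter> N"
        then have "inv x \<otimes> y \<in> N" using N x by (simp add: subgroup.m_closed subgroup.m_inv_closed)
        then have "inv x \<otimes> y \<in> U \<inter> N" using y by simp
        then have "inv x \<otimes> y = \<one>" using U(2) by simp
        moreover have "y \<in> carrier G" using y by blast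
        then have "x \<otimes> (inv x \<otimes> y) = y" using xG by simp
        ultimately show "y \<in> {x}" using xG by simp
      qed
    qed
    ultimately show ?thesis unfolding openin_subtopology by (intro exI[of _ ?V]) simp
  qed
  moreover have "topspace (subtopology (topo G) N) = N" using NG by auto
  ultimately show "discrete_in G N"
    unfolding discrete_in_def by (subst eq_commute) (simp add: discrete_topology_unique)
qed

text \<open>
  Closedness of a subgroup only has to be tested near the identity: if a coset \<open>g V\<close> of the open
  subgroup meets \<open>N\<close>, then \<open>N \<inter> g V\<close> is a translate of \<open>N \<inter> V\<close>.
\<close>

lemma closed_subgroup_if_relatively_closed:
  assumes N: "subgroup N G" and V: "subgroup V G" "openin (topo G) V"
    and c: "closedin (topo G) (N \<inter> V)"
  shows "closedin (topo G) N"
proof -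
  have NG: "N \<subseteq> carrier G" and VG: "V \<subseteq> carrier G" using N V subgroup.subset by blast+
  have "openin (topo G) (carrier G - N)"
  proof (subst openin_subopen, intro ballI)
    fix g assume g: "g \<in> carrier G - N"
    let ?W = "{x \<in> carrier G. inv g \<otimes> x \<in> V}"
    have W: "openin (topo G) ?W"
      using openin_translate[of "inv g" V] g V by simp
    have gW: "g \<in> ?W" using g V by (simp add: subgroup.one_closed)
    show "\<exists>T. openin (topo G) T \<and> g \<in> T \<and> T \<subseteq> carrier G - N"
    proof (cases "?W \<inter> N = {}")
      case True then show ?thesis using W gW by blast
    next
      case False
      then obtain n where n: "n \<in> N" "inv g \<otimes> n \<in> V" "n \<in> carrier G" by blast
      let ?X = "{x \<in> carrier G. inv n \<otimes> x \<in> (carrier G - (N \<inter> V))}"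
      have X: "openin (topo G) ?X"
        using openin_translate[of "inv n" "carrier G - (N \<inter> V)"] n c by (simp add: closedin_def)
      have "inv n \<otimes> g \<notin> N"
      proof
        assume "inv n \<otimes> g \<in> N"
        then have "n \<otimes> (inv n \<otimes> g) \<in> N" using N n by (simp add: subgroup.m_closed)
        then show False using g n by simp
      qed
      then have gX: "g \<in> ?X" using g n by auto
      have "?W \<inter> ?X \<subseteq> carrier G - N"
      proof
        fix x assume x: "x \<in> ?W \<inter> ?X"
        have "inv (inv g \<otimes> n) \<otimes> (inv g \<otimes> x) \<in> V"
          using x n V(1) by (simp add: subgroup.m_closed subgroup.m_inv_closed)
        moreover have "inv (inv g \<otimes> n) \<otimes> (inv g \<otimes> x) = inv n \<otimes> x"
        proof -
          show ?thesis using g n x by (simp add: inv_mult_group m_assoc)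
        qed
        ultimately have "inv n \<otimes> x \<in> V" by simp
        then have "inv n \<otimes> x \<notin> N" using x by blast
        then show "x \<in> carrier G - N"
          using x n N by (auto simp: subgroup.m_closed subgroup.m_inv_closed)
      qed
      then show ?thesis using W X gW gX by (meson IntI openin_Int)
    qed
  qed
  then show ?thesis using NG by (simp add: closedin_def)
qed

lemma m_inv_top_subgroup:
  assumes "subgroup N G" "x \<in> N"
  shows "inv\<^bsub>top_subgroup G N\<^esub> x = inv x"
proof -
  have "inv\<^bsub>top_subgroup G N\<^esub> x = inv\<^bsub>G\<lparr>carrier := N\<rparr>\<^esub> x"
    by (simp add: m_inv_def)
  then show ?thesis using m_inv_consistent[OF assms] by simp
qed

lemma group_top_subgroup:
  assumes "subgroup N G" shows "group (top_subgroup G N)"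
proof -
  have "group (G\<lparr>carrier := N\<rparr>)" by (rule subgroup.subgroup_is_group[OF assms is_group])
  then show ?thesis
    unfolding group_def monoid_def group_axioms_def Units_def by simp
qed

lemma topological_group_top_subgroup:
  assumes N: "subgroup N G"
  shows "topological_group (top_subgroup G N)"
proof -
  have NG: "N \<subseteq> carrier G" using N subgroup.subset by blast
  let ?X = "subtopology (topo G) N"
  have *: "continuous_map (prod_topology ?X ?X) (topo G) fst" "continuous_map (prod_topology ?X ?X) (topo G) snd"
    by (rule continuous_map_into_fulltopology[OF continuous_map_fst],
        rule continuous_map_into_fulltopology[OF continuous_map_snd])
  have "continuous_map (prod_topology ?X ?X) (topo G) (\<lambda>p. fst p \<otimes> snd p)"
    using * by (rule continuous_mult)
  then have m: "continuous_map (prod_topology ?X ?X) ?X (\<lambda>(x, y). x \<otimes> y)"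
    using N NG by (auto simp: continuous_map_in_subtopology case_prod_unfold subgroup.m_closed)
  have "continuous_map ?X (topo G) (\<lambda>x. inv x)"
    by (intro continuous_inv) (simp add: continuous_map_from_subtopology)
  then have "continuous_map ?X ?X (\<lambda>x. inv x)"
    using N NG by (auto simp: continuous_map_in_subtopology subgroup.m_inv_closed)
  then have i: "continuous_map ?X ?X (m_inv (top_subgroup G N))"
    by (rule continuous_map_eq) (use N in \<open>auto simp: m_inv_top_subgroup\<close>)
  show ?thesis
    unfolding topological_group_def
    using m i NG group_top_subgroup[OF N] by auto
qed

lemma subgroup_top_subgroup_iff:
  assumes L: "subgroup L G"
  shows "subgroup N (top_subgroup G L) \<longleftrightarrow> subgroup N G \<and> N \<subseteq> L"
proof (cases "N \<subseteq> L")
  case True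
  then have "inv\<^bsub>top_subgroup G L\<^esub> x = inv x" if "x \<in> N" for x
    using that L m_inv_top_subgroup by blast
  then show ?thesis
    using True subgroup.subset[OF L] unfolding subgroup_def by auto
next
  case False
  then show ?thesis using subgroup.subset[of N "top_subgroup G L"] by auto
qed

lemma normal_top_subgroup_iff:
  assumes L: "subgroup L G"
  shows "N \<lhd> top_subgroup G L \<longleftrightarrow> subgroup N G \<and> N \<subseteq> L \<and> (\<forall>l\<in>L. \<forall>n\<in>N. l \<otimes> n \<otimes> inv l \<in> N)"
  unfolding group.normal_inv_iff[OF group_top_subgroup[OF L]] subgroup_top_subgroup_iff[OF L]
  by (simp add: m_inv_top_subgroup[OF L] conj_assoc)

end

section \<open>Quotients and the quasi-center\<close>

context top_group
begin

lemma topspace_coset_topology: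
  assumes "N \<subseteq> carrier G"
  shows "topspace (coset_topology G N) = rcosets N"
proof -
  have "{g \<in> carrier G. N #> g \<in> rcosets N} = carrier G"
    using rcosetsI[OF assms] by auto
  then have "openin (coset_topology G N) (rcosets N)"
    using openin_topspace[of "topo G"] by (simp add: openin_coset_topology)
  moreover have "openin (coset_topology G N) U \<Longrightarrow> U \<subseteq> rcosets N" for U
    by (simp add: openin_coset_topology)
  ultimately show ?thesis by (meson openin_subset openin_topspace subset_antisym)
qed

lemma continuous_coset_projection:
  assumes "N \<subseteq> carrier G"
  shows "continuous_map (topo G) (coset_topology G N) (\<lambda>g. N #> g)"
  using assms unfolding continuous_map_def topspace_coset_topology[OF assms]
  by (auto simp: openin_coset_topology rcosetsI)

lemma open_coset_projection:
  assumes N: "subgroup N G" and W: "openin (topo G) W"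
  shows "openin (coset_topology G N) ((\<lambda>g. N #> g) ` W)"
proof -
  have NG: "N \<subseteq> carrier G" using N by (rule subgroup.subset)
  have WG: "W \<subseteq> carrier G" using openin_subset[OF W] by simp
  have "{g \<in> carrier G. N #> g \<in> (\<lambda>g. N #> g) ` W} = (\<Union>n\<in>N. {g \<in> carrier G. n \<otimes> g \<in> W})" (is "?L = ?R")
  proof
    show "?L \<subseteq> ?R"
    proof
      fix g assume "g \<in> ?L"
      then obtain w where w: "g \<in> carrier G" "w \<in> W" "N #> g = N #> w" by auto
      then have "w \<in> N #> g" using WG rcos_self[OF _ N] by auto
      then obtain n where "n \<in> N" "w = n \<otimes> g" unfolding r_coset_def by auto
      then show "g \<in> ?R" using w by auto
    qed
    show "?R \<subseteq> ?L"
    proof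
      fix g assume "g \<in> ?R"
      then obtain n where n: "n \<in> N" "g \<in> carrier G" "n \<otimes> g \<in> W" by auto
      then have "N #> g = N #> (n \<otimes> g)"
        by (intro repr_independence[OF _ _ N]) (auto simp: r_coset_def)
      then show "g \<in> ?L" using n by auto
    qed
  qed
  moreover have "openin (topo G) ?R"
    using NG W by (intro openin_clauses(3) ballI) (auto intro: openin_translate)
  moreover have "(\<lambda>g. N #> g) ` W \<subseteq> rcosets N" using rcosetsI[OF NG] WG by auto
  ultimately show ?thesis by (simp add: openin_coset_topology)
qed

lemma group_top_quotient:
  assumes "N \<lhd> G" shows "group (top_quotient G N)"
  using normal.factorgroup_is_group[OF assms]
  unfolding group_def monoid_def group_axioms_def Units_def
  by (simp add: FactGroup_def)

lemma m_inv_top_quotient: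
  assumes N: "N \<lhd> G" and g: "g \<in> carrier G"
  shows "inv\<^bsub>top_quotient G N\<^esub> (N #> g) = N #> inv g"
proof -
  interpret N: normal N G by (rule N)
  interpret Q: group "top_quotient G N" by (rule group_top_quotient[OF N])
  have "(N #> inv g) \<otimes>\<^bsub>top_quotient G N\<^esub> (N #> g) = \<one>\<^bsub>top_quotient G N\<^esub>"
    using g by (simp add: N.rcos_sum coset_mult_one[OF N.subset])
  then show ?thesis
    using g by (intro Q.inv_equality) (auto intro: rcosetsI N.subset)
qed

lemma topological_group_top_quotient:
  assumes N: "N \<lhd> G"
  shows "topological_group (top_quotient G N)"
proof -
  interpret N: normal N G by (rule N)
  let ?Q = "coset_topology G N" and ?p = "\<lambda>g. N #> g"
  have top: "topspace ?Q = rcosets N" by (rule topspace_coset_topology[OF N.subset])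
  have lift: "\<exists>g\<in>carrier G. a = N #> g" if "a \<in> rcosets N" for a
    using that by (auto simp: RCOSETS_def)
  have "continuous_map (prod_topology ?Q ?Q) ?Q (\<lambda>(x, y). x <#> y)"
    unfolding continuous_map_def
  proof (intro conjI allI impI)
    show "(\<lambda>(x, y). x <#> y) \<in> topspace (prod_topology ?Q ?Q) \<rightarrow> topspace ?Q"
      by (auto simp: top N.setmult_closed)
    fix U assume U: "openin ?Q U"
    let ?W = "{x \<in> topspace (prod_topology ?Q ?Q). (case x of (x, y) \<Rightarrow> x <#> y) \<in> U}"
    show "openin (prod_topology ?Q ?Q) ?W"
      unfolding openin_prod_topology_alt
    proof (intro allI impI)
      fix a b assume "(a, b) \<in> ?W"
      then have ab: "a \<in> rcosets N" "b \<in> rcosets N" "a <#> b \<in> U" by (auto simp: top)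
      then obtain g h where gh: "g \<in> carrier G" "h \<in> carrier G" "a = N #> g" "b = N #> h"
        using lift by metis
      have o: "openin (topo G) {z \<in> carrier G. N #> z \<in> U}"
        using U by (simp add: openin_coset_topology)
      have "continuous_map (prod_topology (topo G) (topo G)) (topo G) (\<lambda>(x, y). x \<otimes> y)"
        using topological_group by (simp add: topological_group_def)
      from openin_continuous_map_preimage[OF this o]
      have "openin (prod_topology (topo G) (topo G))
              {x \<in> carrier G \<times> carrier G. (case x of (x, y) \<Rightarrow> x \<otimes> y) \<in> {z \<in> carrier G. N #> z \<in> U}}"
        by simp
      moreover have "(g, h) \<in> {x \<in> carrier G \<times> carrier G. (case x of (x, y) \<Rightarrow> x \<otimes> y) \<in> {z \<in> carrier G. N #> z \<in> U}}"
        using ab gh by (simp add: N.rcos_sum)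
      ultimately obtain A B where AB: "openin (topo G) A" "openin (topo G) B" "g \<in> A" "h \<in> B"
        "A \<times> B \<subseteq> {x \<in> carrier G \<times> carrier G. (case x of (x, y) \<Rightarrow> x \<otimes> y) \<in> {z \<in> carrier G. N #> z \<in> U}}"
        unfolding openin_prod_topology_alt by meson
      have "?p ` A \<times> ?p ` B \<subseteq> ?W"
      proof clarify
        fix x y assume xy: "x \<in> A" "y \<in> B"
        then have "(x, y) \<in> A \<times> B" by simp
        with AB(5) have "x \<in> carrier G" "y \<in> carrier G" "N #> (x \<otimes> y) \<in> U" by auto
        then show "(N #> x, N #> y) \<in> topspace (prod_topology ?Q ?Q) \<and> (N #> x) <#> (N #> y) \<in> U"
          by (simp add: top N.rcos_sum rcosetsI N.subset)
      qed
      moreover have "openin ?Q (?p ` A)" "openin ?Q (?p ` B)"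
        using AB open_coset_projection[OF N.subgroup_axioms] by auto
      ultimately show "\<exists>A B. openin ?Q A \<and> openin ?Q B \<and> a \<in> A \<and> b \<in> B \<and> A \<times> B \<subseteq> ?W"
        using AB gh by blast
    qed
  qed
  moreover have "continuous_map ?Q ?Q (m_inv (top_quotient G N))"
    unfolding continuous_map_def
  proof (intro conjI allI impI)
    show "m_inv (top_quotient G N) \<in> topspace ?Q \<rightarrow> topspace ?Q"
      using group.inv_closed[OF group_top_quotient[OF N]] by (simp add: top)
    fix U assume U: "openin ?Q U"
    have o: "openin (topo G) {z \<in> carrier G. N #> z \<in> U}"
      using U by (simp add: openin_coset_topology)
    have "continuous_map (topo G) (topo G) (\<lambda>x. inv x)"
      using topological_group by (simp add: topological_group_def)
    from openin_continuous_map_preimage[OF this o]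
    have "openin (topo G) {z \<in> carrier G. N #> inv z \<in> U}" by (simp cong: conj_cong)
    moreover have "{z \<in> carrier G. N #> inv z \<in> U} =
        {g \<in> carrier G. N #> g \<in> {x \<in> topspace ?Q. inv\<^bsub>top_quotient G N\<^esub> x \<in> U}}"
      by (auto simp: top m_inv_top_quotient[OF N] rcosetsI N.subset)
    ultimately show "openin ?Q {x \<in> topspace ?Q. inv\<^bsub>top_quotient G N\<^esub> x \<in> U}"
      using top by (simp add: openin_coset_topology)
  qed
  ultimately show ?thesis
    unfolding topological_group_def using group_top_quotient[OF N] top by simp
qed

lemma closed_preimage_coset_projection:
  assumes "N \<subseteq> carrier G" "closedin (coset_topology G N) M"
  shows "closedin (topo G) {g \<in> carrier G. N #> g \<in> M}"
  using closedin_continuous_map_preimage[OF continuous_coset_projection[OF assms(1)] assms(2)] by simp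

lemma closed_coset_iff:
  assumes N: "N \<subseteq> carrier G" and M: "M \<subseteq> rcosets N"
  shows "closedin (coset_topology G N) M \<longleftrightarrow> closedin (topo G) {g \<in> carrier G. N #> g \<in> M}"
proof -
  have "{g \<in> carrier G. N #> g \<in> rcosets N - M} = carrier G - {g \<in> carrier G. N #> g \<in> M}"
    using rcosetsI[OF N] by auto
  then show ?thesis
    using M unfolding closedin_def topspace_coset_topology[OF N]
    by (auto simp: openin_coset_topology)
qed

lemma subgroup_preimage_coset_projection:
  assumes N: "N \<lhd> G" and M: "subgroup M (top_quotient G N)"
  shows "subgroup {g \<in> carrier G. N #> g \<in> M} G" "N \<subseteq> {g \<in> carrier G. N #> g \<in> M}"
proof -
  interpret N: normal N G by (rule N)
  interpret M: subgroup M "top_quotient G N" by (rule M)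
  show "subgroup {g \<in> carrier G. N #> g \<in> M} G"
  proof (rule subgroupI)
    have "\<one> \<in> {g \<in> carrier G. N #> g \<in> M}"
      using M.one_closed by (simp add: coset_mult_one[OF N.subset])
    then show "{g \<in> carrier G. N #> g \<in> M} \<noteq> {}" by blast
    fix a b assume a: "a \<in> {g \<in> carrier G. N #> g \<in> M}"
    then show "inv a \<in> {g \<in> carrier G. N #> g \<in> M}"
      using M.m_inv_closed[of "N #> a"] by (simp add: m_inv_top_quotient[OF N])
    assume b: "b \<in> {g \<in> carrier G. N #> g \<in> M}"
    show "a \<otimes> b \<in> {g \<in> carrier G. N #> g \<in> M}"
      using a b M.m_closed[of "N #> a" "N #> b"] by (simp add: N.rcos_sum)
  qed auto
  show "N \<subseteq> {g \<in> carrier G. N #> g \<in> M}"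
    using M.one_closed N.subset coset_join2[OF _ N.subgroup_axioms] by auto
qed

lemma normal_preimage_coset_projection:
  assumes N: "N \<lhd> G" and M: "M \<lhd> top_quotient G N"
  shows "{g \<in> carrier G. N #> g \<in> M} \<lhd> G"
proof -
  interpret N: normal N G by (rule N)
  interpret Q: group "top_quotient G N" by (rule group_top_quotient[OF N])
  have "N #> (x \<otimes> h \<otimes> inv x) \<in> M" if "x \<in> carrier G" "h \<in> carrier G" "N #> h \<in> M" for x h
  proof -
    have "N #> x \<in> carrier (top_quotient G N)" using that by (simp add: rcosetsI N.subset)
    then have "(N #> x) \<otimes>\<^bsub>top_quotient G N\<^esub> (N #> h) \<otimes>\<^bsub>top_quotient G N\<^esub> inv\<^bsub>top_quotient G N\<^esub> (N #> x) \<in> M"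
      using that(3) M unfolding Q.normal_inv_iff by blast
    then show ?thesis using that by (simp add: m_inv_top_quotient[OF N] N.rcos_sum)
  qed
  then show ?thesis
    unfolding normal_inv_iff
    using subgroup_preimage_coset_projection(1)[OF N normal_imp_subgroup[OF M]] by auto
qed

lemma quasi_center_normal: "quasi_center G \<lhd> G"
proof -
  let ?Z = "\<lambda>h. {g \<in> carrier G. g \<otimes> h = h \<otimes> g}"
  have Z: "subgroup (?Z h) G" if "h \<in> carrier G" for h
  proof (rule subgroupI)
    fix a b assume a: "a \<in> ?Z h"
    then show "inv a \<in> ?Z h" using commute_inv[of a h] that by simp
    assume b: "b \<in> ?Z h"
    show "a \<otimes> b \<in> ?Z h" using commute_mult[of a b h] a b that by simp
  qed (use that in auto)
  have larger: "openin (topo G) (?Z h)"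
    if "h \<in> carrier G" "openin (topo G) U" "\<one> \<in> U" "U \<subseteq> ?Z h" for h U
    using open_subgroup_if_neighborhood[OF Z[OF that(1)] that(2,3), of "carrier G"] that(4)
    by (simp add: subgroup_self subtopology_topspace[of "topo G", simplified] Int_absorb2 Int_commute)
  have sub: "subgroup (quasi_center G) G"
  proof (rule subgroupI)
    show "quasi_center G \<subseteq> carrier G" by (auto simp: quasi_center_def)
    have "?Z \<one> = carrier G" by auto
    then have "\<one> \<in> quasi_center G"
      using openin_topspace[of "topo G"] by (simp add: quasi_center_def)
    then show "quasi_center G \<noteq> {}" by blast
    fix a b assume "a \<in> quasi_center G"
    then have a: "a \<in> carrier G" "openin (topo G) (?Z a)" by (auto simp: quasi_center_def)
    have "?Z a \<subseteq> ?Z (inv a)"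
    proof
      fix g assume "g \<in> ?Z a"
      then show "g \<in> ?Z (inv a)" using commute_inv[of a g] a by simp
    qed
    then show "inv a \<in> quasi_center G"
      using larger[of "inv a" "?Z a"] a by (simp add: quasi_center_def)
    assume "b \<in> quasi_center G"
    then have b: "b \<in> carrier G" "openin (topo G) (?Z b)" by (auto simp: quasi_center_def)
    have "?Z a \<inter> ?Z b \<subseteq> ?Z (a \<otimes> b)"
    proof
      fix g assume "g \<in> ?Z a \<inter> ?Z b"
      then show "g \<in> ?Z (a \<otimes> b)" using commute_mult[of a b g] a b by simp
    qed
    then show "a \<otimes> b \<in> quasi_center G"
      using larger[of "a \<otimes> b" "?Z a \<inter> ?Z b"] a b openin_Int[OF a(2) b(2)] by (simp add: quasi_center_def)
  qed
  have "x \<otimes> h \<otimes> inv x \<in> quasi_center G" if x: "x \<in> carrier G" and "h \<in> quasi_center G" for x h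
  proof -
    have h: "h \<in> carrier G" "openin (topo G) (?Z h)" using that by (auto simp: quasi_center_def)
    let ?U = "{g \<in> carrier G. inv x \<otimes> g \<otimes> inv (inv x) \<in> ?Z h}"
    have "openin (topo G) ?U"
      using openin_continuous_map_preimage[OF continuous_conj[of "inv x"] h(2)] x by simp
    moreover have "?U \<subseteq> ?Z (x \<otimes> h \<otimes> inv x)"
    proof
      fix g assume g: "g \<in> ?U"
      then have "inv x \<otimes> g \<otimes> x \<otimes> h = h \<otimes> (inv x \<otimes> g \<otimes> x)" using x by simp
      then have "x \<otimes> (inv x \<otimes> g \<otimes> x \<otimes> h) \<otimes> inv x = x \<otimes> (h \<otimes> (inv x \<otimes> g \<otimes> x)) \<otimes> inv x" by simp
      moreover have "g \<in> carrier G" using g by simp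
      ultimately show "g \<in> ?Z (x \<otimes> h \<otimes> inv x)" using x h by (simp add: m_assoc)
    qed
    ultimately show ?thesis
      using larger[of "x \<otimes> h \<otimes> inv x" ?U] x h by (simp add: quasi_center_def)
  qed
  then show ?thesis unfolding normal_inv_iff using sub by blast
qed

text \<open>
  The map \<open>u \<mapsto> [g, u]\<close> is continuous and sends the identity to itself. Near the identity it therefore
  avoids the non-trivial elements of the discrete group \<open>D\<close>, and must be constant on \<open>L\<close>. In this way
  commuting modulo a discrete subgroup becomes commuting with a neighborhood of the identity.
\<close>

lemma centralizer_nearly_open:
  assumes L: "subgroup L G" and D: "subgroup D G" "discrete_in G D" and g: "g \<in> carrier G"
    and comm: "\<And>u. u \<in> L \<Longrightarrow> g \<otimes> u \<otimes> inv g \<otimes> inv u \<in> D"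
  shows "\<exists>U. openin (topo G) U \<and> \<one> \<in> U \<and> (\<forall>u\<in>U \<inter> L. u \<otimes> g = g \<otimes> u)"
proof -
  obtain V where V: "openin (topo G) V" "V \<inter> D = {\<one>}" using D discrete_in_iff by blast
  let ?f = "\<lambda>u. g \<otimes> u \<otimes> inv g \<otimes> inv u"
  let ?U = "{u \<in> carrier G. ?f u \<in> V}"
  have "continuous_map (topo G) (topo G) ?f"
    using g by (intro continuous_group) auto
  from openin_continuous_map_preimage[OF this V(1)] have U: "openin (topo G) ?U" by simp
  have "\<one> \<in> V \<inter> D" using V(2) by simp
  then have "\<one> \<in> ?U" using g by simp
  moreover have "u \<otimes> g = g \<otimes> u" if u: "u \<in> ?U \<inter> L" for u
  proof -
    have "?f u \<in> V \<inter> D" using u comm by simp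
    then have "?f u = \<one>" using V(2) by simp
    then have "?f u \<otimes> u \<otimes> g = \<one> \<otimes> u \<otimes> g" by simp
    moreover have "u \<in> carrier G" using u by simp
    ultimately show ?thesis using g by (simp add: m_assoc)
  qed
  ultimately show ?thesis using U by blast
qed

text \<open>
  All commutators \<open>[n, u]\<close> with \<open>n \<in> N\<close> lie in \<open>N\<close>, so the centralizer of \<open>n\<close> contains a neighborhood
  of the identity and is open.
\<close>

lemma discrete_normal_quasi_center:
  assumes N: "N \<lhd> G" "discrete_in G N"
  shows "N \<subseteq> quasi_center G"
proof
  fix n assume n: "n \<in> N"
  interpret N: normal N G by (rule N)
  have nG: "n \<in> carrier G" using n N.subset by blast
  have "n \<otimes> u \<otimes> inv n \<otimes> inv u \<in> N" if "u \<in> carrier G" for u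
  proof -
    have "u \<otimes> inv n \<otimes> inv u \<in> N" using that n by (intro N.inv_op_closed2) auto
    then have "n \<otimes> (u \<otimes> inv n \<otimes> inv u) \<in> N" using n by simp
    then show ?thesis using that nG by (simp add: m_assoc)
  qed
  then obtain U where U: "openin (topo G) U" "\<one> \<in> U" "\<forall>u\<in>U \<inter> carrier G. u \<otimes> n = n \<otimes> u"
    using centralizer_nearly_open[OF subgroup_self N.subgroup_axioms N(2) nG] by blast
  let ?Z = "{g \<in> carrier G. g \<otimes> n = n \<otimes> g}"
  have "openin (topo G) ?Z"
  proof (subst openin_subopen, intro ballI)
    fix z assume z: "z \<in> ?Z"
    \<comment> \<open>The translate \<open>z U\<close>.\<close>
    let ?V = "{x \<in> carrier G. inv z \<otimes> x \<in> U}"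
    have "?V \<subseteq> ?Z"
    proof
      fix x assume x: "x \<in> ?V"
      then have "inv z \<otimes> x \<otimes> n = n \<otimes> (inv z \<otimes> x)" using U(3) z by auto
      then show "x \<in> ?Z" using commute_mult[of z "inv z \<otimes> x" n] x z nG by simp
    qed
    moreover have "openin (topo G) ?V" using U z by (intro openin_translate) auto
    moreover have "z \<in> ?V" using U z by simp
    ultimately show "\<exists>T. openin (topo G) T \<and> z \<in> T \<and> T \<subseteq> ?Z" by blast
  qed
  then show "n \<in> quasi_center G" using nG by (simp add: quasi_center_def)
qed

end

section \<open>Groups in which normal subgroups are discrete or cocompact\<close>

context top_group
begin

lemma subtopology_carrier [simp]: "subtopology (topo G) (carrier G) = topo G"
  using subtopology_topspace[of "topo G"] by simp

text \<open>
  Neighborhoods in the ambient group describe the quasi-center of a subgroup without reference to its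
  own topology, which makes the quasi-centers of \<open>L\<close> and \<open>G\<close> comparable.
\<close>

lemma mem_quasi_center_top_subgroup_iff:
  assumes L: "subgroup L G"
  shows "h \<in> quasi_center (top_subgroup G L) \<longleftrightarrow>
    h \<in> L \<and> (\<exists>U. openin (topo G) U \<and> \<one> \<in> U \<and> (\<forall>u\<in>U \<inter> L. u \<otimes> h = h \<otimes> u))" (is "?l \<longleftrightarrow> ?r")
proof -
  let ?Z = "{g \<in> L. g \<otimes> h = h \<otimes> g}"
  have LG: "L \<subseteq> carrier G" using L by (rule subgroup.subset)
  show ?thesis
  proof
    assume ?l
    then have h: "h \<in> L" and "openin (subtopology (topo G) L) ?Z" by (auto simp: quasi_center_def)
    then obtain U where U: "openin (topo G) U" "?Z = U \<inter> L" by (auto simp: openin_subtopology)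
    have "\<one> \<in> ?Z" using h LG L subgroup.one_closed by auto
    then have "\<one> \<in> U" using U by simp
    moreover have "u \<otimes> h = h \<otimes> u" if "u \<in> U \<inter> L" for u using that unfolding U(2)[symmetric] by simp
    ultimately show ?r using h U by blast
  next
    assume ?r
    then obtain U where h: "h \<in> L" and U: "openin (topo G) U" "\<one> \<in> U" "\<forall>u\<in>U \<inter> L. u \<otimes> h = h \<otimes> u" by blast
    have hG: "h \<in> carrier G" using h LG by blast
    have "subgroup ?Z G"
    proof (rule subgroupI)
      show "?Z \<subseteq> carrier G" using LG by blast
      have "\<one> \<in> ?Z" using hG subgroup.one_closed[OF L] by simp
      then show "?Z \<noteq> {}" by blast
      fix a b assume a: "a \<in> ?Z"
      then show "inv a \<in> ?Z" using commute_inv[of a h] hG LG subgroup.m_inv_closed[OF L] by auto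
      assume b: "b \<in> ?Z"
      show "a \<otimes> b \<in> ?Z" using commute_mult[of a b h] a b hG LG subgroup.m_closed[OF L] by auto
    qed
    from open_subgroup_if_neighborhood[OF this U(1,2) _ L]
    have "openin (subtopology (topo G) L) ?Z" using U(3) by blast
    then show ?l using h by (simp add: quasi_center_def)
  qed
qed

lemma mem_quasi_center_iff:
  "h \<in> quasi_center G \<longleftrightarrow>
    h \<in> carrier G \<and> (\<exists>U. openin (topo G) U \<and> \<one> \<in> U \<and> (\<forall>u\<in>U. u \<otimes> h = h \<otimes> u))"
proof -
  have "quasi_center (top_subgroup G (carrier G)) = quasi_center G"
    by (simp add: quasi_center_def)
  moreover have "U \<inter> carrier G = U" if "openin (topo G) U" for U
    using openin_subset[OF that] by auto
  ultimately show ?thesis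
    using mem_quasi_center_top_subgroup_iff[OF subgroup_self, of h] by (metis (no_types, lifting))
qed

lemma quasi_center_centralizer:
  assumes "h \<in> quasi_center G"
  shows "\<exists>U. openin (topo G) U \<and> \<one> \<in> U \<and> (\<forall>u\<in>U \<inter> M. u \<otimes> h = h \<otimes> u)"
  using assms unfolding mem_quasi_center_iff by blast

lemma quasi_center_top_subgroup_normal:
  assumes L: "L \<lhd> G"
  shows "quasi_center (top_subgroup G L) \<lhd> G"
proof -
  interpret L: normal L G by (rule L)
  interpret LL: top_group "top_subgroup G L"
    by unfold_locales (rule topological_group_top_subgroup[OF L.subgroup_axioms])
  have sub: "subgroup (quasi_center (top_subgroup G L)) G"
    using LL.quasi_center_normal unfolding normal_top_subgroup_iff[OF L.subgroup_axioms] by blast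
  have "x \<otimes> h \<otimes> inv x \<in> quasi_center (top_subgroup G L)"
    if x: "x \<in> carrier G" and h: "h \<in> quasi_center (top_subgroup G L)" for x h
  proof -
    obtain U where hL: "h \<in> L" and U: "openin (topo G) U" "\<one> \<in> U" "\<forall>u\<in>U \<inter> L. u \<otimes> h = h \<otimes> u"
      using h unfolding mem_quasi_center_top_subgroup_iff[OF L.subgroup_axioms] by blast
    have hG: "h \<in> carrier G" using hL L.subset by blast
    let ?U = "{g \<in> carrier G. inv x \<otimes> g \<otimes> inv (inv x) \<in> U}"
    have "openin (topo G) ?U"
      using openin_continuous_map_preimage[OF continuous_conj[of "inv x"] U(1)] x by simp
    moreover have "\<one> \<in> ?U" using U(2) x by simp
    moreover have "u \<otimes> (x \<otimes> h \<otimes> inv x) = (x \<otimes> h \<otimes> inv x) \<otimes> u" if u: "u \<in> ?U \<inter> L" for u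
    proof -
      have uG: "u \<in> carrier G" and uL: "u \<in> L" using u by auto
      have "inv x \<otimes> u \<otimes> inv (inv x) \<in> L" by (intro L.inv_op_closed2 uL) (use x in auto)
      then have "inv x \<otimes> u \<otimes> x \<otimes> h = h \<otimes> (inv x \<otimes> u \<otimes> x)" using u x U(3) by simp
      then have "x \<otimes> (inv x \<otimes> u \<otimes> x \<otimes> h) \<otimes> inv x = x \<otimes> (h \<otimes> (inv x \<otimes> u \<otimes> x)) \<otimes> inv x" by simp
      then show ?thesis using uG x hG by (simp add: m_assoc)
    qed
    moreover have "x \<otimes> h \<otimes> inv x \<in> L" using x hL by (rule L.inv_op_closed2)
    ultimately show ?thesis
      unfolding mem_quasi_center_top_subgroup_iff[OF L.subgroup_axioms] by blast
  qed
  then show ?thesis unfolding normal_inv_iff using sub by blast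
qed

end

text \<open>
  In the application \<open>\<Phi>\<close> is the set of elements that fix an arc and move another one with the same
  origin. It decides between discreteness and cocompactness. For normal \<open>N\<close> the two are shown to be mutually exclusive below, so
  that \<open>N\<close> is discrete iff it misses \<open>\<Phi>\<close>.
\<close>

locale locally_compact_dichotomy = top_group +
  fixes \<Phi> :: "'a set"
  assumes small_subgroups: "\<lbrakk>openin (topo G) U; \<one> \<in> U\<rbrakk> \<Longrightarrow> \<exists>V. subgroup V G \<and> openin (topo G) V \<and> V \<subseteq> U"
    and t1: "closedin (topo G) {\<one>}"
    and nondiscrete: "\<not> discrete_in G (carrier G)"
    and discrete_if_misses: "\<lbrakk>subgroup M G; M \<inter> \<Phi> = {}\<rbrakk> \<Longrightarrow> discrete_in G M"
    and cocompact_if_meets: "\<lbrakk>N \<lhd> G; N \<inter> \<Phi> \<noteq> {}\<rbrakk> \<Longrightarrow> cocompact_in G N"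
    and compact_transversal: "\<lbrakk>N \<lhd> G; cocompact_in G N\<rbrakk> \<Longrightarrow>
      \<exists>C. compactin (topo G) C \<and> C \<subseteq> \<Phi> \<and> (\<forall>c\<in>\<Phi>. \<exists>n\<in>N. n \<otimes> c \<otimes> inv n \<in> C)"
    and finite_centralizer: "\<lbrakk>N \<lhd> G; cocompact_in G N\<rbrakk> \<Longrightarrow>
      \<exists>S U. finite S \<and> S \<subseteq> N \<and> openin (topo G) U \<and> \<one> \<in> U \<and>
        (\<forall>u\<in>U. (\<forall>s\<in>S. u \<otimes> s = s \<otimes> u) \<longrightarrow> u = \<one>)"
begin

text \<open>
  Finitely many elements of \<open>N\<close> have a centralizer that is trivial near the identity. Each of them
  commutes with \<open>M\<close> near the identity, hence \<open>M\<close> is trivial near the identity.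
\<close>

lemma discrete_if_centralizers_open:
  assumes N: "N \<lhd> G" "cocompact_in G N" and M: "subgroup M G"
    and c: "\<And>n. n \<in> N \<Longrightarrow> \<exists>U. openin (topo G) U \<and> \<one> \<in> U \<and> (\<forall>u\<in>U \<inter> M. u \<otimes> n = n \<otimes> u)"
  shows "discrete_in G M"
proof -
  obtain S U where S: "finite S" "S \<subseteq> N" and U: "openin (topo G) U" "\<one> \<in> U"
    "\<And>u. u \<in> U \<Longrightarrow> (\<forall>s\<in>S. u \<otimes> s = s \<otimes> u) \<Longrightarrow> u = \<one>"
    using finite_centralizer[OF N] by metis
  obtain V where V: "\<And>n. n \<in> N \<Longrightarrow> openin (topo G) (V n) \<and> \<one> \<in> V n \<and> (\<forall>u\<in>V n \<inter> M. u \<otimes> n = n \<otimes> u)"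
    using c by metis
  let ?W = "U \<inter> \<Inter>(insert (carrier G) (V ` S))"
  have "openin (topo G) ?W"
    using S U(1) V openin_topspace[of "topo G"] by (intro openin_Int openin_Inter) auto
  moreover have "?W \<inter> M = {\<one>}"
  proof
    show "{\<one>} \<subseteq> ?W \<inter> M" using U(2) V S(2) subgroup.one_closed[OF M] by auto
    show "?W \<inter> M \<subseteq> {\<one>}"
    proof
      fix u assume u: "u \<in> ?W \<inter> M"
      have "u \<otimes> s = s \<otimes> u" if "s \<in> S" for s
      proof -
        have "s \<in> N" using that S(2) by blast
        moreover have "u \<in> V s \<inter> M" using u that by simp
        ultimately show ?thesis using V by blast
      qed
      moreover have "u \<in> U" using u by simp
      ultimately show "u \<in> {\<one>}" using U(3)[of u] by simp
    qed
  qed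
  ultimately show ?thesis using discrete_in_iff[OF M] by blast
qed

lemma discrete_if_commutes_mod_discrete:
  assumes N: "N \<lhd> G" "cocompact_in G N" and M: "subgroup M G"
    and D: "subgroup D G" "discrete_in G D"
    and c: "\<And>n m. n \<in> N \<Longrightarrow> m \<in> M \<Longrightarrow> n \<otimes> m \<otimes> inv n \<otimes> inv m \<in> D"
  shows "discrete_in G M"
  using N M
proof (rule discrete_if_centralizers_open)
  fix n assume n: "n \<in> N"
  have "n \<in> carrier G" by (rule subgroup.mem_carrier[OF normal_imp_subgroup[OF N(1)] n])
  then show "\<exists>U. openin (topo G) U \<and> \<one> \<in> U \<and> (\<forall>u\<in>U \<inter> M. u \<otimes> n = n \<otimes> u)"
    using centralizer_nearly_open[OF M D] c[OF n] by simp
qed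

lemma carrier_cocompact: "carrier G \<inter> \<Phi> \<noteq> {}" "cocompact_in G (carrier G)"
proof -
  show "carrier G \<inter> \<Phi> \<noteq> {}" using discrete_if_misses[OF subgroup_self] nondiscrete by blast
  then show "cocompact_in G (carrier G)"
    by (intro cocompact_if_meets) (simp_all add: normal_inv_iff subgroup_self)
qed

text \<open>
  A discrete normal subgroup is quasi-central; if it were also cocompact, the whole group would be
  discrete.
\<close>

lemma not_discrete_if_cocompact:
  assumes N: "N \<lhd> G" "cocompact_in G N"
  shows "\<not> discrete_in G N"
proof
  assume d: "discrete_in G N"
  have "N \<subseteq> quasi_center G" by (rule discrete_normal_quasi_center[OF N(1) d])
  then have "discrete_in G (carrier G)"
    by (intro discrete_if_centralizers_open[OF N subgroup_self] quasi_center_centralizer) blast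
  then show False using nondiscrete by blast
qed

lemma discrete_iff_misses:
  assumes N: "N \<lhd> G"
  shows "discrete_in G N \<longleftrightarrow> N \<inter> \<Phi> = {}" "cocompact_in G N \<longleftrightarrow> N \<inter> \<Phi> \<noteq> {}"
proof -
  have "discrete_in G N" if "N \<inter> \<Phi> = {}" using discrete_if_misses[OF normal_imp_subgroup[OF N] that] .
  moreover have "cocompact_in G N" if "N \<inter> \<Phi> \<noteq> {}" using cocompact_if_meets[OF N that] .
  moreover have "\<not> discrete_in G N" if "cocompact_in G N" using not_discrete_if_cocompact[OF N that] .
  ultimately show "discrete_in G N \<longleftrightarrow> N \<inter> \<Phi> = {}" "cocompact_in G N \<longleftrightarrow> N \<inter> \<Phi> \<noteq> {}" by argo+
qed

lemma quasi_center_not_cocompact: "\<not> cocompact_in G (quasi_center G)"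
proof
  assume "cocompact_in G (quasi_center G)"
  then have "discrete_in G (carrier G)"
    by (intro discrete_if_centralizers_open[OF quasi_center_normal _ subgroup_self] quasi_center_centralizer)
  then show False using nondiscrete by blast
qed

lemma quasi_center_misses: "quasi_center G \<inter> \<Phi> = {}"
  using quasi_center_not_cocompact discrete_iff_misses[OF quasi_center_normal] by simp

lemma quasi_center_discrete: "discrete_in G (quasi_center G)"
  using quasi_center_misses discrete_iff_misses[OF quasi_center_normal] by simp

theorem quasi_center_maximal: "maximal_in (discrete_normal G) (quasi_center G)"
  unfolding maximal_in_def discrete_normal_def
  using quasi_center_normal quasi_center_discrete discrete_normal_quasi_center by blast

lemma closed_normal_cocompact_iff:
  "N \<in> closed_normal_cocompact G \<longleftrightarrow> N \<lhd> G \<and> closedin (topo G) N \<and> N \<inter> \<Phi> \<noteq> {}"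
  using discrete_iff_misses by (auto simp: closed_normal_cocompact_def)

text \<open>
  The commutators of \<open>N1\<close> and \<open>N2\<close> lie in \<open>N1 \<inter> N2\<close>. Were the latter discrete, then \<open>N2\<close> would commute
  with the cocompact group \<open>N1\<close> modulo a discrete group, and be discrete itself.
\<close>

lemma closed_normal_cocompact_Int:
  assumes N: "N1 \<in> closed_normal_cocompact G" "N2 \<in> closed_normal_cocompact G"
  shows "N1 \<inter> N2 \<in> closed_normal_cocompact G"
proof -
  have n: "N1 \<lhd> G" "N2 \<lhd> G" and cl: "closedin (topo G) (N1 \<inter> N2)" and cc: "cocompact_in G N1" "cocompact_in G N2"
    using N by (auto simp: closed_normal_cocompact_def)
  interpret N1: normal N1 G by (rule n)
  interpret N2: normal N2 G by (rule n)
  have i: "N1 \<inter> N2 \<lhd> G" by (rule normal_subgroup_intersect[OF n])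
  have "\<not> discrete_in G (N1 \<inter> N2)"
  proof
    assume d: "discrete_in G (N1 \<inter> N2)"
    have "discrete_in G N2"
    proof (rule discrete_if_commutes_mod_discrete[OF n(1) cc(1) N2.subgroup_axioms normal_imp_subgroup[OF i] d])
      fix a b assume a: "a \<in> N1" and b: "b \<in> N2"
      have G: "a \<in> carrier G" "b \<in> carrier G" using a b N1.subset N2.subset by blast+
      have "a \<otimes> (b \<otimes> inv a \<otimes> inv b) \<in> N1"
        by (intro N1.m_closed a N1.inv_op_closed2 G N1.m_inv_closed)
      moreover have "(a \<otimes> b \<otimes> inv a) \<otimes> inv b \<in> N2"
        by (intro N2.m_closed b N2.inv_op_closed2 G N2.m_inv_closed)
      ultimately show "a \<otimes> b \<otimes> inv a \<otimes> inv b \<in> N1 \<inter> N2" using G by (simp add: m_assoc)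
    qed
    then show False using not_discrete_if_cocompact[OF n(2) cc(2)] by simp
  qed
  then show ?thesis using i cl discrete_iff_misses[OF i] closed_normal_cocompact_iff by blast
qed

text \<open>
  A closed normal cocompact subgroup contains an element of \<open>\<Phi>\<close>, thus also its conjugate in the compact
  set \<open>C \<subseteq> \<Phi>\<close>. Such subgroups are stable under finite intersections, so by compactness the intersection
  of all of them meets \<open>C\<close>, and with it \<open>\<Phi>\<close>.
\<close>

lemma cocompact_core_closed_normal_cocompact: "cocompact_core G \<in> closed_normal_cocompact G"
proof -
  let ?N = "closed_normal_cocompact G"
  have car: "carrier G \<in> ?N"
    using carrier_cocompact closedin_topspace[of "topo G"]
    by (simp add: closed_normal_cocompact_def normal_inv_iff subgroup_self)
  have carN: "carrier G \<lhd> G" using car by (simp add: closed_normal_cocompact_def)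
  obtain C where C: "compactin (topo G) C" "C \<subseteq> \<Phi>" "\<forall>c\<in>\<Phi>. \<exists>n\<in>carrier G. n \<otimes> c \<otimes> inv n \<in> C"
    using compact_transversal[OF carN carrier_cocompact(2)] by blast
  have meets: "C \<inter> N \<noteq> {}" if "N \<in> ?N" for N
  proof -
    have N: "N \<lhd> G" "N \<inter> \<Phi> \<noteq> {}" using that by (auto simp: closed_normal_cocompact_iff)
    then obtain c where c: "c \<in> N" "c \<in> \<Phi>" by blast
    then obtain n where "n \<in> carrier G" "n \<otimes> c \<otimes> inv n \<in> C" using C by blast
    moreover have "n \<otimes> c \<otimes> inv n \<in> N" if "n \<in> carrier G" for n
      by (rule normal.inv_op_closed2[OF N(1) that c(1)])
    ultimately show ?thesis by blast
  qed
  have fin: "finite \<F> \<Longrightarrow> \<F> \<subseteq> ?N \<Longrightarrow> \<Inter>(insert (carrier G) \<F>) \<in> ?N" for \<F>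
  proof (induction rule: finite_induct)
    case empty
    then show ?case using car by simp
  next
    case (insert N \<F>)
    have "N \<inter> \<Inter>(insert (carrier G) \<F>) \<in> ?N" using insert by (intro closed_normal_cocompact_Int) auto
    moreover have "\<Inter>(insert (carrier G) (insert N \<F>)) = N \<inter> \<Inter>(insert (carrier G) \<F>)" by auto
    ultimately show ?case by simp
  qed
  have "C \<inter> \<Inter>?N \<noteq> {}"
  proof -
    have *: "(\<forall>N\<in>?N. closedin (topo G) N)" by (auto simp: closed_normal_cocompact_def)
    have "C \<inter> \<Inter>\<F> \<noteq> {}" if "finite \<F>" "\<F> \<subseteq> ?N" for \<F>
      using meets[OF fin[OF that]] by auto
    then show ?thesis using C(1) * unfolding compactin_fip by blast
  qed
  then have m: "\<Inter>?N \<inter> \<Phi> \<noteq> {}" using C(2) by blast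
  have ne: "?N \<noteq> {}" using car by blast
  have "closedin (topo G) (\<Inter>?N)" using ne by (intro closedin_Inter) (auto simp: closed_normal_cocompact_def)
  moreover have "\<Inter>?N \<lhd> G"
    unfolding normal_inv_iff
  proof (intro conjI ballI)
    show "subgroup (\<Inter>?N) G"
      using ne by (intro subgroups_Inter) (auto simp: closed_normal_cocompact_def normal_imp_subgroup)
    fix x h assume "x \<in> carrier G" "h \<in> \<Inter>?N"
    then show "x \<otimes> h \<otimes> inv x \<in> \<Inter>?N"
      by (auto simp: closed_normal_cocompact_def intro: normal.inv_op_closed2)
  qed
  ultimately show ?thesis using m by (simp add: cocompact_core_def closed_normal_cocompact_iff)
qed

theorem cocompact_core_minimal: "minimal_in (closed_normal_cocompact G) (cocompact_core G)"
  unfolding minimal_in_def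
  using cocompact_core_closed_normal_cocompact by (auto simp: cocompact_core_def)

lemma core_normal: "cocompact_core G \<lhd> G"
  and core_closed: "closedin (topo G) (cocompact_core G)"
  and core_cocompact: "cocompact_in G (cocompact_core G)"
  and core_meets: "cocompact_core G \<inter> \<Phi> \<noteq> {}"
  using cocompact_core_closed_normal_cocompact closed_normal_cocompact_iff
  by (auto simp: closed_normal_cocompact_def)

lemma core_subset_if_closed_normal:
  assumes "N \<lhd> G" "closedin (topo G) N" "N \<inter> \<Phi> \<noteq> {}"
  shows "cocompact_core G \<subseteq> N"
  using assms closed_normal_cocompact_iff by (auto simp: cocompact_core_def)

text \<open>
  The quasi-center \<open>Z\<close> of the core is normal in \<open>G\<close>. If it were cocompact, then the core, in which the
  elements of \<open>Z\<close> have open centralizers, would be discrete. Hence \<open>Z\<close> is discrete and lies in the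
  quasi-center of \<open>G\<close>.
\<close>

lemma quasi_center_core:
  "quasi_center (top_subgroup G (cocompact_core G)) = quasi_center G \<inter> cocompact_core G"
proof
  let ?L = "cocompact_core G"
  let ?Z = "quasi_center (top_subgroup G ?L)"
  have L: "subgroup ?L G" by (rule normal_imp_subgroup[OF core_normal])
  have n: "?Z \<lhd> G" by (rule quasi_center_top_subgroup_normal[OF core_normal])
  have "\<not> cocompact_in G ?Z"
  proof
    assume "cocompact_in G ?Z"
    then have "discrete_in G ?L"
    proof (rule discrete_if_centralizers_open[OF n _ L])
      fix h assume "h \<in> ?Z"
      then show "\<exists>U. openin (topo G) U \<and> \<one> \<in> U \<and> (\<forall>u\<in>U \<inter> ?L. u \<otimes> h = h \<otimes> u)"
        unfolding mem_quasi_center_top_subgroup_iff[OF L] by blast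
    qed
    then show False using not_discrete_if_cocompact[OF core_normal core_cocompact] by simp
  qed
  then have "discrete_in G ?Z" using discrete_iff_misses[OF n] by simp
  then have "?Z \<subseteq> quasi_center G" by (rule discrete_normal_quasi_center[OF n])
  then show "?Z \<subseteq> quasi_center G \<inter> ?L"
    by (auto simp: mem_quasi_center_top_subgroup_iff[OF L])
  show "quasi_center G \<inter> ?L \<subseteq> ?Z"
    using quasi_center_centralizer[where M = ?L]
    by (auto simp: mem_quasi_center_top_subgroup_iff[OF L])
qed

end

section \<open>Minimal closed normal subgroups\<close>

context top_group
begin

definition centralizer :: "'a set \<Rightarrow> 'a set" where
  "centralizer S = {g \<in> carrier G. \<forall>s\<in>S. g \<otimes> s = s \<otimes> g}"

lemma centralizerI:
  assumes "g \<in> carrier G" "\<And>s. s \<in> S \<Longrightarrow> g \<otimes> s = s \<otimes> g"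
  shows "g \<in> centralizer S"
  using assms by (simp add: centralizer_def)

lemma centralizerD:
  assumes "g \<in> centralizer S"
  shows "g \<in> carrier G" "\<And>s. s \<in> S \<Longrightarrow> g \<otimes> s = s \<otimes> g"
  using assms by (simp_all add: centralizer_def)

lemma centralizer_subgroup:
  assumes "S \<subseteq> carrier G"
  shows "subgroup (centralizer S) G"
proof (rule subgroupI)
  have "\<one> \<in> centralizer S" using assms by (auto simp: centralizer_def)
  then show "centralizer S \<noteq> {}" by blast
  fix a b assume a: "a \<in> centralizer S"
  then show "inv a \<in> centralizer S"
    using assms by (auto simp: centralizer_def intro!: commute_inv)
  assume b: "b \<in> centralizer S"
  have "a \<otimes> b \<otimes> s = s \<otimes> (a \<otimes> b)" if "s \<in> S" for s
    using a b that assms by (intro commute_mult) (auto simp: centralizer_def)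
  then show "a \<otimes> b \<in> centralizer S"
    using a b by (simp add: centralizer_def)
qed (auto simp: centralizer_def)

text \<open>
  The centralizer is cut out by the equations \<open>[g, s] = \<one>\<close>.
\<close>

lemma centralizer_closed:
  assumes t1: "closedin (topo G) {\<one>}" and S: "S \<subseteq> carrier G"
  shows "closedin (topo G) (centralizer S)"
proof -
  let ?f = "\<lambda>s g. g \<otimes> s \<otimes> inv g \<otimes> inv s"
  have "centralizer S = topspace (topo G) \<inter> (\<Inter>s\<in>S. {g \<in> carrier G. ?f s g \<in> {\<one>}})"
  proof -
    have "(?f s g = \<one>) \<longleftrightarrow> g \<otimes> s = s \<otimes> g" if "g \<in> carrier G" "s \<in> carrier G" for g s
    proof -
      have "?f s g = \<one> \<longleftrightarrow> ?f s g \<otimes> s \<otimes> g = s \<otimes> g"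
        using that by (metis inv_closed l_one m_closed r_cancel_one' m_assoc)
      then show ?thesis using that by (simp add: m_assoc)
    qed
    then show ?thesis using S by (auto simp: centralizer_def subset_iff)
  qed
  also have "closedin (topo G) \<dots>"
  proof -
    have "closedin (topo G) {g \<in> carrier G. ?f s g \<in> {\<one>}}" if "s \<in> S" for s
    proof -
      have "continuous_map (topo G) (topo G) (?f s)"
        using that S by (intro continuous_group) auto
      from closedin_continuous_map_preimage[OF this t1] show ?thesis by simp
    qed
    then have "closedin (topo G) (\<Inter>s\<in>S. {g \<in> carrier G. ?f s g \<in> {\<one>}})" if "S \<noteq> {}"
      using that by (intro closedin_Inter) auto
    then show ?thesis
      using closedin_topspace[of "topo G"] by (cases "S = {}") (auto simp del: topspace_eq intro: closedin_Int)
  qed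
  finally show ?thesis .
qed

lemma centralizer_normal:
  assumes S: "S \<subseteq> carrier G" and inv: "\<And>x s. x \<in> carrier G \<Longrightarrow> s \<in> S \<Longrightarrow> x \<otimes> s \<otimes> inv x \<in> S"
  shows "centralizer S \<lhd> G"
  unfolding normal_inv_iff
proof (intro conjI ballI centralizer_subgroup[OF S])
  fix x z assume x: "x \<in> carrier G" and z: "z \<in> centralizer S"
  have zG: "z \<in> carrier G" using z by (simp add: centralizer_def)
  have "x \<otimes> z \<otimes> inv x \<otimes> s = s \<otimes> (x \<otimes> z \<otimes> inv x)" if s: "s \<in> S" for s
  proof -
    have sG: "s \<in> carrier G" using s S by blast
    have "inv x \<otimes> s \<otimes> x \<in> S" using inv[of "inv x" s] x s by simp
    then have "z \<otimes> (inv x \<otimes> s \<otimes> x) = (inv x \<otimes> s \<otimes> x) \<otimes> z" using z by (simp add: centralizer_def)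
    then have "x \<otimes> (z \<otimes> (inv x \<otimes> s \<otimes> x)) \<otimes> inv x = x \<otimes> ((inv x \<otimes> s \<otimes> x) \<otimes> z) \<otimes> inv x" by simp
    then show ?thesis using x zG sG by (simp add: m_assoc)
  qed
  then show "x \<otimes> z \<otimes> inv x \<in> centralizer S" using x zG by (simp add: centralizer_def)
qed

lemma nontrivial_closed_normalD:
  assumes "N \<in> nontrivial_closed_normal G"
  shows "N \<lhd> G" "closedin (topo G) N" "N \<noteq> {\<one>}" "subgroup N G" "N \<subseteq> carrier G"
  using assms normal_imp_subgroup[of N G] subgroup.subset[of N G]
  by (simp_all add: nontrivial_closed_normal_def)

end

text \<open>
  The topological properties of \<open>Q\<close> from which the structure of its minimal closed normal subgroups is
  deduced. The compact set \<open>C\<close> drives all applications of the finite intersection property.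
  The set \<open>A\<close> is a group of topological automorphisms that leaves no proper non-trivial closed normal
  subgroup invariant; its elements are functions that only matter on the carrier, which is why the group
  laws are stated pointwise.
\<close>

locale closed_normal_structure = top_group +
  fixes C :: "'a set" and A :: "('a \<Rightarrow> 'a) set"
  assumes t1: "closedin (topo G) {\<one>}"
    and compact: "compactin (topo G) C" and one_notin: "\<one> \<notin> C"
    and meets: "M \<in> nontrivial_closed_normal G \<Longrightarrow> M \<inter> C \<noteq> {}"
    and trivial_center: "\<lbrakk>q \<in> carrier G; \<forall>x\<in>carrier G. q \<otimes> x = x \<otimes> q\<rbrakk> \<Longrightarrow> q = \<one>"
    and nontrivial: "carrier G \<noteq> {\<one>}"
    and aut_iso: "\<alpha> \<in> A \<Longrightarrow> \<alpha> \<in> iso G G"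
    and aut_homeomorphic: "\<alpha> \<in> A \<Longrightarrow> homeomorphic_map (topo G) (topo G) \<alpha>"
    and aut_id: "\<exists>\<alpha>\<in>A. \<forall>x\<in>carrier G. \<alpha> x = x"
    and aut_comp: "\<lbrakk>\<alpha> \<in> A; \<beta> \<in> A\<rbrakk> \<Longrightarrow> \<exists>\<gamma>\<in>A. \<forall>x\<in>carrier G. \<gamma> x = \<alpha> (\<beta> x)"
    and aut_inv: "\<alpha> \<in> A \<Longrightarrow> \<exists>\<beta>\<in>A. \<forall>x\<in>carrier G. \<alpha> (\<beta> x) = x"
    and invariant: "\<lbrakk>M \<in> nontrivial_closed_normal G; \<And>\<alpha>. \<alpha> \<in> A \<Longrightarrow> \<alpha> ` M \<subseteq> M\<rbrakk> \<Longrightarrow> M = carrier G"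
begin

definition minimals :: "'a set set" where
  "minimals = {M. minimal_in (nontrivial_closed_normal G) M}"

lemma minimalsD:
  assumes "M \<in> minimals"
  shows "M \<lhd> G" "subgroup M G" "M \<subseteq> carrier G" "closedin (topo G) M" "M \<noteq> {\<one>}"
    "\<And>N. N \<in> nontrivial_closed_normal G \<Longrightarrow> N \<subseteq> M \<Longrightarrow> N = M"
proof -
  show "M \<lhd> G" "closedin (topo G) M" "M \<noteq> {\<one>}"
    "\<And>N. N \<in> nontrivial_closed_normal G \<Longrightarrow> N \<subseteq> M \<Longrightarrow> N = M"
    using assms by (auto simp: minimals_def minimal_in_def nontrivial_closed_normal_def)
  then show "subgroup M G" by (simp add: normal_imp_subgroup)
  then show "M \<subseteq> carrier G" by (rule subgroup.subset)
qed

lemma minimals_nontrivial_closed_normal: "M \<in> minimals \<Longrightarrow> M \<in> nontrivial_closed_normal G"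
  by (simp add: minimals_def minimal_in_def)

lemma aut_closed: "\<alpha> \<in> A \<Longrightarrow> x \<in> carrier G \<Longrightarrow> \<alpha> x \<in> carrier G"
  using aut_iso by (auto simp: iso_def hom_def)

lemma aut_mult: "\<alpha> \<in> A \<Longrightarrow> x \<in> carrier G \<Longrightarrow> y \<in> carrier G \<Longrightarrow> \<alpha> (x \<otimes> y) = \<alpha> x \<otimes> \<alpha> y"
  using aut_iso by (auto simp: iso_def hom_def)

lemma aut_inj: "\<alpha> \<in> A \<Longrightarrow> inj_on \<alpha> (carrier G)"
  using aut_iso by (auto simp: iso_def bij_betw_def)

lemma aut_inverse:
  assumes "\<alpha> \<in> A"
  shows "\<exists>\<beta>\<in>A. (\<forall>x\<in>carrier G. \<alpha> (\<beta> x) = x) \<and> (\<forall>x\<in>carrier G. \<beta> (\<alpha> x) = x)"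
proof -
  obtain \<beta> where "\<beta> \<in> A" "\<forall>x\<in>carrier G. \<alpha> (\<beta> x) = x" using aut_inv[OF assms] by (elim bexE)
  then have b: "\<beta> \<in> A" "\<And>x. x \<in> carrier G \<Longrightarrow> \<alpha> (\<beta> x) = x" by simp_all
  have "\<beta> (\<alpha> x) = x" if "x \<in> carrier G" for x
  proof -
    have c: "\<alpha> x \<in> carrier G" by (rule aut_closed[OF assms that])
    show ?thesis
      by (rule inj_onD[OF aut_inj[OF assms] b(2)[OF c] aut_closed[OF b(1) c] that])
  qed
  with b show ?thesis by (intro bexI[of _ \<beta>]) auto
qed

lemma image_nontrivial_closed_normal:
  assumes a: "\<alpha> \<in> A" and M: "M \<in> nontrivial_closed_normal G"
  shows "\<alpha> ` M \<in> nontrivial_closed_normal G"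
proof -
  have M': "M \<lhd> G" "closedin (topo G) M" "M \<noteq> {\<one>}" using M by (auto simp: nontrivial_closed_normal_def)
  have MG: "M \<subseteq> carrier G" "\<one> \<in> M"
    using normal_imp_subgroup[OF M'(1)] by (auto simp: subgroup.subset subgroup.one_closed)
  interpret h: group_hom G G \<alpha>
    using aut_iso[OF a] by unfold_locales (simp add: iso_def)
  have "\<alpha> ` M \<lhd> G"
    by (rule iso_normal_subgroup[OF aut_iso[OF a] is_group is_group M'(1)])
  moreover have "closedin (topo G) (\<alpha> ` M)"
    using homeomorphic_imp_closed_map[OF aut_homeomorphic[OF a]] M'(2) by (simp add: closed_map_def)
  moreover have "\<alpha> ` M \<noteq> {\<one>}"
  proof
    assume e: "\<alpha> ` M = {\<one>}"
    have "x = \<one>" if "x \<in> M" for x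
    proof -
      have "\<alpha> x = \<alpha> \<one>" using e that by auto
      then show ?thesis by (rule inj_onD[OF aut_inj[OF a]]) (use that MG in auto)
    qed
    then show False using M'(3) MG by blast
  qed
  ultimately show ?thesis by (simp add: nontrivial_closed_normal_def)
qed

lemma image_minimal:
  assumes a: "\<alpha> \<in> A" and M: "M \<in> minimals"
  shows "\<alpha> ` M \<in> minimals"
proof -
  obtain \<beta> where "\<beta> \<in> A" "\<forall>x\<in>carrier G. \<alpha> (\<beta> x) = x" "\<forall>x\<in>carrier G. \<beta> (\<alpha> x) = x"
    using aut_inverse[OF a] by (elim bexE conjE)
  then have b: "\<beta> \<in> A" "\<And>x. x \<in> carrier G \<Longrightarrow> \<alpha> (\<beta> x) = x" "\<And>x. x \<in> carrier G \<Longrightarrow> \<beta> (\<alpha> x) = x"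
    by simp_all
  have "N = \<alpha> ` M" if N: "N \<in> nontrivial_closed_normal G" and sub: "N \<subseteq> \<alpha> ` M" for N
  proof -
    have NG: "N \<subseteq> carrier G" by (rule nontrivial_closed_normalD[OF N])
    have MG: "M \<subseteq> carrier G" by (rule minimalsD(3)[OF M])
    have "\<beta> ` N \<subseteq> M"
    proof clarify
      fix n assume "n \<in> N"
      then obtain m where "m \<in> M" "n = \<alpha> m" using sub by auto
      then show "\<beta> n \<in> M" using b(3)[of m] MG by auto
    qed
    from minimalsD(6)[OF M image_nontrivial_closed_normal[OF b(1) N] this]
    have "\<alpha> ` M = (\<lambda>n. \<alpha> (\<beta> n)) ` N" by (simp add: image_image[symmetric])
    also have "\<dots> = N" using b(2) NG by (simp add: subset_iff cong: image_cong_simp)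
    finally show ?thesis by simp
  qed
  then show ?thesis
    using image_nontrivial_closed_normal[OF a minimals_nontrivial_closed_normal[OF M]]
    by (auto simp: minimals_def minimal_in_def)
qed

lemma minimals_disjoint:
  assumes M: "M \<in> minimals" "M' \<in> minimals" "M \<noteq> M'"
  shows "M \<inter> M' = {\<one>}"
proof (rule ccontr)
  assume "M \<inter> M' \<noteq> {\<one>}"
  then have "M \<inter> M' \<in> nontrivial_closed_normal G"
    using normal_subgroup_intersect[OF minimalsD(1)[OF M(1)] minimalsD(1)[OF M(2)]] minimalsD(4)[OF M(1)] minimalsD(4)[OF M(2)]
    by (simp add: nontrivial_closed_normal_def closedin_Int)
  then have "M \<inter> M' = M" "M \<inter> M' = M'"
    using minimalsD(6)[OF M(1)] minimalsD(6)[OF M(2)] by blast+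
  then show False using M(3) by simp
qed

lemma minimals_commute:
  assumes M: "M \<in> minimals" "M' \<in> minimals" "M \<noteq> M'" and x: "x \<in> M" "y \<in> M'"
  shows "x \<otimes> y = y \<otimes> x"
proof -
  interpret M: normal M G by (rule minimalsD[OF M(1)])
  interpret M': normal M' G by (rule minimalsD[OF M(2)])
  have G: "x \<in> carrier G" "y \<in> carrier G" using x M.subset M'.subset by blast+
  have "x \<otimes> (y \<otimes> inv x \<otimes> inv y) \<in> M" by (intro M.m_closed x M.inv_op_closed2 G M.m_inv_closed)
  moreover have "(x \<otimes> y \<otimes> inv x) \<otimes> inv y \<in> M'" by (intro M'.m_closed x M'.inv_op_closed2 G M'.m_inv_closed)
  ultimately have "x \<otimes> y \<otimes> inv x \<otimes> inv y \<in> M \<inter> M'" using G by (simp add: m_assoc)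
  then have "x \<otimes> y \<otimes> inv x \<otimes> inv y = \<one>" using minimals_disjoint[OF M] by simp
  then have "x \<otimes> y \<otimes> inv x \<otimes> inv y \<otimes> y \<otimes> x = \<one> \<otimes> y \<otimes> x" by simp
  then show ?thesis using G by (simp add: m_assoc)
qed

text \<open>
  The centralizer of the union is closed, normal and invariant under \<open>A\<close>. If it were not trivial it would
  be the whole group, and the members of \<open>F\<close> would be central.
\<close>

lemma centralizer_of_invariant_family:
  assumes F: "F \<subseteq> minimals" "F \<noteq> {}" and inv: "\<And>\<alpha> M. \<alpha> \<in> A \<Longrightarrow> M \<in> F \<Longrightarrow> \<alpha> ` M \<in> F"
  shows "centralizer (\<Union>F) = {\<one>}"
proof (rule ccontr)
  assume ne: "centralizer (\<Union>F) \<noteq> {\<one>}"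
  have S: "\<Union>F \<subseteq> carrier G" using F minimalsD(3) by blast
  have "x \<otimes> s \<otimes> inv x \<in> \<Union>F" if x: "x \<in> carrier G" and s: "s \<in> \<Union>F" for x s
  proof -
    obtain M where M: "M \<in> F" "s \<in> M" using s by blast
    then have "M \<in> minimals" using F by blast
    then have "x \<otimes> s \<otimes> inv x \<in> M" using x M(2) by (intro normal.inv_op_closed2[OF minimalsD(1)])
    then show ?thesis using M by blast
  qed
  then have "centralizer (\<Union>F) \<in> nontrivial_closed_normal G"
    using centralizer_normal[OF S] centralizer_closed[OF t1 S] ne by (simp add: nontrivial_closed_normal_def)
  moreover have "\<alpha> ` centralizer (\<Union>F) \<subseteq> centralizer (\<Union>F)" if a: "\<alpha> \<in> A" for \<alpha>
  proof
    fix w assume "w \<in> \<alpha> ` centralizer (\<Union>F)"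
    then obtain z where "z \<in> centralizer (\<Union>F)" and zw: "w = \<alpha> z" by blast
    then have z: "w = \<alpha> z" "z \<in> carrier G" "\<And>s. s \<in> \<Union>F \<Longrightarrow> z \<otimes> s = s \<otimes> z"
      using zw centralizerD by blast+
    obtain \<beta> where "\<beta> \<in> A" "\<forall>x\<in>carrier G. \<alpha> (\<beta> x) = x" "\<forall>x\<in>carrier G. \<beta> (\<alpha> x) = x"
      using aut_inverse[OF a] by (elim bexE conjE)
    then have b: "\<beta> \<in> A" "\<And>x. x \<in> carrier G \<Longrightarrow> \<alpha> (\<beta> x) = x" by simp_all
    show "w \<in> centralizer (\<Union>F)"
    proof (rule centralizerI)
      show "w \<in> carrier G" unfolding z(1) by (rule aut_closed[OF a z(2)])
      fix s assume s: "s \<in> \<Union>F"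
      obtain M where M: "M \<in> F" "s \<in> M" using s by blast
      then have bs: "\<beta> s \<in> \<Union>F" using inv[OF b(1) M(1)] by blast
      have sG: "s \<in> carrier G" using s S by blast
      have bG: "\<beta> s \<in> carrier G" by (rule aut_closed[OF b(1) sG])
      have "\<alpha> (z \<otimes> \<beta> s) = \<alpha> (\<beta> s \<otimes> z)" using z(3)[OF bs] by simp
      then show "w \<otimes> s = s \<otimes> w"
        unfolding z(1) aut_mult[OF a z(2) bG] aut_mult[OF a bG z(2)] b(2)[OF sG] .
    qed
  qed
  ultimately have all: "centralizer (\<Union>F) = carrier G" by (rule invariant)
  obtain M where M: "M \<in> F" using F by blast
  have Mm: "M \<in> minimals" using M F by blast
  have "s = \<one>" if "s \<in> M" for s
  proof (rule trivial_center)
    show "s \<in> carrier G" using that minimalsD(3)[OF Mm] by blast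
    show "\<forall>x\<in>carrier G. s \<otimes> x = x \<otimes> s"
    proof
      fix x assume "x \<in> carrier G"
      then have "x \<in> centralizer (\<Union>F)" using all by simp
      then have "x \<otimes> s = s \<otimes> x" by (rule centralizerD) (use that M in blast)
      then show "s \<otimes> x = x \<otimes> s" by simp
    qed
  qed
  then have "M \<subseteq> {\<one>}" by blast
  then show False using minimalsD(5)[OF Mm] subgroup.one_closed[OF minimalsD(2)[OF Mm]] by blast
qed

text \<open>
  A minimal closed normal subgroup outside the orbit of \<open>M\<close> centralizes all members of the orbit, but
  the centralizer of the orbit is trivial.
\<close>

lemma minimals_conjugate:
  assumes M: "M \<in> minimals" "M' \<in> minimals"
  shows "\<exists>\<alpha>\<in>A. M' = \<alpha> ` M"
proof (rule ccontr)
  assume no: "\<not> ?thesis"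
  let ?F = "(\<lambda>\<alpha>. \<alpha> ` M) ` A"
  have sub: "?F \<subseteq> minimals" using image_minimal M by blast
  have ne: "?F \<noteq> {}" using aut_id by blast
  have inv: "\<alpha> ` N \<in> ?F" if a: "\<alpha> \<in> A" and N: "N \<in> ?F" for \<alpha> N
  proof -
    obtain \<beta> where b: "\<beta> \<in> A" "N = \<beta> ` M" using N by blast
    obtain \<gamma> where g: "\<gamma> \<in> A" "\<forall>x\<in>carrier G. \<gamma> x = \<alpha> (\<beta> x)" using aut_comp[OF a b(1)] by (elim bexE)
    have "\<alpha> ` N = \<gamma> ` M" using g(2) minimalsD(3)[OF M(1)] by (force simp: b image_image)
    then show ?thesis using g by blast
  qed
  from centralizer_of_invariant_family[OF sub ne inv] have c: "centralizer (\<Union>?F) = {\<one>}" .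
  have "M' \<subseteq> centralizer (\<Union>?F)"
  proof
    fix x assume x: "x \<in> M'"
    show "x \<in> centralizer (\<Union>?F)"
    proof (rule centralizerI)
      show "x \<in> carrier G" using x minimalsD(3)[OF M(2)] by (rule subsetD[rotated])
      fix s assume s: "s \<in> \<Union>?F"
      obtain N where N: "N \<in> ?F" "s \<in> N" using s by blast
      have Nm: "N \<in> minimals" using N(1) sub by (rule subsetD[rotated])
      have "M' \<noteq> N" using N(1) no by blast
      from minimals_commute[OF M(2) Nm this x N(2)] show "x \<otimes> s = s \<otimes> x" .
    qed
  qed
  then have "M' \<subseteq> {\<one>}" unfolding c .
  then show False using minimalsD(5)[OF M(2)] subgroup.one_closed[OF minimalsD(2)[OF M(2)]] by blast
qed

text \<open>
  A chain of non-trivial closed normal subgroups has a non-trivial intersection, because each of them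
  meets the compact set \<open>C\<close>. Zorn's lemma is applied to the complements.
\<close>

lemma minimals_exist: "minimals \<noteq> {}"
proof -
  let ?N = "nontrivial_closed_normal G"
  have car: "carrier G \<in> ?N"
    using nontrivial closedin_topspace[of "topo G"]
    by (simp add: nontrivial_closed_normal_def normal_inv_iff subgroup_self)
  let ?P = "(\<lambda>M. carrier G - M) ` ?N"
  have NG: "M \<subseteq> carrier G" if "M \<in> ?N" for M by (rule nontrivial_closed_normalD[OF that])
  have "\<exists>U\<in>?P. \<forall>X\<in>K. X \<subseteq> U" if K: "subset.chain ?P K" for K
  proof (cases "K = {}")
    case True then show ?thesis using car by blast
  next
    case False
    let ?K = "{M \<in> ?N. carrier G - M \<in> K}"
    have KP: "K \<subseteq> ?P" using K by (simp add: subset.chain_def)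
    have Kne: "?K \<noteq> {}" using False KP by blast
    have lin: "M \<subseteq> M' \<or> M' \<subseteq> M" if "M \<in> ?K" "M' \<in> ?K" for M M'
    proof -
      have "carrier G - M \<subseteq> carrier G - M' \<or> carrier G - M' \<subseteq> carrier G - M"
        using that K by (auto simp: subset_chain_def)
      then show ?thesis using NG[of M] NG[of M'] that by blast
    qed
    have fin: "finite F \<Longrightarrow> F \<noteq> {} \<Longrightarrow> F \<subseteq> ?K \<Longrightarrow> \<Inter>F \<in> F" for F
    proof (induction rule: finite_ne_induct)
      case (singleton x) then show ?case by simp
    next
      case (insert x F)
      then have "\<Inter>F \<in> F" by blast
      moreover then have "x \<subseteq> \<Inter>F \<or> \<Inter>F \<subseteq> x" using lin[of x "\<Inter>F"] insert.prems by blast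
      ultimately show ?case by (auto simp: Int_absorb1 Int_absorb2)
    qed
    have "C \<inter> \<Inter>F \<noteq> {}" if "finite F" "F \<subseteq> ?K" for F
    proof (cases "F = {}")
      case True
      then show ?thesis using meets[OF car] by auto
    next
      case False
      then have "\<Inter>F \<in> ?N" using fin[OF that(1) False that(2)] that(2) by blast
      from meets[OF this] show ?thesis by blast
    qed
    moreover have "\<forall>M\<in>?K. closedin (topo G) M" by (auto simp: nontrivial_closed_normal_def)
    ultimately have ne: "C \<inter> \<Inter>?K \<noteq> {}" using compact unfolding compactin_fip by blast
    have "\<Inter>?K \<in> ?N"
    proof -
      have "closedin (topo G) (\<Inter>?K)"
        using Kne by (intro closedin_Inter) (auto simp: nontrivial_closed_normal_def)
      moreover have "subgroup (\<Inter>?K) G"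
        using Kne by (intro subgroups_Inter) (auto simp: nontrivial_closed_normal_def normal_imp_subgroup)
      moreover have "x \<otimes> h \<otimes> inv x \<in> \<Inter>?K" if "x \<in> carrier G" "h \<in> \<Inter>?K" for x h
        using that by (auto simp: nontrivial_closed_normal_def intro: normal.inv_op_closed2)
      moreover have "\<Inter>?K \<noteq> {\<one>}" using ne one_notin by auto
      ultimately show ?thesis by (auto simp: nontrivial_closed_normal_def normal_inv_iff)
    qed
    moreover have "X \<subseteq> carrier G - \<Inter>?K" if X: "X \<in> K" for X
    proof -
      obtain M where M: "M \<in> ?N" "X = carrier G - M" using X KP by blast
      then have "M \<in> ?K" using X by simp
      then show ?thesis using M by blast
    qed
    ultimately show ?thesis by blast
  qed
  then obtain X where X: "X \<in> ?P" "\<forall>Y\<in>?P. X \<subseteq> Y \<longrightarrow> Y = X"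
    using subset_Zorn[of ?P] by blast
  then obtain M where M: "M \<in> ?N" "X = carrier G - M" by blast
  have "N = M" if "N \<in> ?N" "N \<subseteq> M" for N
  proof -
    have "carrier G - N \<in> ?P" using that(1) by (rule imageI)
    moreover have "X \<subseteq> carrier G - N" using that(2) M(2) by blast
    ultimately have "carrier G - N = carrier G - M" unfolding M(2)[symmetric] by (rule X(2)[rule_format])
    then show ?thesis using NG[OF M(1)] NG[OF that(1)] by blast
  qed
  then show ?thesis using M by (auto simp: minimals_def minimal_in_def)
qed

text \<open>
  Finitely many of the centralizers of minimal subgroups contain a common further minimal subgroup,
  which meets \<open>C\<close>. If there were infinitely many, compactness would give a point of \<open>C\<close> in all of the
  centralizers, in contradiction to \<open>\<one> \<notin> C\<close>.
\<close>

lemma minimals_finite: "finite minimals"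
proof (rule ccontr)
  assume inf: "infinite minimals"
  let ?U = "centralizer ` minimals"
  have cl: "\<forall>Z\<in>?U. closedin (topo G) Z" using centralizer_closed[OF t1] minimalsD(3) by blast
  have "C \<inter> \<Inter>F \<noteq> {}" if F: "finite F" "F \<subseteq> ?U" for F
  proof -
    obtain K where K: "K \<subseteq> minimals" "finite K" "F = centralizer ` K"
      using finite_subset_image[OF F] by blast
    obtain M where M: "M \<in> minimals" "M \<notin> K"
      using inf K(2) by (metis finite_subset subsetI)
    have "M \<subseteq> centralizer N" if N: "N \<in> K" for N
    proof
      fix x assume x: "x \<in> M"
      have "N \<in> minimals" "M \<noteq> N" using N K M by blast+
      then show "x \<in> centralizer N"
        using x minimalsD(3)[OF M(1)] by (intro centralizerI minimals_commute[OF M(1) \<open>N \<in> minimals\<close> \<open>M \<noteq> N\<close>]) auto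
    qed
    then show ?thesis
      using meets[OF minimals_nontrivial_closed_normal[OF M(1)]] K(3) by blast
  qed
  then have "C \<inter> \<Inter>?U \<noteq> {}" using compact cl unfolding compactin_fip by blast
  then obtain c where c: "c \<in> C" "\<And>M. M \<in> minimals \<Longrightarrow> c \<in> centralizer M" by blast
  have "c \<in> carrier G" using c(1) compactin_subset_topspace[OF compact] by auto
  then have "c \<in> centralizer (\<Union>minimals)"
    using centralizerD(2)[OF c(2)] by (intro centralizerI) auto
  also have "centralizer (\<Union>minimals) = {\<one>}"
    by (intro centralizer_of_invariant_family minimals_exist image_minimal order_refl)
  finally show False using c(1) one_notin by simp
qed

text \<open>
  The smallest closed subgroup containing all minimal ones is normal and invariant under \<open>A\<close>.
\<close>

lemma closed_subgroup_containing_minimals: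
  assumes W: "subgroup W G" "closedin (topo G) W" "\<Union>minimals \<subseteq> W"
  shows "W = carrier G"
proof -
  let ?K = "{W. subgroup W G \<and> closedin (topo G) W \<and> \<Union>minimals \<subseteq> W}"
  have Kne: "?K \<noteq> {}" using W by blast
  have aux: "f ` \<Inter>?K \<subseteq> \<Inter>?K"
    if f: "f \<in> hom G G" and c: "continuous_map (topo G) (topo G) f"
      and m: "\<And>M. M \<in> minimals \<Longrightarrow> f ` M \<subseteq> \<Union>minimals" for f
  proof clarify
    fix t X assume t: "t \<in> \<Inter>?K" and X: "subgroup X G" "closedin (topo G) X" "\<Union>minimals \<subseteq> X"
    interpret h: group_hom G G f using f by unfold_locales
    let ?X = "{g \<in> carrier G. f g \<in> X}"
    have "subgroup ?X G"
    proof (rule subgroupI)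
      have "\<one> \<in> ?X" using subgroup.one_closed[OF X(1)] by simp
      then show "?X \<noteq> {}" by blast
      fix a b assume a: "a \<in> ?X"
      then show "inv a \<in> ?X" using subgroup.m_inv_closed[OF X(1)] by simp
      assume "b \<in> ?X"
      then show "a \<otimes> b \<in> ?X" using subgroup.m_closed[OF X(1)] a by simp
    qed auto
    moreover have "closedin (topo G) ?X" using closedin_continuous_map_preimage[OF c X(2)] by simp
    moreover have "\<Union>minimals \<subseteq> ?X" using m X(3) minimalsD(3) by blast
    ultimately have "?X \<in> ?K" by blast
    then show "f t \<in> X" using t by blast
  qed
  have "subgroup (\<Inter>?K) G" using Kne by (intro subgroups_Inter) auto
  moreover have "x \<otimes> t \<otimes> inv x \<in> \<Inter>?K" if x: "x \<in> carrier G" and t: "t \<in> \<Inter>?K" for x t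
  proof -
    have "(\<lambda>t. x \<otimes> t \<otimes> inv x) ` \<Inter>?K \<subseteq> \<Inter>?K"
    proof (rule aux)
      show "(\<lambda>t. x \<otimes> t \<otimes> inv x) \<in> hom G G" using x by (auto simp: hom_def m_assoc)
      show "continuous_map (topo G) (topo G) (\<lambda>t. x \<otimes> t \<otimes> inv x)" by (rule continuous_conj[OF x])
      fix M assume "M \<in> minimals"
      then show "(\<lambda>t. x \<otimes> t \<otimes> inv x) ` M \<subseteq> \<Union>minimals"
        using normal.inv_op_closed2[OF minimalsD(1) x] by blast
    qed
    then show ?thesis using t by blast
  qed
  moreover have "closedin (topo G) (\<Inter>?K)" using Kne by (intro closedin_Inter) auto
  moreover have "\<Inter>?K \<noteq> {\<one>}"
  proof -
    obtain M where M: "M \<in> minimals" using minimals_exist by blast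
    have "M \<subseteq> \<Inter>?K" using M by blast
    then show ?thesis using minimalsD(5)[OF M] subgroup.one_closed[OF minimalsD(2)[OF M]] by blast
  qed
  ultimately have "\<Inter>?K \<in> nontrivial_closed_normal G"
    by (simp add: nontrivial_closed_normal_def normal_inv_iff)
  moreover have "\<alpha> ` \<Inter>?K \<subseteq> \<Inter>?K" if a: "\<alpha> \<in> A" for \<alpha>
  proof (rule aux)
    show "\<alpha> \<in> hom G G" using aut_iso[OF a] by (simp add: iso_def)
    show "continuous_map (topo G) (topo G) \<alpha>" using aut_homeomorphic[OF a] by (rule homeomorphic_imp_continuous_map)
    show "\<alpha> ` M \<subseteq> \<Union>minimals" if "M \<in> minimals" for M using image_minimal[OF a that] by blast
  qed
  ultimately have "\<Inter>?K = carrier G" by (rule invariant)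
  then show ?thesis using W subgroup.subset[OF W(1)] by blast
qed

text \<open>
  Let \<open>N\<close> be closed and normal in \<open>M\<close>. Its normalizer is closed and contains \<open>M\<close> as well as the other
  minimal subgroups, which even centralize \<open>M\<close>. So \<open>N\<close> is normal in \<open>G\<close>, and minimality of \<open>M\<close> applies.
\<close>

lemma minimals_simple:
  assumes M: "M \<in> minimals"
  shows "topologically_simple (top_subgroup G M)"
  unfolding topologically_simple_def
proof (intro conjI allI impI)
  show "topological_group (top_subgroup G M)" by (rule topological_group_top_subgroup[OF minimalsD(2)[OF M]])
  show "carrier (top_subgroup G M) \<noteq> {\<one>\<^bsub>top_subgroup G M\<^esub>}" using minimalsD(5)[OF M] by simp
  fix N assume "N \<lhd> top_subgroup G M \<and> closedin (topo (top_subgroup G M)) N"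
  then have N: "subgroup N G" "N \<subseteq> M" "\<And>l n. l \<in> M \<Longrightarrow> n \<in> N \<Longrightarrow> l \<otimes> n \<otimes> inv l \<in> N"
    and c: "closedin (subtopology (topo G) M) N"
    using normal_top_subgroup_iff[OF minimalsD(2)[OF M]] by auto
  have cl: "closedin (topo G) N" using closedin_trans_full[OF c minimalsD(4)[OF M]] .
  have NG: "N \<subseteq> carrier G" using N(1) by (rule subgroup.subset)
  have MG: "M \<subseteq> carrier G" by (rule minimalsD(3)[OF M])
  \<comment> \<open>The normalizer of \<open>N\<close>.\<close>
  let ?W = "{q \<in> carrier G. \<forall>n\<in>N. q \<otimes> n \<otimes> inv q \<in> N \<and> inv q \<otimes> n \<otimes> q \<in> N}"
  have "?W = carrier G"
  proof (rule closed_subgroup_containing_minimals)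
    show "subgroup ?W G"
    proof (rule subgroupI)
      have "\<one> \<in> ?W" using NG by auto
      then show "?W \<noteq> {}" by blast
      fix a b assume a: "a \<in> ?W"
      then show "inv a \<in> ?W" by simp
      assume b: "b \<in> ?W"
      have "(a \<otimes> b) \<otimes> n \<otimes> inv (a \<otimes> b) \<in> N" "inv (a \<otimes> b) \<otimes> n \<otimes> (a \<otimes> b) \<in> N" if n: "n \<in> N" for n
      proof -
        have nG: "n \<in> carrier G" using n NG by blast
        have "a \<otimes> (b \<otimes> n \<otimes> inv b) \<otimes> inv a \<in> N" "inv b \<otimes> (inv a \<otimes> n \<otimes> a) \<otimes> b \<in> N" using a b n by auto
        then show "(a \<otimes> b) \<otimes> n \<otimes> inv (a \<otimes> b) \<in> N" "inv (a \<otimes> b) \<otimes> n \<otimes> (a \<otimes> b) \<in> N"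
          using a b nG by (simp_all add: m_assoc inv_mult_group)
      qed
      then show "a \<otimes> b \<in> ?W" using a b by simp
    qed auto
    have "?W = topspace (topo G) \<inter> (\<Inter>n\<in>N. {q \<in> carrier G. q \<otimes> n \<otimes> inv q \<in> N} \<inter> {q \<in> carrier G. inv q \<otimes> n \<otimes> q \<in> N})"
      by auto
    also have "closedin (topo G) \<dots>"
    proof -
      have "closedin (topo G) {q \<in> carrier G. q \<otimes> n \<otimes> inv q \<in> N}"
        "closedin (topo G) {q \<in> carrier G. inv q \<otimes> n \<otimes> q \<in> N}" if "n \<in> N" for n
      proof -
        have "continuous_map (topo G) (topo G) (\<lambda>q. q \<otimes> n \<otimes> inv q)"
          "continuous_map (topo G) (topo G) (\<lambda>q. inv q \<otimes> n \<otimes> q)"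
          using that NG by (intro continuous_group; auto)+
        from closedin_continuous_map_preimage[OF this(1) cl] closedin_continuous_map_preimage[OF this(2) cl]
        show "closedin (topo G) {q \<in> carrier G. q \<otimes> n \<otimes> inv q \<in> N}"
          "closedin (topo G) {q \<in> carrier G. inv q \<otimes> n \<otimes> q \<in> N}" by simp_all
      qed
      moreover have "N \<noteq> {}" using subgroup.one_closed[OF N(1)] by blast
      ultimately show ?thesis by (intro closedin_Int[OF closedin_topspace] closedin_Inter) auto
    qed
    finally show "closedin (topo G) ?W" .
    show "\<Union>minimals \<subseteq> ?W"
    proof
      fix q assume "q \<in> \<Union>minimals"
      then obtain M' where M': "M' \<in> minimals" "q \<in> M'" by blast
      have qG: "q \<in> carrier G" using M' minimalsD(3) by blast
      have "q \<otimes> n \<otimes> inv q \<in> N \<and> inv q \<otimes> n \<otimes> q \<in> N" if n: "n \<in> N" for n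
      proof (cases "M' = M")
        case True
        then have "q \<in> M" "inv q \<in> M" using M' subgroup.m_inv_closed[OF minimalsD(2)[OF M]] by auto
        then show ?thesis using N(3)[of q n] N(3)[of "inv q" n] n qG by simp
      next
        case False
        have nG: "n \<in> carrier G" using n NG by blast
        have "q \<otimes> n = n \<otimes> q" using minimals_commute[OF M'(1) M False M'(2)] n N(2) by blast
        then have "q \<otimes> n \<otimes> inv q = n" "inv q \<otimes> (n \<otimes> q) = inv q \<otimes> (q \<otimes> n)"
          using qG nG by (simp_all add: m_assoc)
        then show ?thesis using n qG nG by (simp add: m_assoc)
      qed
      then show "q \<in> ?W" using qG by simp
    qed
  qed
  then have "N \<lhd> G" unfolding normal_inv_iff using N(1) by blast
  then have "N = {\<one>} \<or> N = M"
    using minimalsD(6)[OF M, of N] N(2) cl by (auto simp: nontrivial_closed_normal_def)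
  then show "N = {\<one>\<^bsub>top_subgroup G M\<^esub>} \<or> N = carrier (top_subgroup G M)" by simp
qed

end

section \<open>Direct products of minimal closed normal subgroups\<close>

text \<open>
  Two conditions make \<open>G\<close> the topological direct product of its minimal closed normal subgroups. They
  have to generate \<open>G\<close> as an abstract group, not just topologically, in order that every element be a
  product of components. And there has to be a compact open subgroup in which components can be chosen
  inside the same subgroup, in order that the components depend continuously on the element.
\<close>

locale product_structure = closed_normal_structure +
  fixes U :: "'a set"
  assumes generated: "\<lbrakk>subgroup W G; \<Union>minimals \<subseteq> W\<rbrakk> \<Longrightarrow> W = carrier G"
    and U_subgroup: "subgroup U G" and U_open: "openin (topo G) U" and U_compact: "compactin (topo G) U"
    and U_factors: "\<lbrakk>u \<in> U; M \<in> minimals\<rbrakk> \<Longrightarrow> \<exists>m\<in>M \<inter> U. inv m \<otimes> u \<in> centralizer M"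
begin

lemma M_subset: "M \<in> minimals \<Longrightarrow> M \<subseteq> carrier G"
  by (rule minimalsD)

text \<open>
  The elements \<open>m \<otimes> z\<close> with \<open>m \<in> M\<close> and \<open>z\<close> in the centralizer of \<open>M\<close> form a subgroup, and this subgroup
  contains every minimal one.
\<close>

lemma factorization_exists:
  assumes M: "M \<in> minimals" and q: "q \<in> carrier G"
  shows "\<exists>m\<in>M. inv m \<otimes> q \<in> centralizer M"
proof -
  let ?Z = "centralizer M"
  have MG: "M \<subseteq> carrier G" by (rule M_subset[OF M])
  have Msub: "subgroup M G" by (rule minimalsD[OF M])
  have Zsub: "subgroup ?Z G" by (rule centralizer_subgroup[OF MG])
  let ?W = "{q \<in> carrier G. \<exists>m\<in>M. inv m \<otimes> q \<in> ?Z}"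
  have W: "m \<otimes> z \<in> ?W" if "m \<in> M" "z \<in> ?Z" for m z
  proof -
    have "m \<in> carrier G" "z \<in> carrier G" using that MG centralizerD(1) by blast+
    then show ?thesis using that by (auto intro!: bexI[of _ m])
  qed
  have W': "\<exists>m\<in>M. \<exists>z\<in>?Z. q = m \<otimes> z" if q: "q \<in> ?W" for q
  proof -
    obtain m where m: "m \<in> M" "inv m \<otimes> q \<in> ?Z" using q by blast
    have "q = m \<otimes> (inv m \<otimes> q)" using q m MG by (simp add: subset_iff)
    then show ?thesis using m by blast
  qed
  have "?W = carrier G"
  proof (rule generated)
    show "subgroup ?W G"
    proof (rule subgroupI)
      have "\<one> \<otimes> \<one> \<in> ?W" using W subgroup.one_closed[OF Msub] subgroup.one_closed[OF Zsub] by blast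
      then show "?W \<noteq> {}" by blast
      fix a b assume "a \<in> ?W"
      then obtain m z where a: "m \<in> M" "z \<in> ?Z" "a = m \<otimes> z" using W' by blast
      have G: "m \<in> carrier G" "z \<in> carrier G" using a MG centralizerD(1) by blast+
      have "z \<otimes> m = m \<otimes> z" using centralizerD(2)[OF a(2,1)] .
      then have "inv a = inv m \<otimes> inv z" unfolding a(3) using G by (metis inv_mult_group)
      then show "inv a \<in> ?W"
        using W[of "inv m" "inv z"] subgroup.m_inv_closed[OF Msub a(1)] subgroup.m_inv_closed[OF Zsub a(2)] by simp
      assume "b \<in> ?W"
      then obtain n y where b: "n \<in> M" "y \<in> ?Z" "b = n \<otimes> y" using W' by blast
      have G': "n \<in> carrier G" "y \<in> carrier G" using b MG centralizerD(1) by blast+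
      have zn: "z \<otimes> n = n \<otimes> z" using centralizerD(2)[OF a(2) b(1)] .
      have "a \<otimes> b = m \<otimes> (z \<otimes> n) \<otimes> y" unfolding a(3) b(3) using G G' by (simp add: m_assoc)
      also have "\<dots> = (m \<otimes> n) \<otimes> (z \<otimes> y)" unfolding zn using G G' by (simp add: m_assoc)
      finally show "a \<otimes> b \<in> ?W"
        using W[of "m \<otimes> n" "z \<otimes> y"] subgroup.m_closed[OF Msub a(1) b(1)] subgroup.m_closed[OF Zsub a(2) b(2)] by simp
    qed auto
    show "\<Union>minimals \<subseteq> ?W"
    proof
      fix x assume "x \<in> \<Union>minimals"
      then obtain M' where M': "M' \<in> minimals" "x \<in> M'" by blast
      have xG: "x \<in> carrier G" using M' M_subset by blast
      show "x \<in> ?W"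
      proof (cases "M' = M")
        case True
        then show ?thesis using W[of x \<one>] M'(2) subgroup.one_closed[OF Zsub] xG by simp
      next
        case False
        have "x \<in> ?Z" by (rule centralizerI[OF xG]) (rule minimals_commute[OF M'(1) M False M'(2)])
        then show ?thesis using W[of \<one> x] subgroup.one_closed[OF Msub] xG by simp
      qed
    qed
  qed
  then show ?thesis using q by blast
qed

lemma minimal_Int_centralizer:
  assumes M: "M \<in> minimals" and c: "c \<in> M" "c \<in> centralizer M"
  shows "c = \<one>"
proof (rule trivial_center)
  show cG: "c \<in> carrier G" using M_subset[OF M] c(1) by blast
  have "centralizer {c} = carrier G"
  proof (rule generated)
    show "subgroup (centralizer {c}) G" using cG by (intro centralizer_subgroup) simp
    show "\<Union>minimals \<subseteq> centralizer {c}"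
    proof
      fix x assume "x \<in> \<Union>minimals"
      then obtain M' where M': "M' \<in> minimals" "x \<in> M'" by blast
      have xG: "x \<in> carrier G" using M' M_subset by blast
      have "x \<otimes> c = c \<otimes> x"
      proof (cases "M' = M")
        case True
        then have "x \<in> M" using M' by simp
        from centralizerD(2)[OF c(2) this] show ?thesis by simp
      next
        case False
        from minimals_commute[OF M'(1) M False M'(2) c(1)] show ?thesis .
      qed
      then show "x \<in> centralizer {c}" using xG by (intro centralizerI) auto
    qed
  qed
  then show "\<forall>x\<in>carrier G. c \<otimes> x = x \<otimes> c"
    using centralizerD(2)[of _ "{c}" c] by auto
qed

text \<open>
  The component in \<open>M\<close>. It is well defined since \<open>M\<close> intersects its centralizer trivially.
\<close>

definition projection :: "'a set \<Rightarrow> 'a \<Rightarrow> 'a" where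
  "projection M q = (THE m. m \<in> M \<and> inv m \<otimes> q \<in> centralizer M)"

lemma projection_eq:
  assumes M: "M \<in> minimals" and q: "q \<in> carrier G" and m: "m \<in> M" "inv m \<otimes> q \<in> centralizer M"
  shows "projection M q = m"
  unfolding projection_def
proof (rule the_equality)
  show "m \<in> M \<and> inv m \<otimes> q \<in> centralizer M" using m by simp
  fix n assume n: "n \<in> M \<and> inv n \<otimes> q \<in> centralizer M"
  have Msub: "subgroup M G" by (rule minimalsD[OF M])
  have Zsub: "subgroup (centralizer M) G" by (rule centralizer_subgroup[OF M_subset[OF M]])
  have G: "m \<in> carrier G" "n \<in> carrier G" using m n M_subset[OF M] by blast+
  have "inv n \<otimes> q \<otimes> inv (inv m \<otimes> q) \<in> centralizer M"
    by (rule subgroup.m_closed[OF Zsub _ subgroup.m_inv_closed[OF Zsub]]) (use n m in auto)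
  moreover have "inv n \<otimes> q \<otimes> inv (inv m \<otimes> q) = inv n \<otimes> m"
    using G q by (simp add: inv_mult_group m_assoc)
  moreover have "inv n \<otimes> m \<in> M" by (rule subgroup.m_closed[OF Msub subgroup.m_inv_closed[OF Msub]]) (use n m in auto)
  ultimately have "inv n \<otimes> m = \<one>" using minimal_Int_centralizer[OF M] by simp
  then have "n \<otimes> (inv n \<otimes> m) = n" using G by simp
  then show "n = m" using G by simp
qed

lemma projection:
  assumes M: "M \<in> minimals" and q: "q \<in> carrier G"
  shows "projection M q \<in> M" "inv (projection M q) \<otimes> q \<in> centralizer M"
proof -
  obtain m where m: "m \<in> M" "inv m \<otimes> q \<in> centralizer M" using factorization_exists[OF M q] by blast
  have "projection M q = m" by (rule projection_eq[OF M q m])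
  with m show "projection M q \<in> M" "inv (projection M q) \<otimes> q \<in> centralizer M" by simp_all
qed

lemma projection_carrier: "M \<in> minimals \<Longrightarrow> q \<in> carrier G \<Longrightarrow> projection M q \<in> carrier G"
  using subsetD[OF M_subset projection(1)] .

lemma projection_mult:
  assumes M: "M \<in> minimals" and q: "q \<in> carrier G" "r \<in> carrier G"
  shows "projection M (q \<otimes> r) = projection M q \<otimes> projection M r"
proof (rule projection_eq[OF M])
  let ?m = "projection M q" and ?n = "projection M r"
  have mn: "?m \<in> M" "?n \<in> M" using projection(1)[OF M] q by auto
  have G: "?m \<in> carrier G" "?n \<in> carrier G" using projection_carrier[OF M] q by auto
  show "q \<otimes> r \<in> carrier G" using q by simp
  show "?m \<otimes> ?n \<in> M" using subgroup.m_closed[OF minimalsD(2)[OF M] mn] .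
  have Zsub: "subgroup (centralizer M) G" by (rule centralizer_subgroup[OF M_subset[OF M]])
  have c: "(inv ?m \<otimes> q) \<otimes> ?n = ?n \<otimes> (inv ?m \<otimes> q)" by (rule centralizerD(2)[OF projection(2)[OF M q(1)] mn(2)])
  have "inv (?m \<otimes> ?n) \<otimes> (q \<otimes> r) = inv ?n \<otimes> ((inv ?m \<otimes> q) \<otimes> ?n) \<otimes> (inv ?n \<otimes> r)"
    using G q by (simp add: inv_mult_group m_assoc)
  also have "\<dots> = (inv ?m \<otimes> q) \<otimes> (inv ?n \<otimes> r)"
    unfolding c using G q by (simp add: m_assoc)
  also have "\<dots> \<in> centralizer M"
    by (rule subgroup.m_closed[OF Zsub projection(2)[OF M q(1)] projection(2)[OF M q(2)]])
  finally show "inv (?m \<otimes> ?n) \<otimes> (q \<otimes> r) \<in> centralizer M" .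
qed

lemma projection_self: "M \<in> minimals \<Longrightarrow> m \<in> M \<Longrightarrow> projection M m = m"
  using M_subset[of M] subgroup.one_closed[OF centralizer_subgroup[of M]]
  by (intro projection_eq) auto

lemma projection_other:
  assumes M: "M \<in> minimals" "M' \<in> minimals" "M \<noteq> M'" and m: "m \<in> M'"
  shows "projection M m = \<one>"
proof (rule projection_eq[OF M(1)])
  show mG: "m \<in> carrier G" using M_subset[OF M(2)] m by blast
  show "\<one> \<in> M" by (rule subgroup.one_closed[OF minimalsD(2)[OF M(1)]])
  have "m \<in> centralizer M"
    by (rule centralizerI[OF mG]) (rule minimals_commute[OF M(2,1) M(3)[symmetric] m])
  then show "inv \<one> \<otimes> m \<in> centralizer M" using mG by simp
qed

lemma projection_inj:
  assumes q: "q \<in> carrier G" "r \<in> carrier G" and eq: "\<And>M. M \<in> minimals \<Longrightarrow> projection M q = projection M r"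
  shows "q = r"
proof -
  have one: "s = \<one>" if s: "s \<in> carrier G" "\<And>M. M \<in> minimals \<Longrightarrow> projection M s = \<one>" for s
  proof -
    have c: "s \<in> centralizer M" if M: "M \<in> minimals" for M
      using projection(2)[OF M s(1)] s(1) unfolding s(2)[OF M] by simp
    have "s \<in> centralizer (\<Union>minimals)"
    proof (rule centralizerI[OF s(1)])
      fix x assume "x \<in> \<Union>minimals"
      then obtain M where M: "M \<in> minimals" "x \<in> M" by blast
      show "s \<otimes> x = x \<otimes> s" by (rule centralizerD(2)[OF c[OF M(1)] M(2)])
    qed
    also have "centralizer (\<Union>minimals) = {\<one>}"
      by (intro centralizer_of_invariant_family minimals_exist image_minimal order_refl)
    finally show ?thesis by simp
  qed
  have "projection M (inv r \<otimes> q) = \<one>" if M: "M \<in> minimals" for M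
  proof -
    have "projection M r \<otimes> projection M (inv r \<otimes> q) = projection M (r \<otimes> (inv r \<otimes> q))"
      using projection_mult[OF M, of r "inv r \<otimes> q"] q by simp
    also have "\<dots> = projection M r" using q eq[OF M] by simp
    finally have "projection M r \<otimes> projection M (inv r \<otimes> q) = projection M r" .
    then have "inv (projection M r) \<otimes> (projection M r \<otimes> projection M (inv r \<otimes> q)) = inv (projection M r) \<otimes> projection M r"
      by simp
    then show ?thesis using projection_carrier[OF M] q by simp
  qed
  moreover have "inv r \<otimes> q \<in> carrier G" using q by simp
  ultimately have "inv r \<otimes> q = \<one>" by (rule one[rotated])
  then have "r \<otimes> (inv r \<otimes> q) = r \<otimes> \<one>" by (simp only:)
  then show ?thesis using q by simp
qed

text \<open>
  A closed graph argument. The pairs \<open>(u, m) \<in> U \<times> U\<close> with \<open>m \<in> M - V\<close> and \<open>inv m \<otimes> u\<close> centralizing \<open>M\<close>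
  form a closed set, because centralizers are closed; its image in \<open>U\<close>, where the projection leaves \<open>V\<close>,
  is closed as the second factor \<open>U\<close> is compact.
\<close>

lemma projection_continuous_on_U:
  assumes M: "M \<in> minimals" and V: "openin (topo G) V"
  shows "openin (topo G) {u \<in> U. projection M u \<in> V}"
proof -
  let ?X = "subtopology (topo G) U"
  have UG: "U \<subseteq> carrier G" by (rule subgroup.subset[OF U_subgroup])
  have top: "topspace ?X = U" using UG by auto
  have comp: "compact_space ?X" using U_compact by (simp add: compact_space_subtopology)
  have f: "continuous_map (prod_topology ?X ?X) (topo G) fst" "continuous_map (prod_topology ?X ?X) (topo G) snd"
    by (rule continuous_map_into_fulltopology[OF continuous_map_fst],
        rule continuous_map_into_fulltopology[OF continuous_map_snd])
  have g: "continuous_map (prod_topology ?X ?X) (topo G) (\<lambda>p. inv (snd p) \<otimes> fst p)"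
    by (intro continuous_mult continuous_inv f)
  have cM: "closedin (topo G) (M - V)" using minimalsD(4)[OF M] V by (simp add: closedin_diff)
  let ?R = "{p \<in> U \<times> U. snd p \<in> M - V} \<inter> {p \<in> U \<times> U. inv (snd p) \<otimes> fst p \<in> centralizer M}"
  have "closedin (prod_topology ?X ?X) ?R"
    using closedin_continuous_map_preimage[OF f(2) cM]
      closedin_continuous_map_preimage[OF g centralizer_closed[OF t1 M_subset[OF M]]]
    by (intro closedin_Int) (simp_all only: topspace_prod_topology top)
  then have cl: "closedin ?X (fst ` ?R)" using closed_map_fst[OF comp] unfolding closed_map_def by blast
  have "fst ` ?R = {u \<in> U. projection M u \<notin> V}"
  proof
    show "fst ` ?R \<subseteq> {u \<in> U. projection M u \<notin> V}"
    proof
      fix u assume "u \<in> fst ` ?R"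
      then obtain m where m: "u \<in> U" "m \<in> M" "m \<notin> V" "inv m \<otimes> u \<in> centralizer M" by auto
      have "u \<in> carrier G" using m(1) UG by blast
      from projection_eq[OF M this m(2,4)] show "u \<in> {u \<in> U. projection M u \<notin> V}" using m(1,3) by simp
    qed
    show "{u \<in> U. projection M u \<notin> V} \<subseteq> fst ` ?R"
    proof
      fix u assume u: "u \<in> {u \<in> U. projection M u \<notin> V}"
      then obtain m where m: "m \<in> M" "m \<in> U" "inv m \<otimes> u \<in> centralizer M" using U_factors[OF _ M] by blast
      have "u \<in> carrier G" using u UG by blast
      from projection_eq[OF M this m(1,3)] have "(u, m) \<in> ?R" using u m by simp
      then show "u \<in> fst ` ?R" by (rule rev_image_eqI) simp
    qed
  qed
  then have "openin ?X (U - {u \<in> U. projection M u \<notin> V})" using cl unfolding closedin_def top by simp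
  moreover have "U - {u \<in> U. projection M u \<notin> V} = {u \<in> U. projection M u \<in> V}" by blast
  ultimately have "openin ?X {u \<in> U. projection M u \<in> V}" by simp
  then show ?thesis using U_open by (rule openin_trans_full)
qed

lemma projection_one: "M \<in> minimals \<Longrightarrow> projection M \<one> = \<one>"
  using projection_self[of M \<one>] subgroup.one_closed[OF minimalsD(2)] by blast

lemma projection_continuous:
  assumes M: "M \<in> minimals"
  shows "continuous_map (topo G) (subtopology (topo G) M) (projection M)"
proof -
  have "continuous_map (topo G) (topo G) (projection M)"
    unfolding continuous_map_def
  proof (intro conjI allI impI)
    show "projection M \<in> topspace (topo G) \<rightarrow> topspace (topo G)" using projection_carrier[OF M] by simp
    fix V assume V: "openin (topo G) V"
    show "openin (topo G) {q \<in> topspace (topo G). projection M q \<in> V}"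
    proof (subst openin_subopen, intro ballI)
      fix q assume "q \<in> {q \<in> topspace (topo G). projection M q \<in> V}"
      then have q: "q \<in> carrier G" "projection M q \<in> V" by simp_all
      \<comment> \<open>Continuity at \<open>q\<close> follows from continuity at the identity by translation.\<close>
      let ?W = "{x \<in> carrier G. projection M q \<otimes> x \<in> V}"
      have W: "openin (topo G) ?W" by (rule openin_translate[OF projection_carrier[OF M q(1)] V])
      let ?B = "{u \<in> U. projection M u \<in> ?W}"
      let ?T = "{x \<in> carrier G. inv q \<otimes> x \<in> ?B}"
      have "openin (topo G) ?T"
        using q by (intro openin_translate projection_continuous_on_U[OF M W]) simp
      moreover have "q \<in> ?T"
        using q projection_one[OF M] projection_carrier[OF M q(1)] subgroup.one_closed[OF U_subgroup] by simp
      moreover have "?T \<subseteq> {q \<in> topspace (topo G). projection M q \<in> V}"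
      proof
        fix x assume x: "x \<in> ?T"
        then have xG: "x \<in> carrier G" and i: "projection M q \<otimes> projection M (inv q \<otimes> x) \<in> V" by auto
        have "projection M q \<otimes> projection M (inv q \<otimes> x) = projection M x"
          using projection_mult[OF M, of q "inv q \<otimes> x"] q xG by simp
        then show "x \<in> {q \<in> topspace (topo G). projection M q \<in> V}" using i xG by simp
      qed
      ultimately show "\<exists>T. openin (topo G) T \<and> q \<in> T \<and> T \<subseteq> {q \<in> topspace (topo G). projection M q \<in> V}" by blast
    qed
  qed
  then show ?thesis using projection(1)[OF M] by (auto simp: continuous_map_in_subtopology)
qed

abbreviation product_topology_of_minimals :: "('a set \<Rightarrow> 'a) topology" where
  "product_topology_of_minimals \<equiv> product_topology (\<lambda>M. subtopology (topo G) M) minimals"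

lemma topspace_product: "topspace product_topology_of_minimals = (\<Pi>\<^sub>E M\<in>minimals. M)"
  using M_subset by (auto simp: PiE_iff)

text \<open>
  Multiplying up the components in the factors from \<open>S\<close>. For \<open>S = minimals\<close> this gives a continuous
  inverse of the map that sends an element to the family of its components.
\<close>

lemma combine:
  assumes "finite S" "S \<subseteq> minimals"
  shows "\<exists>\<phi>. continuous_map product_topology_of_minimals (topo G) \<phi> \<and>
    (\<forall>f\<in>topspace product_topology_of_minimals. \<forall>M\<in>minimals. projection M (\<phi> f) = (if M \<in> S then f M else \<one>))"
  using assms
proof (induction S)
  case empty
  then show ?case using projection_one by (intro exI[of _ "\<lambda>f. \<one>"]) (auto intro: continuous_const)
next
  case (insert N S)
  then obtain \<phi> where p: "continuous_map product_topology_of_minimals (topo G) \<phi>"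
    "\<And>f M. f \<in> topspace product_topology_of_minimals \<Longrightarrow> M \<in> minimals \<Longrightarrow> projection M (\<phi> f) = (if M \<in> S then f M else \<one>)"
    by auto
  have N: "N \<in> minimals" using insert by blast
  have "continuous_map product_topology_of_minimals (topo G) (\<lambda>f. \<phi> f \<otimes> f N)"
    by (rule continuous_mult[OF p(1) continuous_map_into_fulltopology[OF continuous_map_product_projection[OF N]]])
  moreover have "projection M (\<phi> f \<otimes> f N) = (if M \<in> insert N S then f M else \<one>)"
    if f: "f \<in> topspace product_topology_of_minimals" and M: "M \<in> minimals" for f M
  proof -
    have pG: "\<phi> f \<in> carrier G" using continuous_map_funspace[OF p(1)] f by (auto simp del: topspace_product_topology)
    have fN: "f N \<in> N" and fM: "f M \<in> M" using f N M unfolding topspace_product by (auto simp: PiE_iff)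
    have fG: "f N \<in> carrier G" "f M \<in> carrier G" using fN fM M_subset N M by blast+
    have "projection M (\<phi> f \<otimes> f N) = (if M \<in> S then f M else \<one>) \<otimes> projection M (f N)"
      using projection_mult[OF M pG fG(1)] p(2)[OF f M] by simp
    also have "\<dots> = (if M \<in> insert N S then f M else \<one>)"
    proof (cases "M = N")
      case True
      then show ?thesis using insert.hyps(2) projection_self[OF N fN] fG by simp
    next
      case False
      then show ?thesis using projection_other[OF M N False fN] fG by simp
    qed
    finally show ?thesis .
  qed
  ultimately show ?case by blast
qed

lemma product_isomorphism:
  shows "\<exists>\<psi>. \<psi> \<in> hom G (product_group minimals (top_subgroup G)) \<and>
    bij_betw \<psi> (carrier G) (carrier (product_group minimals (top_subgroup G))) \<and>
    homeomorphic_map (topo G) product_topology_of_minimals \<psi>"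
proof -
  let ?P = product_topology_of_minimals
  let ?\<psi> = "\<lambda>q. \<lambda>M\<in>minimals. projection M q"
  obtain \<phi> where p: "continuous_map ?P (topo G) \<phi>"
    "\<forall>f\<in>topspace ?P. \<forall>M\<in>minimals. projection M (\<phi> f) = (if M \<in> minimals then f M else \<one>)"
    using combine[OF minimals_finite order_refl] by (elim exE conjE)
  have into: "?\<psi> q \<in> topspace ?P" if "q \<in> carrier G" for q
    unfolding topspace_product using projection(1) that by (auto simp: PiE_iff)
  have pG: "\<phi> f \<in> carrier G" if "f \<in> topspace ?P" for f
    using continuous_map_funspace[OF p(1)] that by (auto simp del: topspace_product_topology)
  have r: "?\<psi> (\<phi> f) = f" if f: "f \<in> topspace ?P" for f
  proof (rule extensionalityI[of _ minimals])
    show "?\<psi> (\<phi> f) \<in> extensional minimals" by simp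
    show "f \<in> extensional minimals" using f unfolding topspace_product by (simp add: PiE_iff)
    fix M assume M: "M \<in> minimals"
    then show "?\<psi> (\<phi> f) M = f M" using bspec[OF bspec[OF p(2) f] M] by simp
  qed
  have l: "\<phi> (?\<psi> q) = q" if q: "q \<in> carrier G" for q
  proof (rule projection_inj[OF pG[OF into[OF q]] q])
    fix M assume M: "M \<in> minimals"
    show "projection M (\<phi> (?\<psi> q)) = projection M q" using bspec[OF bspec[OF p(2) into[OF q]] M] M by simp
  qed
  have "continuous_map (topo G) ?P ?\<psi>"
    unfolding continuous_map_componentwise using projection_continuous by auto
  then have "homeomorphic_maps (topo G) ?P ?\<psi> \<phi>"
    unfolding homeomorphic_maps_def using p(1) l r by (simp only: topspace_eq) simp
  then have "homeomorphic_map (topo G) ?P ?\<psi>" by (rule homeomorphic_maps_map[THEN iffD1, THEN conjunct1])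
  moreover have "?\<psi> \<in> hom G (product_group minimals (top_subgroup G))"
    using projection(1) by (auto simp: hom_def PiE_iff projection_mult intro!: restrict_ext)
  moreover have "bij_betw ?\<psi> (carrier G) (carrier (product_group minimals (top_subgroup G)))"
  proof (rule bij_betw_byWitness[where f' = \<phi>])
    show "?\<psi> ` carrier G \<subseteq> carrier (product_group minimals (top_subgroup G))"
      using projection(1) by auto
    show "\<phi> ` carrier (product_group minimals (top_subgroup G)) \<subseteq> carrier G"
      using pG unfolding topspace_product by (intro image_subsetI) simp
    show "\<forall>f\<in>carrier (product_group minimals (top_subgroup G)). ?\<psi> (\<phi> f) = f"
      using r unfolding topspace_product by simp
  qed (use l in auto)
  ultimately show ?thesis by (intro exI[of _ ?\<psi>] conjI)
qed

end

lemma product_of_topologically_simple_if_structure: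
  fixes Q :: "'a topgroup"
  assumes "product_structure Q C A U"
  shows "product_of_topologically_simple Q"
proof -
  interpret product_structure Q C A U by (rule assms)
  obtain \<psi> where p: "\<psi> \<in> hom Q (product_group minimals (top_subgroup Q))"
    "bij_betw \<psi> (carrier Q) (carrier (product_group minimals (top_subgroup Q)))"
    "homeomorphic_map (topo Q) (product_topology (\<lambda>M. subtopology (topo Q) M) minimals) \<psi>"
    using product_isomorphism by (elim exE conjE)
  have "\<psi> \<in> iso Q (top_product minimals (top_subgroup Q))"
    using p(1,2) by (simp add: iso_def hom_def top_product_def)
  moreover have "homeomorphic_map (topo Q) (topo (top_product minimals (top_subgroup Q))) \<psi>"
    using p(3) by (simp add: top_product_def)
  ultimately have "top_isomorphic Q (top_product minimals (top_subgroup Q))"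
    unfolding top_isomorphic_def by blast
  then show ?thesis
    unfolding product_of_topologically_simple_def using minimals_simple by blast
qed

section \<open>The quotient of the core by its quasi-center\<close>

lemma r_coset_top_subgroup [simp]: "N #>\<^bsub>top_subgroup G M\<^esub> g = N #>\<^bsub>G\<^esub> g"
  by (simp add: r_coset_def)

lemma set_mult_top_subgroup [simp]: "set_mult (top_subgroup G M) = set_mult G"
  by (auto simp: set_mult_def fun_eq_iff)

context locally_compact_dichotomy
begin

abbreviation core_group :: "('a, 'b) topgroup_scheme" where
  "core_group \<equiv> top_subgroup G (cocompact_core G)"

abbreviation core_quotient :: "'a set topgroup" where
  "core_quotient \<equiv> top_quotient core_group (quasi_center core_group)"

text \<open>
  The action of \<open>G\<close> on the cosets of \<open>D\<close> in \<open>L\<close>, where \<open>L\<close> is the core and \<open>D\<close> its quasi-center. Here and below,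
  \<open>L\<close> and \<open>D\<close> always have this meaning.
\<close>

definition conjugation :: "'a \<Rightarrow> 'a set \<Rightarrow> 'a set" where
  "conjugation h = (\<lambda>c. h <# c #> inv h)"

lemma core_subgroup: "subgroup (cocompact_core G) G"
  by (rule normal_imp_subgroup[OF core_normal])

lemma core_subset: "cocompact_core G \<subseteq> carrier G"
  by (rule subgroup.subset[OF core_subgroup])

lemma top_group_core: "top_group core_group"
  by (rule top_group.intro[OF topological_group_top_subgroup[OF core_subgroup]])

lemma qc_core_normal_in_core: "quasi_center core_group \<lhd> core_group"
  by (rule top_group.quasi_center_normal[OF top_group_core])

lemma qc_core_normal: "quasi_center core_group \<lhd> G"
  by (rule quasi_center_top_subgroup_normal[OF core_normal])

lemma qc_core_misses: "quasi_center core_group \<inter> \<Phi> = {}"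
  using quasi_center_misses by (auto simp: quasi_center_core)

lemma qc_core_discrete: "discrete_in G (quasi_center core_group)"
  using discrete_iff_misses(1)[OF qc_core_normal] qc_core_misses by simp

text \<open>
  A discrete subgroup intersects a sufficiently small open subgroup trivially, and \<open>{\<one>}\<close> is closed.
\<close>

lemma qc_core_closed: "closedin (topo G) (quasi_center core_group)"
proof -
  have sub: "subgroup (quasi_center core_group) G" by (rule normal_imp_subgroup[OF qc_core_normal])
  obtain U where U: "openin (topo G) U" "U \<inter> quasi_center core_group = {\<one>}"
    using qc_core_discrete discrete_in_iff[OF sub] by auto
  then have "\<one> \<in> U" by blast
  from small_subgroups[OF U(1) this] obtain V where V: "subgroup V G" "openin (topo G) V" "V \<subseteq> U" by blast
  have "quasi_center core_group \<inter> V = {\<one>}"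
    using U(2) V(3) subgroup.one_closed[OF V(1)] subgroup.one_closed[OF sub] by blast
  then show ?thesis
    using closed_subgroup_if_relatively_closed[OF sub V(1,2)] t1 by simp
qed

lemma conjugation_coset:
  assumes h: "h \<in> carrier G" and l: "l \<in> cocompact_core G"
  shows "conjugation h (quasi_center core_group #> l) = quasi_center core_group #> (h \<otimes> l \<otimes> inv h)"
proof -
  let ?D = "quasi_center core_group"
  interpret D: normal ?D G by (rule qc_core_normal)
  have lG: "l \<in> carrier G" using l core_subset by blast
  have DG: "d \<in> carrier G" if "d \<in> ?D" for d using that D.subset by blast
  show ?thesis
  proof
    show "conjugation h (?D #> l) \<subseteq> ?D #> (h \<otimes> l \<otimes> inv h)"
    proof
      fix x assume "x \<in> conjugation h (?D #> l)"
      then obtain d where d: "d \<in> ?D" "x = h \<otimes> (d \<otimes> l) \<otimes> inv h"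
        by (auto simp: conjugation_def l_coset_def r_coset_def)
      then have "x = (h \<otimes> d \<otimes> inv h) \<otimes> (h \<otimes> l \<otimes> inv h)" using h lG DG by (simp add: m_assoc)
      moreover have "h \<otimes> d \<otimes> inv h \<in> ?D" using h d(1) by (rule D.inv_op_closed2)
      ultimately show "x \<in> ?D #> (h \<otimes> l \<otimes> inv h)" unfolding r_coset_def by blast
    qed
    show "?D #> (h \<otimes> l \<otimes> inv h) \<subseteq> conjugation h (?D #> l)"
    proof
      fix x assume "x \<in> ?D #> (h \<otimes> l \<otimes> inv h)"
      then obtain d where d: "d \<in> ?D" "x = d \<otimes> (h \<otimes> l \<otimes> inv h)" by (auto simp: r_coset_def)
      then have "x = h \<otimes> ((inv h \<otimes> d \<otimes> h) \<otimes> l) \<otimes> inv h" using h lG DG by (simp add: m_assoc)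
      moreover have "inv h \<otimes> d \<otimes> h \<in> ?D" using h d(1) by (rule D.inv_op_closed1)
      ultimately show "x \<in> conjugation h (?D #> l)"
        unfolding conjugation_def l_coset_def r_coset_def by blast
    qed
  qed
qed

lemma rcosets_core: "rcosets\<^bsub>core_group\<^esub> N = (\<lambda>l. N #> l) ` cocompact_core G"
  by (auto simp: RCOSETS_def)

lemma conj_core:
  assumes "h \<in> carrier G" "l \<in> cocompact_core G"
  shows "h \<otimes> l \<otimes> inv h \<in> cocompact_core G"
  using core_normal assms by (rule normal.inv_op_closed2)

lemma conjugation_comp:
  assumes "h \<in> carrier G" "k \<in> carrier G" "x \<in> carrier core_quotient"
  shows "conjugation (h \<otimes> k) x = conjugation h (conjugation k x)"
proof -
  obtain l where l: "l \<in> cocompact_core G" "x = quasi_center core_group #> l"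
    using assms(3) by (auto simp: rcosets_core)
  have "l \<in> carrier G" using l core_subset by blast
  then have "h \<otimes> k \<otimes> l \<otimes> inv (h \<otimes> k) = h \<otimes> (k \<otimes> l \<otimes> inv k) \<otimes> inv h"
    using assms(1,2) by (simp add: inv_mult_group m_assoc)
  then show ?thesis
    unfolding l(2) conjugation_coset[OF m_closed[OF assms(1,2)] l(1)] conjugation_coset[OF assms(2) l(1)]
      conjugation_coset[OF assms(1) conj_core[OF assms(2) l(1)]] by simp
qed

lemma conjugation_one:
  assumes "x \<in> carrier core_quotient"
  shows "conjugation \<one> x = x"
proof -
  obtain l where l: "l \<in> cocompact_core G" "x = quasi_center core_group #> l"
    using assms by (auto simp: rcosets_core)
  have "l \<in> carrier G" using l core_subset by blast
  then show ?thesis using l by (simp add: conjugation_coset)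
qed

lemma conjugation_closed:
  assumes "h \<in> carrier G" "x \<in> carrier core_quotient"
  shows "conjugation h x \<in> carrier core_quotient"
  using assms conj_core by (auto simp: rcosets_core conjugation_coset)

lemma topspace_core_quotient: "topspace (coset_topology core_group (quasi_center core_group)) = carrier core_quotient"
  using top_group.topspace_coset_topology[OF top_group_core, of "quasi_center core_group"]
    normal_imp_subgroup[OF qc_core_normal_in_core] subgroup.subset by fastforce

lemma conjugation_continuous:
  assumes h: "h \<in> carrier G"
  shows "continuous_map (topo core_quotient) (topo core_quotient) (conjugation h)"
  unfolding continuous_map_def
proof (intro conjI allI impI)
  let ?D = "quasi_center core_group" and ?L = "cocompact_core G"
  let ?T = "coset_topology core_group ?D"
  have top: "topspace (topo core_group) = carrier core_group" by (rule top_group.topspace_eq[OF top_group_core])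
  show "conjugation h \<in> topspace (topo core_quotient) \<rightarrow> topspace (topo core_quotient)"
    using conjugation_closed[OF h] by (simp add: topspace_core_quotient)
  fix U assume "openin (topo core_quotient) U"
  then have U: "openin (subtopology (topo G) ?L) {g \<in> ?L. ?D #> g \<in> U}"
    using openin_coset_topology[OF top, of ?D] by simp
  have "continuous_map (subtopology (topo G) ?L) (subtopology (topo G) ?L) (\<lambda>x. h \<otimes> x \<otimes> inv h)"
    using conj_core[OF h] core_subset continuous_map_from_subtopology[OF continuous_conj[OF h]]
    by (auto simp: continuous_map_in_subtopology)
  from openin_continuous_map_preimage[OF this U]
  have "openin (subtopology (topo G) ?L) {g \<in> ?L. ?D #> (h \<otimes> g \<otimes> inv h) \<in> U}"
    using core_subset conj_core[OF h] by (simp add: Int_absorb1 cong: conj_cong)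
  moreover have "{g \<in> ?L. ?D #> g \<in> {x \<in> carrier core_quotient. conjugation h x \<in> U}} =
      {g \<in> ?L. ?D #> (h \<otimes> g \<otimes> inv h) \<in> U}"
    using h by (auto simp: rcosets_core conjugation_coset)
  ultimately show "openin (topo core_quotient) {x \<in> topspace (topo core_quotient). conjugation h x \<in> U}"
    using openin_coset_topology[OF top, of ?D] by (auto simp: topspace_core_quotient simp del: r_coset_top_subgroup) (auto)
qed

lemma conjugation_inverse:
  assumes h: "h \<in> carrier G" and x: "x \<in> carrier core_quotient"
  shows "conjugation h (conjugation (inv h) x) = x" "conjugation (inv h) (conjugation h x) = x"
  using conjugation_comp[of h "inv h" x] conjugation_comp[of "inv h" h x] conjugation_one[OF x] h x by simp_all

lemma core_mult_coset:
  assumes "a \<in> cocompact_core G" "b \<in> cocompact_core G"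
  shows "(quasi_center core_group #> a) <#> (quasi_center core_group #> b) = quasi_center core_group #> (a \<otimes> b)"
  using normal.rcos_sum[OF qc_core_normal_in_core, of a b] assms by simp

lemma conjugation_iso:
  assumes h: "h \<in> carrier G"
  shows "conjugation h \<in> iso core_quotient core_quotient"
proof -
  let ?D = "quasi_center core_group"
  have "conjugation h (x <#> y) = conjugation h x <#> conjugation h y"
    if xy: "x \<in> carrier core_quotient" "y \<in> carrier core_quotient" for x y
  proof -
    obtain a b where ab: "a \<in> cocompact_core G" "b \<in> cocompact_core G" "x = ?D #> a" "y = ?D #> b"
      using xy by (auto simp: rcosets_core)
    have G: "a \<in> carrier G" "b \<in> carrier G" using ab core_subset by blast+
    have "a \<otimes> b \<in> cocompact_core G" using subgroup.m_closed[OF core_subgroup ab(1,2)] .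
    then have "conjugation h (x <#> y) = ?D #> (h \<otimes> (a \<otimes> b) \<otimes> inv h)"
      unfolding ab core_mult_coset[OF ab(1,2)] by (rule conjugation_coset[OF h])
    also have "\<dots> = ?D #> ((h \<otimes> a \<otimes> inv h) \<otimes> (h \<otimes> b \<otimes> inv h))" using h G by (simp add: m_assoc)
    also have "\<dots> = conjugation h x <#> conjugation h y"
      unfolding ab conjugation_coset[OF h ab(1)] conjugation_coset[OF h ab(2)]
        core_mult_coset[OF conj_core[OF h ab(1)] conj_core[OF h ab(2)]] ..
    finally show ?thesis .
  qed
  then have "conjugation h \<in> hom core_quotient core_quotient"
    using conjugation_closed[OF h] by (auto simp: hom_def)
  moreover have "bij_betw (conjugation h) (carrier core_quotient) (carrier core_quotient)"
    by (rule bij_betw_byWitness[where f' = "conjugation (inv h)"])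
       (use conjugation_inverse[OF h] conjugation_closed[OF h] conjugation_closed[of "inv h"] h in auto)
  ultimately show ?thesis by (simp add: iso_def)
qed

lemma conjugation_homeomorphic:
  assumes h: "h \<in> carrier G"
  shows "homeomorphic_map (topo core_quotient) (topo core_quotient) (conjugation h)"
proof -
  have "homeomorphic_maps (topo core_quotient) (topo core_quotient) (conjugation h) (conjugation (inv h))"
    unfolding homeomorphic_maps_def
    using conjugation_continuous[OF h] conjugation_continuous[of "inv h"] h conjugation_inverse[OF h]
    by (simp add: topspace_core_quotient)
  then show ?thesis by (rule homeomorphic_maps_map[THEN iffD1, THEN conjunct1])
qed

lemma commutator_in_quasi_center:
  assumes a: "a \<in> cocompact_core G" and b: "b \<in> cocompact_core G"
    and c: "(quasi_center core_group #> a) <#> (quasi_center core_group #> b) =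
      (quasi_center core_group #> b) <#> (quasi_center core_group #> a)"
  shows "a \<otimes> b \<otimes> inv a \<otimes> inv b \<in> quasi_center core_group"
proof -
  let ?D = "quasi_center core_group"
  have sub: "subgroup ?D G" by (rule normal_imp_subgroup[OF qc_core_normal])
  have G: "a \<in> carrier G" "b \<in> carrier G" using a b core_subset by blast+
  have "?D #> (a \<otimes> b) = ?D #> (b \<otimes> a)"
    using c unfolding core_mult_coset[OF a b] core_mult_coset[OF b a] .
  then have "a \<otimes> b \<in> ?D #> (b \<otimes> a)" using rcos_self[OF _ sub, of "a \<otimes> b"] G by simp
  then obtain d where d: "d \<in> ?D" "a \<otimes> b = d \<otimes> (b \<otimes> a)" by (auto simp: r_coset_def)
  have "d \<in> carrier G" by (rule subgroup.mem_carrier[OF sub d(1)])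
  then have "a \<otimes> b \<otimes> inv a \<otimes> inv b = d" unfolding d(2) using G by (simp add: m_assoc)
  then show ?thesis using d(1) by simp
qed

definition lift :: "'a set set \<Rightarrow> 'a set" where
  "lift M = {l \<in> cocompact_core G. quasi_center core_group #> l \<in> M}"

lemma lift_conjugate:
  assumes h: "h \<in> carrier G" and M: "M \<subseteq> carrier core_quotient"
  shows "lift (conjugation h ` M) = (\<lambda>m. h \<otimes> m \<otimes> inv h) ` lift M"
proof
  let ?D = "quasi_center core_group" and ?L = "cocompact_core G"
  show "(\<lambda>m. h \<otimes> m \<otimes> inv h) ` lift M \<subseteq> lift (conjugation h ` M)"
  proof (rule image_subsetI)
    fix m assume "m \<in> lift M"
    then have m: "m \<in> ?L" "?D #> m \<in> M" by (simp_all add: lift_def)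
    have "conjugation h (?D #> m) \<in> conjugation h ` M" using m(2) by (rule imageI)
    then show "h \<otimes> m \<otimes> inv h \<in> lift (conjugation h ` M)"
      unfolding conjugation_coset[OF h m(1)] lift_def using conj_core[OF h m(1)] by simp
  qed
  show "lift (conjugation h ` M) \<subseteq> (\<lambda>m. h \<otimes> m \<otimes> inv h) ` lift M"
  proof
    fix l assume "l \<in> lift (conjugation h ` M)"
    then have l: "l \<in> ?L" "?D #> l \<in> conjugation h ` M" by (simp_all add: lift_def)
    then obtain x where x: "x \<in> M" "?D #> l = conjugation h x" by (elim imageE)
    let ?l = "inv h \<otimes> l \<otimes> inv (inv h)"
    have ih: "inv h \<in> carrier G" using h by simp
    have lG: "l \<in> carrier G" using l(1) core_subset by blast
    have xC: "x \<in> carrier core_quotient" using x(1) M by blast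
    have "?D #> ?l = conjugation (inv h) (?D #> l)" by (rule conjugation_coset[OF ih l(1), symmetric])
    also have "\<dots> = x" unfolding x(2) by (rule conjugation_inverse(2)[OF h xC])
    finally have "?l \<in> lift M" unfolding lift_def using x(1) conj_core[OF ih l(1)] by simp
    moreover have "l = h \<otimes> ?l \<otimes> inv h" using h lG by (simp add: m_assoc)
    ultimately show "l \<in> (\<lambda>m. h \<otimes> m \<otimes> inv h) ` lift M" by (rule rev_image_eqI)
  qed
qed

lemma subgroup_lift:
  assumes W: "subgroup W core_quotient"
  shows "subgroup (lift W) G"
proof -
  have "subgroup (lift W) core_group"
    using top_group.subgroup_preimage_coset_projection(1)[OF top_group_core qc_core_normal_in_core W]
    by (simp add: lift_def)
  then show ?thesis using subgroup_top_subgroup_iff[OF core_subgroup] by simp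
qed

text \<open>
  If the preimage in \<open>L\<close> of a non-trivial closed normal subgroup missed \<open>\<Phi>\<close>, it would be a discrete normal
  subgroup of \<open>L\<close>, hence contained in the quasi-center, and its image would be trivial.
\<close>

lemma lift_nontrivial:
  assumes M: "M \<in> nontrivial_closed_normal core_quotient"
  defines "M' \<equiv> lift M"
  shows "subgroup M' G" "closedin (topo G) M'" "M' \<inter> \<Phi> \<noteq> {}"
    "\<And>l m. l \<in> cocompact_core G \<Longrightarrow> m \<in> M' \<Longrightarrow> l \<otimes> m \<otimes> inv l \<in> M'"
    "quasi_center core_group \<subseteq> M'"
proof -
  let ?D = "quasi_center core_group" and ?L = "cocompact_core G"
  interpret L: top_group core_group by (rule top_group_core)
  interpret Q: group core_quotient by (rule L.group_top_quotient[OF qc_core_normal_in_core])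
  have m: "M \<lhd> core_quotient" "closedin (topo core_quotient) M" "M \<noteq> {?D}"
    using M by (auto simp: nontrivial_closed_normal_def)
  have "M' \<lhd> core_group"
    using L.normal_preimage_coset_projection[OF qc_core_normal_in_core m(1)] by (simp add: M'_def lift_def)
  then have n: "subgroup M' G" "M' \<subseteq> ?L" "\<forall>l\<in>?L. \<forall>n\<in>M'. l \<otimes> n \<otimes> inv l \<in> M'" and nL: "M' \<lhd> core_group"
    using normal_top_subgroup_iff[OF core_subgroup] by auto
  show "subgroup M' G" by (rule n)
  show "l \<otimes> m \<otimes> inv l \<in> M'" if "l \<in> ?L" "m \<in> M'" for l m using n(3) that by blast
  have DL: "?D \<subseteq> ?L" using subgroup.subset[OF normal_imp_subgroup[OF qc_core_normal_in_core]] by simp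
  have "closedin (topo core_group) M'"
    using L.closed_preimage_coset_projection[of ?D M] m(2) DL by (simp add: M'_def lift_def)
  then show "closedin (topo G) M'" using closedin_trans_full[OF _ core_closed] by simp
  show DM: "?D \<subseteq> M'"
    using L.subgroup_preimage_coset_projection(2)[OF qc_core_normal_in_core normal_imp_subgroup[OF m(1)]]
    by (simp add: M'_def lift_def)
  show "M' \<inter> \<Phi> \<noteq> {}"
  proof
    assume "M' \<inter> \<Phi> = {}"
    then have "discrete_in G M'" using discrete_if_misses n(1) by blast
    then have "discrete_in core_group M'"
      using n(2) by (simp add: discrete_in_def subtopology_subtopology Int_absorb1)
    then have sub: "M' \<subseteq> ?D" using L.discrete_normal_quasi_center[OF nL] by blast
    have "x = ?D" if x: "x \<in> M" for x
    proof -
      have "x \<in> carrier core_quotient" using x m(1) normal_imp_subgroup subgroup.subset by blast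
      then obtain l where l: "l \<in> ?L" "x = ?D #> l" by (auto simp: rcosets_core)
      then have "l \<in> ?D" using x sub by (auto simp: M'_def lift_def)
      then show ?thesis
        using l core_subset coset_join2[OF _ normal_imp_subgroup[OF qc_core_normal]] by blast
    qed
    moreover have "?D \<in> M" using subgroup.one_closed[OF normal_imp_subgroup[OF m(1)]] by simp
    ultimately show False using m(3) by blast
  qed
qed

text \<open>
  The compact set is the image of \<open>C \<inter> L\<close>, where \<open>C \<subseteq> \<Phi>\<close> is compact and every element of \<open>\<Phi>\<close> has an
  \<open>L\<close>-conjugate in \<open>C\<close>. The centre is trivial since an element that is central modulo \<open>D\<close> commutes with
  \<open>L\<close> near the identity, and so belongs to \<open>D\<close>. An invariant closed normal subgroup has a preimage that
  is normal in the whole group, meets \<open>\<Phi>\<close>, and thus contains \<open>L\<close>.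
\<close>

theorem closed_normal_structure_core_quotient:
  "\<exists>C. closed_normal_structure core_quotient C (conjugation ` carrier G)"
proof -
  let ?D = "quasi_center core_group" and ?L = "cocompact_core G"
  note lift = lift_nontrivial[unfolded lift_def]
  interpret L: top_group core_group by (rule top_group_core)
  have tq: "topological_group core_quotient" by (rule L.topological_group_top_quotient[OF qc_core_normal_in_core])
  have DL: "?D \<subseteq> ?L" using subgroup.subset[OF normal_imp_subgroup[OF qc_core_normal_in_core]] by simp
  have Dsub: "subgroup ?D G" by (rule normal_imp_subgroup[OF qc_core_normal])
  have eqD: "?D #> l = ?D \<longleftrightarrow> l \<in> ?D" if "l \<in> ?L" for l
  proof -
    have "l \<in> carrier G" using that core_subset by blast
    then show ?thesis using coset_join1[of ?D l] coset_join2[of l ?D] Dsub subgroup.subset[OF Dsub] by blast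
  qed
  obtain C where C: "compactin (topo G) C" "C \<subseteq> \<Phi>" "\<forall>c\<in>\<Phi>. \<exists>n\<in>?L. n \<otimes> c \<otimes> inv n \<in> C"
    using compact_transversal[OF core_normal core_cocompact] by blast
  let ?C = "(\<lambda>l. ?D #> l) ` (C \<inter> ?L)"
  have "closed_normal_structure core_quotient ?C (conjugation ` carrier G)"
  proof (intro closed_normal_structure.intro closed_normal_structure_axioms.intro)
    show "top_group core_quotient" using tq by (rule top_group.intro)
    have "{l \<in> ?L. ?D #> l \<in> {?D}} = ?D" using eqD DL by auto
    moreover have "{?D} \<subseteq> rcosets\<^bsub>core_group\<^esub> ?D"
      using subgroup.subgroup_in_rcosets[OF normal_imp_subgroup[OF qc_core_normal_in_core] L.is_group] by simp
    moreover have "closedin (subtopology (topo G) ?L) ?D"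
      using qc_core_closed DL by (simp add: closedin_subset_topspace)
    ultimately show "closedin (topo core_quotient) {\<one>\<^bsub>core_quotient\<^esub>}"
      using L.closed_coset_iff[of ?D "{?D}"] DL by simp
    have "compactin (topo G) (?L \<inter> C)" by (rule closed_Int_compactin[OF core_closed C(1)])
    then have "compactin (topo core_group) (C \<inter> ?L)" by (simp add: compactin_subtopology Int_commute)
    from image_compactin[OF this L.continuous_coset_projection[of ?D]]
    show "compactin (topo core_quotient) ?C" using DL by simp
    show "\<one>\<^bsub>core_quotient\<^esub> \<notin> ?C"
    proof
      assume "\<one>\<^bsub>core_quotient\<^esub> \<in> ?C"
      then obtain c where "c \<in> C" "c \<in> ?L" "?D #> c = ?D" by auto
      then have "c \<in> ?D \<inter> \<Phi>" using eqD C(2) by blast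
      then show False using qc_core_misses by simp
    qed
    show "M \<inter> ?C \<noteq> {}" if M: "M \<in> nontrivial_closed_normal core_quotient" for M
    proof -
      obtain l where l: "l \<in> ?L" "?D #> l \<in> M" "l \<in> \<Phi>" using lift(3)[OF M] by blast
      obtain n where n: "n \<in> ?L" "n \<otimes> l \<otimes> inv n \<in> C" using C(3) l(3) by blast
      have "n \<otimes> l \<otimes> inv n \<in> {l \<in> ?L. ?D #> l \<in> M}" using lift(4)[OF M n(1)] l by blast
      then show ?thesis using n(2) by blast
    qed
    show "q = \<one>\<^bsub>core_quotient\<^esub>"
      if q: "q \<in> carrier core_quotient" "\<forall>x\<in>carrier core_quotient. q \<otimes>\<^bsub>core_quotient\<^esub> x = x \<otimes>\<^bsub>core_quotient\<^esub> q" for q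
    proof -
      obtain l where l: "l \<in> ?L" "q = ?D #> l" using q(1) by (auto simp: rcosets_core)
      have lG: "l \<in> carrier G" using l core_subset by blast
      have "l \<otimes> u \<otimes> inv l \<otimes> inv u \<in> ?D" if u: "u \<in> ?L" for u
      proof -
        have "?D #> u \<in> carrier core_quotient" using u by (auto simp: rcosets_core)
        then have "(?D #> l) <#> (?D #> u) = (?D #> u) <#> (?D #> l)" using q(2) l(2) by simp
        then show ?thesis by (rule commutator_in_quasi_center[OF l(1) u])
      qed
      from centralizer_nearly_open[OF core_subgroup Dsub qc_core_discrete lG this]
      have "l \<in> ?D" using l(1) mem_quasi_center_top_subgroup_iff[OF core_subgroup] by simp
      then show ?thesis using l eqD by simp
    qed
    show "carrier core_quotient \<noteq> {\<one>\<^bsub>core_quotient\<^esub>}"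
    proof
      assume e: "carrier core_quotient = {\<one>\<^bsub>core_quotient\<^esub>}"
      have "l \<in> ?D" if "l \<in> ?L" for l
      proof -
        have "?D #> l \<in> carrier core_quotient" using that by (auto simp: rcosets_core)
        then show ?thesis using e eqD[OF that] by simp
      qed
      then show False using core_meets qc_core_misses by blast
    qed
    fix \<alpha> assume a: "\<alpha> \<in> conjugation ` carrier G"
    then obtain h where h: "h \<in> carrier G" "\<alpha> = conjugation h" by blast
    show "\<alpha> \<in> iso core_quotient core_quotient" unfolding h(2) by (rule conjugation_iso[OF h(1)])
    show "homeomorphic_map (topo core_quotient) (topo core_quotient) \<alpha>"
      unfolding h(2) by (rule conjugation_homeomorphic[OF h(1)])
    show "\<exists>\<beta>\<in>conjugation ` carrier G. \<forall>x\<in>carrier core_quotient. \<alpha> (\<beta> x) = x"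
      using conjugation_inverse[OF h(1)] h by (intro bexI[of _ "conjugation (inv h)"]) auto
    fix \<beta> assume "\<beta> \<in> conjugation ` carrier G"
    then obtain k where k: "k \<in> carrier G" "\<beta> = conjugation k" by blast
    show "\<exists>\<gamma>\<in>conjugation ` carrier G. \<forall>x\<in>carrier core_quotient. \<gamma> x = \<alpha> (\<beta> x)"
      using conjugation_comp[OF h(1) k(1)] h k by (intro bexI[of _ "conjugation (h \<otimes> k)"]) auto
  next
    show "\<exists>\<alpha>\<in>conjugation ` carrier G. \<forall>x\<in>carrier core_quotient. \<alpha> x = x"
      using conjugation_one by blast
    fix M assume M: "M \<in> nontrivial_closed_normal core_quotient"
      and inv: "\<And>\<alpha>. \<alpha> \<in> conjugation ` carrier G \<Longrightarrow> \<alpha> ` M \<subseteq> M"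
    let ?M = "{l \<in> ?L. ?D #> l \<in> M}"
    have "h \<otimes> l \<otimes> inv h \<in> ?M" if h: "h \<in> carrier G" and l: "l \<in> ?M" for h l
    proof -
      have "conjugation h (?D #> l) \<in> M" using inv[of "conjugation h"] h l by blast
      then show ?thesis using conj_core[OF h] conjugation_coset[OF h] l by simp
    qed
    then have "?M \<lhd> G" unfolding normal_inv_iff using lift(1)[OF M] by blast
    from core_subset_if_closed_normal[OF this lift(2,3)[OF M]]
    have "carrier core_quotient \<subseteq> M" by (auto simp: rcosets_core)
    moreover have "M \<subseteq> carrier core_quotient"
      using M normal_imp_subgroup[of M core_quotient] subgroup.subset[of M core_quotient]
      by (simp add: nontrivial_closed_normal_def)
    ultimately show "M = carrier core_quotient" by blast
  qed
  then show ?thesis by blast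
qed

end

section \<open>Automorphism groups of graphs\<close>

locale graph_automorphisms = bidirected_digraph \<Gamma> bar
  for \<Gamma> :: "('v, 'e) pre_digraph" and bar :: "'e \<Rightarrow> 'e"
begin

abbreviation points :: "('v + 'e) set" where "points \<equiv> verts \<Gamma> <+> arcs \<Gamma>"
abbreviation Aut where "Aut \<equiv> Aut_graph \<Gamma> bar"

lemma in_points [simp]: "Inl x \<in> points \<longleftrightarrow> x \<in> verts \<Gamma>" "Inr e \<in> points \<longleftrightarrow> e \<in> arcs \<Gamma>"
  by auto

lemma carrier_Aut [simp]: "carrier Aut = graph_auts \<Gamma> bar"
  by (simp add: Aut_graph_def)

lemma autsD:
  assumes h: "h \<in> graph_auts \<Gamma> bar"
  shows "h \<in> Bij points"
    and "x \<in> verts \<Gamma> \<Longrightarrow> h (Inl x) = Inl (vert_map h x)"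
    and "e \<in> arcs \<Gamma> \<Longrightarrow> h (Inr e) = Inr (arc_map h e)"
    and "x \<in> verts \<Gamma> \<Longrightarrow> vert_map h x \<in> verts \<Gamma>"
    and "e \<in> arcs \<Gamma> \<Longrightarrow> arc_map h e \<in> arcs \<Gamma>"
    and "e \<in> arcs \<Gamma> \<Longrightarrow> tail \<Gamma> (arc_map h e) = vert_map h (tail \<Gamma> e)"
    and "e \<in> arcs \<Gamma> \<Longrightarrow> head \<Gamma> (arc_map h e) = vert_map h (head \<Gamma> e)"
    and "e \<in> arcs \<Gamma> \<Longrightarrow> arc_map h (bar e) = bar (arc_map h e)"
proof -
  have B: "h \<in> Bij points" and V: "h ` Inl ` verts \<Gamma> = Inl ` verts \<Gamma>" and E: "h ` Inr ` arcs \<Gamma> = Inr ` arcs \<Gamma>"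
    using h by (auto simp: graph_auts_def)
  show "h \<in> Bij points" by (rule B)
  show v: "h (Inl x) = Inl (vert_map h x)" if "x \<in> verts \<Gamma>" for x
  proof -
    have "h (Inl x) \<in> Inl ` verts \<Gamma>" using V that by blast
    then show ?thesis by (auto simp: vert_map_def)
  qed
  show e: "h (Inr e) = Inr (arc_map h e)" if "e \<in> arcs \<Gamma>" for e
  proof -
    have "h (Inr e) \<in> Inr ` arcs \<Gamma>" using E that by blast
    then show ?thesis by (auto simp: arc_map_def)
  qed
  show "vert_map h x \<in> verts \<Gamma>" if "x \<in> verts \<Gamma>" for x
  proof -
    have "h (Inl x) \<in> Inl ` verts \<Gamma>" using V that by blast
    then show ?thesis using v[OF that] by auto
  qed
  show "arc_map h e \<in> arcs \<Gamma>" if "e \<in> arcs \<Gamma>" for e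
  proof -
    have "h (Inr e) \<in> Inr ` arcs \<Gamma>" using E that by blast
    then show ?thesis using e[OF that] by auto
  qed
qed (use h in \<open>auto simp: graph_auts_def\<close>)

text \<open>
  In terms of arbitrary vertex and arc maps, so that it also applies to pointwise limits of
  automorphisms.
\<close>

lemma autsI:
  assumes B: "h \<in> Bij points"
    and V: "\<And>x. x \<in> verts \<Gamma> \<Longrightarrow> vm x \<in> verts \<Gamma> \<and> h (Inl x) = Inl (vm x)"
    and E: "\<And>e. e \<in> arcs \<Gamma> \<Longrightarrow> am e \<in> arcs \<Gamma> \<and> h (Inr e) = Inr (am e)"
    and I: "\<And>e. e \<in> arcs \<Gamma> \<Longrightarrow> tail \<Gamma> (am e) = vm (tail \<Gamma> e) \<and> head \<Gamma> (am e) = vm (head \<Gamma> e) \<and> am (bar e) = bar (am e)"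
  shows "h \<in> graph_auts \<Gamma> bar"
proof -
  have surj: "h ` points = points" using B by (simp add: Bij_def bij_betw_def)
  have "Inl ` verts \<Gamma> \<subseteq> h ` Inl ` verts \<Gamma>"
  proof clarify
    fix x assume "x \<in> verts \<Gamma>"
    then have "Inl x \<in> points" by simp
    then have "Inl x \<in> h ` points" by (simp only: surj)
    then obtain p where p: "p \<in> points" "Inl x = h p" by blast
    show "Inl x \<in> h ` Inl ` verts \<Gamma>"
    proof (cases p)
      case (Inl y) then show ?thesis using p by auto
    next
      case (Inr e) then show ?thesis using p E[of e] by auto
    qed
  qed
  moreover have "Inr ` arcs \<Gamma> \<subseteq> h ` Inr ` arcs \<Gamma>"
  proof clarify
    fix x assume "x \<in> arcs \<Gamma>"
    then have "Inr x \<in> points" by simp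
    then have "Inr x \<in> h ` points" by (simp only: surj)
    then obtain p where p: "p \<in> points" "Inr x = h p" by blast
    show "Inr x \<in> h ` Inr ` arcs \<Gamma>"
    proof (cases p)
      case (Inl y) then show ?thesis using p V[of y] by auto
    next
      case (Inr e) then show ?thesis using p by auto
    qed
  qed
  moreover have "h ` Inl ` verts \<Gamma> \<subseteq> Inl ` verts \<Gamma>" "h ` Inr ` arcs \<Gamma> \<subseteq> Inr ` arcs \<Gamma>"
    using V E by auto
  moreover have "vert_map h x = vm x" if "x \<in> verts \<Gamma>" for x using V[OF that] by (simp add: vert_map_def)
  moreover have "arc_map h e = am e" if "e \<in> arcs \<Gamma>" for e using E[OF that] by (simp add: arc_map_def)
  ultimately show ?thesis using B I by (simp add: graph_auts_def)
qed

lemma auts_eqI: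
  assumes g: "g \<in> graph_auts \<Gamma> bar" and h: "h \<in> graph_auts \<Gamma> bar"
    and v: "\<And>x. x \<in> verts \<Gamma> \<Longrightarrow> vert_map g x = vert_map h x"
    and e: "\<And>e. e \<in> arcs \<Gamma> \<Longrightarrow> arc_map g e = arc_map h e"
  shows "g = h"
proof (rule extensionalityI[of _ points])
  show "g \<in> extensional points" "h \<in> extensional points"
    using autsD(1)[OF g] autsD(1)[OF h] by (simp_all add: Bij_def)
  fix p assume "p \<in> points"
  then show "g p = h p"
    using v e by (auto simp: autsD(2,3)[OF g] autsD(2,3)[OF h])
qed

lemma mult_Aut:
  assumes "g \<in> graph_auts \<Gamma> bar" "h \<in> graph_auts \<Gamma> bar"
  shows "g \<otimes>\<^bsub>Aut\<^esub> h = compose points g h"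
  using autsD(1)[OF assms(1)] autsD(1)[OF assms(2)] by (simp add: Aut_graph_def BijGroup_def)

lemma one_Aut: "\<one>\<^bsub>Aut\<^esub> = (\<lambda>x\<in>points. x)"
  by (simp add: Aut_graph_def BijGroup_def)

lemma auts_subgroup: "subgroup (graph_auts \<Gamma> bar) (BijGroup points)"
proof -
  interpret B: group "BijGroup points" by (rule group_BijGroup)
  show ?thesis
  proof (rule B.subgroupI)
    show "graph_auts \<Gamma> bar \<subseteq> carrier (BijGroup points)"
      using autsD(1) by (auto simp: BijGroup_def)
    have "(\<lambda>x\<in>points. x) \<in> graph_auts \<Gamma> bar"
      by (rule autsI[where vm = "\<lambda>x. x" and am = "\<lambda>x. x"]) (auto simp: id_Bij)
    then show "graph_auts \<Gamma> bar \<noteq> {}" by blast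
    fix g h assume g: "g \<in> graph_auts \<Gamma> bar"
    have gB: "g \<in> Bij points" by (rule autsD[OF g])
    have inj: "inj_on g points" and surj: "g ` points = points" using gB by (auto simp: Bij_def bij_betw_def)
    let ?k = "restrict (inv_into points g) points"
    have V: "\<exists>y. y \<in> verts \<Gamma> \<and> ?k (Inl x) = Inl y \<and> vert_map g y = x" if x: "x \<in> verts \<Gamma>" for x
    proof -
      have "Inl x \<in> g ` Inl ` verts \<Gamma>" using g x by (simp add: graph_auts_def)
      then obtain y where y: "y \<in> verts \<Gamma>" "g (Inl y) = Inl x" by auto
      then have "inv_into points g (Inl x) = Inl y" using inv_into_f_f[OF inj, of "Inl y"] by auto
      then show ?thesis using x y autsD(2)[OF g y(1)] by auto
    qed
    have E: "\<exists>y. y \<in> arcs \<Gamma> \<and> ?k (Inr x) = Inr y \<and> arc_map g y = x" if x: "x \<in> arcs \<Gamma>" for x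
    proof -
      have "Inr x \<in> g ` Inr ` arcs \<Gamma>" using g x by (simp add: graph_auts_def)
      then obtain y where y: "y \<in> arcs \<Gamma>" "g (Inr y) = Inr x" by auto
      then have "inv_into points g (Inr x) = Inr y" using inv_into_f_f[OF inj, of "Inr y"] by auto
      then show ?thesis using x y autsD(3)[OF g y(1)] by auto
    qed
    obtain vm where vm: "\<And>x. x \<in> verts \<Gamma> \<Longrightarrow> vm x \<in> verts \<Gamma> \<and> ?k (Inl x) = Inl (vm x) \<and> vert_map g (vm x) = x"
      using V by metis
    obtain am where am: "\<And>x. x \<in> arcs \<Gamma> \<Longrightarrow> am x \<in> arcs \<Gamma> \<and> ?k (Inr x) = Inr (am x) \<and> arc_map g (am x) = x"
      using E by metis
    have vm': "vm (vert_map g y) = y" if "y \<in> verts \<Gamma>" for y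
    proof -
      have "Inl (vm (vert_map g y)) = ?k (g (Inl y))"
        using vm[OF autsD(4)[OF g that]] autsD(2)[OF g that] by simp
      also have "\<dots> = Inl y" using inv_into_f_f[OF inj, of "Inl y"] surj that by auto
      finally show ?thesis by simp
    qed
    have am': "am (arc_map g y) = y" if "y \<in> arcs \<Gamma>" for y
    proof -
      have "Inr (am (arc_map g y)) = ?k (g (Inr y))"
        using am[OF autsD(5)[OF g that]] autsD(3)[OF g that] by simp
      also have "\<dots> = Inr y" using inv_into_f_f[OF inj, of "Inr y"] surj that by auto
      finally show ?thesis by simp
    qed
    have "?k \<in> graph_auts \<Gamma> bar"
    proof (rule autsI[where vm = vm and am = am])
      show "?k \<in> Bij points" by (rule restrict_inv_into_Bij[OF gB])
      fix e assume e: "e \<in> arcs \<Gamma>"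
      obtain y where y: "y \<in> arcs \<Gamma>" "e = arc_map g y" using am[OF e] by metis
      have b: "bar y \<in> arcs \<Gamma>" using y(1) by simp
      show "tail \<Gamma> (am e) = vm (tail \<Gamma> e) \<and> head \<Gamma> (am e) = vm (head \<Gamma> e) \<and> am (bar e) = bar (am e)"
        unfolding y(2) am'[OF y(1)] autsD(6,7)[OF g y(1)] autsD(8)[OF g y(1), symmetric] am'[OF b]
        using vm'[OF tail_in_verts[OF y(1)]] vm'[OF head_in_verts[OF y(1)]] by simp
    qed (use vm am in auto)
    then show "inv\<^bsub>BijGroup points\<^esub> g \<in> graph_auts \<Gamma> bar" using inv_BijGroup[OF gB] by simp
    assume h: "h \<in> graph_auts \<Gamma> bar"
    have "compose points g h \<in> graph_auts \<Gamma> bar"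
      by (rule autsI[where vm = "\<lambda>x. vert_map g (vert_map h x)" and am = "\<lambda>x. arc_map g (arc_map h x)"])
         (use autsD[OF g] autsD[OF h] in \<open>auto simp: compose_Bij compose_eq\<close>)
    then show "g \<otimes>\<^bsub>BijGroup points\<^esub> h \<in> graph_auts \<Gamma> bar"
      using gB autsD(1)[OF h] by (simp add: BijGroup_def)
  qed
qed

lemma group_Aut: "group Aut"
proof -
  have "group ((BijGroup points)\<lparr>carrier := graph_auts \<Gamma> bar\<rparr>)"
    by (rule subgroup.subgroup_is_group[OF auts_subgroup group_BijGroup])
  then show ?thesis
    unfolding group_def monoid_def group_axioms_def Units_def by (simp add: Aut_graph_def)
qed

sublocale Aut: group Aut by (rule group_Aut)

lemma auts_maps_point: "g \<in> graph_auts \<Gamma> bar \<Longrightarrow> p \<in> points \<Longrightarrow> g p \<in> points"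
  using autsD(1)[of g] Bij_imp_funcset by blast

text \<open>
  The generating sets prescribe images \<open>h x = y\<close> for arbitrary pairs; around a member \<open>g\<close> this means that
  \<open>h\<close> agrees with \<open>g\<close> at finitely many points.
\<close>

lemma openin_permutation_topology:
  "openin (permutation_topology points (graph_auts \<Gamma> bar)) U \<longleftrightarrow>
    U \<subseteq> graph_auts \<Gamma> bar \<and>
    (\<forall>g\<in>U. \<exists>F. finite F \<and> F \<subseteq> points \<and> {h \<in> graph_auts \<Gamma> bar. \<forall>p\<in>F. h p = g p} \<subseteq> U)" (is "?l \<longleftrightarrow> ?r U")
proof
  let ?B = "{{h \<in> graph_auts \<Gamma> bar. \<forall>(x, y)\<in>F. h x = y} | F. finite F \<and> F \<subseteq> points \<times> points}"
  assume ?l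
  then have "generate_topology_on ?B U"
    by (simp add: permutation_topology_def openin_topology_generated_by_iff)
  then show "?r U"
  proof induction
    case Empty then show ?case by simp
  next
    case (Int a b)
    show ?case
    proof (intro conjI ballI)
      show "a \<inter> b \<subseteq> graph_auts \<Gamma> bar" using Int by blast
      fix g assume "g \<in> a \<inter> b"
      then obtain F F' where F: "finite F" "F \<subseteq> points" "{h \<in> graph_auts \<Gamma> bar. \<forall>p\<in>F. h p = g p} \<subseteq> a"
        and F': "finite F'" "F' \<subseteq> points" "{h \<in> graph_auts \<Gamma> bar. \<forall>p\<in>F'. h p = g p} \<subseteq> b"
        using Int by (meson IntE)
      then show "\<exists>F. finite F \<and> F \<subseteq> points \<and> {h \<in> graph_auts \<Gamma> bar. \<forall>p\<in>F. h p = g p} \<subseteq> a \<inter> b"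
        by (intro exI[of _ "F \<union> F'"]) auto
    qed
  next
    case (UN K)
    show ?case
    proof (intro conjI ballI)
      show "\<Union>K \<subseteq> graph_auts \<Gamma> bar" using UN by blast
      fix g assume "g \<in> \<Union>K"
      then obtain a where a: "a \<in> K" "g \<in> a" by blast
      then obtain F where "finite F" "F \<subseteq> points" "{h \<in> graph_auts \<Gamma> bar. \<forall>p\<in>F. h p = g p} \<subseteq> a"
        using UN by meson
      then show "\<exists>F. finite F \<and> F \<subseteq> points \<and> {h \<in> graph_auts \<Gamma> bar. \<forall>p\<in>F. h p = g p} \<subseteq> \<Union>K"
        using a by blast
    qed
  next
    case (Basis s)
    then obtain F where F: "s = {h \<in> graph_auts \<Gamma> bar. \<forall>(x, y)\<in>F. h x = y}" "finite F" "F \<subseteq> points \<times> points"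
      by blast
    show ?case
    proof (intro conjI ballI)
      show "s \<subseteq> graph_auts \<Gamma> bar" using F by blast
      fix g assume "g \<in> s"
      then have g: "\<forall>(x, y)\<in>F. g x = y" unfolding F(1) by simp
      have "{h \<in> graph_auts \<Gamma> bar. \<forall>p\<in>fst ` F. h p = g p} \<subseteq> s"
      proof
        fix h assume h: "h \<in> {h \<in> graph_auts \<Gamma> bar. \<forall>p\<in>fst ` F. h p = g p}"
        have "h x = y" if xy: "(x, y) \<in> F" for x y
        proof -
          have "x \<in> fst ` F" using imageI[OF xy, of fst] by simp
          moreover have "\<forall>p\<in>fst ` F. h p = g p" using h by (rule CollectE) (erule conjE)
          ultimately have "h x = g x" by (rule bspec[rotated])
          then show ?thesis using bspec[OF g xy] by simp
        qed
        then have "\<forall>(x, y)\<in>F. h x = y" by blast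
        then show "h \<in> s" using h by (simp add: F(1))
      qed
      moreover have "finite (fst ` F)" "fst ` F \<subseteq> points" using F(2,3) by (simp, auto)
      ultimately show "\<exists>F. finite F \<and> F \<subseteq> points \<and> {h \<in> graph_auts \<Gamma> bar. \<forall>p\<in>F. h p = g p} \<subseteq> s"
        by (intro exI[of _ "fst ` F"]) simp
    qed
  qed
next
  let ?B = "{{h \<in> graph_auts \<Gamma> bar. \<forall>(x, y)\<in>F. h x = y} | F. finite F \<and> F \<subseteq> points \<times> points}"
  assume r: "?r U"
  show ?l
  proof (subst openin_subopen, intro ballI)
    fix g assume g: "g \<in> U"
    then obtain F where F: "finite F" "F \<subseteq> points" "{h \<in> graph_auts \<Gamma> bar. \<forall>p\<in>F. h p = g p} \<subseteq> U"
      using r by meson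
    have gA: "g \<in> graph_auts \<Gamma> bar" using r g by blast
    let ?F = "(\<lambda>p. (p, g p)) ` F"
    have "{h \<in> graph_auts \<Gamma> bar. \<forall>(x, y)\<in>?F. h x = y} \<in> ?B"
      using F auts_maps_point[OF gA] by (intro CollectI exI[of _ ?F]) auto
    then have "openin (permutation_topology points (graph_auts \<Gamma> bar)) {h \<in> graph_auts \<Gamma> bar. \<forall>(x, y)\<in>?F. h x = y}"
      unfolding permutation_topology_def by (rule topology_generated_by_Basis)
    moreover have "{h \<in> graph_auts \<Gamma> bar. \<forall>(x, y)\<in>?F. h x = y} = {h \<in> graph_auts \<Gamma> bar. \<forall>p\<in>F. h p = g p}" by auto
    ultimately show "\<exists>T. openin (permutation_topology points (graph_auts \<Gamma> bar)) T \<and> g \<in> T \<and> T \<subseteq> U"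
      using F(3) gA by auto
  qed
qed

lemma openin_Aut:
  "openin (topo Aut) U \<longleftrightarrow> U \<subseteq> graph_auts \<Gamma> bar \<and>
    (\<forall>g\<in>U. \<exists>F. finite F \<and> F \<subseteq> points \<and> {h \<in> graph_auts \<Gamma> bar. \<forall>p\<in>F. h p = g p} \<subseteq> U)"
  using openin_permutation_topology by (simp add: Aut_graph_def)

lemma openin_fixator_coset:
  assumes "finite F" "F \<subseteq> points"
  shows "openin (topo Aut) {h \<in> graph_auts \<Gamma> bar. \<forall>p\<in>F. h p = g p}"
  unfolding openin_Aut using assms by (auto intro!: exI[of _ F])

lemma topspace_Aut: "topspace (topo Aut) = graph_auts \<Gamma> bar"
proof -
  have "openin (topo Aut) (graph_auts \<Gamma> bar)" unfolding openin_Aut by blast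
  moreover have "openin (topo Aut) U \<Longrightarrow> U \<subseteq> graph_auts \<Gamma> bar" for U unfolding openin_Aut by blast
  ultimately show ?thesis by (meson openin_subset openin_topspace subset_antisym)
qed

lemma mult_Aut_apply:
  assumes "g \<in> graph_auts \<Gamma> bar" "h \<in> graph_auts \<Gamma> bar" "p \<in> points"
  shows "(g \<otimes>\<^bsub>Aut\<^esub> h) p = g (h p)"
  using assms by (simp add: mult_Aut compose_eq)

lemma inv_Aut_apply:
  assumes "g \<in> graph_auts \<Gamma> bar" "p \<in> points"
  shows "(inv\<^bsub>Aut\<^esub> g) (g p) = p" "g ((inv\<^bsub>Aut\<^esub> g) p) = p"
proof -
  have i: "inv\<^bsub>Aut\<^esub> g \<in> graph_auts \<Gamma> bar" using Aut.inv_closed assms by simp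
  have "(inv\<^bsub>Aut\<^esub> g \<otimes>\<^bsub>Aut\<^esub> g) p = p" "(g \<otimes>\<^bsub>Aut\<^esub> inv\<^bsub>Aut\<^esub> g) p = p"
    using assms by (simp_all add: one_Aut)
  then show "(inv\<^bsub>Aut\<^esub> g) (g p) = p" "g ((inv\<^bsub>Aut\<^esub> g) p) = p"
    using mult_Aut_apply[OF i assms(1,2)] mult_Aut_apply[OF assms(1) i assms(2)] by simp_all
qed

lemma topological_group_Aut: "topological_group Aut"
  unfolding topological_group_def
proof (intro conjI)
  show "group Aut" by (rule group_Aut)
  show "topspace (topo Aut) = carrier Aut" by (simp add: topspace_Aut)
  show "continuous_map (prod_topology (topo Aut) (topo Aut)) (topo Aut) (\<lambda>(x, y). x \<otimes>\<^bsub>Aut\<^esub> y)"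
    unfolding continuous_map_def
  proof (intro conjI allI impI)
    show "(\<lambda>(x, y). x \<otimes>\<^bsub>Aut\<^esub> y) \<in> topspace (prod_topology (topo Aut) (topo Aut)) \<rightarrow> topspace (topo Aut)"
      using Aut.m_closed by (auto simp: topspace_Aut)
    fix U assume U: "openin (topo Aut) U"
    let ?W = "{x \<in> topspace (prod_topology (topo Aut) (topo Aut)). (case x of (x, y) \<Rightarrow> x \<otimes>\<^bsub>Aut\<^esub> y) \<in> U}"
    show "openin (prod_topology (topo Aut) (topo Aut)) ?W"
      unfolding openin_prod_topology_alt
    proof (intro allI impI)
      fix g h assume "(g, h) \<in> ?W"
      then have gh: "g \<in> graph_auts \<Gamma> bar" "h \<in> graph_auts \<Gamma> bar" "g \<otimes>\<^bsub>Aut\<^esub> h \<in> U" by (auto simp: topspace_Aut)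
      obtain F where F: "finite F" "F \<subseteq> points" "{k \<in> graph_auts \<Gamma> bar. \<forall>p\<in>F. k p = (g \<otimes>\<^bsub>Aut\<^esub> h) p} \<subseteq> U"
        using U gh(3) unfolding openin_Aut by meson
      let ?A = "{k \<in> graph_auts \<Gamma> bar. \<forall>p\<in>h ` F. k p = g p}" and ?B = "{k \<in> graph_auts \<Gamma> bar. \<forall>p\<in>F. k p = h p}"
      have "openin (topo Aut) ?A" "openin (topo Aut) ?B"
        using F auts_maps_point[OF gh(2)] by (intro openin_fixator_coset; auto)+
      moreover have "?A \<times> ?B \<subseteq> ?W"
      proof clarify
        fix a b assume ab: "a \<in> graph_auts \<Gamma> bar" "b \<in> graph_auts \<Gamma> bar" "\<forall>p\<in>h ` F. a p = g p" "\<forall>p\<in>F. b p = h p"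
        have "(a \<otimes>\<^bsub>Aut\<^esub> b) p = (g \<otimes>\<^bsub>Aut\<^esub> h) p" if "p \<in> F" for p
          using that F(2) ab mult_Aut_apply[OF ab(1,2)] mult_Aut_apply[OF gh(1,2)] by auto
        moreover have "a \<otimes>\<^bsub>Aut\<^esub> b \<in> graph_auts \<Gamma> bar" using ab Aut.m_closed by simp
        ultimately have "a \<otimes>\<^bsub>Aut\<^esub> b \<in> U" using F(3) by blast
        then show "(a, b) \<in> topspace (prod_topology (topo Aut) (topo Aut)) \<and> a \<otimes>\<^bsub>Aut\<^esub> b \<in> U"
          using ab by (simp add: topspace_Aut)
      qed
      ultimately show "\<exists>A B. openin (topo Aut) A \<and> openin (topo Aut) B \<and> g \<in> A \<and> h \<in> B \<and> A \<times> B \<subseteq> ?W"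
        using gh by (intro exI[of _ ?A] exI[of _ ?B]) auto
    qed
  qed
  show "continuous_map (topo Aut) (topo Aut) (m_inv Aut)"
    unfolding continuous_map_def
  proof (intro conjI allI impI)
    show "m_inv Aut \<in> topspace (topo Aut) \<rightarrow> topspace (topo Aut)"
      using Aut.inv_closed by (auto simp: topspace_Aut)
    fix U assume U: "openin (topo Aut) U"
    show "openin (topo Aut) {x \<in> topspace (topo Aut). inv\<^bsub>Aut\<^esub> x \<in> U}"
    proof (subst openin_subopen, intro ballI)
      fix g assume "g \<in> {x \<in> topspace (topo Aut). inv\<^bsub>Aut\<^esub> x \<in> U}"
      then have g: "g \<in> graph_auts \<Gamma> bar" "inv\<^bsub>Aut\<^esub> g \<in> U" by (auto simp: topspace_Aut)
      have ig: "inv\<^bsub>Aut\<^esub> g \<in> graph_auts \<Gamma> bar" using g Aut.inv_closed by simp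
      obtain F where F: "finite F" "F \<subseteq> points" "{k \<in> graph_auts \<Gamma> bar. \<forall>p\<in>F. k p = (inv\<^bsub>Aut\<^esub> g) p} \<subseteq> U"
        using U g(2) unfolding openin_Aut by meson
      let ?A = "{k \<in> graph_auts \<Gamma> bar. \<forall>p\<in>(inv\<^bsub>Aut\<^esub> g) ` F. k p = g p}"
      have "openin (topo Aut) ?A"
        using F auts_maps_point[OF ig] by (intro openin_fixator_coset) auto
      moreover have "?A \<subseteq> {x \<in> topspace (topo Aut). inv\<^bsub>Aut\<^esub> x \<in> U}"
      proof
        fix k assume k: "k \<in> ?A"
        then have kA: "k \<in> graph_auts \<Gamma> bar" by simp
        have "(inv\<^bsub>Aut\<^esub> k) p = (inv\<^bsub>Aut\<^esub> g) p" if p: "p \<in> F" for p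
        proof -
          have pp: "p \<in> points" using p F by blast
          have q: "(inv\<^bsub>Aut\<^esub> g) p \<in> points" using auts_maps_point[OF ig pp] .
          have "k ((inv\<^bsub>Aut\<^esub> g) p) = g ((inv\<^bsub>Aut\<^esub> g) p)" using k p by blast
          also have "\<dots> = p" by (rule inv_Aut_apply(2)[OF g(1) pp])
          finally show ?thesis using inv_Aut_apply(1)[OF kA q] by simp
        qed
        moreover have "inv\<^bsub>Aut\<^esub> k \<in> graph_auts \<Gamma> bar" using kA Aut.inv_closed by simp
        ultimately show "k \<in> {x \<in> topspace (topo Aut). inv\<^bsub>Aut\<^esub> x \<in> U}"
          using F(3) kA by (auto simp: topspace_Aut)
      qed
      ultimately show "\<exists>T. openin (topo Aut) T \<and> g \<in> T \<and> T \<subseteq> {x \<in> topspace (topo Aut). inv\<^bsub>Aut\<^esub> x \<in> U}"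
        using g by (intro exI[of _ ?A]) auto
    qed
  qed
qed

end

section \<open>Closed groups of automorphisms of a locally finite connected graph\<close>

lemma openin_product_discrete:
  fixes B :: "'a \<Rightarrow> 'b set"
  assumes "finite F" "F \<subseteq> I"
  defines "P \<equiv> product_topology (\<lambda>p. discrete_topology (B p)) I"
  shows "openin P {f \<in> topspace P. \<forall>p\<in>F. f p = g p}"
  using assms(1,2)
proof (induction F)
  case empty
  then show ?case by simp
next
  case (insert p F)
  have "openin P {f \<in> topspace P. f p \<in> B p \<inter> {g p}}"
    using insert.prems unfolding P_def
    by (intro openin_continuous_map_preimage[OF continuous_map_product_projection]) auto
  moreover have "{f \<in> topspace P. f p \<in> B p \<inter> {g p}} = {f \<in> topspace P. f p = g p}"
    using insert.prems by (auto simp: P_def PiE_iff)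
  ultimately have "openin P ({f \<in> topspace P. f p = g p} \<inter> {f \<in> topspace P. \<forall>p\<in>F. f p = g p})"
    using insert.IH insert.prems by (intro openin_Int) auto
  moreover have "{f \<in> topspace P. f p = g p} \<inter> {f \<in> topspace P. \<forall>p\<in>F. f p = g p} =
      {f \<in> topspace P. \<forall>p\<in>insert p F. f p = g p}" by blast
  ultimately show ?case by simp
qed

locale graph_group = graph_automorphisms \<Gamma> bar
  for \<Gamma> :: "('v, 'e) pre_digraph" and bar :: "'e \<Rightarrow> 'e" +
  fixes H :: "('v + 'e \<Rightarrow> 'v + 'e) set"
  assumes locally_finite: "locally_finite_graph \<Gamma>"
    and connected: "Digraph_Component.connected \<Gamma>"
    and H_subgroup: "subgroup H (Aut_graph \<Gamma> bar)"
    and H_closed: "closedin (topo (Aut_graph \<Gamma> bar)) H"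
begin

definition K :: "('v + 'e \<Rightarrow> 'v + 'e) topgroup" where "K = top_subgroup Aut H"

lemma topological_group_K: "topological_group K"
  unfolding K_def
  by (rule top_group.topological_group_top_subgroup[OF top_group.intro[OF topological_group_Aut] H_subgroup])

sublocale K: top_group K by (rule top_group.intro[OF topological_group_K])

lemma carrier_K [simp]: "carrier K = H"
  by (simp add: K_def)

lemma H_auts: "h \<in> H \<Longrightarrow> h \<in> graph_auts \<Gamma> bar"
  using subgroup.subset[OF H_subgroup] by auto

lemma act [simp]:
  assumes "h \<in> H"
  shows "x \<in> verts \<Gamma> \<Longrightarrow> h (Inl x) = Inl (vert_map h x)"
    and "e \<in> arcs \<Gamma> \<Longrightarrow> h (Inr e) = Inr (arc_map h e)"
    and "x \<in> verts \<Gamma> \<Longrightarrow> vert_map h x \<in> verts \<Gamma>"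
    and "e \<in> arcs \<Gamma> \<Longrightarrow> arc_map h e \<in> arcs \<Gamma>"
    and "e \<in> arcs \<Gamma> \<Longrightarrow> tail \<Gamma> (arc_map h e) = vert_map h (tail \<Gamma> e)"
    and "e \<in> arcs \<Gamma> \<Longrightarrow> head \<Gamma> (arc_map h e) = vert_map h (head \<Gamma> e)"
    and "e \<in> arcs \<Gamma> \<Longrightarrow> arc_map h (bar e) = bar (arc_map h e)"
  using autsD[OF H_auts[OF assms]] by auto

lemma mult_K: "g \<otimes>\<^bsub>K\<^esub> h = g \<otimes>\<^bsub>Aut\<^esub> h" "\<one>\<^bsub>K\<^esub> = \<one>\<^bsub>Aut\<^esub>"
  by (simp_all add: K_def)

lemma mult_apply:
  assumes "g \<in> H" "h \<in> H" "p \<in> points"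
  shows "(g \<otimes>\<^bsub>K\<^esub> h) p = g (h p)"
  using mult_Aut_apply[OF H_auts[OF assms(1)] H_auts[OF assms(2)] assms(3)] by (simp add: mult_K)

lemma act_mult [simp]:
  assumes gh: "g \<in> H" "h \<in> H"
  shows "x \<in> verts \<Gamma> \<Longrightarrow> vert_map (g \<otimes>\<^bsub>K\<^esub> h) x = vert_map g (vert_map h x)"
    and "e \<in> arcs \<Gamma> \<Longrightarrow> arc_map (g \<otimes>\<^bsub>K\<^esub> h) e = arc_map g (arc_map h e)"
proof -
  show "vert_map (g \<otimes>\<^bsub>K\<^esub> h) x = vert_map g (vert_map h x)" if x: "x \<in> verts \<Gamma>"
    using mult_apply[OF gh, of "Inl x"] x gh by (simp add: vert_map_def[of "g \<otimes>\<^bsub>K\<^esub> h"])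
  show "arc_map (g \<otimes>\<^bsub>K\<^esub> h) e = arc_map g (arc_map h e)" if e: "e \<in> arcs \<Gamma>"
    using mult_apply[OF gh, of "Inr e"] e gh by (simp add: arc_map_def[of "g \<otimes>\<^bsub>K\<^esub> h"])
qed

lemma act_one [simp]: "x \<in> verts \<Gamma> \<Longrightarrow> vert_map \<one>\<^bsub>K\<^esub> x = x" "e \<in> arcs \<Gamma> \<Longrightarrow> arc_map \<one>\<^bsub>K\<^esub> e = e"
  by (simp_all add: mult_K one_Aut vert_map_def arc_map_def)

lemma inv_H [simp]: "h \<in> H \<Longrightarrow> inv\<^bsub>K\<^esub> h \<in> H"
  using K.inv_closed by simp

lemma mult_H [simp]: "g \<in> H \<Longrightarrow> h \<in> H \<Longrightarrow> g \<otimes>\<^bsub>K\<^esub> h \<in> H"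
  using K.m_closed by simp

lemma one_H [simp]: "\<one>\<^bsub>K\<^esub> \<in> H"
  using K.one_closed by simp

lemma act_inv [simp]:
  assumes h: "h \<in> H"
  shows "x \<in> verts \<Gamma> \<Longrightarrow> vert_map (inv\<^bsub>K\<^esub> h) (vert_map h x) = x"
    and "x \<in> verts \<Gamma> \<Longrightarrow> vert_map h (vert_map (inv\<^bsub>K\<^esub> h) x) = x"
    and "e \<in> arcs \<Gamma> \<Longrightarrow> arc_map (inv\<^bsub>K\<^esub> h) (arc_map h e) = e"
    and "e \<in> arcs \<Gamma> \<Longrightarrow> arc_map h (arc_map (inv\<^bsub>K\<^esub> h) e) = e"
proof -
  have i: "inv\<^bsub>K\<^esub> h \<otimes>\<^bsub>K\<^esub> h = \<one>\<^bsub>K\<^esub>" "h \<otimes>\<^bsub>K\<^esub> inv\<^bsub>K\<^esub> h = \<one>\<^bsub>K\<^esub>" using h by simp_all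
  show "x \<in> verts \<Gamma> \<Longrightarrow> vert_map (inv\<^bsub>K\<^esub> h) (vert_map h x) = x"
    using act_mult(1)[of "inv\<^bsub>K\<^esub> h" h x] h unfolding i by simp
  show "x \<in> verts \<Gamma> \<Longrightarrow> vert_map h (vert_map (inv\<^bsub>K\<^esub> h) x) = x"
    using act_mult(1)[of h "inv\<^bsub>K\<^esub> h" x] h unfolding i by simp
  show "e \<in> arcs \<Gamma> \<Longrightarrow> arc_map (inv\<^bsub>K\<^esub> h) (arc_map h e) = e"
    using act_mult(2)[of "inv\<^bsub>K\<^esub> h" h e] h unfolding i by simp
  show "e \<in> arcs \<Gamma> \<Longrightarrow> arc_map h (arc_map (inv\<^bsub>K\<^esub> h) e) = e"
    using act_mult(2)[of h "inv\<^bsub>K\<^esub> h" e] h unfolding i by simp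
qed

lemma act_inv_eq:
  assumes "h \<in> H"
  shows "\<lbrakk>x \<in> verts \<Gamma>; vert_map h x = y\<rbrakk> \<Longrightarrow> vert_map (inv\<^bsub>K\<^esub> h) y = x"
    and "\<lbrakk>e \<in> arcs \<Gamma>; arc_map h e = f\<rbrakk> \<Longrightarrow> arc_map (inv\<^bsub>K\<^esub> h) f = e"
  using assms by auto

lemma arc_map_inj: "\<lbrakk>h \<in> H; e \<in> arcs \<Gamma>; f \<in> arcs \<Gamma>; arc_map h e = arc_map h f\<rbrakk> \<Longrightarrow> e = f"
  by (metis act_inv(3))

lemma out_arcs_iff [simp]: "e \<in> out_arcs \<Gamma> x \<longleftrightarrow> e \<in> arcs \<Gamma> \<and> tail \<Gamma> e = x"
  by simp

text \<open>
  Connectedness disregards directions, but since arcs come with their inverses, every vertex can be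
  reached from \<open>x\<close> by following arcs.
\<close>

lemma vertex_induct [consumes 2, case_names base step]:
  assumes "x \<in> verts \<Gamma>" "y \<in> verts \<Gamma>" and base: "P x"
    and step: "\<And>e. e \<in> arcs \<Gamma> \<Longrightarrow> P (tail \<Gamma> e) \<Longrightarrow> P (head \<Gamma> e)"
  shows "P y"
proof -
  have "(x, y) \<in> rtrancl_on (verts \<Gamma>) ((arcs_ends \<Gamma>)\<^sup>s)"
    using connected assms(1,2) unfolding connected_conv by blast
  then show ?thesis
  proof (induction rule: rtrancl_on_induct)
    case base show ?case by (rule assms(3))
  next
    case (step y z)
    then consider "(y, z) \<in> arcs_ends \<Gamma>" | "(z, y) \<in> arcs_ends \<Gamma>" by (auto simp: symcl_def)
    then show ?case
    proof cases
      case 1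
      then obtain e where "e \<in> arcs \<Gamma>" "tail \<Gamma> e = y" "head \<Gamma> e = z" by (auto simp: arcs_ends_conv)
      then show ?thesis using assms(4)[of e] step by simp
    next
      case 2
      then obtain e where "e \<in> arcs \<Gamma>" "tail \<Gamma> e = z" "head \<Gamma> e = y" by (auto simp: arcs_ends_conv)
      then show ?thesis using assms(4)[of "bar e"] step by simp
    qed
  qed
qed

lemma verts_nonempty: "verts \<Gamma> \<noteq> {}"
  using connected unfolding connected_conv by blast

lemma eq_one_if_fixes:
  assumes h: "h \<in> H" and v: "\<And>x. x \<in> verts \<Gamma> \<Longrightarrow> vert_map h x = x" and e: "\<And>e. e \<in> arcs \<Gamma> \<Longrightarrow> arc_map h e = e"
  shows "h = \<one>\<^bsub>K\<^esub>"
  using v e h by (intro auts_eqI H_auts) simp_all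

lemma openin_K:
  "openin (topo K) U \<longleftrightarrow> U \<subseteq> H \<and>
    (\<forall>g\<in>U. \<exists>F. finite F \<and> F \<subseteq> points \<and> {h \<in> H. \<forall>p\<in>F. h p = g p} \<subseteq> U)" (is "?l \<longleftrightarrow> ?r")
proof
  assume ?l
  then obtain V where V: "openin (topo Aut) V" "U = V \<inter> H" by (auto simp: K_def openin_subtopology)
  show ?r
  proof (intro conjI ballI)
    show "U \<subseteq> H" using V by blast
    fix g assume "g \<in> U"
    then obtain F where F: "finite F" "F \<subseteq> points" "{h \<in> graph_auts \<Gamma> bar. \<forall>p\<in>F. h p = g p} \<subseteq> V"
      using V unfolding openin_Aut by (meson IntE)
    then have "{h \<in> H. \<forall>p\<in>F. h p = g p} \<subseteq> U" using V(2) H_auts by blast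
    then show "\<exists>F. finite F \<and> F \<subseteq> points \<and> {h \<in> H. \<forall>p\<in>F. h p = g p} \<subseteq> U" using F by blast
  qed
next
  assume r: ?r
  show ?l
  proof (subst openin_subopen, intro ballI)
    fix g assume g: "g \<in> U"
    then obtain F where F: "finite F" "F \<subseteq> points" "{h \<in> H. \<forall>p\<in>F. h p = g p} \<subseteq> U" using r by meson
    have "openin (topo K) ({h \<in> graph_auts \<Gamma> bar. \<forall>p\<in>F. h p = g p} \<inter> H)"
      unfolding K_def using openin_fixator_coset[OF F(1,2)] by (auto simp: openin_subtopology)
    moreover have "{h \<in> graph_auts \<Gamma> bar. \<forall>p\<in>F. h p = g p} \<inter> H = {h \<in> H. \<forall>p\<in>F. h p = g p}"
      using H_auts by blast
    ultimately show "\<exists>T. openin (topo K) T \<and> g \<in> T \<and> T \<subseteq> U"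
      using F(3) g r by (intro exI[of _ "{h \<in> H. \<forall>p\<in>F. h p = g p}"]) auto
  qed
qed

lemma topspace_K: "topspace (topo K) = H"
  using K.topspace_eq by simp

definition fixator :: "('v + 'e) set \<Rightarrow> ('v + 'e \<Rightarrow> 'v + 'e) set" where
  "fixator F = {h \<in> H. \<forall>p\<in>F. h p = p}"

lemma fixator_subgroup:
  assumes F: "F \<subseteq> points"
  shows "subgroup (fixator F) K"
proof (rule K.subgroupI)
  show "fixator F \<subseteq> carrier K" by (auto simp: fixator_def)
  have "\<one>\<^bsub>K\<^esub> \<in> fixator F" using F by (auto simp: fixator_def mult_K(2) one_Aut simp flip: mult_K(2) intro: restrict_apply')
  then show "fixator F \<noteq> {}" by blast
  fix a b assume a: "a \<in> fixator F"
  have aH: "a \<in> H" using a by (simp add: fixator_def)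
  have "(inv\<^bsub>K\<^esub> a) p = p" if "p \<in> F" for p
  proof -
    have "(inv\<^bsub>K\<^esub> a \<otimes>\<^bsub>K\<^esub> a) p = (inv\<^bsub>K\<^esub> a) (a p)" using aH that F by (intro mult_apply) auto
    moreover have "a p = p" using a that by (simp add: fixator_def)
    moreover have "\<one>\<^bsub>K\<^esub> p = p" using that F by (auto simp: mult_K(2) one_Aut)
    ultimately show ?thesis using aH by simp
  qed
  then show "inv\<^bsub>K\<^esub> a \<in> fixator F" using aH by (simp add: fixator_def)
  assume b: "b \<in> fixator F"
  have bH: "b \<in> H" using b by (simp add: fixator_def)
  have "(a \<otimes>\<^bsub>K\<^esub> b) p = p" if "p \<in> F" for p
    using mult_apply[OF aH bH, of p] that F a b by (auto simp: fixator_def)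
  then show "a \<otimes>\<^bsub>K\<^esub> b \<in> fixator F" using aH bH by (simp add: fixator_def)
qed

lemma fixator_open:
  assumes F: "F \<subseteq> points" "finite F"
  shows "openin (topo K) (fixator F)"
  unfolding openin_K
proof (intro conjI ballI)
  show "fixator F \<subseteq> H" by (auto simp: fixator_def)
  fix g assume "g \<in> fixator F"
  then show "\<exists>F'. finite F' \<and> F' \<subseteq> points \<and> {h \<in> H. \<forall>p\<in>F'. h p = g p} \<subseteq> fixator F"
    using F by (intro exI[of _ F]) (auto simp: fixator_def)
qed

lemma small_fixator:
  assumes U: "openin (topo K) U" "\<one>\<^bsub>K\<^esub> \<in> U"
  shows "\<exists>F. finite F \<and> F \<subseteq> points \<and> fixator F \<subseteq> U"
proof -
  obtain F where F: "finite F" "F \<subseteq> points" "{h \<in> H. \<forall>p\<in>F. h p = \<one>\<^bsub>K\<^esub> p} \<subseteq> U"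
    using U unfolding openin_K by meson
  moreover have "\<one>\<^bsub>K\<^esub> p = p" if "p \<in> F" for p using that F(2) by (auto simp: mult_K(2) one_Aut)
  ultimately show ?thesis by (intro exI[of _ F]) (auto simp: fixator_def)
qed

lemma one_closed_K: "closedin (topo K) {\<one>\<^bsub>K\<^esub>}"
proof -
  have "openin (topo K) (H - {\<one>\<^bsub>K\<^esub>})"
    unfolding openin_K
  proof (intro conjI ballI)
    fix g assume g: "g \<in> H - {\<one>\<^bsub>K\<^esub>}"
    have "\<exists>p\<in>points. g p \<noteq> \<one>\<^bsub>K\<^esub> p"
    proof (rule ccontr)
      assume "\<not> ?thesis"
      then have "g = \<one>\<^bsub>K\<^esub>"
        using autsD(1)[OF H_auts[of g]] autsD(1)[OF H_auts[OF one_H]] g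
        by (intro extensionalityI[of _ points]) (auto simp: Bij_def)
      then show False using g by simp
    qed
    then obtain p where "p \<in> points" "g p \<noteq> \<one>\<^bsub>K\<^esub> p" by blast
    then show "\<exists>F. finite F \<and> F \<subseteq> points \<and> {h \<in> H. \<forall>p\<in>F. h p = g p} \<subseteq> H - {\<one>\<^bsub>K\<^esub>}"
      by (intro exI[of _ "{p}"]) auto
  qed auto
  then show ?thesis by (simp add: closedin_def topspace_K)
qed

definition stab :: "'v \<Rightarrow> ('v + 'e \<Rightarrow> 'v + 'e) set" where
  "stab x = {h \<in> H. vert_map h x = x}"

lemma stab_eq_fixator: "x \<in> verts \<Gamma> \<Longrightarrow> stab x = fixator {Inl x}"
  by (auto simp: stab_def fixator_def)

lemma stab_subgroup: "x \<in> verts \<Gamma> \<Longrightarrow> subgroup (stab x) K"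
  using fixator_subgroup[of "{Inl x}"] by (simp add: stab_eq_fixator)

text \<open>
  By local finiteness the orbits of the stabilizer on the arcs issuing from a finite orbit of vertices
  are finite, so finiteness spreads from \<open>x\<close> through the connected graph.
\<close>

lemma finite_stab_orbits:
  assumes x: "x \<in> verts \<Gamma>" and p: "p \<in> points"
  shows "finite {h p | h. h \<in> stab x}"
proof -
  have arc: "finite {arc_map h e | h. h \<in> stab x}"
    if fin: "finite {vert_map h (tail \<Gamma> e) | h. h \<in> stab x}" and e: "e \<in> arcs \<Gamma>" for e
  proof (rule finite_subset)
    have "vert_map h (tail \<Gamma> e) \<in> verts \<Gamma>" if "h \<in> stab x" for h using that e by (simp add: stab_def)
    then show "finite (\<Union>v\<in>{vert_map h (tail \<Gamma> e) | h. h \<in> stab x}. out_arcs \<Gamma> v)"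
      using fin locally_finite unfolding locally_finite_graph_def by blast
    show "{arc_map h e | h. h \<in> stab x} \<subseteq> (\<Union>v\<in>{vert_map h (tail \<Gamma> e) | h. h \<in> stab x}. out_arcs \<Gamma> v)"
      using e by (auto simp: stab_def)
  qed
  have vert: "finite {vert_map h y | h. h \<in> stab x}" if y: "y \<in> verts \<Gamma>" for y
    using x y
  proof (induction rule: vertex_induct)
    case base
    have "{vert_map h x | h. h \<in> stab x} \<subseteq> {x}" by (auto simp: stab_def)
    then show ?case by (rule finite_subset) simp
  next
    case (step e)
    have "{vert_map h (head \<Gamma> e) | h. h \<in> stab x} \<subseteq> head \<Gamma> ` {arc_map h e | h. h \<in> stab x}"
      using step(1) by (auto simp: stab_def image_iff) (metis act(6))
    then show ?case using arc[OF step(2,1)] by (meson finite_imageI finite_subset)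
  qed
  show ?thesis
  proof (cases p)
    case (Inl y)
    have "{h p | h. h \<in> stab x} \<subseteq> Inl ` {vert_map h y | h. h \<in> stab x}"
      using p Inl by (auto simp: stab_def)
    then show ?thesis using vert p Inl by (meson finite_imageI finite_subset in_points(1))
  next
    case (Inr e)
    have "{h p | h. h \<in> stab x} \<subseteq> Inr ` {arc_map h e | h. h \<in> stab x}"
      using p Inr by (auto simp: stab_def)
    moreover have e: "e \<in> arcs \<Gamma>" using p Inr by simp
    ultimately show ?thesis
      using arc[OF vert[OF tail_in_verts[OF e]] e] by (meson finite_imageI finite_subset)
  qed
qed

text \<open>
  The stabilizer is embedded in the product of its orbits, which are finite discrete spaces. The image is
  closed: a map that agrees on every finite set with some element of the stabilizer is an automorphism,
  and lies in \<open>H\<close> because \<open>H\<close> is closed.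
\<close>

lemma stab_compact:
  assumes x: "x \<in> verts \<Gamma>"
  shows "compactin (topo K) (stab x)"
proof -
  let ?O = "\<lambda>p. {h p | h. h \<in> stab x}"
  let ?P = "product_topology (\<lambda>p. discrete_topology (?O p)) points"
  have top: "topspace ?P = (\<Pi>\<^sub>E p\<in>points. ?O p)" by simp
  have comp: "compact_space ?P"
    using finite_stab_orbits[OF x] by (simp add: compact_space_product_topology compact_space_discrete_topology)
  have openP: "openin ?P {f \<in> topspace ?P. \<forall>p\<in>F. f p = g p}" if "finite F" "F \<subseteq> points" for F g
    using that by (rule openin_product_discrete)
  have SP: "stab x \<subseteq> topspace ?P"
    unfolding top
  proof
    fix h assume h: "h \<in> stab x"
    then have "h \<in> extensional points" using autsD(1)[OF H_auts[of h]] by (simp add: stab_def Bij_def)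
    then show "h \<in> (\<Pi>\<^sub>E p\<in>points. ?O p)" using h by (auto simp: PiE_iff)
  qed
  have approx: "f \<in> stab x"
    if f: "f \<in> topspace ?P" and a: "\<And>F. finite F \<Longrightarrow> F \<subseteq> points \<Longrightarrow> \<exists>h\<in>stab x. \<forall>p\<in>F. h p = f p" for f
  proof -
    have ap: "\<exists>h\<in>H. \<forall>p\<in>F. h p = f p" if "finite F" "F \<subseteq> points" for F
      using a[OF that] by (auto simp: stab_def)
    have ext: "f \<in> extensional points" using f unfolding top by (simp add: PiE_iff)
    have V: "\<exists>w. w \<in> verts \<Gamma> \<and> f (Inl v) = Inl w" if v: "v \<in> verts \<Gamma>" for v
    proof -
      obtain h where h: "h \<in> H" "h (Inl v) = f (Inl v)" using ap[of "{Inl v}"] v by auto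
      then show ?thesis using act(1,3)[OF h(1) v] by metis
    qed
    have E: "\<exists>w. w \<in> arcs \<Gamma> \<and> f (Inr v) = Inr w" if v: "v \<in> arcs \<Gamma>" for v
    proof -
      obtain h where h: "h \<in> H" "h (Inr v) = f (Inr v)" using ap[of "{Inr v}"] v by auto
      then show ?thesis using act(2,4)[OF h(1) v] by metis
    qed
    obtain vm where vm: "\<And>v. v \<in> verts \<Gamma> \<Longrightarrow> vm v \<in> verts \<Gamma> \<and> f (Inl v) = Inl (vm v)" using V by metis
    obtain am where am: "\<And>v. v \<in> arcs \<Gamma> \<Longrightarrow> am v \<in> arcs \<Gamma> \<and> f (Inr v) = Inr (am v)" using E by metis
    have "f \<in> graph_auts \<Gamma> bar"
    proof (rule autsI[OF _ vm am])
      have into: "f p \<in> points" if "p \<in> points" for p using that vm am by (cases p) auto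
      have inj: "inj_on f points"
      proof (rule inj_onI)
        fix p q assume pq: "p \<in> points" "q \<in> points" "f p = f q"
        then obtain h where h: "h \<in> H" "h p = f p" "h q = f q" using ap[of "{p, q}"] by auto
        have "inj_on h points" using autsD(1)[OF H_auts[OF h(1)]] by (simp add: Bij_def bij_betw_def)
        moreover have "h p = h q" using pq(3) h by simp
        ultimately show "p = q" using pq(1,2) by (auto dest: inj_onD)
      qed
      have "q \<in> f ` points" if q: "q \<in> points" for q
      proof -
        have sub: "?O q \<subseteq> points"
          using auts_maps_point[OF H_auts q] by (auto simp: stab_def simp del: in_points)
        \<comment> \<open>Surjectivity: the finite orbit of \<open>q\<close> contains its preimages under all elements of the stabilizer.\<close>
        obtain h where h: "h \<in> stab x" "\<forall>p\<in>?O q. h p = f p"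
          using a[OF finite_stab_orbits[OF x q] sub] by blast
        have hH: "h \<in> H" using h by (simp add: stab_def)
        have ih: "inv\<^bsub>K\<^esub> h \<in> stab x" using subgroup.m_inv_closed[OF stab_subgroup[OF x] h(1)] .
        let ?p = "(inv\<^bsub>K\<^esub> h) q"
        have p: "?p \<in> ?O q" using ih by blast
        have "(h \<otimes>\<^bsub>K\<^esub> inv\<^bsub>K\<^esub> h) q = h ?p" using hH q by (intro mult_apply) auto
        moreover have "\<one>\<^bsub>K\<^esub> q = q" using q by (auto simp: mult_K(2) one_Aut)
        ultimately have "h ?p = q" using hH by simp
        then have "q = f ?p" using bspec[OF h(2) p] by simp
        moreover have "?p \<in> points" using sub p by (rule subsetD)
        ultimately show ?thesis by (rule image_eqI)
      qed
      then have "f ` points = points" using into by blast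
      then show "f \<in> Bij points" using ext inj by (simp add: Bij_def bij_betw_def)
      fix e assume e: "e \<in> arcs \<Gamma>"
      obtain h where h: "h \<in> H" "\<forall>p\<in>{Inr e, Inr (bar e), Inl (tail \<Gamma> e), Inl (head \<Gamma> e)}. h p = f p"
        using ap[of "{Inr e, Inr (bar e), Inl (tail \<Gamma> e), Inl (head \<Gamma> e)}"] e by auto
      have "am e = arc_map h e" "am (bar e) = arc_map h (bar e)"
        "vm (tail \<Gamma> e) = vert_map h (tail \<Gamma> e)" "vm (head \<Gamma> e) = vert_map h (head \<Gamma> e)"
        using h e am[OF e] am[OF arev_in_arcs[OF e]] vm[OF tail_in_verts[OF e]] vm[OF head_in_verts[OF e]] by auto
      then show "tail \<Gamma> (am e) = vm (tail \<Gamma> e) \<and> head \<Gamma> (am e) = vm (head \<Gamma> e) \<and> am (bar e) = bar (am e)"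
        using h(1) e by simp
    qed
    have "f \<in> H"
    proof (rule ccontr)
      assume "f \<notin> H"
      moreover have "openin (topo Aut) (graph_auts \<Gamma> bar - H)"
        using H_closed by (simp add: closedin_def topspace_Aut)
      ultimately obtain F where "finite F" "F \<subseteq> points" "{h \<in> graph_auts \<Gamma> bar. \<forall>p\<in>F. h p = f p} \<subseteq> graph_auts \<Gamma> bar - H"
        using \<open>f \<in> graph_auts \<Gamma> bar\<close> unfolding openin_Aut by (meson DiffI)
      then show False using ap[of F] H_auts by blast
    qed
    moreover have "f (Inl x) = Inl x"
      using a[of "{Inl x}"] x by (auto simp: stab_eq_fixator fixator_def)
    ultimately show ?thesis using x by (simp add: stab_eq_fixator fixator_def)
  qed
  have "openin ?P (topspace ?P - stab x)"
  proof (subst openin_subopen, intro ballI)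
    fix f assume f: "f \<in> topspace ?P - stab x"
    then obtain F where F: "finite F" "F \<subseteq> points" "\<And>h. h \<in> stab x \<Longrightarrow> \<not> (\<forall>p\<in>F. h p = f p)"
      using approx[of f] by blast
    show "\<exists>T. openin ?P T \<and> f \<in> T \<and> T \<subseteq> topspace ?P - stab x"
      using openP[OF F(1,2), of f] F(3) f
      by (intro exI[of _ "{k \<in> topspace ?P. \<forall>p\<in>F. k p = f p}"]) auto
  qed
  then have "closedin ?P (stab x)" using SP by (simp add: closedin_def)
  then have c: "compactin ?P (stab x)" using comp by (simp add: closedin_compact_space)
  have "continuous_map (subtopology ?P (stab x)) (topo K) (\<lambda>h. h)"
    unfolding continuous_map_def
  proof (intro conjI allI impI)
    show "(\<lambda>h. h) \<in> topspace (subtopology ?P (stab x)) \<rightarrow> topspace (topo K)"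
      by (auto simp: topspace_K stab_def)
    fix U assume U: "openin (topo K) U"
    have "openin (subtopology ?P (stab x)) (U \<inter> stab x)"
    proof (subst openin_subopen, intro ballI)
      fix g assume g: "g \<in> U \<inter> stab x"
      then obtain F where F: "finite F" "F \<subseteq> points" "{h \<in> H. \<forall>p\<in>F. h p = g p} \<subseteq> U"
        using U unfolding openin_K by (meson IntE)
      let ?T = "{f \<in> topspace ?P. \<forall>p\<in>F. f p = g p} \<inter> stab x"
      have "openin (subtopology ?P (stab x)) ?T"
        using openP[OF F(1,2)] unfolding openin_subtopology by blast
      moreover have "g \<in> ?T" using g SP by auto
      moreover have "?T \<subseteq> U \<inter> stab x" using F(3) by (auto simp: stab_def)
      ultimately show "\<exists>T. openin (subtopology ?P (stab x)) T \<and> g \<in> T \<and> T \<subseteq> U \<inter> stab x" by blast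
    qed
    moreover have "{h \<in> topspace (subtopology ?P (stab x)). h \<in> U} = U \<inter> stab x" using SP by auto
    ultimately show "openin (subtopology ?P (stab x)) {h \<in> topspace (subtopology ?P (stab x)). h \<in> U}" by simp
  qed
  from image_compactin[OF _ this, of "stab x"] c show ?thesis
    by (simp add: compactin_subtopology)
qed

end

section \<open>Locally semiprimitive groups\<close>

lemma transitive_permsD:
  assumes "transitive_perms X P"
  shows "group (perm_group X P)" "P \<subseteq> Bij X" "\<And>x y. \<lbrakk>x \<in> X; y \<in> X\<rbrakk> \<Longrightarrow> \<exists>p\<in>P. p x = y"
proof -
  interpret t: transitive_action "perm_group X P" X "\<lambda>p. p"
    using assms by (simp add: transitive_perms_def)
  show "group (perm_group X P)" using t.group_hom group_hom.axioms(1) by auto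
  show "P \<subseteq> Bij X" using t.bij_prop0 by (auto simp: perm_group_def)
  show "\<exists>p\<in>P. p x = y" if "x \<in> X" "y \<in> X" for x y
    using t.unique_orbit[OF that] by (auto simp: perm_group_def)
qed

context graph_group
begin

definition induced :: "'v \<Rightarrow> ('v + 'e \<Rightarrow> 'v + 'e) \<Rightarrow> 'e \<Rightarrow> 'e" where
  "induced x h = restrict (arc_map h) (out_arcs \<Gamma> x)"

lemma fixator_fixes:
  assumes h: "h \<in> fixator F"
  shows "\<lbrakk>Inl x \<in> F; x \<in> verts \<Gamma>\<rbrakk> \<Longrightarrow> vert_map h x = x"
    and "\<lbrakk>Inr e \<in> F; e \<in> arcs \<Gamma>\<rbrakk> \<Longrightarrow> arc_map h e = e"
proof -
  have hH: "h \<in> H" and fx: "\<And>p. p \<in> F \<Longrightarrow> h p = p" using h by (simp_all add: fixator_def)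
  show "vert_map h x = x" if "Inl x \<in> F" "x \<in> verts \<Gamma>" using act(1)[OF hH that(2)] fx[OF that(1)] by simp
  show "arc_map h e = e" if "Inr e \<in> F" "e \<in> arcs \<Gamma>" using act(2)[OF hH that(2)] fx[OF that(1)] by simp
qed

lemma local_action_induced: "M \<subseteq> H \<Longrightarrow> local_action \<Gamma> M x = induced x ` (M \<inter> stab x)"
  by (auto simp: local_action_def induced_def stab_def)

lemma stab_out_arcs: "h \<in> stab x \<Longrightarrow> e \<in> out_arcs \<Gamma> x \<Longrightarrow> arc_map h e \<in> out_arcs \<Gamma> x"
  by (simp add: stab_def)

lemma stab_if_fixes_arc: "h \<in> H \<Longrightarrow> e \<in> out_arcs \<Gamma> x \<Longrightarrow> f \<in> out_arcs \<Gamma> x \<Longrightarrow> arc_map h e = f \<Longrightarrow> h \<in> stab x"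
  using act(5)[of h e] by (simp add: stab_def)

lemma local_action_normal:
  assumes t: "transitive_perms (out_arcs \<Gamma> x) (local_action \<Gamma> H x)" and x: "x \<in> verts \<Gamma>" and N: "N \<lhd> K"
  shows "local_action \<Gamma> N x \<lhd> perm_group (out_arcs \<Gamma> x) (local_action \<Gamma> H x)"
proof -
  let ?E = "out_arcs \<Gamma> x" and ?P = "local_action \<Gamma> H x"
  let ?S = "top_subgroup K (stab x)"
  have S: "subgroup (stab x) K" by (rule stab_subgroup[OF x])
  have NH: "N \<subseteq> H" using subgroup.subset[OF normal_imp_subgroup[OF N]] by simp
  have N': "N \<inter> stab x \<lhd> ?S"
    unfolding K.normal_top_subgroup_iff[OF S]
  proof (intro conjI ballI)
    show "subgroup (N \<inter> stab x) K" by (rule K.subgroups_Inter_pair[OF normal_imp_subgroup[OF N] S])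
    fix l n assume l: "l \<in> stab x" and n: "n \<in> N \<inter> stab x"
    have lK: "l \<in> carrier K" using l by (simp add: stab_def)
    have "l \<otimes>\<^bsub>K\<^esub> n \<otimes>\<^bsub>K\<^esub> inv\<^bsub>K\<^esub> l \<in> N" by (rule normal.inv_op_closed2[OF N lK]) (use n in simp)
    moreover have "l \<otimes>\<^bsub>K\<^esub> n \<otimes>\<^bsub>K\<^esub> inv\<^bsub>K\<^esub> l \<in> stab x"
      using l n S by (intro subgroup.m_closed[OF S] subgroup.m_inv_closed[OF S]) auto
    ultimately show "l \<otimes>\<^bsub>K\<^esub> n \<otimes>\<^bsub>K\<^esub> inv\<^bsub>K\<^esub> l \<in> N \<inter> stab x" by blast
  qed auto
  have PB: "induced x h \<in> Bij ?E" if "h \<in> stab x" for h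
    using transitive_permsD(2)[OF t] that by (auto simp: local_action_induced stab_def)
  have "induced x (g \<otimes>\<^bsub>K\<^esub> h) = compose ?E (induced x g) (induced x h)" if gh: "g \<in> stab x" "h \<in> stab x" for g h
  proof
    fix e
    show "induced x (g \<otimes>\<^bsub>K\<^esub> h) e = compose ?E (induced x g) (induced x h) e"
      using gh stab_out_arcs[OF gh(2), of e] by (simp add: induced_def compose_def stab_def)
  qed
  then have "induced x \<in> hom ?S (perm_group ?E ?P)"
    using PB by (auto simp: hom_def perm_group_def BijGroup_def local_action_induced stab_def)
  then have h: "group_hom ?S (perm_group ?E ?P) (induced x)"
    using K.group_top_subgroup[OF S] transitive_permsD(1)[OF t]
    by (simp add: group_hom_def group_hom_axioms_def)
  have surj: "induced x ` carrier ?S = carrier (perm_group ?E ?P)"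
    by (auto simp: perm_group_def local_action_induced stab_def)
  have "induced x ` (N \<inter> stab x) \<lhd> perm_group ?E ?P"
    by (rule normal.surj_hom_normal_subgroup[OF N' h surj])
  then show ?thesis using local_action_induced[OF NH] by simp
qed

lemma transitive_local_action:
  assumes t: "transitive_perms (out_arcs \<Gamma> x) (local_action \<Gamma> M x)" and M: "M \<subseteq> H"
    and e: "e \<in> out_arcs \<Gamma> x" "f \<in> out_arcs \<Gamma> x"
  shows "\<exists>h\<in>M \<inter> stab x. arc_map h e = f"
proof -
  obtain p where p: "p \<in> local_action \<Gamma> M x" "p e = f" using transitive_permsD(3)[OF t e] by blast
  then obtain h where h: "h \<in> M \<inter> stab x" "p = induced x h" unfolding local_action_induced[OF M] by blast
  then show ?thesis using p(2) e(1) by (intro bexI[of _ h]) (simp_all add: induced_def)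
qed

end

locale semiprimitive_group = graph_group \<Gamma> bar H
  for \<Gamma> :: "('v, 'e) pre_digraph" and bar :: "'e \<Rightarrow> 'e" and H :: "('v + 'e \<Rightarrow> 'v + 'e) set" +
  assumes not_discrete: "\<not> discrete_in (Aut_graph \<Gamma> bar) H"
    and semiprimitive: "locally_semiprimitive \<Gamma> H"
begin

lemma not_discrete_K: "\<not> discrete_in K (carrier K)"
  using not_discrete by (simp add: discrete_in_def K_def subtopology_subtopology)

lemma stab_transitive:
  assumes "x \<in> verts \<Gamma>" "e \<in> out_arcs \<Gamma> x" "f \<in> out_arcs \<Gamma> x"
  shows "\<exists>h\<in>stab x. arc_map h e = f"
proof -
  have "transitive_perms (out_arcs \<Gamma> x) (local_action \<Gamma> H x)"
    using semiprimitive assms(1) by (simp add: locally_semiprimitive_def semiprimitive_perms_def)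
  from transitive_local_action[OF this order_refl assms(2,3)] show ?thesis by blast
qed

text \<open>
  Semiprimitivity of the local action of \<open>H\<close>, applied to its normal subgroup induced by \<open>N\<close>.
\<close>

lemma local_dichotomy:
  assumes N: "N \<lhd> K" and x: "x \<in> verts \<Gamma>"
  shows "(\<forall>e\<in>out_arcs \<Gamma> x. \<forall>f\<in>out_arcs \<Gamma> x. \<exists>n\<in>N \<inter> stab x. arc_map n e = f) \<or>
    (\<forall>n\<in>N. \<forall>e\<in>out_arcs \<Gamma> x. \<forall>f\<in>out_arcs \<Gamma> x. arc_map n e = e \<longrightarrow> arc_map n f = f)"
proof -
  let ?E = "out_arcs \<Gamma> x"
  have NH: "N \<subseteq> H" using subgroup.subset[OF normal_imp_subgroup[OF N]] by simp
  have sp: "semiprimitive_perms ?E (local_action \<Gamma> H x)"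
    using semiprimitive x by (simp add: locally_semiprimitive_def)
  then have t: "transitive_perms ?E (local_action \<Gamma> H x)" by (simp add: semiprimitive_perms_def)
  have "transitive_perms ?E (local_action \<Gamma> N x) \<or> semiregular_perms ?E (local_action \<Gamma> N x)"
    using sp local_action_normal[OF t x N] by (simp add: semiprimitive_perms_def)
  then show ?thesis
  proof
    assume "transitive_perms ?E (local_action \<Gamma> N x)"
    then show ?thesis using transitive_local_action[OF _ NH] by blast
  next
    assume sr: "semiregular_perms ?E (local_action \<Gamma> N x)"
    have "arc_map n f = f" if n: "n \<in> N" "e \<in> ?E" "f \<in> ?E" "arc_map n e = e" for n e f
    proof -
      have nH: "n \<in> H" using n(1) NH by blast
      have "n \<in> stab x" by (rule stab_if_fixes_arc[OF nH n(2) n(2) n(4)])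
      then have "induced x n \<in> local_action \<Gamma> N x" using n(1) by (simp add: local_action_induced[OF NH])
      moreover have "induced x n e = e" using n(2,4) by (simp add: induced_def)
      ultimately have "induced x n \<in> stabilizer (perm_group ?E (local_action \<Gamma> N x)) (\<lambda>p. p) e"
        by (simp add: stabilizer_def perm_group_def)
      then have "induced x n = (\<lambda>x\<in>?E. x)"
        using sr n(2) by (simp add: semiregular_perms_def perm_group_def BijGroup_def)
      then have "induced x n f = f" using n(3) by simp
      then show ?thesis using n(3) by (simp add: induced_def)
    qed
    then show ?thesis by blast
  qed
qed

definition locally_transitive_at :: "('v + 'e \<Rightarrow> 'v + 'e) set \<Rightarrow> 'v \<Rightarrow> bool" where
  "locally_transitive_at N x \<longleftrightarrow> (\<forall>e\<in>out_arcs \<Gamma> x. \<forall>f\<in>out_arcs \<Gamma> x. \<exists>n\<in>N \<inter> stab x. arc_map n e = f)"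

definition nonfree_at :: "'v \<Rightarrow> ('v + 'e \<Rightarrow> 'v + 'e) set" where
  "nonfree_at x = {h \<in> H. \<exists>e\<in>out_arcs \<Gamma> x. \<exists>f\<in>out_arcs \<Gamma> x. arc_map h e = e \<and> arc_map h f \<noteq> f}"

definition nonfree :: "('v + 'e \<Rightarrow> 'v + 'e) set" where
  "nonfree = (\<Union>x\<in>verts \<Gamma>. nonfree_at x)"

definition cofinite :: "('v + 'e \<Rightarrow> 'v + 'e) set \<Rightarrow> bool" where
  "cofinite N \<longleftrightarrow> (\<exists>F. finite F \<and> F \<subseteq> verts \<Gamma> \<and> (\<forall>v\<in>verts \<Gamma>. \<exists>n\<in>N. \<exists>f\<in>F. v = vert_map n f))"

lemma normal_subset_H: "N \<lhd> K \<Longrightarrow> N \<subseteq> H"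
  using subgroup.subset[OF normal_imp_subgroup, of N K] by simp

lemma arc_at_vertex:
  assumes e: "e \<in> arcs \<Gamma>" and x: "x \<in> verts \<Gamma>"
  shows "\<exists>f\<in>arcs \<Gamma>. tail \<Gamma> f = x"
  using tail_in_verts[OF e] x
proof (induction rule: vertex_induct)
  case base show ?case using e by blast
next
  case (step g) then show ?case by (intro bexI[of _ "bar g"]) auto
qed

text \<open>
  An element outside \<open>nonfree\<close> that fixes one arc fixes the star of its origin, hence the stars of all
  neighbors, and so on.
\<close>

lemma eq_one_if_free_fixes_arc:
  assumes h: "h \<in> M" and MH: "M \<subseteq> H" and free: "M \<inter> nonfree = {}" and e: "e \<in> arcs \<Gamma>" "arc_map h e = e"
  shows "h = \<one>\<^bsub>K\<^esub>"
proof -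
  have hH: "h \<in> H" using h MH by blast
  have star: "\<forall>f\<in>out_arcs \<Gamma> (tail \<Gamma> g). arc_map h f = f" if "g \<in> arcs \<Gamma>" "arc_map h g = g" for g
  proof (rule ccontr)
    assume "\<not> ?thesis"
    then have "h \<in> nonfree_at (tail \<Gamma> g)" unfolding nonfree_at_def using that hH by auto
    then have "h \<in> nonfree" unfolding nonfree_def using that by auto
    then show False using free h by blast
  qed
  have all: "\<forall>f\<in>out_arcs \<Gamma> y. arc_map h f = f" if y: "y \<in> verts \<Gamma>" for y
    using tail_in_verts[OF e(1)] y
  proof (induction rule: vertex_induct)
    case base
    show ?case by (rule star[OF e])
  next
    case (step g)
    have "arc_map h g = g" using step by simp
    then have "arc_map h (bar g) = bar g" using step(1) hH by simp
    from star[OF arev_in_arcs[OF step(1)] this] show ?case using step(1) by simp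
  qed
  show ?thesis
  proof (rule eq_one_if_fixes[OF hH])
    show arc: "arc_map h f = f" if "f \<in> arcs \<Gamma>" for f using all[OF tail_in_verts[OF that]] that by simp
    show "vert_map h x = x" if x: "x \<in> verts \<Gamma>" for x
    proof -
      obtain f where f: "f \<in> arcs \<Gamma>" "tail \<Gamma> f = x" using arc_at_vertex[OF e(1) x] by blast
      then show ?thesis using act(5)[OF hH f(1)] arc[OF f(1)] by simp
    qed
  qed
qed

lemma arcs_nonempty: "arcs \<Gamma> \<noteq> {}"
proof
  assume no: "arcs \<Gamma> = {}"
  obtain x where x: "x \<in> verts \<Gamma>" using verts_nonempty by blast
  have one: "y = x" if "y \<in> verts \<Gamma>" for y
    using x that by (induction rule: vertex_induct) (auto simp: no)
  have "h = \<one>\<^bsub>K\<^esub>" if h: "h \<in> H" for h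
    by (rule eq_one_if_fixes[OF h]) (use one x act(3)[OF h] no in auto)
  then have "H = {\<one>\<^bsub>K\<^esub>}" using one_H by blast
  then have "H \<inter> carrier K = {\<one>\<^bsub>K\<^esub>}" by simp
  moreover have "openin (topo K) H" using openin_topspace[of "topo K"] by (simp only: topspace_K)
  ultimately have "discrete_in K (carrier K)"
    using K.discrete_in_iff[OF K.subgroup_self] by blast
  then show False using not_discrete_K by simp
qed

lemma out_arcs_nonempty:
  assumes x: "x \<in> verts \<Gamma>"
  shows "out_arcs \<Gamma> x \<noteq> {}"
proof -
  obtain e where e: "e \<in> arcs \<Gamma>" using arcs_nonempty by blast
  then have "\<exists>f\<in>arcs \<Gamma>. tail \<Gamma> f = x" using x by (rule arc_at_vertex)
  then show ?thesis by auto
qed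

lemma discrete_if_free:
  assumes M: "subgroup M K" and free: "M \<inter> nonfree = {}"
  shows "discrete_in K M"
proof -
  obtain e where e: "e \<in> arcs \<Gamma>" using arcs_nonempty by blast
  have MH: "M \<subseteq> H" using subgroup.subset[OF M] by simp
  have "fixator {Inr e} \<inter> M = {\<one>\<^bsub>K\<^esub>}"
  proof
    have "\<one>\<^bsub>K\<^esub> \<in> fixator {Inr e}" using subgroup.one_closed[OF fixator_subgroup[of "{Inr e}"]] e by simp
    then show "{\<one>\<^bsub>K\<^esub>} \<subseteq> fixator {Inr e} \<inter> M" using subgroup.one_closed[OF M] by blast
    show "fixator {Inr e} \<inter> M \<subseteq> {\<one>\<^bsub>K\<^esub>}"
    proof
      fix h assume h: "h \<in> fixator {Inr e} \<inter> M"
      then have hf: "h \<in> fixator {Inr e}" and hM: "h \<in> M" by blast+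
      have "arc_map h e = e" by (rule fixator_fixes(2)[OF hf _ e]) simp
      from eq_one_if_free_fixes_arc[OF hM MH free e this] show "h \<in> {\<one>\<^bsub>K\<^esub>}" by simp
    qed
  qed
  moreover have "openin (topo K) (fixator {Inr e})" using e by (intro fixator_open) auto
  ultimately show ?thesis using K.discrete_in_iff[OF M] by blast
qed

text \<open>
  Stabilizers act transitively on stars, so if one neighbor of a vertex lies in the orbit of \<open>x\<close>, all
  do. Along a walk starting at \<open>x\<close>, each vertex not in the orbit therefore has all its neighbors in it.
\<close>

lemma arc_meets_orbit:
  assumes x: "x \<in> verts \<Gamma>" and e: "e \<in> arcs \<Gamma>"
  shows "(\<exists>h\<in>H. tail \<Gamma> e = vert_map h x) \<or> (\<exists>h\<in>H. head \<Gamma> e = vert_map h x)"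
proof -
  let ?O = "\<lambda>v. \<exists>h\<in>H. v = vert_map h x"
  have "?O v \<or> (\<forall>b\<in>out_arcs \<Gamma> v. ?O (head \<Gamma> b))" if v: "v \<in> verts \<Gamma>" for v
    using x v
  proof (induction rule: vertex_induct)
    case base
    have "?O x" using x by (intro bexI[of _ "\<one>\<^bsub>K\<^esub>"]) auto
    then show ?case ..
  next
    case (step b)
    show ?case
    proof (cases "?O (tail \<Gamma> b)")
      case False
      then show ?thesis using step by simp
    next
      case True
      have "?O (head \<Gamma> c)" if c: "c \<in> out_arcs \<Gamma> (head \<Gamma> b)" for c
      proof -
        have "bar b \<in> out_arcs \<Gamma> (head \<Gamma> b)" using step(1) by simp
        from stab_transitive[OF head_in_verts[OF step(1)] this c]
        obtain h where h: "h \<in> stab (head \<Gamma> b)" "arc_map h (bar b) = c" by blast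
        have hH: "h \<in> H" using h by (simp add: stab_def)
        obtain k where k: "k \<in> H" "tail \<Gamma> b = vert_map k x" using True by blast
        have "head \<Gamma> c = vert_map h (head \<Gamma> (bar b))"
          using act(6)[OF hH arev_in_arcs[OF step(1)]] h(2) by simp
        also have "\<dots> = vert_map (h \<otimes>\<^bsub>K\<^esub> k) x" using step(1) k hH x by simp
        finally show ?thesis using hH k by (intro bexI[of _ "h \<otimes>\<^bsub>K\<^esub> k"]) auto
      qed
      then show ?thesis by blast
    qed
  qed
  from this[OF tail_in_verts[OF e]] show ?thesis using e by auto
qed

lemma conj_H: "N \<lhd> K \<Longrightarrow> h \<in> H \<Longrightarrow> n \<in> N \<Longrightarrow> h \<otimes>\<^bsub>K\<^esub> n \<otimes>\<^bsub>K\<^esub> inv\<^bsub>K\<^esub> h \<in> N"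
  by (rule normal.inv_op_closed2) auto

lemma locally_transitive_translate:
  assumes N: "N \<lhd> K" and x: "x \<in> verts \<Gamma>" and h: "h \<in> H" and t: "locally_transitive_at N x"
  shows "locally_transitive_at N (vert_map h x)"
  unfolding locally_transitive_at_def
proof (intro ballI)
  fix e f assume ef: "e \<in> out_arcs \<Gamma> (vert_map h x)" "f \<in> out_arcs \<Gamma> (vert_map h x)"
  have ih: "inv\<^bsub>K\<^esub> h \<in> H" using h by simp
  have "arc_map (inv\<^bsub>K\<^esub> h) e \<in> out_arcs \<Gamma> x" "arc_map (inv\<^bsub>K\<^esub> h) f \<in> out_arcs \<Gamma> x"
    using ef act(4,5)[OF ih] h x by simp_all
  then obtain n where n: "n \<in> N" "arc_map n (arc_map (inv\<^bsub>K\<^esub> h) e) = arc_map (inv\<^bsub>K\<^esub> h) f"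
    using t unfolding locally_transitive_at_def by blast
  have nH: "n \<in> H" using n normal_subset_H[OF N] by blast
  let ?n = "h \<otimes>\<^bsub>K\<^esub> n \<otimes>\<^bsub>K\<^esub> inv\<^bsub>K\<^esub> h"
  have "?n \<in> N" by (rule conj_H[OF N h n(1)])
  moreover have c: "arc_map ?n e = f" using ef n nH h ih by simp
  moreover have "?n \<in> H" using h nH by simp
  ultimately show "\<exists>n\<in>N \<inter> stab (vert_map h x). arc_map n e = f"
    using stab_if_fixes_arc[of ?n e "vert_map h x" f] ef by blast
qed

text \<open>
  Choose a vertex \<open>y\<close> all of whose neighbors lie in the \<open>H\<close>-orbit of \<open>x\<close>. Then \<open>N\<close> is transitive on the
  star of each neighbor of \<open>y\<close>, and a walk from \<open>y\<close> shows that the translates of the star of \<open>y\<close> by \<open>N\<close>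
  cover the graph.
\<close>

lemma cofinite_if_locally_transitive:
  assumes N: "N \<lhd> K" and x: "x \<in> verts \<Gamma>" and t: "locally_transitive_at N x"
  shows "cofinite N"
proof -
  let ?O = "\<lambda>v. \<exists>h\<in>H. v = vert_map h x"
  have NH: "N \<subseteq> H" by (rule normal_subset_H[OF N])
  have Nsub: "subgroup N K" by (rule normal_imp_subgroup[OF N])
  \<comment> \<open>If all vertices lie in the orbit of \<open>x\<close>, then \<open>y = x\<close> will do; otherwise any vertex outside the orbit.\<close>
  obtain y where y: "y \<in> verts \<Gamma>" "\<And>b. b \<in> out_arcs \<Gamma> y \<Longrightarrow> ?O (head \<Gamma> b)"
  proof (cases "\<forall>v\<in>verts \<Gamma>. ?O v")
    case True
    then show ?thesis using x by (intro that[of x]) auto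
  next
    case False
    then obtain y where y: "y \<in> verts \<Gamma>" "\<not> ?O y" by blast
    show ?thesis
    proof (rule that[OF y(1)])
      fix b assume "b \<in> out_arcs \<Gamma> y"
      then have b: "b \<in> arcs \<Gamma>" "tail \<Gamma> b = y" by simp_all
      from arc_meets_orbit[OF x b(1)] show "?O (head \<Gamma> b)" unfolding b(2) using y(2) by blast
    qed
  qed
  let ?F = "insert y (head \<Gamma> ` out_arcs \<Gamma> y)"
  have "\<exists>n\<in>N. \<exists>f\<in>?F. v = vert_map n f" if v: "v \<in> verts \<Gamma>" for v
    using y(1) v
  proof (induction rule: vertex_induct)
    case base
    show ?case using y(1) subgroup.one_closed[OF Nsub] by (intro bexI[of _ "\<one>\<^bsub>K\<^esub>"] bexI[of _ y]) auto
  next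
    case (step e)
    then obtain n f where n: "n \<in> N" "f \<in> ?F" "tail \<Gamma> e = vert_map n f" by blast
    have nH: "n \<in> H" using n NH by blast
    have fV: "f \<in> verts \<Gamma>" using n(2) y(1) by auto
    let ?e = "arc_map (inv\<^bsub>K\<^esub> n) e"
    have e': "?e \<in> arcs \<Gamma>" "tail \<Gamma> ?e = f" "e = arc_map n ?e"
      using act(4,5)[of "inv\<^bsub>K\<^esub> n" e] step(1) nH n(3) fV by simp_all
    have he: "head \<Gamma> e = vert_map n (head \<Gamma> ?e)" using e' nH act(6)[OF nH e'(1)] by simp
    show ?case
    proof (cases "f = y")
      case True
      then have "head \<Gamma> ?e \<in> ?F" using e' by auto
      then show ?thesis using n(1) he by blast
    next
      case False
      then obtain c where c: "c \<in> out_arcs \<Gamma> y" "f = head \<Gamma> c" using n(2) by blast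
      obtain h where "h \<in> H" "f = vert_map h x" using y(2)[OF c(1)] c(2) by blast
      then have "locally_transitive_at N f" using locally_transitive_translate[OF N x _ t] by blast
      moreover have "bar c \<in> out_arcs \<Gamma> f" "?e \<in> out_arcs \<Gamma> f" using c e' by auto
      ultimately obtain m where m: "m \<in> N" "arc_map m (bar c) = ?e" unfolding locally_transitive_at_def by blast
      have mH: "m \<in> H" using m NH by blast
      have "head \<Gamma> ?e = vert_map m y" using act(6)[OF mH, of "bar c"] c m by simp
      then have "head \<Gamma> e = vert_map (n \<otimes>\<^bsub>K\<^esub> m) y" using he nH mH y(1) by simp
      then show ?thesis using subgroup.m_closed[OF Nsub n(1) m(1)] by blast
    qed
  qed
  moreover have "finite ?F" "?F \<subseteq> verts \<Gamma>"
    using locally_finite y(1) by (auto simp: locally_finite_graph_def)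
  ultimately show ?thesis unfolding cofinite_def by blast
qed

lemma cofinite_if_meets:
  assumes N: "N \<lhd> K" and m: "N \<inter> nonfree \<noteq> {}"
  shows "cofinite N"
proof -
  obtain n x where nx: "n \<in> N" "x \<in> verts \<Gamma>" "n \<in> nonfree_at x" using m by (auto simp: nonfree_def)
  then have "locally_transitive_at N x"
    using local_dichotomy[OF N nx(2)] unfolding locally_transitive_at_def nonfree_at_def by blast
  then show ?thesis using cofinite_if_locally_transitive[OF N nx(2)] by blast
qed

lemma H_normal: "H \<lhd> K"
  using K.normal_inv_iff K.subgroup_self by simp

lemma cofinite_H: "cofinite H"
  using cofinite_if_meets[OF H_normal] discrete_if_free[of H] not_discrete_K K.subgroup_self by auto

text \<open>
  \<open>H\<close> is the union of finitely many sets \<open>N t\<^sub>f H\<^sub>x\<close>, where \<open>f\<close> runs through finitely many vertices that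
  represent the \<open>N\<close>-orbits inside the orbit of \<open>x\<close>, and \<open>t\<^sub>f\<close> maps \<open>x\<close> to \<open>f\<close>; and \<open>H\<^sub>x\<close> is compact.
\<close>

lemma cocompact_if_cofinite:
  assumes N: "N \<lhd> K" and c: "cofinite N"
  shows "cocompact_in K N"
proof -
  have NH: "N \<subseteq> H" by (rule normal_subset_H[OF N])
  have Nsub: "subgroup N K" by (rule normal_imp_subgroup[OF N])
  obtain x where x: "x \<in> verts \<Gamma>" using verts_nonempty by blast
  obtain F where F: "finite F" "F \<subseteq> verts \<Gamma>" "\<And>v. v \<in> verts \<Gamma> \<Longrightarrow> \<exists>n\<in>N. \<exists>f\<in>F. v = vert_map n f"
    using c unfolding cofinite_def by blast
  let ?p = "\<lambda>g. N #>\<^bsub>K\<^esub> g"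
  let ?F = "{f \<in> F. \<exists>h\<in>H. f = vert_map h x}"
  have "\<forall>f\<in>?F. \<exists>h. h \<in> H \<and> f = vert_map h x" by blast
  from bchoice[OF this] obtain t where "\<forall>f\<in>?F. t f \<in> H \<and> f = vert_map (t f) x" by (elim exE)
  then have t: "t f \<in> H \<and> f = vert_map (t f) x" if "f \<in> ?F" for f using that by (rule bspec)
  have NC: "N \<subseteq> carrier K" using NH by simp
  have comp: "compactin (coset_topology K N) (?p ` (\<lambda>s. t f \<otimes>\<^bsub>K\<^esub> s) ` stab x)" if f: "f \<in> ?F" for f
  proof -
    have "continuous_map (topo K) (topo K) (\<lambda>s. t f \<otimes>\<^bsub>K\<^esub> s)"
      using t[OF f] by (intro K.continuous_group) auto
    from image_compactin[OF image_compactin[OF stab_compact[OF x] this] K.continuous_coset_projection[OF NC]]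
    show ?thesis .
  qed
  have "rcosets\<^bsub>K\<^esub> N \<subseteq> (\<Union>f\<in>?F. ?p ` (\<lambda>s. t f \<otimes>\<^bsub>K\<^esub> s) ` stab x)"
  proof
    fix c assume "c \<in> rcosets\<^bsub>K\<^esub> N"
    then obtain h where h: "h \<in> H" "c = ?p h" by (auto simp: RCOSETS_def)
    have "vert_map h x \<in> verts \<Gamma>" using h x by simp
    then obtain n f where n: "n \<in> N" "f \<in> F" "vert_map h x = vert_map n f" using F(3) by blast
    have nH: "n \<in> H" using n NH by blast
    have fV: "f \<in> verts \<Gamma>" using n F by blast
    have "f = vert_map (inv\<^bsub>K\<^esub> n \<otimes>\<^bsub>K\<^esub> h) x"
      using act_inv_eq(1)[OF nH fV n(3)[symmetric]] nH h x by simp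
    then have f: "f \<in> ?F" using n nH h by (auto intro!: bexI[of _ "inv\<^bsub>K\<^esub> n \<otimes>\<^bsub>K\<^esub> h"])
    have tH: "t f \<in> H" "f = vert_map (t f) x" using t[OF f] by auto
    let ?s = "inv\<^bsub>K\<^esub> (t f) \<otimes>\<^bsub>K\<^esub> (inv\<^bsub>K\<^esub> n \<otimes>\<^bsub>K\<^esub> h)"
    have "vert_map (inv\<^bsub>K\<^esub> (t f)) f = x" by (rule act_inv_eq(1)[OF tH(1) x tH(2)[symmetric]])
    then have "vert_map ?s x = x"
      using tH(1) nH h(1) x \<open>f = vert_map (inv\<^bsub>K\<^esub> n \<otimes>\<^bsub>K\<^esub> h) x\<close> by simp
    then have s: "?s \<in> stab x" using tH(1) nH h(1) by (simp add: stab_def)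
    have e: "t f \<otimes>\<^bsub>K\<^esub> ?s = inv\<^bsub>K\<^esub> n \<otimes>\<^bsub>K\<^esub> h"
      using K.mult_inv_cancel(1)[of "t f" "inv\<^bsub>K\<^esub> n \<otimes>\<^bsub>K\<^esub> h"] tH(1) nH h(1) by simp
    have "inv\<^bsub>K\<^esub> n \<otimes>\<^bsub>K\<^esub> h \<in> ?p h" unfolding r_coset_def using subgroup.m_inv_closed[OF Nsub n(1)] by blast
    then have "?p h = ?p (inv\<^bsub>K\<^esub> n \<otimes>\<^bsub>K\<^esub> h)" using h by (intro K.repr_independence[OF _ _ Nsub]) simp_all
    then have "c = ?p (t f \<otimes>\<^bsub>K\<^esub> ?s)" unfolding h(2) e by simp
    then show "c \<in> (\<Union>f\<in>?F. ?p ` (\<lambda>s. t f \<otimes>\<^bsub>K\<^esub> s) ` stab x)" using f s by blast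
  qed
  moreover have "(\<Union>f\<in>?F. ?p ` (\<lambda>s. t f \<otimes>\<^bsub>K\<^esub> s) ` stab x) \<subseteq> rcosets\<^bsub>K\<^esub> N"
  proof (rule UN_least)
    fix f assume "f \<in> ?F"
    from t[OF this] show "?p ` (\<lambda>s. t f \<otimes>\<^bsub>K\<^esub> s) ` stab x \<subseteq> rcosets\<^bsub>K\<^esub> N"
      by (auto simp: stab_def intro!: K.rcosetsI[OF NC])
  qed
  ultimately have eq: "rcosets\<^bsub>K\<^esub> N = (\<Union>f\<in>?F. ?p ` (\<lambda>s. t f \<otimes>\<^bsub>K\<^esub> s) ` stab x)" by (rule subset_antisym)
  have "compactin (coset_topology K N) (\<Union>f\<in>?F. ?p ` (\<lambda>s. t f \<otimes>\<^bsub>K\<^esub> s) ` stab x)"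
    using comp F(1) by (intro compactin_Union finite_imageI) (auto simp only: image_iff, simp)
  then show ?thesis
    unfolding cocompact_in_def compact_space_def K.topspace_coset_topology[OF NC] eq by simp
qed

text \<open>
  The open sets \<open>{g \<in> H. g x = h x}\<close> have open images in the quotient. Finitely many of them cover it, so
  the \<open>H\<close>-orbit of \<open>x\<close> splits into finitely many \<open>N\<close>-orbits.
\<close>

lemma cofinite_if_cocompact:
  assumes N: "N \<lhd> K" and c: "cocompact_in K N"
  shows "cofinite N"
proof -
  have NH: "N \<subseteq> H" by (rule normal_subset_H[OF N])
  have Nsub: "subgroup N K" by (rule normal_imp_subgroup[OF N])
  have NC: "N \<subseteq> carrier K" using NH by simp
  let ?p = "\<lambda>g. N #>\<^bsub>K\<^esub> g"
  have orbit: "\<exists>A. finite A \<and> A \<subseteq> H \<and> (\<forall>h\<in>H. \<exists>n\<in>N. \<exists>a\<in>A. vert_map h x = vert_map n (vert_map a x))"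
    if x: "x \<in> verts \<Gamma>" for x
  proof -
    let ?U = "\<lambda>h. {g \<in> H. vert_map g x = vert_map h x}"
    have o: "openin (topo K) (?U h)" for h
      unfolding openin_K using x by (auto intro!: exI[of _ "{Inl x}"])
    let ?\<U> = "(\<lambda>h. ?p ` ?U h) ` H"
    have "\<forall>u\<in>?\<U>. openin (coset_topology K N) u" using K.open_coset_projection[OF Nsub o] by blast
    moreover have "topspace (coset_topology K N) \<subseteq> \<Union>?\<U>"
      unfolding K.topspace_coset_topology[OF NC] by (auto simp: RCOSETS_def)
    ultimately obtain \<F> where Fi: "finite \<F>" "\<F> \<subseteq> ?\<U>" "topspace (coset_topology K N) \<subseteq> \<Union>\<F>"
      using c unfolding cocompact_in_def compact_space_alt by meson
    obtain A where A: "A \<subseteq> H" "finite A" "\<F> = (\<lambda>h. ?p ` ?U h) ` A"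
      using finite_subset_image[OF Fi(1,2)] by blast
    have "\<exists>n\<in>N. \<exists>a\<in>A. vert_map h x = vert_map n (vert_map a x)" if h: "h \<in> H" for h
    proof -
      have "?p h \<in> topspace (coset_topology K N)"
        unfolding K.topspace_coset_topology[OF NC] using h by (intro K.rcosetsI[OF NC]) simp
      then obtain a g where a: "a \<in> A" "g \<in> ?U a" "?p h = ?p g" using Fi(3) A(3) by blast
      have "h \<in> ?p g" using K.rcos_self[OF _ Nsub, of h] h a(3) by simp
      then obtain n where n: "n \<in> N" "h = n \<otimes>\<^bsub>K\<^esub> g" by (auto simp: r_coset_def)
      have "vert_map h x = vert_map n (vert_map a x)"
        unfolding n(2) using act_mult(1)[of n g x] n(1) NH a(2) x by auto
      then show ?thesis using n(1) a(1) by blast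
    qed
    then show ?thesis using A by blast
  qed
  obtain F where F: "finite F" "F \<subseteq> verts \<Gamma>" "\<And>v. v \<in> verts \<Gamma> \<Longrightarrow> \<exists>h\<in>H. \<exists>f\<in>F. v = vert_map h f"
    using cofinite_H unfolding cofinite_def by blast
  have "\<forall>f\<in>F. \<exists>A. finite A \<and> A \<subseteq> H \<and> (\<forall>h\<in>H. \<exists>n\<in>N. \<exists>a\<in>A. vert_map h f = vert_map n (vert_map a f))"
    using orbit F(2) by (intro ballI orbit) (rule subsetD)
  from bchoice[OF this] obtain A where "\<forall>f\<in>F. finite (A f) \<and> A f \<subseteq> H \<and> (\<forall>h\<in>H. \<exists>n\<in>N. \<exists>a\<in>A f. vert_map h f = vert_map n (vert_map a f))"
    by (elim exE)
  then have A: "finite (A f) \<and> A f \<subseteq> H \<and> (\<forall>h\<in>H. \<exists>n\<in>N. \<exists>a\<in>A f. vert_map h f = vert_map n (vert_map a f))"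
    if "f \<in> F" for f using that by (rule bspec)
  let ?F = "\<Union>f\<in>F. (\<lambda>a. vert_map a f) ` A f"
  have "finite ?F" using F(1) A by blast
  moreover have "?F \<subseteq> verts \<Gamma>"
  proof
    fix v assume "v \<in> ?F"
    then obtain f a where f: "f \<in> F" "a \<in> A f" "v = vert_map a f" by blast
    then have "a \<in> H" using A by blast
    then show "v \<in> verts \<Gamma>" using f F(2) by auto
  qed
  moreover have "\<exists>n\<in>N. \<exists>f\<in>?F. v = vert_map n f" if v: "v \<in> verts \<Gamma>" for v
  proof -
    obtain h f where hf: "h \<in> H" "f \<in> F" "v = vert_map h f" using F(3)[OF v] by blast
    have "\<exists>n\<in>N. \<exists>a\<in>A f. vert_map h f = vert_map n (vert_map a f)" using A[OF hf(2)] hf(1) by simp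
    then obtain n a where n: "n \<in> N" "a \<in> A f" "vert_map h f = vert_map n (vert_map a f)" by (elim bexE)
    have "vert_map a f \<in> (\<lambda>a. vert_map a f) ` A f" using n(2) by (rule imageI)
    with hf(2) have "vert_map a f \<in> ?F" by (rule UN_I)
    then show ?thesis unfolding hf(3) n(3) using n(1) by (intro bexI[of _ n] bexI[of _ "vert_map a f"] refl)
  qed
  ultimately show ?thesis unfolding cofinite_def by (intro exI[of _ ?F] conjI ballI)
qed

text \<open>
  Whether \<open>h\<close> belongs to the set depends only on its values on the finite star of \<open>x\<close>, so the set is a
  closed subset of the compact stabilizer of \<open>x\<close>.
\<close>

lemma nonfree_at_compact:
  assumes x: "x \<in> verts \<Gamma>"
  shows "compactin (topo K) (nonfree_at x)"
proof -
  have sub: "nonfree_at x \<subseteq> stab x"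
  proof
    fix h assume "h \<in> nonfree_at x"
    then obtain e where "h \<in> H" "e \<in> out_arcs \<Gamma> x" "arc_map h e = e" by (auto simp: nonfree_at_def)
    then show "h \<in> stab x" using stab_if_fixes_arc[of h e x e] by blast
  qed
  have "openin (topo K) (H - nonfree_at x)"
    unfolding openin_K
  proof (intro conjI ballI)
    fix g assume g: "g \<in> H - nonfree_at x"
    let ?F = "Inr ` out_arcs \<Gamma> x"
    have "finite ?F" "?F \<subseteq> points" using locally_finite x by (auto simp: locally_finite_graph_def)
    moreover have "{h \<in> H. \<forall>p\<in>?F. h p = g p} \<subseteq> H - nonfree_at x"
    proof
      fix h assume h: "h \<in> {h \<in> H. \<forall>p\<in>?F. h p = g p}"
      have "arc_map h e = arc_map g e" if "e \<in> out_arcs \<Gamma> x" for e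
      proof -
        have "h (Inr e) = g (Inr e)" using h that by blast
        then show ?thesis using h g that by simp
      qed
      then show "h \<in> H - nonfree_at x" using g h by (simp add: nonfree_at_def del: out_arcs_iff)
    qed
    ultimately show "\<exists>F. finite F \<and> F \<subseteq> points \<and> {h \<in> H. \<forall>p\<in>F. h p = g p} \<subseteq> H - nonfree_at x" by blast
  qed auto
  then have "closedin (topo K) (nonfree_at x)"
    by (simp add: closedin_def topspace_K nonfree_at_def)
  from closed_Int_compactin[OF this stab_compact[OF x]] sub show ?thesis by (simp add: Int_absorb2)
qed

lemma nonfree_translate:
  assumes x: "x \<in> verts \<Gamma>" and h: "h \<in> H" and g: "g \<in> nonfree_at (vert_map h x)"
  shows "inv\<^bsub>K\<^esub> h \<otimes>\<^bsub>K\<^esub> g \<otimes>\<^bsub>K\<^esub> inv\<^bsub>K\<^esub> (inv\<^bsub>K\<^esub> h) \<in> nonfree_at x"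
proof -
  obtain e f where ef: "e \<in> out_arcs \<Gamma> (vert_map h x)" "f \<in> out_arcs \<Gamma> (vert_map h x)" "arc_map g e = e" "arc_map g f \<noteq> f"
    and gH: "g \<in> H" using g by (auto simp: nonfree_at_def)
  have ih: "inv\<^bsub>K\<^esub> h \<in> H" using h by simp
  let ?e = "arc_map (inv\<^bsub>K\<^esub> h) e" and ?f = "arc_map (inv\<^bsub>K\<^esub> h) f"
  let ?g = "inv\<^bsub>K\<^esub> h \<otimes>\<^bsub>K\<^esub> g \<otimes>\<^bsub>K\<^esub> inv\<^bsub>K\<^esub> (inv\<^bsub>K\<^esub> h)"
  have o: "?e \<in> out_arcs \<Gamma> x" "?f \<in> out_arcs \<Gamma> x"
    using ef act(4,5)[OF ih] h x by simp_all
  have "arc_map ?g ?e = ?e" using ef gH ih h by simp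
  moreover have "arc_map ?g ?f \<noteq> ?f"
  proof
    assume "arc_map ?g ?f = ?f"
    then have "arc_map (inv\<^bsub>K\<^esub> h) (arc_map g f) = arc_map (inv\<^bsub>K\<^esub> h) f" using ef gH ih h by simp
    then have "arc_map g f = f" using arc_map_inj[OF ih] ef gH by simp
    then show False using ef by simp
  qed
  moreover have "?g \<in> H" using ih gH by simp
  ultimately show ?thesis using o unfolding nonfree_at_def by blast
qed

lemma compact_transversal_if_cofinite:
  assumes N: "N \<lhd> K" and c: "cofinite N"
  shows "\<exists>C. compactin (topo K) C \<and> C \<subseteq> nonfree \<and> (\<forall>g\<in>nonfree. \<exists>n\<in>N. n \<otimes>\<^bsub>K\<^esub> g \<otimes>\<^bsub>K\<^esub> inv\<^bsub>K\<^esub> n \<in> C)"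
proof -
  have NH: "N \<subseteq> H" by (rule normal_subset_H[OF N])
  obtain F where F: "finite F" "F \<subseteq> verts \<Gamma>" "\<And>v. v \<in> verts \<Gamma> \<Longrightarrow> \<exists>n\<in>N. \<exists>f\<in>F. v = vert_map n f"
    using c unfolding cofinite_def by blast
  let ?C = "\<Union>(nonfree_at ` F)"
  have "compactin (topo K) ?C" using F(1,2) nonfree_at_compact by (intro compactin_Union) auto
  moreover have "?C \<subseteq> nonfree" using F(2) by (auto simp: nonfree_def)
  moreover have "\<exists>n\<in>N. n \<otimes>\<^bsub>K\<^esub> g \<otimes>\<^bsub>K\<^esub> inv\<^bsub>K\<^esub> n \<in> ?C" if g: "g \<in> nonfree" for g
  proof -
    obtain v where v: "v \<in> verts \<Gamma>" "g \<in> nonfree_at v" using g unfolding nonfree_def by blast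
    obtain n f where n: "n \<in> N" "f \<in> F" "v = vert_map n f" using F(3)[OF v(1)] by blast
    have "n \<in> H" "f \<in> verts \<Gamma>" using n NH F(2) by blast+
    from nonfree_translate[OF this(2,1)] v(2) n(3)
    have "inv\<^bsub>K\<^esub> n \<otimes>\<^bsub>K\<^esub> g \<otimes>\<^bsub>K\<^esub> inv\<^bsub>K\<^esub> (inv\<^bsub>K\<^esub> n) \<in> nonfree_at f" by simp
    moreover have "inv\<^bsub>K\<^esub> n \<in> N" using subgroup.m_inv_closed[OF normal_imp_subgroup[OF N] n(1)] .
    ultimately show ?thesis using n(2) by blast
  qed
  ultimately show ?thesis by blast
qed

text \<open>
  Let \<open>F\<close> be a set of representatives for the \<open>N\<close>-orbits of vertices. For each neighbor \<open>v\<close> of a vertex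
  in \<open>F\<close>, pick \<open>s v \<in> N\<close> that maps a vertex in \<open>F\<close> to \<open>v\<close>. By induction along walks, products of the \<open>s v\<close>
  carry the stars of the vertices in \<open>F\<close> over the entire graph. Hence an element \<open>u\<close> that fixes these stars
  and commutes with all \<open>s v\<close> fixes everything.
\<close>

lemma finite_centralizer_if_cofinite:
  assumes N: "N \<lhd> K" and c: "cofinite N"
  shows "\<exists>S U. finite S \<and> S \<subseteq> N \<and> openin (topo K) U \<and> \<one>\<^bsub>K\<^esub> \<in> U \<and>
    (\<forall>u\<in>U. (\<forall>s\<in>S. u \<otimes>\<^bsub>K\<^esub> s = s \<otimes>\<^bsub>K\<^esub> u) \<longrightarrow> u = \<one>\<^bsub>K\<^esub>)"
proof -
  have NH: "N \<subseteq> H" by (rule normal_subset_H[OF N])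
  obtain F where F: "finite F" "F \<subseteq> verts \<Gamma>" "\<And>v. v \<in> verts \<Gamma> \<Longrightarrow> \<exists>n\<in>N. \<exists>f\<in>F. v = vert_map n f"
    using c unfolding cofinite_def by blast
  let ?A = "\<Union>f\<in>F. out_arcs \<Gamma> f"
  let ?B = "head \<Gamma> ` ?A"
  have Afin: "finite ?A" and BV: "?B \<subseteq> verts \<Gamma>"
    using F locally_finite by (auto simp: locally_finite_graph_def)
  have "\<exists>n\<in>N. \<exists>f\<in>F. v = vert_map n f" if "v \<in> ?B" for v by (rule F(3)) (use that BV in blast)
  then have "\<forall>v\<in>?B. \<exists>n. n \<in> N \<and> (\<exists>f\<in>F. v = vert_map n f)" by (intro ballI) blast
  from bchoice[OF this] obtain s where "\<forall>v\<in>?B. s v \<in> N \<and> (\<exists>f\<in>F. v = vert_map (s v) f)" by (elim exE)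
  then have s: "s v \<in> N \<and> (\<exists>f\<in>F. v = vert_map (s v) f)" if "v \<in> ?B" for v using that by (rule bspec)
  let ?P = "Inl ` F \<union> Inr ` ?A"
  have P: "finite ?P" "?P \<subseteq> points" using F Afin by auto
  have main: "u = \<one>\<^bsub>K\<^esub>" if u: "u \<in> fixator ?P" and comm: "\<forall>t\<in>s ` ?B. u \<otimes>\<^bsub>K\<^esub> t = t \<otimes>\<^bsub>K\<^esub> u" for u
  proof -
    have uH: "u \<in> H" using u by (simp add: fixator_def)
    have uF: "vert_map u f = f" if "f \<in> F" for f
      by (rule fixator_fixes(1)[OF u]) (use that F(2) in auto)
    have uA: "arc_map u e = e" if "f \<in> F" "e \<in> out_arcs \<Gamma> f" for e f
      by (rule fixator_fixes(2)[OF u]) (use that in auto)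
    obtain y where y: "y \<in> F" using F(3) verts_nonempty by blast
    have yV: "y \<in> verts \<Gamma>" using y F by blast
    \<comment> \<open>Each vertex is the image of one in \<open>F\<close> under an element that commutes with \<open>u\<close>.\<close>
    have J: "\<exists>g\<in>H. u \<otimes>\<^bsub>K\<^esub> g = g \<otimes>\<^bsub>K\<^esub> u \<and> (\<exists>f\<in>F. v = vert_map g f)" if v: "v \<in> verts \<Gamma>" for v
      using yV v
    proof (induction rule: vertex_induct)
      case base
      show ?case using y yV uH by (intro bexI[of _ "\<one>\<^bsub>K\<^esub>"] conjI bexI[of _ y]) auto
    next
      case (step e)
      then obtain g f where g: "g \<in> H" "u \<otimes>\<^bsub>K\<^esub> g = g \<otimes>\<^bsub>K\<^esub> u" "f \<in> F" "tail \<Gamma> e = vert_map g f" by blast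
      have fV: "f \<in> verts \<Gamma>" using g F by blast
      have ig: "inv\<^bsub>K\<^esub> g \<in> H" using g by simp
      let ?e = "arc_map (inv\<^bsub>K\<^esub> g) e"
      have e': "?e \<in> out_arcs \<Gamma> f" "e = arc_map g ?e"
        using act(4,5)[OF ig step(1)] step(1) g fV by simp_all
      have "head \<Gamma> ?e \<in> ?B" using e' g(3) by blast
      from s[OF this] obtain f' where f': "s (head \<Gamma> ?e) \<in> N" "f' \<in> F" "head \<Gamma> ?e = vert_map (s (head \<Gamma> ?e)) f'" by blast
      let ?s = "s (head \<Gamma> ?e)"
      have sH: "?s \<in> H" using f' NH by blast
      have us: "u \<otimes>\<^bsub>K\<^esub> ?s = ?s \<otimes>\<^bsub>K\<^esub> u" using comm \<open>head \<Gamma> ?e \<in> ?B\<close> by blast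
      have f'V: "f' \<in> verts \<Gamma>" using f' F by blast
      have "head \<Gamma> e = vert_map g (head \<Gamma> ?e)" using e' act(6)[OF g(1), of ?e] by simp
      also have "\<dots> = vert_map g (vert_map ?s f')" using f'(3) by simp
      also have "\<dots> = vert_map (g \<otimes>\<^bsub>K\<^esub> ?s) f'" using act_mult(1)[OF g(1) sH f'V] by simp
      finally have "head \<Gamma> e = vert_map (g \<otimes>\<^bsub>K\<^esub> ?s) f'" .
      moreover have "u \<otimes>\<^bsub>K\<^esub> (g \<otimes>\<^bsub>K\<^esub> ?s) = (g \<otimes>\<^bsub>K\<^esub> ?s) \<otimes>\<^bsub>K\<^esub> u"
        using K.commute_mult[of g ?s u] g(1,2) sH us uH by simp
      ultimately show ?case using g(1) sH f'(2) mult_H[OF g(1) sH] by blast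
    qed
    show ?thesis
    proof (rule eq_one_if_fixes[OF uH])
      fix v assume v: "v \<in> verts \<Gamma>"
      obtain g f where g: "g \<in> H" "u \<otimes>\<^bsub>K\<^esub> g = g \<otimes>\<^bsub>K\<^esub> u" "f \<in> F" "v = vert_map g f" using J[OF v] by blast
      have fV: "f \<in> verts \<Gamma>" using g F by blast
      have "vert_map u v = vert_map (g \<otimes>\<^bsub>K\<^esub> u) f" using g(4) act_mult(1)[OF uH g(1) fV] g(2) by simp
      then show "vert_map u v = v" using act_mult(1)[OF g(1) uH fV] uF[OF g(3)] g(4) by simp
    next
      fix e assume e: "e \<in> arcs \<Gamma>"
      obtain g f where g: "g \<in> H" "u \<otimes>\<^bsub>K\<^esub> g = g \<otimes>\<^bsub>K\<^esub> u" "f \<in> F" "tail \<Gamma> e = vert_map g f"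
        using J[OF tail_in_verts[OF e]] by blast
      have fV: "f \<in> verts \<Gamma>" using g F by blast
      have ig: "inv\<^bsub>K\<^esub> g \<in> H" using g by simp
      let ?e = "arc_map (inv\<^bsub>K\<^esub> g) e"
      have e': "?e \<in> out_arcs \<Gamma> f" "arc_map g ?e = e"
        using act(4,5)[OF ig e] e g fV by simp_all
      have eA: "?e \<in> arcs \<Gamma>" using e' by simp
      have "arc_map u (arc_map g ?e) = arc_map (g \<otimes>\<^bsub>K\<^esub> u) ?e" using act_mult(2)[OF uH g(1) eA] g(2) by simp
      then show "arc_map u e = e" using act_mult(2)[OF g(1) uH eA] uA[OF g(3) e'(1)] e'(2) by simp
    qed
  qed
  have "finite (s ` ?B)" using Afin by simp
  moreover have "s ` ?B \<subseteq> N" using s by (intro image_subsetI) simp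
  moreover have "openin (topo K) (fixator ?P)" by (rule fixator_open[OF P(2,1)])
  moreover have "\<one>\<^bsub>K\<^esub> \<in> fixator ?P" by (rule subgroup.one_closed[OF fixator_subgroup[OF P(2)]])
  moreover have "\<forall>u\<in>fixator ?P. (\<forall>t\<in>s ` ?B. u \<otimes>\<^bsub>K\<^esub> t = t \<otimes>\<^bsub>K\<^esub> u) \<longrightarrow> u = \<one>\<^bsub>K\<^esub>"
    by (rule ballI, rule impI) (rule main)
  ultimately show ?thesis
    by (rule_tac exI[of _ "s ` ?B"], rule_tac exI[of _ "fixator ?P"]) (intro conjI)
qed

sublocale dich: locally_compact_dichotomy K nonfree
proof unfold_locales
  show "\<exists>V. subgroup V K \<and> openin (topo K) V \<and> V \<subseteq> U" if U: "openin (topo K) U" "\<one>\<^bsub>K\<^esub> \<in> U" for U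
  proof -
    obtain F where F: "finite F" "F \<subseteq> points" "fixator F \<subseteq> U" using small_fixator[OF U] by blast
    then show ?thesis using fixator_subgroup[OF F(2)] fixator_open[OF F(2,1)] by blast
  qed
  show "closedin (topo K) {\<one>\<^bsub>K\<^esub>}" by (rule one_closed_K)
  show "\<not> discrete_in K (carrier K)" by (rule not_discrete_K)
  show "discrete_in K M" if "subgroup M K" "M \<inter> nonfree = {}" for M using discrete_if_free[OF that] .
  show "cocompact_in K N" if "N \<lhd> K" "N \<inter> nonfree \<noteq> {}" for N
    using cocompact_if_cofinite[OF that(1) cofinite_if_meets[OF that]] .
  show "\<exists>C. compactin (topo K) C \<and> C \<subseteq> nonfree \<and> (\<forall>c\<in>nonfree. \<exists>n\<in>N. n \<otimes>\<^bsub>K\<^esub> c \<otimes>\<^bsub>K\<^esub> inv\<^bsub>K\<^esub> n \<in> C)"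
    if "N \<lhd> K" "cocompact_in K N" for N
    using compact_transversal_if_cofinite[OF that(1) cofinite_if_cocompact[OF that]] .
  show "\<exists>S U. finite S \<and> S \<subseteq> N \<and> openin (topo K) U \<and> \<one>\<^bsub>K\<^esub> \<in> U \<and>
    (\<forall>u\<in>U. (\<forall>s\<in>S. u \<otimes>\<^bsub>K\<^esub> s = s \<otimes>\<^bsub>K\<^esub> u) \<longrightarrow> u = \<one>\<^bsub>K\<^esub>)"
    if "N \<lhd> K" "cocompact_in K N" for N
    using finite_centralizer_if_cofinite[OF that(1) cofinite_if_cocompact[OF that]] .
qed

end

section \<open>Reduced paths and ping-pong on a tree\<close>

text \<open>
  Non-empty products of elements of \<open>F c - C\<close> in which the index \<open>c\<close> changes from each factor to the
  next; the index recorded is that of the first factor. These are the normal forms of an amalgamated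
  product of the groups \<open>F c\<close> over \<open>C\<close>.
\<close>

inductive (in group) alternating :: "'i set \<Rightarrow> ('i \<Rightarrow> 'a set) \<Rightarrow> 'a set \<Rightarrow> 'i \<Rightarrow> 'a \<Rightarrow> bool"
  for I F C where
    single: "\<lbrakk>c \<in> I; s \<in> F c; s \<notin> C\<rbrakk> \<Longrightarrow> alternating I F C c s"
  | cons: "\<lbrakk>c \<in> I; s \<in> F c; s \<notin> C; alternating I F C d h; d \<noteq> c\<rbrakk> \<Longrightarrow> alternating I F C c (s \<otimes> h)"

lemma (in group) alternating_in_carrier:
  assumes "alternating I F C c h" "\<And>c. c \<in> I \<Longrightarrow> subgroup (F c) G"
  shows "h \<in> carrier G" "c \<in> I"
proof -
  have "h \<in> carrier G \<and> c \<in> I"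
    using assms(1)
  proof induction
    case (single c s)
    then show ?case using subgroup.mem_carrier[OF assms(2)] by blast
  next
    case (cons c s d h)
    then show ?case using subgroup.mem_carrier[OF assms(2)] by blast
  qed
  then show "h \<in> carrier G" "c \<in> I" by simp_all
qed

lemma (in group) subgroup_cancel_left:
  assumes "subgroup C G" "s \<in> C" "s \<otimes> z \<in> C" "z \<in> carrier G"
  shows "z \<in> C"
proof -
  have "s \<in> carrier G" using subgroup.mem_carrier[OF assms(1,2)] .
  then have "z = inv s \<otimes> (s \<otimes> z)" using assms(4) by simp
  also have "\<dots> \<in> C" by (rule subgroup.m_closed[OF assms(1) subgroup.m_inv_closed[OF assms(1,2)] assms(3)])
  finally show ?thesis .
qed

lemma (in group) alternating_mult_left:
  assumes F: "\<And>c. c \<in> I \<Longrightarrow> subgroup (F c) G" and C: "subgroup C G" "\<And>c. c \<in> I \<Longrightarrow> C \<subseteq> F c"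
    and s: "s \<in> C" and z: "alternating I F C d z"
  shows "alternating I F C d (s \<otimes> z)"
  using z
proof cases
  case single
  have zG: "z \<in> carrier G" by (rule subgroup.mem_carrier[OF F[OF single(1)] single(2)])
  have "s \<in> F d" using s C(2)[OF single(1)] by blast
  then have "s \<otimes> z \<in> F d" using single(2) by (rule subgroup.m_closed[OF F[OF single(1)]])
  moreover have "s \<otimes> z \<notin> C" using subgroup_cancel_left[OF C(1) s _ zG] single(3) by blast
  ultimately show ?thesis by (rule alternating.single[where I = I and F = F and C = C and c = d, OF single(1)])
next
  case (cons t e h)
  have tG: "t \<in> carrier G" by (rule subgroup.mem_carrier[OF F[OF cons(2)] cons(3)])
  have sG: "s \<in> carrier G" by (rule subgroup.mem_carrier[OF C(1) s])
  have hG: "h \<in> carrier G" using alternating_in_carrier(1)[OF cons(5) F] .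
  have "s \<in> F d" using s C(2)[OF cons(2)] by blast
  then have "s \<otimes> t \<in> F d" using cons(3) by (rule subgroup.m_closed[OF F[OF cons(2)]])
  moreover have "s \<otimes> t \<notin> C" using subgroup_cancel_left[OF C(1) s _ tG] cons(4) by blast
  ultimately have "alternating I F C d (s \<otimes> t \<otimes> h)"
    using cons(5,6) by (rule alternating.cons[where I = I and F = F and C = C and c = d, OF cons(2)])
  then show ?thesis using cons(1) sG tG hG by (simp add: m_assoc)
qed

text \<open>
  Multiplying a word from the left by an element of \<open>F c\<close> either extends it, or is absorbed in its
  first factor; if this factor drops into \<open>C\<close>, it is absorbed in the next one.
\<close>

lemma (in group) generate_normal_form:
  assumes F: "\<And>c. c \<in> I \<Longrightarrow> subgroup (F c) G" and C: "subgroup C G" "\<And>c. c \<in> I \<Longrightarrow> C \<subseteq> F c"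
    and g: "g \<in> generate G (\<Union>c\<in>I. F c)"
  shows "g \<in> C \<or> (\<exists>c. alternating I F C c g)"
proof -
  let ?A = "alternating I F C"
  let ?Z = "{g \<in> carrier G. g \<in> C \<or> (\<exists>c. ?A c g)}"
  note single = alternating.single[where I = I and F = F and C = C]
    and cons = alternating.cons[where I = I and F = F and C = C]
  have FG: "s \<in> carrier G" if "c \<in> I" "s \<in> F c" for s c using subgroup.mem_carrier[OF F[OF that(1)] that(2)] .
  have inF: "s \<in> C \<or> ?A c s" if "c \<in> I" "s \<in> F c" for c s using single[OF that] by blast
  have mult: "s \<otimes> z \<in> ?Z" if c: "c \<in> I" and s: "s \<in> F c" and z: "z \<in> ?Z" for c s z
  proof -
    have sG: "s \<in> carrier G" by (rule FG[OF c s])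
    have zG: "z \<in> carrier G" using z by simp
    have "s \<otimes> z \<in> C \<or> (\<exists>e. ?A e (s \<otimes> z))"
    proof (cases "z \<in> F c")
      case True
      have "s \<otimes> z \<in> F c" by (rule subgroup.m_closed[OF F[OF c] s True])
      then show ?thesis using inF[OF c] by blast
    next
      case notF: False
      then have "z \<notin> C" using C(2)[OF c] by blast
      then obtain d where alt: "?A d z" using z by blast
      show ?thesis
      proof (cases "s \<in> C")
        case True
        then show ?thesis using alternating_mult_left[OF F C True alt] by blast
      next
        case sC: False
        show ?thesis
        proof (cases "d = c")
          case False
          from cons[OF c s sC alt this] show ?thesis by blast
        next
          case dc: True
          from alt show ?thesis
          proof cases
            case single
            then show ?thesis using notF dc by blast
          next
            case (cons t e h)
            have t: "t \<in> F c" using cons(3) dc by simp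
            have tG: "t \<in> carrier G" by (rule FG[OF c t])
            have hG: "h \<in> carrier G" using alternating_in_carrier(1)[OF cons(5) F] .
            have st: "s \<otimes> t \<in> F c" by (rule subgroup.m_closed[OF F[OF c] s t])
            have eq: "s \<otimes> z = s \<otimes> t \<otimes> h" using cons(1) sG tG hG by (simp add: m_assoc)
            have ec: "e \<noteq> c" using cons(6) dc by simp
            show ?thesis
            proof (cases "s \<otimes> t \<in> C")
              case True
              then show ?thesis unfolding eq using alternating_mult_left[OF F C True cons(5)] by blast
            next
              case False
              from alternating.cons[where I = I and F = F and C = C, OF c st False cons(5) ec]
              show ?thesis unfolding eq by blast
            qed
          qed
        qed
      qed
    qed
    then show ?thesis using sG zG by simp
  qed
  have sub: "(\<Union>c\<in>I. F c) \<subseteq> carrier G" using FG by blast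
  have "\<forall>z\<in>?Z. g \<otimes> z \<in> ?Z"
    using g
  proof induction
    case one
    then show ?case by simp
  next
    case (incl h)
    then show ?case using mult by blast
  next
    case (inv h)
    then obtain c where "c \<in> I" "h \<in> F c" by blast
    then show ?case using mult subgroup.m_inv_closed[OF F] by blast
  next
    case (eng h1 h2)
    have G: "h1 \<in> carrier G" "h2 \<in> carrier G" using eng(1,2) generate_in_carrier[OF sub] by auto
    have "h1 \<otimes> h2 \<otimes> z \<in> ?Z" if z: "z \<in> ?Z" for z
    proof -
      have "h1 \<otimes> (h2 \<otimes> z) \<in> ?Z" using eng.IH z by blast
      moreover have "z \<in> carrier G" using z by simp
      ultimately show ?thesis using G by (simp add: m_assoc)
    qed
    then show ?case by blast
  qed
  moreover have "\<one> \<in> ?Z" using subgroup.one_closed[OF C(1)] by simp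
  ultimately have "g \<otimes> \<one> \<in> ?Z" by blast
  moreover have "g \<in> carrier G" using g generate_in_carrier[OF sub] by blast
  ultimately show ?thesis by simp
qed

locale tree_group = semiprimitive_group \<Gamma> bar H
  for \<Gamma> :: "('v, 'e) pre_digraph" and bar :: "'e \<Rightarrow> 'e" and H :: "('v + 'e \<Rightarrow> 'v + 'e) set" +
  assumes no_circuit: "\<nexists>p. circuit \<Gamma> bar p"
    and primitive: "locally_primitive \<Gamma> H"
begin

text \<open>
  Walks without backtracking. They are described by consecutive arcs only, so that the empty walk and
  concatenation need no base points.
\<close>

definition reduced :: "'e list \<Rightarrow> bool" where
  "reduced p \<longleftrightarrow> set p \<subseteq> arcs \<Gamma> \<and> successively (\<lambda>e f. head \<Gamma> e = tail \<Gamma> f \<and> f \<noteq> bar e) p"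

lemma reduced_cas: "reduced p \<Longrightarrow> p \<noteq> [] \<Longrightarrow> cas (tail \<Gamma> (hd p)) p (head \<Gamma> (last p))"
  by (induction p rule: induct_list012) (auto simp: reduced_def)

lemma tl_awalk_verts: "cas u p v \<Longrightarrow> tl (awalk_verts u p) = map (head \<Gamma>) p"
proof (induction p arbitrary: u)
  case (Cons e p)
  then show ?case by (cases p) auto
qed simp

lemma reduced_Cons:
  "reduced (e # p) \<longleftrightarrow> e \<in> arcs \<Gamma> \<and> reduced p \<and> (p \<noteq> [] \<longrightarrow> head \<Gamma> e = tail \<Gamma> (hd p) \<and> hd p \<noteq> bar e)"
  by (cases p) (auto simp: reduced_def)

lemma reduced_appendD: "reduced (p @ q) \<Longrightarrow> reduced p" "reduced (p @ q) \<Longrightarrow> reduced q"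
  by (simp_all add: reduced_def successively_append_iff)

text \<open>
  If the heads of the arcs are pairwise distinct, a closed reduced walk is a circuit. Otherwise some
  vertex is visited twice, and the part in between is a shorter closed reduced walk.
\<close>

lemma reduced_not_closed:
  assumes "reduced p" "p \<noteq> []"
  shows "head \<Gamma> (last p) \<noteq> tail \<Gamma> (hd p)"
  using assms
proof (induction "length p" arbitrary: p rule: less_induct)
  case less
  show ?case
  proof
    assume closed: "head \<Gamma> (last p) = tail \<Gamma> (hd p)"
    let ?u = "tail \<Gamma> (hd p)"
    have cas: "cas ?u p ?u" using reduced_cas[OF less.prems] closed by simp
    show False
    proof (cases "distinct (map (head \<Gamma>) p)")
      case True
      have "hd p \<in> arcs \<Gamma>" using less.prems by (auto simp: reduced_def)
      then have "awalk ?u p ?u"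
        using cas less.prems by (simp add: awalk_def reduced_def)
      then have "pre_digraph.cycle \<Gamma> p"
        unfolding cycle_def using True tl_awalk_verts[OF cas] less.prems(2) by auto
      moreover have "p ! Suc i \<noteq> bar (p ! i)" if "Suc i < length p" for i
        using less.prems(1) that by (auto simp: reduced_def successively_conv_nth)
      ultimately have "circuit \<Gamma> bar p" by (simp add: circuit_def)
      then show False using no_circuit by blast
    next
      case False
      then obtain xs ys zs y where d: "map (head \<Gamma>) p = xs @ [y] @ ys @ [y] @ zs" using not_distinct_decomp by blast
      have "xs @ (y # ys @ y # zs) = map (head \<Gamma>) p" by (simp only: d append_Cons append_Nil)
      from append_eq_map_conv[THEN iffD1, OF this]
      obtain p1 q1 where 1: "p = p1 @ q1" "y # ys @ y # zs = map (head \<Gamma>) q1" by (elim exE conjE)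
      from Cons_eq_map_conv[THEN iffD1, OF 1(2)]
      obtain e1 q2 where 2: "q1 = e1 # q2" "y = head \<Gamma> e1" "ys @ y # zs = map (head \<Gamma>) q2" by (elim exE conjE)
      from append_eq_map_conv[THEN iffD1, OF 2(3)]
      obtain p2 q3 where 3: "q2 = p2 @ q3" "y # zs = map (head \<Gamma>) q3" by (elim exE conjE)
      from Cons_eq_map_conv[THEN iffD1, OF 3(2)]
      obtain e2 p3 where 4: "q3 = e2 # p3" "y = head \<Gamma> e2" by (elim exE conjE)
      have p: "p = p1 @ e1 # p2 @ e2 # p3" by (simp only: 1(1) 2(1) 3(1) 4(1))
      have he: "head \<Gamma> e1 = head \<Gamma> e2" by (rule trans[OF 2(2)[symmetric] 4(2)])
      let ?q = "p2 @ [e2]"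
      have r: "reduced (e1 # p2 @ e2 # p3)"
        by (rule reduced_appendD(2)[of p1]) (use less.prems(1) in \<open>simp only: p\<close>)
      then have "reduced (?q @ p3)" and t: "head \<Gamma> e1 = tail \<Gamma> (hd (p2 @ e2 # p3))"
        by (simp_all add: reduced_Cons)
      then have q: "reduced ?q" by (intro reduced_appendD(1)[of ?q p3])
      have "hd (p2 @ e2 # p3) = hd ?q" by (cases p2) simp_all
      have "length ?q < length p" by (simp add: p)
      from less.hyps[OF this q] show False using t he \<open>hd (p2 @ e2 # p3) = hd ?q\<close> by simp
    qed
  qed
qed

lemma reduced_map:
  assumes g: "g \<in> H" and p: "reduced p"
  shows "reduced (map (arc_map g) p)"
proof -
  have "successively (\<lambda>e f. head \<Gamma> (arc_map g e) = tail \<Gamma> (arc_map g f) \<and> arc_map g f \<noteq> bar (arc_map g e)) p"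
    using p unfolding reduced_def
  proof (elim conjE)
    assume s: "set p \<subseteq> arcs \<Gamma>" and c: "successively (\<lambda>e f. head \<Gamma> e = tail \<Gamma> f \<and> f \<noteq> bar e) p"
    show ?thesis
      using c
    proof (rule successively_mono)
      fix e f assume ef: "e \<in> set p" "f \<in> set p" "head \<Gamma> e = tail \<Gamma> f \<and> f \<noteq> bar e"
      have A: "e \<in> arcs \<Gamma>" "f \<in> arcs \<Gamma>" using ef s by blast+
      have "arc_map g f \<noteq> arc_map g (bar e)"
        using arc_map_inj[OF g A(2) arev_in_arcs[OF A(1)]] ef(3) by blast
      then show "head \<Gamma> (arc_map g e) = tail \<Gamma> (arc_map g f) \<and> arc_map g f \<noteq> bar (arc_map g e)"
        using ef(3) A g by simp
    qed
  qed
  then show ?thesis using p g by (auto simp: reduced_def successively_map)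
qed

text \<open>
  Each \<open>F c\<close> fixes the head of \<open>c\<close>, and an element of \<open>F c\<close> outside \<open>C\<close> moves \<open>bar c\<close>. Hence an alternating
  word that starts with index \<open>c\<close> maps \<open>c0\<close>, up to inversion, to the last arc of a reduced walk of length
  at least two with first arc \<open>c\<close>: the first factor \<open>s\<close> puts the walk \<open>[c, s (bar c)]\<close> in front of the image of
  the walk of the remaining word. If the word fixed \<open>c0\<close>, this walk would end with \<open>c0\<close> or its inverse
  although \<open>c\<close> starts at an endpoint of \<open>c0\<close>; that gives a closed reduced walk, which a tree does not
  have.
\<close>

lemma pingpong:
  assumes I: "I \<subseteq> arcs \<Gamma>" and c0: "c0 \<in> arcs \<Gamma>"
    and base: "\<And>c. c \<in> I \<Longrightarrow> tail \<Gamma> c0 = tail \<Gamma> c \<or> head \<Gamma> c0 = tail \<Gamma> c"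
    and pairs: "\<And>c d. c \<in> I \<Longrightarrow> d \<in> I \<Longrightarrow> c \<noteq> d \<Longrightarrow> tail \<Gamma> d = tail \<Gamma> c \<or> d = bar c"
    and F: "\<And>c. c \<in> I \<Longrightarrow> subgroup (F c) K" "\<And>c g. c \<in> I \<Longrightarrow> g \<in> F c \<Longrightarrow> vert_map g (head \<Gamma> c) = head \<Gamma> c"
    and C: "subgroup C K" "\<And>c. c \<in> I \<Longrightarrow> C \<subseteq> F c"
    and fixC: "\<And>c g. c \<in> I \<Longrightarrow> g \<in> F c \<Longrightarrow> arc_map g (bar c) = bar c \<Longrightarrow> g \<in> C"
    and g: "g \<in> generate K (\<Union>c\<in>I. F c)" "arc_map g c0 = c0"
  shows "g \<in> C"
proof (rule ccontr)
  assume "g \<notin> C"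
  then obtain c where alt: "K.alternating I F C c g" using K.generate_normal_form[OF F(1) C g(1)] by blast
  \<comment> \<open>\<open>?W c b\<close>: a reduced walk of length at least two leads from \<open>c\<close> to \<open>b\<close> or its inverse.\<close>
  let ?W = "\<lambda>c b. \<exists>p. reduced p \<and> p \<noteq> [] \<and> tl p \<noteq> [] \<and> hd p = c \<and> (last p = b \<or> last p = bar b)"
  have turn: "reduced [c, arc_map s (bar c)]" if "c \<in> I" "s \<in> F c" "s \<notin> C" for c s
  proof -
    have sH: "s \<in> H" using subgroup.mem_carrier[OF F(1)[OF that(1)] that(2)] by simp
    have cA: "c \<in> arcs \<Gamma>" using that I by blast
    have "arc_map s (bar c) \<noteq> bar c" using fixC[OF that(1,2)] that(3) by blast
    then show ?thesis using cA sH F(2)[OF that(1,2)] by (simp add: reduced_def)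
  qed
  have "g \<in> H \<and> c \<in> I \<and> ?W c (arc_map g c0)"
    using alt
  proof induction
    case (single c s)
    have sH: "s \<in> H" using subgroup.mem_carrier[OF F(1)[OF single(1)] single(2)] by simp
    have cA: "c \<in> arcs \<Gamma>" using single I by blast
    have t: "reduced [c, arc_map s (bar c)]" using turn single by blast
    obtain c' where c': "c' = c0 \<or> c' = bar c0" "tail \<Gamma> c' = tail \<Gamma> c"
    proof (cases "tail \<Gamma> c0 = tail \<Gamma> c")
      case False
      then show ?thesis using base[OF single(1)] c0 that[of "bar c0"] by simp
    qed (use that in blast)
    have c'A: "c' \<in> arcs \<Gamma>" using c'(1) c0 by auto
    have img: "arc_map s c' = arc_map s c0 \<or> arc_map s c' = bar (arc_map s c0)" using c'(1) sH c0 by auto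
    show ?case
    proof (cases "c' = c")
      case True
      have "arc_map s (bar c) = arc_map s c0 \<or> arc_map s (bar c) = bar (arc_map s c0)"
        using img True sH cA c0 c' by auto
      then show ?thesis using t sH single(1) by (intro conjI exI[of _ "[c, arc_map s (bar c)]"]) auto
    next
      case False
      have "reduced [c, arc_map s (bar c), arc_map s c']"
        using t sH cA c'A c'(2) False arc_map_inj[OF sH c'A cA] by (auto simp: reduced_def)
      then show ?thesis using img sH single(1)
        by (intro conjI exI[of _ "[c, arc_map s (bar c), arc_map s c']"]) auto
    qed
  next
    case (cons c s d h)
    have sH: "s \<in> H" using subgroup.mem_carrier[OF F(1)[OF cons(1)] cons(2)] by simp
    have cA: "c \<in> arcs \<Gamma>" using cons I by blast
    have t: "reduced [c, arc_map s (bar c)]" using turn cons by blast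
    obtain p where hH: "h \<in> H" and dI: "d \<in> I" and p: "reduced p" "p \<noteq> []" "tl p \<noteq> []" "hd p = d"
      "last p = arc_map h c0 \<or> last p = bar (arc_map h c0)" using cons.IH by blast
    have dA: "d \<in> arcs \<Gamma>" using dI I by blast
    let ?p = "map (arc_map s) p"
    have rp: "reduced ?p" by (rule reduced_map[OF sH p(1)])
    have hp: "hd ?p = arc_map s d" using p(2,4) by (simp add: hd_map)
    have hcA: "arc_map h c0 \<in> arcs \<Gamma>" using hH c0 by simp
    have "last ?p = arc_map s (last p)" using p(2) by (simp add: last_map)
    then have lp: "last ?p = arc_map (s \<otimes>\<^bsub>K\<^esub> h) c0 \<or> last ?p = bar (arc_map (s \<otimes>\<^bsub>K\<^esub> h) c0)"
      using p(5) sH hH c0 hcA by auto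
    have "\<exists>q. reduced (q @ ?p) \<and> q \<noteq> [] \<and> hd q = c"
    proof (cases "d = bar c")
      case True
      then have "reduced ([c] @ ?p)" using rp hp t p(2) by (simp add: reduced_Cons)
      then show ?thesis by (intro exI[of _ "[c]"]) simp
    next
      case False
      then have td: "tail \<Gamma> d = tail \<Gamma> c" using pairs[OF cons(1) dI] cons(5) by blast
      have "arc_map s d \<noteq> bar (arc_map s (bar c))"
        using arc_map_inj[OF sH dA cA] cons(5) sH cA by auto
      then have "reduced ([c, arc_map s (bar c)] @ ?p)"
        using rp hp t p(2) td sH cA dA by (simp add: reduced_Cons)
      then show ?thesis by (intro exI[of _ "[c, arc_map s (bar c)]"]) simp
    qed
    then obtain q where q: "reduced (q @ ?p)" "q \<noteq> []" "hd q = c" by blast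
    have "tl (q @ ?p) \<noteq> []" using q(2) p(2) by (cases q) auto
    moreover have "last (q @ ?p) = last ?p" using p(2) by simp
    ultimately have "?W c (arc_map (s \<otimes>\<^bsub>K\<^esub> h) c0)"
      using q lp p(2) by (intro exI[of _ "q @ ?p"]) simp
    then show ?case using sH hH cons(1) by simp
  qed
  then obtain p where cI: "c \<in> I" and p: "reduced p" "p \<noteq> []" "tl p \<noteq> []" "hd p = c" "last p = c0 \<or> last p = bar c0"
    using g(2) by auto
  have lA: "last p \<in> arcs \<Gamma>" using p(1,2) by (auto simp: reduced_def)
  have "tail \<Gamma> c = tail \<Gamma> (last p) \<or> tail \<Gamma> c = head \<Gamma> (last p)" using base[OF cI] p(5) c0 by auto
  then show False
  proof
    assume "tail \<Gamma> c = head \<Gamma> (last p)"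
    then show False using reduced_not_closed[OF p(1,2)] p(4) by simp
  next
    assume t: "tail \<Gamma> c = tail \<Gamma> (last p)"
    let ?q = "butlast p"
    have pq: "p = ?q @ [last p]" using p(2) by simp
    have qne: "?q \<noteq> []" using p(2,3) by (cases p) auto
    have "reduced (?q @ [last p])" using p(1) pq by simp
    then have "reduced ?q" "head \<Gamma> (last ?q) = tail \<Gamma> (last p)"
      using qne by (auto simp: reduced_def successively_append_iff)
    moreover have "hd ?q = c" using p(4) pq qne by (metis hd_append2)
    ultimately show False using reduced_not_closed[OF _ qne] t by simp
  qed
qed

text \<open>
  The classes of an equivalence relation on the star that is invariant under the vertex stabilizer form
  an invariant partition.
\<close>

lemma primitive_relation:
  assumes x: "x \<in> verts \<Gamma>"
    and refl: "\<And>a. a \<in> out_arcs \<Gamma> x \<Longrightarrow> r a a"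
    and sym: "\<And>a b. a \<in> out_arcs \<Gamma> x \<Longrightarrow> b \<in> out_arcs \<Gamma> x \<Longrightarrow> r a b \<Longrightarrow> r b a"
    and trans: "\<And>a b c. a \<in> out_arcs \<Gamma> x \<Longrightarrow> b \<in> out_arcs \<Gamma> x \<Longrightarrow> c \<in> out_arcs \<Gamma> x \<Longrightarrow> r a b \<Longrightarrow> r b c \<Longrightarrow> r a c"
    and inv: "\<And>h a b. h \<in> stab x \<Longrightarrow> a \<in> out_arcs \<Gamma> x \<Longrightarrow> b \<in> out_arcs \<Gamma> x \<Longrightarrow> r a b \<Longrightarrow> r (arc_map h a) (arc_map h b)"
  shows "(\<forall>a\<in>out_arcs \<Gamma> x. \<forall>b\<in>out_arcs \<Gamma> x. r a b) \<or> (\<forall>a\<in>out_arcs \<Gamma> x. \<forall>b\<in>out_arcs \<Gamma> x. r a b \<longrightarrow> a = b)"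
proof -
  let ?E = "out_arcs \<Gamma> x"
  let ?c = "\<lambda>a. {b \<in> ?E. r a b}"
  let ?B = "?c ` ?E"
  have "partition_on ?E ?B"
  proof (rule partition_onI)
    show "\<Union>?B = ?E" using refl by blast
    show "{} \<notin> ?B" using refl by blast
    show "disjnt p q" if p: "p \<in> ?B" and q: "q \<in> ?B" and ne: "p \<noteq> q" for p q
    proof (rule ccontr)
      obtain a where a: "a \<in> ?E" "p = ?c a" using p by blast
      obtain b where b: "b \<in> ?E" "q = ?c b" using q by blast
      note ab = a(1) b(1) a(2) b(2)
      assume "\<not> disjnt p q"
      then obtain d where d: "d \<in> ?E" "r a d" "r b d" unfolding disjnt_def ab by blast
      have rab: "r a b" using trans[OF ab(1) d(1) ab(2) d(2) sym[OF ab(2) d(1,3)]] .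
      have rba: "r b a" by (rule sym[OF ab(1,2) rab])
      have "?c a = ?c b" using trans[OF ab(1,2) _ rab] trans[OF ab(2,1) _ rba] by blast
      then show False using ne unfolding ab by blast
    qed
  qed
  moreover have "p ` B \<in> ?B" if p: "p \<in> local_action \<Gamma> H x" and B: "B \<in> ?B" for p B
  proof -
    obtain h where h: "h \<in> stab x" "p = induced x h"
      using p unfolding local_action_induced[OF order_refl] by blast
    have hH: "h \<in> H" using h by (simp add: stab_def)
    have ih: "inv\<^bsub>K\<^esub> h \<in> stab x" using subgroup.m_inv_closed[OF stab_subgroup[OF x] h(1)] .
    obtain a where a: "a \<in> ?E" "B = ?c a" using B by blast
    have haE: "arc_map h a \<in> ?E" by (rule stab_out_arcs[OF h(1) a(1)])
    have "p ` B = arc_map h ` B" unfolding h(2) a(2) induced_def by (rule image_cong) auto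
    also have "\<dots> = ?c (arc_map h a)"
    proof
      show "arc_map h ` B \<subseteq> ?c (arc_map h a)"
      proof
        fix b' assume "b' \<in> arc_map h ` B"
        then obtain b where b: "b \<in> ?E" "r a b" "b' = arc_map h b" unfolding a(2) by blast
        then show "b' \<in> ?c (arc_map h a)" using stab_out_arcs[OF h(1) b(1)] inv[OF h(1) a(1) b(1,2)] by blast
      qed
      show "?c (arc_map h a) \<subseteq> arc_map h ` B"
      proof
        fix b assume "b \<in> ?c (arc_map h a)"
        then have b: "b \<in> ?E" "r (arc_map h a) b" by blast+
        let ?b = "arc_map (inv\<^bsub>K\<^esub> h) b"
        have bE: "?b \<in> ?E" by (rule stab_out_arcs[OF ih b(1)])
        have "arc_map (inv\<^bsub>K\<^esub> h) (arc_map h a) = a" using act_inv(3)[OF hH] a(1) by simp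
        then have "r a ?b" using inv[OF ih haE b] by (simp only:)
        then have "?b \<in> B" unfolding a(2) using bE by (intro CollectI conjI)
        moreover have "b = arc_map h ?b" using act_inv(4)[OF hH] b(1) by simp
        ultimately show "b \<in> arc_map h ` B" by (rule rev_image_eqI)
      qed
    qed
    finally show ?thesis using haE by (rule image_eqI)
  qed
  ultimately have part: "partition_on ?E ?B \<and> (\<forall>p\<in>local_action \<Gamma> H x. \<forall>B\<in>?B. p ` B \<in> ?B)"
    by (intro conjI ballI)
  have "primitive_perms ?E (local_action \<Gamma> H x)"
    using primitive x unfolding locally_primitive_def by (rule bspec)
  from this[unfolded primitive_perms_def, THEN conjunct2, rule_format, OF part]
  have "?B = {?E} \<or> ?B = (\<lambda>x. {x}) ` ?E" .
  then show ?thesis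
  proof
    assume e: "?B = {?E}"
    have "r a b" if "a \<in> ?E" "b \<in> ?E" for a b
    proof -
      have "?c a \<in> ?B" using that(1) by (rule imageI)
      then have "?c a = ?E" unfolding e by simp
      then have "b \<in> ?c a" using that(2) by (simp only:)
      then show ?thesis by simp
    qed
    then show ?thesis by (intro disjI1 ballI)
  next
    assume e: "?B = (\<lambda>x. {x}) ` ?E"
    have "a = b" if "a \<in> ?E" "b \<in> ?E" "r a b" for a b
    proof -
      have "?c a \<in> ?B" using that(1) by (rule imageI)
      then have "\<exists>y. ?c a = {y}" unfolding e by (elim imageE) (rule exI)
      then obtain y where y: "?c a = {y}" by (elim exE)
      have "a \<in> ?c a" using that refl by (intro CollectI conjI)
      moreover have "b \<in> ?c a" using that by (intro CollectI conjI)
      ultimately show ?thesis unfolding y by simp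
    qed
    then show ?thesis by (intro disjI2 ballI impI)
  qed
qed

text \<open>
  Being in the same orbit of \<open>R\<close> is an invariant equivalence relation on the star.
\<close>

lemma primitive_normal_subgroup:
  assumes x: "x \<in> verts \<Gamma>" and R: "subgroup R K" "R \<subseteq> stab x"
    and conj: "\<And>h u. h \<in> stab x \<Longrightarrow> u \<in> R \<Longrightarrow> h \<otimes>\<^bsub>K\<^esub> u \<otimes>\<^bsub>K\<^esub> inv\<^bsub>K\<^esub> h \<in> R"
  shows "(\<forall>a\<in>out_arcs \<Gamma> x. \<forall>b\<in>out_arcs \<Gamma> x. \<exists>u\<in>R. arc_map u a = b) \<or>
    (\<forall>u\<in>R. \<forall>a\<in>out_arcs \<Gamma> x. arc_map u a = a)"
proof -
  let ?r = "\<lambda>a b. \<exists>u\<in>R. arc_map u a = b"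
  have RH: "u \<in> H" if "u \<in> R" for u using subgroup.mem_carrier[OF R(1) that] by simp
  have "(\<forall>a\<in>out_arcs \<Gamma> x. \<forall>b\<in>out_arcs \<Gamma> x. ?r a b) \<or> (\<forall>a\<in>out_arcs \<Gamma> x. \<forall>b\<in>out_arcs \<Gamma> x. ?r a b \<longrightarrow> a = b)"
  proof (rule primitive_relation[OF x])
    show "?r a a" if "a \<in> out_arcs \<Gamma> x" for a
      using that by (intro bexI[of _ "\<one>\<^bsub>K\<^esub>"] subgroup.one_closed[OF R(1)]) simp
    show "?r b a" if ab: "a \<in> out_arcs \<Gamma> x" "b \<in> out_arcs \<Gamma> x" and r: "?r a b" for a b
    proof -
      obtain d where d: "d \<in> R" "arc_map d a = b" using r by (elim bexE)
      from act_inv_eq(2)[OF RH[OF d(1)] _ d(2)] have "arc_map (inv\<^bsub>K\<^esub> d) b = a" using ab(1) by simp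
      then show ?thesis by (intro bexI[OF _ subgroup.m_inv_closed[OF R(1) d(1)]])
    qed
    show "?r a c" if "a \<in> out_arcs \<Gamma> x" "b \<in> out_arcs \<Gamma> x" "c \<in> out_arcs \<Gamma> x" and r: "?r a b" "?r b c" for a b c
    proof -
      obtain d e where d: "d \<in> R" "arc_map d a = b" and e: "e \<in> R" "arc_map e b = c"
        using r by (elim bexE)
      have "arc_map (e \<otimes>\<^bsub>K\<^esub> d) a = c" using act_mult(2)[OF RH[OF e(1)] RH[OF d(1)]] that(1) d(2) e(2) by simp
      then show ?thesis by (intro bexI[OF _ subgroup.m_closed[OF R(1) e(1) d(1)]])
    qed
    show "?r (arc_map h a) (arc_map h b)"
      if h: "h \<in> stab x" and ab: "a \<in> out_arcs \<Gamma> x" "b \<in> out_arcs \<Gamma> x" and r: "?r a b" for h a b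
    proof -
      obtain d where d: "d \<in> R" "arc_map d a = b" using r by (elim bexE)
      have H: "h \<in> H" "d \<in> H" using h RH[OF d(1)] by (auto simp: stab_def)
      have "arc_map (h \<otimes>\<^bsub>K\<^esub> d \<otimes>\<^bsub>K\<^esub> inv\<^bsub>K\<^esub> h) (arc_map h a) = arc_map h b"
        using H ab d(2) by simp
      then show ?thesis by (rule bexI[of _ "h \<otimes>\<^bsub>K\<^esub> d \<otimes>\<^bsub>K\<^esub> inv\<^bsub>K\<^esub> h"]) (rule conj[OF h d(1)])
    qed
  qed
  then show ?thesis
  proof
    assume t: "\<forall>a\<in>out_arcs \<Gamma> x. \<forall>b\<in>out_arcs \<Gamma> x. ?r a b \<longrightarrow> a = b"
    have "arc_map u a = a" if u: "u \<in> R" and a: "a \<in> out_arcs \<Gamma> x" for u a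
    proof -
      have r: "?r a (arc_map u a)" by (rule bexI[of _ u], rule refl, rule u)
      from mp[OF bspec[OF bspec[OF t a] stab_out_arcs[OF subsetD[OF R(2) u] a]] r] show ?thesis by (rule sym)
    qed
    then show ?thesis by (intro disjI2 ballI)
  qed (rule disjI1)
qed

end

section \<open>Commuting normal subgroups of a locally primitive group on a tree\<close>

text \<open>
  As \<open>A\<close> commutes with \<open>X\<close>, it commutes with the group generated by \<open>X\<close>, and the products form a group.
\<close>

lemma (in group) generate_factor:
  assumes A: "subgroup A G" and X: "X \<subseteq> carrier G" and comm: "\<And>a x. a \<in> A \<Longrightarrow> x \<in> X \<Longrightarrow> a \<otimes> x = x \<otimes> a"
    and u: "u \<in> generate G (A \<union> X)"
  shows "\<exists>a\<in>A. \<exists>c\<in>generate G X. u = a \<otimes> c"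
proof -
  let ?B = "generate G X"
  let ?W = "{u \<in> carrier G. \<exists>a\<in>A. \<exists>c\<in>?B. u = a \<otimes> c}"
  have B: "subgroup ?B G" by (rule generate_is_subgroup[OF X])
  have AG: "a \<in> carrier G" if "a \<in> A" for a by (rule subgroup.mem_carrier[OF A that])
  have BG: "b \<in> carrier G" if "b \<in> ?B" for b by (rule subgroup.mem_carrier[OF B that])
  have AB: "a \<otimes> b = b \<otimes> a" if "a \<in> A" "b \<in> ?B" for a b
    using that(2)
  proof induction
    case one
    then show ?case using AG[OF that(1)] by simp
  next
    case (incl h)
    then show ?case by (rule comm[OF that(1)])
  next
    case (inv h)
    have "h \<in> carrier G" using inv X by blast
    then show ?case using commute_inv[OF _ AG[OF that(1)] comm[OF that(1) inv, symmetric]] by simp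
  next
    case (eng h1 h2)
    show ?case
      by (rule commute_mult[OF BG[OF eng(1)] BG[OF eng(2)] AG[OF that(1)] eng.IH(1)[symmetric] eng.IH(2)[symmetric], symmetric])
  qed
  have W: "a \<otimes> c \<in> ?W" if "a \<in> A" "c \<in> ?B" for a c
    using that AG BG by (intro CollectI conjI m_closed) (simp, simp, intro bexI[of _ a] bexI[of _ c], simp_all)
  have "subgroup ?W G"
  proof (rule subgroupI)
    have "\<one> \<otimes> \<one> \<in> ?W" by (rule W[OF subgroup.one_closed[OF A] subgroup.one_closed[OF B]])
    then show "?W \<noteq> {}" by (rule ex_in_conv[THEN iffD1, OF exI])
    fix u assume "u \<in> ?W"
    then obtain a c where u: "a \<in> A" "c \<in> ?B" "u = a \<otimes> c" by (elim CollectE conjE bexE)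
    have i: "inv a \<in> A" "inv c \<in> ?B" using subgroup.m_inv_closed[OF A u(1)] subgroup.m_inv_closed[OF B u(2)] .
    have "inv u = inv c \<otimes> inv a" using inv_mult_group[OF AG[OF u(1)] BG[OF u(2)]] u(3) by simp
    also have "\<dots> = inv a \<otimes> inv c" using AB[OF i] by simp
    finally show "inv u \<in> ?W" using W[OF i] by simp
    fix v assume "v \<in> ?W"
    then obtain b d where v: "b \<in> A" "d \<in> ?B" "v = b \<otimes> d" by (elim CollectE conjE bexE)
    note c = AG[OF u(1)] BG[OF u(2)] AG[OF v(1)] BG[OF v(2)]
    have "u \<otimes> v = a \<otimes> (c \<otimes> b) \<otimes> d" unfolding u(3) v(3) using c by (simp add: m_assoc)
    also have "\<dots> = (a \<otimes> b) \<otimes> (c \<otimes> d)" unfolding AB[OF v(1) u(2), symmetric] using c by (simp add: m_assoc)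
    finally show "u \<otimes> v \<in> ?W" using W[OF subgroup.m_closed[OF A u(1) v(1)] subgroup.m_closed[OF B u(2) v(2)]] by simp
  qed auto
  moreover have "A \<union> X \<subseteq> ?W"
  proof
    fix x assume "x \<in> A \<union> X"
    then show "x \<in> ?W"
    proof
      assume x: "x \<in> A"
      then show ?thesis using W[OF x subgroup.one_closed[OF B]] AG[OF x] by simp
    next
      assume x: "x \<in> X"
      then have "x \<in> ?B" by (rule generate.incl)
      from W[OF subgroup.one_closed[OF A] this] show ?thesis using BG[OF \<open>x \<in> ?B\<close>] by simp
    qed
  qed
  ultimately have "u \<in> ?W" using generate_subgroup_incl[of "A \<union> X" ?W] u by (meson subsetD)
  then show ?thesis by (elim CollectE conjE)
qed

lemma (in group) generate_conj:
  assumes h: "h \<in> carrier G" and B: "subgroup B G" and X: "X \<subseteq> carrier G"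
    and conj: "\<And>x. x \<in> X \<Longrightarrow> h \<otimes> x \<otimes> inv h \<in> B" and u: "u \<in> generate G X"
  shows "h \<otimes> u \<otimes> inv h \<in> B"
  using u
proof induction
  case one
  then show ?case using subgroup.one_closed[OF B] h by simp
next
  case (incl x)
  then show ?case by (rule conj)
next
  case (inv x)
  have xG: "x \<in> carrier G" using inv X by blast
  have "inv (h \<otimes> x \<otimes> inv h) \<in> B" by (rule subgroup.m_inv_closed[OF B conj[OF inv]])
  then show ?case using h xG by (simp add: inv_mult_group m_assoc)
next
  case (eng a b)
  have G: "a \<in> carrier G" "b \<in> carrier G" using generate_in_carrier[OF X] eng by simp_all
  have "h \<otimes> (a \<otimes> b) \<otimes> inv h = (h \<otimes> a \<otimes> inv h) \<otimes> (h \<otimes> b \<otimes> inv h)" using h G by (simp add: m_assoc)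
  then show ?case using subgroup.m_closed[OF B eng.IH] by simp
qed

context graph_group
begin

lemma Hausdorff_K: "Hausdorff_space (topo K)"
  unfolding Hausdorff_space_def topspace_K
proof (intro allI impI, elim conjE)
  fix g h assume g: "g \<in> H" and h: "h \<in> H" and ne: "g \<noteq> h"
  have "\<exists>p\<in>points. g p \<noteq> h p"
  proof (rule ccontr)
    assume "\<not> ?thesis"
    then have "g = h"
      using autsD(1)[OF H_auts[OF g]] autsD(1)[OF H_auts[OF h]]
      by (intro extensionalityI[of _ points]) (auto simp: Bij_def)
    then show False using ne by simp
  qed
  then obtain p where p: "p \<in> points" "g p \<noteq> h p" by (elim bexE)
  have o: "openin (topo K) {k \<in> H. k p = q}" for q
    unfolding openin_K using p(1) by (intro conjI ballI exI[of _ "{p}"]) auto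
  show "\<exists>U V. openin (topo K) U \<and> openin (topo K) V \<and> g \<in> U \<and> h \<in> V \<and> disjnt U V"
    by (intro exI[of _ "{k \<in> H. k p = g p}"] exI[of _ "{k \<in> H. k p = h p}"] conjI o)
      (use g h p(2) in \<open>auto simp: disjnt_def\<close>)
qed

definition arc_stab :: "'e \<Rightarrow> ('v + 'e \<Rightarrow> 'v + 'e) set" where
  "arc_stab a = {h \<in> H. arc_map h a = a}"

lemma arc_stab_eq_fixator: "a \<in> arcs \<Gamma> \<Longrightarrow> arc_stab a = fixator {Inr a}"
  by (auto simp: arc_stab_def fixator_def)

lemma arc_stab_subgroup: "a \<in> arcs \<Gamma> \<Longrightarrow> subgroup (arc_stab a) K"
  using fixator_subgroup[of "{Inr a}"] by (simp add: arc_stab_eq_fixator)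

lemma arc_stab_open: "a \<in> arcs \<Gamma> \<Longrightarrow> openin (topo K) (arc_stab a)"
  using fixator_open[of "{Inr a}"] by (simp add: arc_stab_eq_fixator)

lemma arc_stab_bar: "a \<in> arcs \<Gamma> \<Longrightarrow> arc_stab (bar a) = arc_stab a"
  unfolding arc_stab_def
proof (intro Collect_cong conj_cong refl)
  fix h assume a: "a \<in> arcs \<Gamma>" and h: "h \<in> H"
  have "bar (arc_map h a) = bar a \<longleftrightarrow> arc_map h a = a" using a h by (metis act(4) arev_arev)
  then show "arc_map h (bar a) = bar a \<longleftrightarrow> arc_map h a = a" using a h by simp
qed

lemma arc_stab_subset_stab: "a \<in> arcs \<Gamma> \<Longrightarrow> arc_stab a \<subseteq> stab (tail \<Gamma> a)"
proof
  fix h assume a: "a \<in> arcs \<Gamma>" and "h \<in> arc_stab a"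
  then have "h \<in> H" "arc_map h a = a" by (simp_all add: arc_stab_def)
  then show "h \<in> stab (tail \<Gamma> a)" using act(5)[of h a] a by (simp add: stab_def)
qed

text \<open>
  Arc stabilizers are closed subsets of compact vertex stabilizers.
\<close>

lemma arc_stab_compact:
  assumes a: "a \<in> arcs \<Gamma>"
  shows "compactin (topo K) (arc_stab a)"
proof -
  have "openin (topo K) (H - arc_stab a)"
    unfolding openin_K
  proof (intro conjI ballI)
    fix g assume g: "g \<in> H - arc_stab a"
    have "{h \<in> H. \<forall>p\<in>{Inr a}. h p = g p} \<subseteq> H - arc_stab a"
      using g a by (auto simp: arc_stab_def)
    then show "\<exists>F. finite F \<and> F \<subseteq> points \<and> {h \<in> H. \<forall>p\<in>F. h p = g p} \<subseteq> H - arc_stab a"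
      using a by (intro exI[of _ "{Inr a}"]) auto
  qed auto
  then have "closedin (topo K) (arc_stab a)"
    by (simp add: closedin_def topspace_K) (auto simp: arc_stab_def)
  from closed_Int_compactin[OF this stab_compact[OF tail_in_verts[OF a]]] arc_stab_subset_stab[OF a]
  show ?thesis by (simp add: Int_absorb2)
qed

end


text \<open>
  In the application \<open>D\<close> is the quasi-center of the core, and \<open>\<M>\<close> consists of the preimages in the core of
  the minimal closed normal subgroups of the quotient.
\<close>

locale commuting_family = tree_group \<Gamma> bar H
  for \<Gamma> :: "('v, 'e) pre_digraph" and bar :: "'e \<Rightarrow> 'e" and H :: "('v + 'e \<Rightarrow> 'v + 'e) set" +
  fixes D :: "('v + 'e \<Rightarrow> 'v + 'e) set" and \<M> :: "('v + 'e \<Rightarrow> 'v + 'e) set set"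
  assumes D_normal: "D \<lhd> K" and D_misses: "D \<inter> nonfree = {}"
    and finite_family: "finite \<M>" and family_nonempty: "\<M> \<noteq> {}"
    and family_subgroup: "M \<in> \<M> \<Longrightarrow> subgroup M K"
    and family_closed: "M \<in> \<M> \<Longrightarrow> closedin (topo K) M"
    and family_meets: "M \<in> \<M> \<Longrightarrow> M \<inter> nonfree \<noteq> {}"
    and family_commutator: "\<lbrakk>M \<in> \<M>; M' \<in> \<M>; M \<noteq> M'; m \<in> M; m' \<in> M'\<rbrakk> \<Longrightarrow>
      m \<otimes>\<^bsub>K\<^esub> m' \<otimes>\<^bsub>K\<^esub> inv\<^bsub>K\<^esub> m \<otimes>\<^bsub>K\<^esub> inv\<^bsub>K\<^esub> m' \<in> D"
    and family_conj: "\<lbrakk>h \<in> H; M \<in> \<M>\<rbrakk> \<Longrightarrow> (\<lambda>m. h \<otimes>\<^bsub>K\<^esub> m \<otimes>\<^bsub>K\<^esub> inv\<^bsub>K\<^esub> h) ` M \<in> \<M>"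
begin

lemma family_subset: "M \<in> \<M> \<Longrightarrow> M \<subseteq> H"
  using subgroup.subset[OF family_subgroup] by simp

text \<open>
  The stabilizer of \<open>x\<close> in \<open>D\<close> is normal in that of \<open>H\<close>, so by primitivity it is transitive on the star of
  \<open>x\<close> or fixes it pointwise. In the first case \<open>D\<close> would be cocompact and meet \<open>nonfree\<close>.
\<close>

lemma D_stab_trivial:
  assumes x: "x \<in> verts \<Gamma>" and d: "d \<in> D" "d \<in> stab x"
  shows "d = \<one>\<^bsub>K\<^esub>"
proof -
  interpret D: normal D K by (rule D_normal)
  have DH: "D \<subseteq> H" by (rule normal_subset_H[OF D_normal])
  have S: "subgroup (stab x) K" by (rule stab_subgroup[OF x])
  have DS: "subgroup (D \<inter> stab x) K" by (rule K.subgroups_Inter_pair[OF D.subgroup_axioms S])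
  have conj: "h \<otimes>\<^bsub>K\<^esub> u \<otimes>\<^bsub>K\<^esub> inv\<^bsub>K\<^esub> h \<in> D \<inter> stab x" if h: "h \<in> stab x" and u: "u \<in> D \<inter> stab x" for h u
  proof
    have "h \<in> H" using h by (simp add: stab_def)
    then show "h \<otimes>\<^bsub>K\<^esub> u \<otimes>\<^bsub>K\<^esub> inv\<^bsub>K\<^esub> h \<in> D" using u by (intro D.inv_op_closed2) auto
    show "h \<otimes>\<^bsub>K\<^esub> u \<otimes>\<^bsub>K\<^esub> inv\<^bsub>K\<^esub> h \<in> stab x"
      using u h by (intro subgroup.m_closed[OF S] subgroup.m_inv_closed[OF S]) simp_all
  qed
  from primitive_normal_subgroup[OF x DS Int_lower2 conj] show ?thesis
  proof
    assume "\<forall>a\<in>out_arcs \<Gamma> x. \<forall>b\<in>out_arcs \<Gamma> x. \<exists>u\<in>D \<inter> stab x. arc_map u a = b"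
    then have "locally_transitive_at D x" unfolding locally_transitive_at_def .
    from cocompact_if_cofinite[OF D_normal cofinite_if_locally_transitive[OF D_normal x this]]
    have "cocompact_in K D" .
    then show ?thesis using dich.discrete_iff_misses(2)[OF D_normal] D_misses by simp
  next
    assume t: "\<forall>u\<in>D \<inter> stab x. \<forall>a\<in>out_arcs \<Gamma> x. arc_map u a = a"
    obtain a where a: "a \<in> out_arcs \<Gamma> x" using out_arcs_nonempty[OF x] by (metis all_not_in_conv)
    have "arc_map d a = a" by (rule bspec[OF bspec[OF t] a]) (use d in simp)
    then show ?thesis using eq_one_if_free_fixes_arc[OF d(1) DH D_misses, of a] a by simp
  qed
qed

text \<open>
  The commutator lies in \<open>D\<close> and fixes \<open>x\<close>.
\<close>

lemma family_commute:
  assumes M: "M \<in> \<M>" "M' \<in> \<M>" "M \<noteq> M'" and x: "x \<in> verts \<Gamma>"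
    and m: "m \<in> M \<inter> stab x" "m' \<in> M' \<inter> stab x"
  shows "m \<otimes>\<^bsub>K\<^esub> m' = m' \<otimes>\<^bsub>K\<^esub> m"
proof -
  have S: "subgroup (stab x) K" by (rule stab_subgroup[OF x])
  have G: "m \<in> H" "m' \<in> H" using m by (simp_all add: stab_def)
  let ?c = "m \<otimes>\<^bsub>K\<^esub> m' \<otimes>\<^bsub>K\<^esub> inv\<^bsub>K\<^esub> m \<otimes>\<^bsub>K\<^esub> inv\<^bsub>K\<^esub> m'"
  have cS: "?c \<in> stab x" using m by (intro subgroup.m_closed[OF S] subgroup.m_inv_closed[OF S]) simp_all
  have "?c \<in> D" using m by (intro family_commutator[OF M]) simp_all
  from D_stab_trivial[OF x this cS] have c: "?c = \<one>\<^bsub>K\<^esub>" .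
  have "m \<otimes>\<^bsub>K\<^esub> m' = ?c \<otimes>\<^bsub>K\<^esub> (m' \<otimes>\<^bsub>K\<^esub> m)" using G by (simp add: K.m_assoc)
  then show ?thesis unfolding c using G by simp
qed

definition same_type :: "'e \<Rightarrow> 'e \<Rightarrow> bool" where
  "same_type a b \<longleftrightarrow> (\<forall>M\<in>\<M>. M \<inter> arc_stab a = M \<inter> arc_stab b)"

lemma same_type_translate:
  assumes h: "h \<in> H" and ab: "a \<in> arcs \<Gamma>" "b \<in> arcs \<Gamma>" and s: "same_type a b"
  shows "same_type (arc_map h a) (arc_map h b)"
proof -
  have sub: "M \<inter> arc_stab (arc_map h a) \<subseteq> M \<inter> arc_stab (arc_map h b)"
    if M: "M \<in> \<M>" and ab: "a \<in> arcs \<Gamma>" "b \<in> arcs \<Gamma>" and s: "same_type a b" for M a b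
  proof
    fix m assume "m \<in> M \<inter> arc_stab (arc_map h a)"
    then have m: "m \<in> M" "m \<in> H" "arc_map m (arc_map h a) = arc_map h a" by (auto simp: arc_stab_def)
    let ?M = "(\<lambda>m. inv\<^bsub>K\<^esub> h \<otimes>\<^bsub>K\<^esub> m \<otimes>\<^bsub>K\<^esub> inv\<^bsub>K\<^esub> (inv\<^bsub>K\<^esub> h)) ` M"
    let ?m = "inv\<^bsub>K\<^esub> h \<otimes>\<^bsub>K\<^esub> m \<otimes>\<^bsub>K\<^esub> inv\<^bsub>K\<^esub> (inv\<^bsub>K\<^esub> h)"
    have "?M \<in> \<M>" using family_conj[of "inv\<^bsub>K\<^esub> h" M] h M by simp
    then have e: "?M \<inter> arc_stab a = ?M \<inter> arc_stab b" using s unfolding same_type_def by (rule bspec[rotated])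
    have "?m \<in> arc_stab a" using m h ab by (simp add: arc_stab_def)
    moreover have "?m \<in> ?M" using m(1) by (rule imageI)
    ultimately have "?m \<in> arc_stab b" using e by blast
    then have "arc_map (inv\<^bsub>K\<^esub> h) (arc_map m (arc_map h b)) = b" using m h ab by (simp add: arc_stab_def)
    then have "arc_map h (arc_map (inv\<^bsub>K\<^esub> h) (arc_map m (arc_map h b))) = arc_map h b" by simp
    then show "m \<in> M \<inter> arc_stab (arc_map h b)" using m h ab by (simp add: arc_stab_def)
  qed
  have ba: "same_type b a" using s by (simp add: same_type_def)
  show ?thesis unfolding same_type_def by (intro ballI equalityI sub[OF _ ab s] sub[OF _ ab(2,1) ba])
qed

text \<open>
  At a splitting vertex an arc can be recovered from its stabilizers in the members of \<open>\<M>\<close>. At any other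
  vertex, primitivity makes all arcs of the star indistinguishable in this sense.
\<close>

definition splitting :: "'v \<Rightarrow> bool" where
  "splitting x \<longleftrightarrow> x \<in> verts \<Gamma> \<and> (\<forall>a\<in>out_arcs \<Gamma> x. \<forall>b\<in>out_arcs \<Gamma> x. same_type a b \<longrightarrow> a = b)"

lemma splittingD:
  assumes "splitting x"
  shows "x \<in> verts \<Gamma>" "\<lbrakk>a \<in> out_arcs \<Gamma> x; b \<in> out_arcs \<Gamma> x; same_type a b\<rbrakk> \<Longrightarrow> a = b"
  using assms unfolding splitting_def by (simp, metis)

lemma same_type_if_not_splitting:
  assumes x: "x \<in> verts \<Gamma>" "\<not> splitting x" and ab: "a \<in> out_arcs \<Gamma> x" "b \<in> out_arcs \<Gamma> x"
  shows "same_type a b"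
proof -
  have "(\<forall>a\<in>out_arcs \<Gamma> x. \<forall>b\<in>out_arcs \<Gamma> x. same_type a b) \<or>
      (\<forall>a\<in>out_arcs \<Gamma> x. \<forall>b\<in>out_arcs \<Gamma> x. same_type a b \<longrightarrow> a = b)"
  proof (rule primitive_relation[OF x(1)])
    show "same_type (arc_map h a) (arc_map h b)"
      if "h \<in> stab x" "a \<in> out_arcs \<Gamma> x" "b \<in> out_arcs \<Gamma> x" "same_type a b" for h a b
      using that by (intro same_type_translate) (simp_all add: stab_def)
  qed (simp_all add: same_type_def)
  then show ?thesis using x ab unfolding splitting_def by (elim disjE) (simp_all del: out_arcs_iff)
qed

lemma splitting_translate:
  assumes s: "splitting x" and h: "h \<in> H"
  shows "splitting (vert_map h x)"
  unfolding splitting_def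
proof (intro conjI ballI impI)
  have x: "x \<in> verts \<Gamma>" using s by (simp add: splitting_def)
  then show "vert_map h x \<in> verts \<Gamma>" using h by simp
  fix a b assume a: "a \<in> out_arcs \<Gamma> (vert_map h x)" and b: "b \<in> out_arcs \<Gamma> (vert_map h x)" and ab: "same_type a b"
  have ih: "inv\<^bsub>K\<^esub> h \<in> H" using h by simp
  have "arc_map (inv\<^bsub>K\<^esub> h) a \<in> out_arcs \<Gamma> x" "arc_map (inv\<^bsub>K\<^esub> h) b \<in> out_arcs \<Gamma> x"
    using a b act(4,5)[OF ih] h x by simp_all
  moreover have "same_type (arc_map (inv\<^bsub>K\<^esub> h) a) (arc_map (inv\<^bsub>K\<^esub> h) b)"
    using a b by (intro same_type_translate[OF ih _ _ ab]) simp_all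
  ultimately have "arc_map (inv\<^bsub>K\<^esub> h) a = arc_map (inv\<^bsub>K\<^esub> h) b" using s by (simp add: splitting_def)
  then show "a = b" using arc_map_inj[OF ih] a b by simp
qed

text \<open>
  An element of \<open>M\<close> that fixes one arc at \<open>x\<close> and moves another distinguishes them.
\<close>

lemma splitting_if_nonfree:
  assumes M: "M \<in> \<M>" and x: "x \<in> verts \<Gamma>" and m: "m \<in> M" "m \<in> nonfree_at x"
  shows "splitting x" "m \<in> M \<inter> stab x"
proof -
  obtain a b where ab: "a \<in> out_arcs \<Gamma> x" "b \<in> out_arcs \<Gamma> x" "arc_map m a = a" "arc_map m b \<noteq> b" and mH: "m \<in> H"
    using m(2) unfolding nonfree_at_def by (elim CollectE conjE bexE)
  show "m \<in> M \<inter> stab x" using stab_if_fixes_arc[OF mH ab(1,1,3)] m(1) by simp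
  show "splitting x"
  proof (rule ccontr)
    assume "\<not> splitting x"
    from same_type_if_not_splitting[OF x this ab(1,2)] have "M \<inter> arc_stab a = M \<inter> arc_stab b"
      unfolding same_type_def using M by (rule bspec)
    moreover have "m \<in> M \<inter> arc_stab a" using m mH ab by (simp add: arc_stab_def)
    ultimately have "m \<in> arc_stab b" by blast
    then show False using ab by (simp add: arc_stab_def)
  qed
qed

definition vertex_part :: "('v + 'e \<Rightarrow> 'v + 'e) set set \<Rightarrow> 'v \<Rightarrow> ('v + 'e \<Rightarrow> 'v + 'e) set" where
  "vertex_part S x = generate K (\<Union>M\<in>S. M \<inter> stab x)"

definition arc_part :: "('v + 'e \<Rightarrow> 'v + 'e) set set \<Rightarrow> 'e \<Rightarrow> ('v + 'e \<Rightarrow> 'v + 'e) set" where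
  "arc_part S a = generate K (\<Union>M\<in>S. M \<inter> arc_stab a)"

lemma part_generators: "S \<subseteq> \<M> \<Longrightarrow> (\<Union>M\<in>S. M \<inter> X) \<subseteq> carrier K"
  using family_subset by auto

lemma vertex_part_subgroup: "S \<subseteq> \<M> \<Longrightarrow> subgroup (vertex_part S x) K"
  unfolding vertex_part_def by (rule K.generate_is_subgroup[OF part_generators])

lemma arc_part_subgroup: "S \<subseteq> \<M> \<Longrightarrow> subgroup (arc_part S a) K"
  unfolding arc_part_def by (rule K.generate_is_subgroup[OF part_generators])

lemma vertex_part_subset_stab: "x \<in> verts \<Gamma> \<Longrightarrow> vertex_part S x \<subseteq> stab x"
  unfolding vertex_part_def by (rule K.generate_subgroup_incl[OF _ stab_subgroup]) blast+

lemma arc_part_subset_arc_stab: "a \<in> arcs \<Gamma> \<Longrightarrow> arc_part S a \<subseteq> arc_stab a"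
  unfolding arc_part_def by (rule K.generate_subgroup_incl[OF _ arc_stab_subgroup]) blast+

lemma arc_part_subset_vertex_part: "a \<in> arcs \<Gamma> \<Longrightarrow> arc_part S a \<subseteq> vertex_part S (tail \<Gamma> a)"
  unfolding arc_part_def vertex_part_def
  using arc_stab_subset_stab[of a] by (intro K.mono_generate UN_mono Int_mono subset_refl)

lemma arc_part_bar: "a \<in> arcs \<Gamma> \<Longrightarrow> arc_part S (bar a) = arc_part S a"
  by (simp add: arc_part_def arc_stab_bar)

lemma vertex_part_factor:
  assumes S: "S \<subseteq> \<M>" and M: "M \<in> \<M>" "M \<notin> S" and x: "x \<in> verts \<Gamma>" and u: "u \<in> vertex_part (insert M S) x"
  shows "\<exists>m\<in>M \<inter> stab x. \<exists>c\<in>vertex_part S x. u = m \<otimes>\<^bsub>K\<^esub> c"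
  unfolding vertex_part_def
proof (rule K.generate_factor)
  show "subgroup (M \<inter> stab x) K" by (rule K.subgroups_Inter_pair[OF family_subgroup[OF M(1)] stab_subgroup[OF x]])
  show "(\<Union>M\<in>S. M \<inter> stab x) \<subseteq> carrier K" by (rule part_generators[OF S])
  show "u \<in> generate K ((M \<inter> stab x) \<union> (\<Union>M\<in>S. M \<inter> stab x))" using u by (simp add: vertex_part_def)
  fix a y assume a: "a \<in> M \<inter> stab x" and "y \<in> (\<Union>M\<in>S. M \<inter> stab x)"
  then obtain M' where y: "M' \<in> S" "y \<in> M' \<inter> stab x" by (elim UN_E)
  have "M' \<in> \<M>" "M \<noteq> M'" using y(1) S M(2) by auto
  from family_commute[OF M(1) this x a y(2)] show "a \<otimes>\<^bsub>K\<^esub> y = y \<otimes>\<^bsub>K\<^esub> a" .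
qed

lemma arc_part_factor:
  assumes S: "S \<subseteq> \<M>" and M: "M \<in> \<M>" "M \<notin> S" and x: "a \<in> arcs \<Gamma>" and u: "u \<in> arc_part (insert M S) a"
  shows "\<exists>m\<in>M \<inter> arc_stab a. \<exists>c\<in>arc_part S a. u = m \<otimes>\<^bsub>K\<^esub> c"
  unfolding arc_part_def
proof (rule K.generate_factor)
  show "subgroup (M \<inter> arc_stab a) K" by (rule K.subgroups_Inter_pair[OF family_subgroup[OF M(1)] arc_stab_subgroup[OF x]])
  show "(\<Union>M\<in>S. M \<inter> arc_stab a) \<subseteq> carrier K" by (rule part_generators[OF S])
  show "u \<in> generate K ((M \<inter> arc_stab a) \<union> (\<Union>M\<in>S. M \<inter> arc_stab a))" using u by (simp add: arc_part_def)
  fix b y assume b: "b \<in> M \<inter> arc_stab a" and "y \<in> (\<Union>M\<in>S. M \<inter> arc_stab a)"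
  then obtain M' where y: "M' \<in> S" "y \<in> M' \<inter> arc_stab a" by (elim UN_E)
  have "M' \<in> \<M>" "M \<noteq> M'" using y(1) S M(2) by auto
  from family_commute[OF M(1) this tail_in_verts[OF x], of b y] b y(2) arc_stab_subset_stab[OF x]
  show "b \<otimes>\<^bsub>K\<^esub> y = y \<otimes>\<^bsub>K\<^esub> b" by blast
qed

lemma vertex_part_commute:
  assumes S: "S \<subseteq> \<M>" and M: "M \<in> \<M>" "M \<notin> S" and x: "x \<in> verts \<Gamma>"
    and m: "m \<in> M \<inter> stab x" and c: "c \<in> vertex_part S x"
  shows "c \<otimes>\<^bsub>K\<^esub> m = m \<otimes>\<^bsub>K\<^esub> c"
proof -
  have "vertex_part S x \<subseteq> K.centralizer (M \<inter> stab x)"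
    unfolding vertex_part_def
  proof (rule K.generate_subgroup_incl)
    show "subgroup (K.centralizer (M \<inter> stab x)) K"
      using family_subset[OF M(1)] by (intro K.centralizer_subgroup) auto
    show "(\<Union>M\<in>S. M \<inter> stab x) \<subseteq> K.centralizer (M \<inter> stab x)"
    proof (intro subsetI K.centralizerI)
      fix y assume "y \<in> (\<Union>M\<in>S. M \<inter> stab x)"
      then obtain M' where y: "M' \<in> S" "y \<in> M' \<inter> stab x" by (elim UN_E)
      have M': "M' \<in> \<M>" "M' \<noteq> M" using y(1) S M(2) by auto
      show "y \<in> carrier K" using y(2) by (simp add: stab_def)
      show "y \<otimes>\<^bsub>K\<^esub> s = s \<otimes>\<^bsub>K\<^esub> y" if "s \<in> M \<inter> stab x" for s
        by (rule family_commute[OF M'(1) M(1) M'(2) x y(2) that])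
    qed
  qed
  then have "c \<in> K.centralizer (M \<inter> stab x)" using c by (rule subsetD)
  then show ?thesis using m by (rule K.centralizerD(2))
qed

lemma fixes_arc_conj:
  assumes H: "n \<in> H" "m \<in> H" and a: "a \<in> arcs \<Gamma>" "b \<in> arcs \<Gamma>" and ab: "arc_map n a = b"
    and c: "n \<otimes>\<^bsub>K\<^esub> m = m \<otimes>\<^bsub>K\<^esub> n"
  shows "arc_map m a = a \<longleftrightarrow> arc_map m b = b"
proof -
  have "arc_map n (arc_map m a) = arc_map m (arc_map n a)"
    using act_mult(2)[OF H a(1)] act_mult(2)[OF H(2,1) a(1)] c by simp
  then have e: "arc_map m b = arc_map n (arc_map m a)" using ab by simp
  have "arc_map m a \<in> arcs \<Gamma>" using H a by simp
  then show ?thesis unfolding e using arc_map_inj[OF H(1) _ a(1)] ab by metis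
qed

text \<open>
  By induction on \<open>S\<close>. Write \<open>u = n c\<close>, where \<open>n\<close> fixes \<open>x\<close> and lies in one member \<open>N\<close> of \<open>S\<close>, and \<open>c\<close> is a
  product of elements of the other members that fix \<open>x\<close>. As \<open>u\<close> fixes \<open>a\<close>, both \<open>c\<close> and the inverse of \<open>n\<close>
  map \<open>a\<close> to the same arc \<open>b\<close>. The stabilizer of \<open>x\<close> in \<open>N\<close> commutes with \<open>c\<close>, and those in the other members
  of \<open>\<M>\<close> commute with \<open>n\<close>, so \<open>a\<close> and \<open>b\<close> are of the same type. At a splitting vertex this means \<open>a = b\<close>,
  hence both factors fix \<open>a\<close>.
\<close>

lemma arc_part_if_fixes:
  assumes x: "splitting x" and a: "a \<in> out_arcs \<Gamma> x" and S: "S \<subseteq> \<M>"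
    and u: "u \<in> vertex_part S x" "arc_map u a = a"
  shows "u \<in> arc_part S a"
proof -
  have xV: "x \<in> verts \<Gamma>" using x by (simp add: splitting_def)
  have aA: "a \<in> arcs \<Gamma>" using a by simp
  have "finite S" using S finite_family by (rule finite_subset)
  then show ?thesis
    using S u
  proof (induction S arbitrary: u)
    case empty
    then show ?case by (simp add: vertex_part_def arc_part_def)
  next
    case (insert N S)
    have N: "N \<in> \<M>" and SM: "S \<subseteq> \<M>" using insert.prems(1) by simp_all
    obtain n c where nc: "n \<in> N \<inter> stab x" "c \<in> vertex_part S x" "u = n \<otimes>\<^bsub>K\<^esub> c"
      using vertex_part_factor[OF SM N insert.hyps(2) xV insert.prems(2)] by (elim bexE)
    have cS: "c \<in> stab x" using nc(2) vertex_part_subset_stab[OF xV] by (rule subsetD[rotated])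
    have H: "n \<in> H" "c \<in> H" using nc(1) cS by (simp_all add: stab_def)
    have cE: "arc_map c a \<in> out_arcs \<Gamma> x" by (rule stab_out_arcs[OF cS a])
    have cA: "arc_map c a \<in> arcs \<Gamma>" using cE by simp
    have na: "arc_map n (arc_map c a) = a" using insert.prems(3) act_mult(2)[OF H aA] unfolding nc(3) by simp
    have "same_type a (arc_map c a)"
      unfolding same_type_def
    proof (intro ballI)
      fix M assume M: "M \<in> \<M>"
      have "m \<in> arc_stab a \<longleftrightarrow> m \<in> arc_stab (arc_map c a)" if m: "m \<in> M \<inter> stab x" for m
      proof -
        have mH: "m \<in> H" using m by (simp add: stab_def)
        have "arc_map m a = a \<longleftrightarrow> arc_map m (arc_map c a) = arc_map c a"
        proof (cases "M = N")
          case True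
          have "c \<otimes>\<^bsub>K\<^esub> m = m \<otimes>\<^bsub>K\<^esub> c"
            using vertex_part_commute[OF SM N insert.hyps(2) xV _ nc(2)] m True by simp
          then show ?thesis by (rule fixes_arc_conj[OF H(2) mH aA cA refl])
        next
          case False
          have "n \<otimes>\<^bsub>K\<^esub> m = m \<otimes>\<^bsub>K\<^esub> n" by (rule family_commute[OF N M False[symmetric] xV nc(1) m])
          from fixes_arc_conj[OF H(1) mH cA aA na this] show ?thesis by simp
        qed
        then show ?thesis using mH by (simp add: arc_stab_def)
      qed
      moreover have "arc_stab a \<subseteq> stab x" "arc_stab (arc_map c a) \<subseteq> stab x"
        using arc_stab_subset_stab[OF aA] arc_stab_subset_stab[OF cA] a cE by simp_all
      ultimately show "M \<inter> arc_stab a = M \<inter> arc_stab (arc_map c a)" by blast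
    qed
    from splittingD(2)[OF x a cE this] have ca: "arc_map c a = a" by (rule sym)
    then have "arc_map n a = a" using na by simp
    then have "n \<in> arc_part (insert N S) a"
      unfolding arc_part_def using nc(1) H by (intro generate.incl UN_I[of N]) (simp_all add: arc_stab_def)
    moreover have "arc_part S a \<subseteq> arc_part (insert N S) a"
      unfolding arc_part_def by (rule K.mono_generate) blast
    then have "c \<in> arc_part (insert N S) a" using insert.IH[OF SM nc(2) ca] by (rule subsetD)
    ultimately show ?case unfolding nc(3) by (rule subgroup.m_closed[OF arc_part_subgroup[OF insert.prems(1)]])
  qed
qed

lemma vertex_part_conj:
  assumes h: "h \<in> H" and x: "x \<in> verts \<Gamma>" and u: "u \<in> vertex_part \<M> x"
  shows "h \<otimes>\<^bsub>K\<^esub> u \<otimes>\<^bsub>K\<^esub> inv\<^bsub>K\<^esub> h \<in> vertex_part \<M> (vert_map h x)"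
proof (rule K.generate_conj[OF _ vertex_part_subgroup[OF order_refl] part_generators[OF order_refl] _ u[unfolded vertex_part_def]])
  show "h \<in> carrier K" using h by simp
  fix m assume "m \<in> (\<Union>M\<in>\<M>. M \<inter> stab x)"
  then obtain M where M: "M \<in> \<M>" "m \<in> M" "m \<in> H" "vert_map m x = x" by (auto simp: stab_def)
  let ?m = "h \<otimes>\<^bsub>K\<^esub> m \<otimes>\<^bsub>K\<^esub> inv\<^bsub>K\<^esub> h"
  have "?m \<in> stab (vert_map h x)" using h M x by (simp add: stab_def)
  moreover have "?m \<in> (\<lambda>m. h \<otimes>\<^bsub>K\<^esub> m \<otimes>\<^bsub>K\<^esub> inv\<^bsub>K\<^esub> h) ` M" using M(2) by (rule imageI)
  ultimately show "?m \<in> vertex_part \<M> (vert_map h x)"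
    unfolding vertex_part_def by (intro generate.incl UN_I[OF family_conj[OF h M(1)]] IntI)
qed

text \<open>
  The vertex part is normal in the stabilizer of \<open>x\<close>. If it fixed the star pointwise, all arcs at \<open>x\<close> would
  be of the same type, so there could be only one.
\<close>

lemma vertex_part_transitive:
  assumes s: "splitting x" and ab: "a \<in> out_arcs \<Gamma> x" "b \<in> out_arcs \<Gamma> x"
  shows "\<exists>u\<in>vertex_part \<M> x. arc_map u a = b"
proof -
  let ?R = "vertex_part \<M> x"
  have x: "x \<in> verts \<Gamma>" by (rule splittingD(1)[OF s])
  have R: "subgroup ?R K" by (rule vertex_part_subgroup[OF order_refl])
  have conj: "h \<otimes>\<^bsub>K\<^esub> u \<otimes>\<^bsub>K\<^esub> inv\<^bsub>K\<^esub> h \<in> ?R" if "h \<in> stab x" "u \<in> ?R" for h u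
    using vertex_part_conj[OF _ x that(2), of h] that(1) by (simp add: stab_def)
  from primitive_normal_subgroup[OF x R vertex_part_subset_stab[OF x] conj] show ?thesis
  proof
    assume "\<forall>a\<in>out_arcs \<Gamma> x. \<forall>b\<in>out_arcs \<Gamma> x. \<exists>u\<in>?R. arc_map u a = b"
    then show ?thesis using ab by (simp del: out_arcs_iff)
  next
    assume t: "\<forall>u\<in>?R. \<forall>a\<in>out_arcs \<Gamma> x. arc_map u a = a"
    have fx: "arc_map m c = c" if M: "M \<in> \<M>" "m \<in> M \<inter> stab x" and c: "c \<in> out_arcs \<Gamma> x" for M m c
    proof -
      have "m \<in> ?R" unfolding vertex_part_def by (rule generate.incl, rule UN_I, rule M(1), rule M(2))
      from bspec[OF bspec[OF t this] c] show ?thesis .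
    qed
    have eq: "M \<inter> arc_stab c = M \<inter> stab x" if M: "M \<in> \<M>" and c: "c \<in> out_arcs \<Gamma> x" for M c
    proof
      show "M \<inter> arc_stab c \<subseteq> M \<inter> stab x" using arc_stab_subset_stab[of c] c by auto
      show "M \<inter> stab x \<subseteq> M \<inter> arc_stab c"
        using fx[OF M _ c] by (intro subsetI) (simp add: arc_stab_def stab_def)
    qed
    have "same_type a b" unfolding same_type_def using eq[OF _ ab(1)] eq[OF _ ab(2)] by simp
    then have "a = b" by (rule splittingD(2)[OF s ab])
    then show ?thesis using ab by (intro bexI[of _ "\<one>\<^bsub>K\<^esub>"] subgroup.one_closed[OF R]) simp
  qed
qed

text \<open>
  This group turns out to contain the core.
\<close>

definition split_part :: "('v + 'e \<Rightarrow> 'v + 'e) set" where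
  "split_part = generate K (\<Union>x\<in>Collect splitting. vertex_part \<M> x)"

lemma split_part_generators: "(\<Union>x\<in>Collect splitting. vertex_part \<M> x) \<subseteq> carrier K"
  using subgroup.subset[OF vertex_part_subgroup[OF order_refl]] by (intro UN_least)

lemma split_part_subgroup: "subgroup split_part K"
  unfolding split_part_def by (rule K.generate_is_subgroup[OF split_part_generators])

lemma vertex_part_subset_split_part: "splitting x \<Longrightarrow> vertex_part \<M> x \<subseteq> split_part"
  unfolding split_part_def by (intro subsetI generate.incl UN_I[of x]) simp_all

lemma split_part_normal: "split_part \<lhd> K"
  unfolding K.normal_inv_iff
proof (intro conjI ballI split_part_subgroup)
  fix h u assume h: "h \<in> carrier K" and u: "u \<in> split_part"
  show "h \<otimes>\<^bsub>K\<^esub> u \<otimes>\<^bsub>K\<^esub> inv\<^bsub>K\<^esub> h \<in> split_part"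
  proof (rule K.generate_conj[OF h split_part_subgroup split_part_generators _ u[unfolded split_part_def]])
    fix y assume "y \<in> (\<Union>x\<in>Collect splitting. vertex_part \<M> x)"
    then obtain x where x: "splitting x" "y \<in> vertex_part \<M> x" by (elim UN_E CollectE)
    have "x \<in> verts \<Gamma>" "h \<in> H" using x(1) h by (simp_all add: splitting_def)
    from vertex_part_conj[OF this(2,1) x(2)]
    show "h \<otimes>\<^bsub>K\<^esub> y \<otimes>\<^bsub>K\<^esub> inv\<^bsub>K\<^esub> h \<in> split_part"
      by (rule subsetD[OF vertex_part_subset_split_part[OF splitting_translate[OF x(1) \<open>h \<in> H\<close>]]])
  qed
qed

lemma split_part_meets: "split_part \<inter> nonfree \<noteq> {}" "\<exists>x. splitting x"
proof -
  obtain M where M: "M \<in> \<M>" using family_nonempty by (metis all_not_in_conv)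
  obtain m x where m: "m \<in> M" "x \<in> verts \<Gamma>" "m \<in> nonfree_at x"
    using family_meets[OF M] unfolding nonfree_def by auto
  note s = splitting_if_nonfree[OF M m(2,1,3)]
  have "m \<in> vertex_part \<M> x" unfolding vertex_part_def by (rule generate.incl, rule UN_I, rule M, rule s(2))
  then have "m \<in> split_part" using vertex_part_subset_split_part[OF s(1)] by (rule subsetD[rotated])
  moreover have "m \<in> nonfree" unfolding nonfree_def using m(2,3) by (rule UN_I)
  ultimately show "split_part \<inter> nonfree \<noteq> {}" by (intro ex_in_conv[THEN iffD1] exI[of _ m] IntI)
  show "\<exists>x. splitting x" using s(1) by (rule exI)
qed

lemma split_part_subset:
  assumes W: "subgroup W K" "\<Union>\<M> \<subseteq> W"
  shows "split_part \<subseteq> W"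
proof -
  have "vertex_part \<M> x \<subseteq> W" for x
    unfolding vertex_part_def using W(2) by (intro K.generate_subgroup_incl[OF _ W(1)]) blast
  then show ?thesis unfolding split_part_def by (intro K.generate_subgroup_incl[OF _ W(1)] UN_least)
qed

text \<open>
  If the vertex parts at the heads of the arcs in \<open>I\<close> generate a group whose translates of these heads
  include all splitting vertices, they generate \<open>split_part\<close> by conjugation, and ping-pong applies to
  them.
\<close>

lemma split_part_arc_covering:
  assumes I: "I \<subseteq> arcs \<Gamma>" "I \<noteq> {}" and c0: "c0 \<in> arcs \<Gamma>"
    and base: "\<And>c. c \<in> I \<Longrightarrow> tail \<Gamma> c0 = tail \<Gamma> c \<or> head \<Gamma> c0 = tail \<Gamma> c"
    and pairs: "\<And>c d. c \<in> I \<Longrightarrow> d \<in> I \<Longrightarrow> c \<noteq> d \<Longrightarrow> tail \<Gamma> d = tail \<Gamma> c \<or> d = bar c"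
    and heads: "\<And>c. c \<in> I \<Longrightarrow> splitting (head \<Gamma> c)"
    and parts: "\<And>c. c \<in> I \<Longrightarrow> arc_part \<M> c = C"
    and cover: "\<And>y. splitting y \<Longrightarrow>
      \<exists>n\<in>generate K (\<Union>c\<in>I. vertex_part \<M> (head \<Gamma> c)). \<exists>c\<in>I. y = vert_map n (head \<Gamma> c)"
    and g: "g \<in> split_part" "arc_map g c0 = c0"
  shows "g \<in> C"
proof -
  let ?N = "generate K (\<Union>c\<in>I. vertex_part \<M> (head \<Gamma> c))"
  have gens: "(\<Union>c\<in>I. vertex_part \<M> (head \<Gamma> c)) \<subseteq> carrier K"
    using subgroup.subset[OF vertex_part_subgroup[OF order_refl]] by (intro UN_least)
  have N: "subgroup ?N K" by (rule K.generate_is_subgroup[OF gens])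
  have NH: "n \<in> H" if "n \<in> ?N" for n using subgroup.mem_carrier[OF N that] by simp
  have "vertex_part \<M> y \<subseteq> ?N" if y: "splitting y" for y
  proof
    fix u assume u: "u \<in> vertex_part \<M> y"
    have yV: "y \<in> verts \<Gamma>" by (rule splittingD(1)[OF y])
    obtain n c where n: "n \<in> ?N" "c \<in> I" "y = vert_map n (head \<Gamma> c)" using cover[OF y] by (elim bexE)
    have nH: "n \<in> H" "inv\<^bsub>K\<^esub> n \<in> H" using NH[OF n(1)] by simp_all
    have cV: "head \<Gamma> c \<in> verts \<Gamma>" using n(2) I by auto
    have uH: "u \<in> H" using subgroup.mem_carrier[OF vertex_part_subgroup[OF order_refl] u] by simp
    have "inv\<^bsub>K\<^esub> n \<otimes>\<^bsub>K\<^esub> u \<otimes>\<^bsub>K\<^esub> n \<in> vertex_part \<M> (head \<Gamma> c)"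
      using vertex_part_conj[OF nH(2) yV u] nH cV unfolding n(3) by simp
    then have "inv\<^bsub>K\<^esub> n \<otimes>\<^bsub>K\<^esub> u \<otimes>\<^bsub>K\<^esub> n \<in> ?N" by (rule generate.incl[OF UN_I[where a = c, OF n(2)]])
    then have "n \<otimes>\<^bsub>K\<^esub> (inv\<^bsub>K\<^esub> n \<otimes>\<^bsub>K\<^esub> u \<otimes>\<^bsub>K\<^esub> n) \<otimes>\<^bsub>K\<^esub> inv\<^bsub>K\<^esub> n \<in> ?N"
      by (rule subgroup.m_closed[OF N subgroup.m_closed[OF N n(1)] subgroup.m_inv_closed[OF N n(1)]])
    then show "u \<in> ?N" using nH uH by (simp add: K.m_assoc)
  qed
  then have "split_part \<subseteq> ?N"
    unfolding split_part_def by (intro K.generate_subgroup_incl[OF _ N] UN_least) simp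
  then have gN: "g \<in> ?N" using g(1) by (rule subsetD)
  obtain c1 where "c1 \<in> I" using I(2) by (metis all_not_in_conv)
  then have C: "subgroup C K" using parts arc_part_subgroup[OF order_refl] by metis
  have bar: "bar c \<in> out_arcs \<Gamma> (head \<Gamma> c)" "c \<in> arcs \<Gamma>" if "c \<in> I" for c using that I by auto
  have part: "arc_part \<M> (bar c) = C" if "c \<in> I" for c
    using parts[OF that] arc_part_bar[OF bar(2)[OF that]] by simp
  show ?thesis
  proof (rule pingpong[OF I(1) c0 base pairs _ _ C _ _ gN g(2)])
    fix c assume c: "c \<in> I"
    show "subgroup (vertex_part \<M> (head \<Gamma> c)) K" by (rule vertex_part_subgroup[OF order_refl])
    show "C \<subseteq> vertex_part \<M> (head \<Gamma> c)"
      using arc_part_subset_vertex_part[of "bar c" \<M>] bar(1)[OF c] part[OF c] by simp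
    fix h assume h: "h \<in> vertex_part \<M> (head \<Gamma> c)"
    show "vert_map h (head \<Gamma> c) = head \<Gamma> c"
      using subsetD[OF vertex_part_subset_stab[OF splittingD(1)[OF heads[OF c]]] h] by (simp add: stab_def)
    assume "arc_map h (bar c) = bar c"
    from arc_part_if_fixes[OF heads[OF c] bar(1)[OF c] order_refl h this]
    show "h \<in> C" by (simp only: part[OF c])
  qed
qed

text \<open>
  For the arc \<open>a\<close> from \<open>x\<close> to \<open>z\<close> there are two cases. If \<open>z\<close> is splitting as well, \<open>split_part\<close> is generated
  by the vertex parts at \<open>x\<close> and \<open>z\<close>, since both are transitive on stars. If not, then the neighbors of
  \<open>z\<close> are splitting, the arcs at \<open>z\<close> are all of the same type and hence have the same arc part, and
  \<open>split_part\<close> is generated by the vertex parts at the neighbors of \<open>z\<close>. In either case it behaves like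
  an amalgam over the arc part of \<open>a\<close>.
\<close>

lemma split_part_arc_stab:
  assumes x: "splitting x" and a: "a \<in> out_arcs \<Gamma> x" and g: "g \<in> split_part" "arc_map g a = a"
  shows "g \<in> arc_part \<M> a"
proof -
  let ?z = "head \<Gamma> a"
  have xV: "x \<in> verts \<Gamma>" by (rule splittingD(1)[OF x])
  have aA: "a \<in> arcs \<Gamma>" and ax: "tail \<Gamma> a = x" using a by simp_all
  have zV: "?z \<in> verts \<Gamma>" using aA by simp
  \<comment> \<open>Transitivity on the star of a splitting vertex \<open>v\<close> moves \<open>b\<close> to any arc at the translate \<open>n v\<close>.\<close>
  have move: "\<exists>u\<in>vertex_part \<M> v. tail \<Gamma> e = vert_map (n \<otimes>\<^bsub>K\<^esub> u) (tail \<Gamma> b) \<and> head \<Gamma> e = vert_map (n \<otimes>\<^bsub>K\<^esub> u) (head \<Gamma> b)"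
    if v: "splitting v" and n: "n \<in> H" and e: "e \<in> arcs \<Gamma>" "tail \<Gamma> e = vert_map n v" and b: "b \<in> out_arcs \<Gamma> v"
    for v n e b
  proof -
    have vV: "v \<in> verts \<Gamma>" by (rule splittingD(1)[OF v])
    have i: "inv\<^bsub>K\<^esub> n \<in> H" using n by simp
    have "arc_map (inv\<^bsub>K\<^esub> n) e \<in> out_arcs \<Gamma> v" using act(4,5)[OF i] e n vV by simp
    from vertex_part_transitive[OF v b this] obtain u where
      u: "u \<in> vertex_part \<M> v" "arc_map u b = arc_map (inv\<^bsub>K\<^esub> n) e" by (elim bexE)
    have uH: "u \<in> H" using subgroup.mem_carrier[OF vertex_part_subgroup[OF order_refl] u(1)] by simp
    have bA: "b \<in> arcs \<Gamma>" using b by simp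
    have nu: "n \<otimes>\<^bsub>K\<^esub> u \<in> H" using n uH by simp
    have eq: "arc_map (n \<otimes>\<^bsub>K\<^esub> u) b = e" using act_mult(2)[OF n uH bA] u(2) e(1) n by simp
    show ?thesis using act(5,6)[OF nu bA] u(1) unfolding eq by blast
  qed
  show ?thesis
  proof (cases "splitting ?z")
    case True
    let ?I = "{a, bar a}"
    let ?N = "generate K (\<Union>c\<in>?I. vertex_part \<M> (head \<Gamma> c))"
    have incl: "vertex_part \<M> x \<subseteq> ?N" "vertex_part \<M> ?z \<subseteq> ?N"
      using ax aA by (auto intro: generate.incl)
    have gens: "(\<Union>c\<in>?I. vertex_part \<M> (head \<Gamma> c)) \<subseteq> carrier K"
      using subgroup.subset[OF vertex_part_subgroup[OF order_refl]] by (intro UN_least)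
    have N: "subgroup ?N K" by (rule K.generate_is_subgroup[OF gens])
    have NH: "n \<in> H" if "n \<in> ?N" for n using subgroup.mem_carrier[OF N that] by simp
    have cov: "\<exists>n\<in>?N. y = vert_map n x \<or> y = vert_map n ?z" if y: "y \<in> verts \<Gamma>" for y
      using xV y
    proof (induction rule: vertex_induct)
      case base
      show ?case using xV by (intro bexI[of _ "\<one>\<^bsub>K\<^esub>"] subgroup.one_closed[OF N]) simp
    next
      case (step e)
      then obtain n where n: "n \<in> ?N" "tail \<Gamma> e = vert_map n x \<or> tail \<Gamma> e = vert_map n ?z" by (elim bexE)
      from n(2) show ?case
      proof
        assume t: "tail \<Gamma> e = vert_map n x"
        from move[OF x NH[OF n(1)] step(1) t a] obtain u where
          u: "u \<in> vertex_part \<M> x" "head \<Gamma> e = vert_map (n \<otimes>\<^bsub>K\<^esub> u) ?z" by (elim bexE conjE)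
        show ?thesis
          by (rule bexI[of _ "n \<otimes>\<^bsub>K\<^esub> u"], rule disjI2[OF u(2)], rule subgroup.m_closed[OF N n(1) subsetD[OF incl(1) u(1)]])
      next
        assume t: "tail \<Gamma> e = vert_map n ?z"
        have "bar a \<in> out_arcs \<Gamma> ?z" using aA by simp
        from move[OF True NH[OF n(1)] step(1) t this] obtain u where
          u: "u \<in> vertex_part \<M> ?z" "head \<Gamma> e = vert_map (n \<otimes>\<^bsub>K\<^esub> u) x" using aA ax by auto
        show ?thesis
          by (rule bexI[of _ "n \<otimes>\<^bsub>K\<^esub> u"], rule disjI1[OF u(2)], rule subgroup.m_closed[OF N n(1) subsetD[OF incl(2) u(1)]])
      qed
    qed
    show ?thesis
    proof (rule split_part_arc_covering[of ?I a])
      fix y assume "splitting y"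
      from cov[OF splittingD(1)[OF this]] obtain n where n: "n \<in> ?N" "y = vert_map n x \<or> y = vert_map n ?z"
        by (elim bexE)
      have hx: "head \<Gamma> (bar a) = x" using aA ax by simp
      from n(2) have "\<exists>c\<in>?I. y = vert_map n (head \<Gamma> c)" using hx by auto
      then show "\<exists>n\<in>?N. \<exists>c\<in>?I. y = vert_map n (head \<Gamma> c)" by (rule bexI[of _ n]) (rule n(1))
    qed (use aA ax g x True arc_part_bar[OF aA] in auto)
  next
    case False
    let ?I = "out_arcs \<Gamma> ?z"
    let ?N = "generate K (\<Union>c\<in>?I. vertex_part \<M> (head \<Gamma> c))"
    have barI: "bar a \<in> ?I" using aA by simp
    have heads: "splitting (head \<Gamma> c)" if c: "c \<in> ?I" for c
    proof -
      obtain h where h: "h \<in> stab ?z" "arc_map h (bar a) = c" using stab_transitive[OF zV barI c] by (elim bexE)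
      have hH: "h \<in> H" using h(1) by (simp add: stab_def)
      have "bar a \<in> arcs \<Gamma>" using aA by simp
      from act(6)[OF hH this] have "head \<Gamma> c = vert_map h x" using h(2) aA ax by simp
      then show ?thesis using splitting_translate[OF x hH] by simp
    qed
    have incl: "vertex_part \<M> (head \<Gamma> c) \<subseteq> ?N" if "c \<in> ?I" for c
      using that by (intro subsetI generate.incl) (rule UN_I)
    have gens: "(\<Union>c\<in>?I. vertex_part \<M> (head \<Gamma> c)) \<subseteq> carrier K"
      using subgroup.subset[OF vertex_part_subgroup[OF order_refl]] by (intro UN_least)
    have N: "subgroup ?N K" by (rule K.generate_is_subgroup[OF gens])
    have NH: "n \<in> H" if "n \<in> ?N" for n using subgroup.mem_carrier[OF N that] by simp
    have cov: "\<exists>n\<in>?N. y = vert_map n ?z \<or> (\<exists>c\<in>?I. y = vert_map n (head \<Gamma> c))" if y: "y \<in> verts \<Gamma>" for y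
      using zV y
    proof (induction rule: vertex_induct)
      case base
      show ?case using zV by (intro bexI[of _ "\<one>\<^bsub>K\<^esub>"] subgroup.one_closed[OF N]) simp
    next
      case (step e)
      then obtain n where n: "n \<in> ?N" "tail \<Gamma> e = vert_map n ?z \<or> (\<exists>c\<in>?I. tail \<Gamma> e = vert_map n (head \<Gamma> c))"
        by (elim bexE)
      have nH: "n \<in> H" "inv\<^bsub>K\<^esub> n \<in> H" using NH[OF n(1)] by simp_all
      from n(2) show ?case
      proof
        assume t: "tail \<Gamma> e = vert_map n ?z"
        let ?c = "arc_map (inv\<^bsub>K\<^esub> n) e"
        have c: "?c \<in> ?I" using act(4,5)[OF nH(2)] step(1) t nH zV by simp
        then have "head \<Gamma> e = vert_map n (head \<Gamma> ?c)" using act(6)[OF nH(1), of ?c] nH step(1) by simp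
        then have ex: "\<exists>c\<in>?I. head \<Gamma> e = vert_map n (head \<Gamma> c)" by (rule bexI[of _ ?c]) (rule c)
        show ?thesis by (rule bexI[of _ n], rule disjI2, rule ex, rule n(1))
      next
        assume "\<exists>c\<in>?I. tail \<Gamma> e = vert_map n (head \<Gamma> c)"
        then obtain c where c: "c \<in> ?I" "tail \<Gamma> e = vert_map n (head \<Gamma> c)" by (elim bexE)
        have "bar c \<in> out_arcs \<Gamma> (head \<Gamma> c)" using c(1) by simp
        from move[OF heads[OF c(1)] nH(1) step(1) c(2) this] obtain u where
          u: "u \<in> vertex_part \<M> (head \<Gamma> c)" "head \<Gamma> e = vert_map (n \<otimes>\<^bsub>K\<^esub> u) ?z" using c(1) by auto
        show ?thesis
          by (rule bexI[of _ "n \<otimes>\<^bsub>K\<^esub> u"], rule disjI1[OF u(2)], rule subgroup.m_closed[OF N n(1) subsetD[OF incl[OF c(1)] u(1)]])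
      qed
    qed
    have gb: "arc_map g (bar a) = bar a"
      using g(2) subgroup.mem_carrier[OF split_part_subgroup g(1)] aA by simp
    show ?thesis
    proof (rule split_part_arc_covering[of ?I "bar a"])
      show "arc_part \<M> c = arc_part \<M> a" if c: "c \<in> ?I" for c
      proof -
        have "same_type c (bar a)" by (rule same_type_if_not_splitting[OF zV False c barI])
        then have "arc_part \<M> c = arc_part \<M> (bar a)" unfolding arc_part_def same_type_def by simp
        then show ?thesis by (simp only: arc_part_bar[OF aA])
      qed
      fix y assume y: "splitting y"
      from cov[OF splittingD(1)[OF y]] obtain n where
        n: "n \<in> ?N" "y = vert_map n ?z \<or> (\<exists>c\<in>?I. y = vert_map n (head \<Gamma> c))" by (elim bexE)
      have ne: "y \<noteq> vert_map n ?z"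
      proof
        assume e: "y = vert_map n ?z"
        have "splitting (vert_map (inv\<^bsub>K\<^esub> n) y)" using NH[OF n(1)] by (intro splitting_translate[OF y]) simp
        then show False using False e NH[OF n(1)] zV by simp
      qed
      from n(2) have "\<exists>c\<in>?I. y = vert_map n (head \<Gamma> c)"
        by (rule disjE) (rule notE[OF ne], assumption+)
      then show "\<exists>n\<in>?N. \<exists>c\<in>?I. y = vert_map n (head \<Gamma> c)" by (rule bexI[of _ n]) (rule n(1))
    next
      show "?I \<noteq> {}" using barI by (rule ex_in_conv[THEN iffD1, OF exI])
    qed (use aA g(1) gb heads in auto)
  qed
qed

text \<open>
  A product of finitely many compact groups that commute pairwise.
\<close>

lemma arc_part_compact:
  assumes a: "a \<in> arcs \<Gamma>" and S: "S \<subseteq> \<M>"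
  shows "compactin (topo K) (arc_part S a)"
proof -
  have "finite S" using S finite_family by (rule finite_subset)
  then show ?thesis
    using S
  proof (induction S)
    case empty
    have "arc_part {} a = {\<one>\<^bsub>K\<^esub>}" by (simp add: arc_part_def K.generate_empty)
    then show ?case by (simp add: topspace_K)
  next
    case (insert M S)
    have M: "M \<in> \<M>" and SM: "S \<subseteq> \<M>" using insert.prems by simp_all
    let ?A = "M \<inter> arc_stab a" and ?B = "arc_part S a"
    have comp: "compactin (prod_topology (topo K) (topo K)) (?A \<times> ?B)"
      using closed_Int_compactin[OF family_closed[OF M] arc_stab_compact[OF a]] insert.IH[OF SM]
      by (simp add: compactin_Times)
    have "continuous_map (prod_topology (topo K) (topo K)) (topo K) (\<lambda>p. fst p \<otimes>\<^bsub>K\<^esub> snd p)"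
      by (intro K.continuous_mult continuous_map_fst continuous_map_snd)
    from image_compactin[OF comp this]
    have "compactin (topo K) ((\<lambda>p. fst p \<otimes>\<^bsub>K\<^esub> snd p) ` (?A \<times> ?B))" .
    moreover have "(\<lambda>p. fst p \<otimes>\<^bsub>K\<^esub> snd p) ` (?A \<times> ?B) = arc_part (insert M S) a"
    proof
      have B: "arc_part S a \<subseteq> arc_part (insert M S) a" unfolding arc_part_def by (rule K.mono_generate) blast
      have A: "?A \<subseteq> arc_part (insert M S) a" unfolding arc_part_def by (auto intro: generate.incl)
      show "(\<lambda>p. fst p \<otimes>\<^bsub>K\<^esub> snd p) ` (?A \<times> ?B) \<subseteq> arc_part (insert M S) a"
      proof (rule image_subsetI)
        fix p assume "p \<in> ?A \<times> ?B"
        then have "fst p \<in> ?A" "snd p \<in> ?B" by (simp_all add: mem_Times_iff)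
        then show "fst p \<otimes>\<^bsub>K\<^esub> snd p \<in> arc_part (insert M S) a"
          by (intro subgroup.m_closed[OF arc_part_subgroup[OF insert.prems]] subsetD[OF A] subsetD[OF B])
      qed
      show "arc_part (insert M S) a \<subseteq> (\<lambda>p. fst p \<otimes>\<^bsub>K\<^esub> snd p) ` (?A \<times> ?B)"
      proof
        fix u assume "u \<in> arc_part (insert M S) a"
        from arc_part_factor[OF SM M insert.hyps(2) a this] obtain m c where
          "m \<in> ?A" "c \<in> ?B" "u = m \<otimes>\<^bsub>K\<^esub> c" by (elim bexE)
        then show "u \<in> (\<lambda>p. fst p \<otimes>\<^bsub>K\<^esub> snd p) ` (?A \<times> ?B)" by (intro image_eqI[of _ _ "(m, c)"]) simp_all
      qed
    qed
    ultimately show ?case by simp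
  qed
qed

text \<open>
  Its intersection with an open arc stabilizer is compact.
\<close>

lemma split_part_closed: "closedin (topo K) split_part"
proof -
  obtain x where x: "splitting x" using split_part_meets(2) by (elim exE)
  obtain a where a: "a \<in> out_arcs \<Gamma> x" using out_arcs_nonempty[OF splittingD(1)[OF x]] by (metis all_not_in_conv)
  have aA: "a \<in> arcs \<Gamma>" using a by simp
  have "split_part \<inter> arc_stab a = arc_part \<M> a"
  proof
    show "split_part \<inter> arc_stab a \<subseteq> arc_part \<M> a"
      using split_part_arc_stab[OF x a] by (intro subsetI) (simp add: arc_stab_def)
    show "arc_part \<M> a \<subseteq> split_part \<inter> arc_stab a"
      using arc_part_subset_arc_stab[OF aA] arc_part_subset_vertex_part[OF aA, of \<M>]
        vertex_part_subset_split_part[OF x] a by auto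
  qed
  then have "closedin (topo K) (split_part \<inter> arc_stab a)"
    using compactin_imp_closedin[OF Hausdorff_K arc_part_compact[OF aA order_refl]] by simp
  then show ?thesis
    by (rule K.closed_subgroup_if_relatively_closed[OF split_part_subgroup arc_stab_subgroup[OF aA] arc_stab_open[OF aA]])
qed

lemma core_subset_split_part: "cocompact_core K \<subseteq> split_part"
  by (rule dich.core_subset_if_closed_normal[OF split_part_normal split_part_closed split_part_meets(1)])

lemma core_subset_if_contains_family:
  "\<lbrakk>subgroup W K; \<Union>\<M> \<subseteq> W\<rbrakk> \<Longrightarrow> cocompact_core K \<subseteq> W"
  using core_subset_split_part split_part_subset by blast

text \<open>
  The form in which the splitting of arc stabilizers of the core descends to the quotient: the second
  factor commutes with \<open>M\<close> modulo \<open>D\<close>.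
\<close>

lemma core_arc_factor:
  "\<exists>a\<in>arcs \<Gamma>. \<forall>l\<in>cocompact_core K \<inter> arc_stab a. \<forall>M\<in>\<M>.
    \<exists>m\<in>M \<inter> arc_stab a. \<exists>c\<in>generate K (\<Union>(\<M> - {M})). l = m \<otimes>\<^bsub>K\<^esub> c"
proof -
  obtain x where x: "splitting x" using split_part_meets(2) by (elim exE)
  obtain a where a: "a \<in> out_arcs \<Gamma> x" using out_arcs_nonempty[OF splittingD(1)[OF x]] by (metis all_not_in_conv)
  have aA: "a \<in> arcs \<Gamma>" using a by simp
  show ?thesis
  proof (intro bexI[OF _ aA] ballI)
    fix l M assume l: "l \<in> cocompact_core K \<inter> arc_stab a" and M: "M \<in> \<M>"
    have "l \<in> split_part" "arc_map l a = a" using l core_subset_split_part by (auto simp: arc_stab_def)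
    from split_part_arc_stab[OF x a this] have "l \<in> arc_part (insert M (\<M> - {M})) a"
      using M by (simp add: insert_absorb)
    from arc_part_factor[OF Diff_subset M _ aA this] obtain m c where
      m: "m \<in> M \<inter> arc_stab a" "c \<in> arc_part (\<M> - {M}) a" "l = m \<otimes>\<^bsub>K\<^esub> c" by auto
    have "arc_part (\<M> - {M}) a \<subseteq> generate K (\<Union>(\<M> - {M}))"
      unfolding arc_part_def by (rule K.mono_generate) blast
    then have "c \<in> generate K (\<Union>(\<M> - {M}))" using m(2) by (rule subsetD)
    then show "\<exists>m\<in>M \<inter> arc_stab a. \<exists>c\<in>generate K (\<Union>(\<M> - {M})). l = m \<otimes>\<^bsub>K\<^esub> c"
      using m(1,3) by (intro bexI[of _ m] bexI[of _ c])
  qed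
qed

end

section \<open>The structure of closed locally semiprimitive groups\<close>

context tree_group
begin

text \<open>
  The compact open subgroup required by \<open>product_structure\<close> is the image of the stabilizer in the core of
  an arc at a splitting vertex.
\<close>

theorem product_of_topologically_simple_core_quotient:
  "product_of_topologically_simple dich.core_quotient"
proof -
  let ?D = "quasi_center dich.core_group" and ?L = "cocompact_core K"
  let ?p = "\<lambda>l. ?D #>\<^bsub>K\<^esub> l"
  obtain C where "closed_normal_structure dich.core_quotient C (dich.conjugation ` carrier K)"
    using dich.closed_normal_structure_core_quotient by (elim exE)
  then interpret S: closed_normal_structure dich.core_quotient C "dich.conjugation ` carrier K" .
  interpret L: top_group dich.core_group by (rule dich.top_group_core)
  have lift: "l \<in> ?L" "?p l \<in> M" if "l \<in> dich.lift M" for l M using that by (simp_all add: dich.lift_def)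
  have nontriv: "M \<in> nontrivial_closed_normal dich.core_quotient" if "M \<in> S.minimals" for M
    by (rule S.minimals_nontrivial_closed_normal[OF that])
  interpret F: commuting_family \<Gamma> bar H ?D "dich.lift ` S.minimals"
  proof (intro commuting_family.intro commuting_family_axioms.intro tree_group_axioms)
    show "?D \<lhd> K" by (rule dich.qc_core_normal)
    show "?D \<inter> nonfree = {}" by (rule dich.qc_core_misses)
    show "finite (dich.lift ` S.minimals)" using S.minimals_finite by simp
    show "dich.lift ` S.minimals \<noteq> {}" using S.minimals_exist by simp
    fix M' assume "M' \<in> dich.lift ` S.minimals"
    then obtain M where M: "M \<in> S.minimals" "M' = dich.lift M" by (elim imageE)
    show "subgroup M' K" "closedin (topo K) M'" "M' \<inter> nonfree \<noteq> {}"
      unfolding M(2) by (rule dich.lift_nontrivial[OF nontriv[OF M(1)]])+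
    show "(\<lambda>m. h \<otimes>\<^bsub>K\<^esub> m \<otimes>\<^bsub>K\<^esub> inv\<^bsub>K\<^esub> h) ` M' \<in> dich.lift ` S.minimals" if h: "h \<in> H" for h
    proof -
      have "dich.conjugation h ` M \<in> S.minimals" using h by (intro S.image_minimal[OF _ M(1)] imageI) simp
      then show ?thesis
        unfolding M(2) using dich.lift_conjugate[OF _ S.minimalsD(3)[OF M(1)], of h] h
        by (intro image_eqI[of _ _ "dich.conjugation h ` M"]) simp_all
    qed
    fix N' m n assume "N' \<in> dich.lift ` S.minimals" and ne: "M' \<noteq> N'" and mn: "m \<in> M'" "n \<in> N'"
    then obtain N where N: "N \<in> S.minimals" "N' = dich.lift N" by (elim imageE)
    have "M \<noteq> N" using ne M(2) N(2) by blast
    from S.minimals_commute[OF M(1) N(1) this lift(2)[OF mn(1)[unfolded M(2)]] lift(2)[OF mn(2)[unfolded N(2)]]]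
    show "m \<otimes>\<^bsub>K\<^esub> n \<otimes>\<^bsub>K\<^esub> inv\<^bsub>K\<^esub> m \<otimes>\<^bsub>K\<^esub> inv\<^bsub>K\<^esub> n \<in> ?D"
      using lift(1)[OF mn(1)[unfolded M(2)]] lift(1)[OF mn(2)[unfolded N(2)]]
      by (intro dich.commutator_in_quasi_center) simp_all
  qed
  obtain a where a: "a \<in> arcs \<Gamma>" and factor: "\<forall>l\<in>?L \<inter> arc_stab a. \<forall>M\<in>dich.lift ` S.minimals.
      \<exists>m\<in>M \<inter> arc_stab a. \<exists>c\<in>generate K (\<Union>(dich.lift ` S.minimals - {M})). l = m \<otimes>\<^bsub>K\<^esub> c"
    using F.core_arc_factor by (elim bexE)
  let ?V = "?L \<inter> arc_stab a"
  have DL: "?D \<subseteq> ?L" using subgroup.subset[OF normal_imp_subgroup[OF dich.qc_core_normal_in_core]] by simp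
  have hom: "group_hom dich.core_group dich.core_quotient ?p"
  proof (intro group_hom.intro group_hom_axioms.intro homI)
    show "?p x \<in> carrier dich.core_quotient" if "x \<in> carrier dich.core_group" for x
      using that by (auto simp: dich.rcosets_core)
    show "?p (x \<otimes>\<^bsub>dich.core_group\<^esub> y) = ?p x \<otimes>\<^bsub>dich.core_quotient\<^esub> ?p y"
      if "x \<in> carrier dich.core_group" "y \<in> carrier dich.core_group" for x y
      using that dich.core_mult_coset by simp
  qed (rule L.is_group S.is_group)+
  have V: "subgroup ?V K" by (rule K.subgroups_Inter_pair[OF dich.core_subgroup arc_stab_subgroup[OF a]])
  have VL: "subgroup ?V dich.core_group" using V K.subgroup_top_subgroup_iff[OF dich.core_subgroup] by simp
  have "product_structure dich.core_quotient C (dich.conjugation ` carrier K) (?p ` ?V)"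
  proof (intro product_structure.intro product_structure_axioms.intro)
    show "closed_normal_structure dich.core_quotient C (dich.conjugation ` carrier K)"
      by (rule S.closed_normal_structure_axioms)
    show "W = carrier dich.core_quotient" if W: "subgroup W dich.core_quotient" "\<Union>S.minimals \<subseteq> W" for W
    proof
      show "W \<subseteq> carrier dich.core_quotient" by (rule subgroup.subset[OF W(1)])
      have "\<Union>(dich.lift ` S.minimals) \<subseteq> dich.lift W" using W(2) by (auto simp: dich.lift_def)
      from F.core_subset_if_contains_family[OF dich.subgroup_lift[OF W(1)] this]
      have "?L \<subseteq> dich.lift W" .
      then show "carrier dich.core_quotient \<subseteq> W" by (auto simp: dich.rcosets_core dich.lift_def)
    qed
    show "subgroup (?p ` ?V) dich.core_quotient" by (rule group_hom.subgroup_img_is_subgroup[OF hom VL])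
    have "openin (topo dich.core_group) ?V"
      using arc_stab_open[OF a] by (simp add: openin_subtopology_Int2)
    from L.open_coset_projection[OF normal_imp_subgroup[OF dich.qc_core_normal_in_core] this]
    show "openin (topo dich.core_quotient) (?p ` ?V)" by simp
    have "compactin (topo K) ?V" by (rule closed_Int_compactin[OF dich.core_closed arc_stab_compact[OF a]])
    then have "compactin (topo dich.core_group) ?V" by (simp add: compactin_subtopology)
    from image_compactin[OF this L.continuous_coset_projection[of ?D]] DL
    show "compactin (topo dich.core_quotient) (?p ` ?V)" by simp
    fix u M assume "u \<in> ?p ` ?V" and M: "M \<in> S.minimals"
    then obtain l where l: "l \<in> ?V" "u = ?p l" by (elim imageE)
    let ?Z = "S.centralizer M"
    have Zsub: "subgroup (dich.lift ?Z) K"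
      by (rule dich.subgroup_lift[OF S.centralizer_subgroup[OF S.minimalsD(3)[OF M]]])
    obtain m c where m: "m \<in> dich.lift M \<inter> arc_stab a" and
      c: "c \<in> generate K (\<Union>(dich.lift ` S.minimals - {dich.lift M}))" and lmc: "l = m \<otimes>\<^bsub>K\<^esub> c"
      using bspec[OF bspec[OF factor l(1)] imageI[OF M]] by (elim bexE)
    have "\<Union>(dich.lift ` S.minimals - {dich.lift M}) \<subseteq> dich.lift ?Z"
    proof
      fix y assume "y \<in> \<Union>(dich.lift ` S.minimals - {dich.lift M})"
      then obtain N where N: "N \<in> S.minimals" "N \<noteq> M" "y \<in> dich.lift N" by auto
      have "?p y \<in> ?Z"
      proof (rule S.centralizerI)
        show "?p y \<in> carrier dich.core_quotient" using lift(2)[OF N(3)] S.minimalsD(3)[OF N(1)] by blast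
        show "?p y \<otimes>\<^bsub>dich.core_quotient\<^esub> s = s \<otimes>\<^bsub>dich.core_quotient\<^esub> ?p y" if "s \<in> M" for s
          by (rule S.minimals_commute[OF N(1) M N(2) lift(2)[OF N(3)] that])
      qed
      then show "y \<in> dich.lift ?Z" using lift(1)[OF N(3)] by (simp add: dich.lift_def)
    qed
    from K.generate_subgroup_incl[OF this Zsub] have cZ: "c \<in> dich.lift ?Z" using c by (rule subsetD)
    have mL: "m \<in> ?L" using m lift(1) by blast
    have cL: "c \<in> ?L" by (rule lift(1)[OF cZ])
    have pm: "?p m \<in> carrier dich.core_quotient" "?p c \<in> carrier dich.core_quotient"
      using mL cL by (auto simp: dich.rcosets_core)
    have "u = ?p m \<otimes>\<^bsub>dich.core_quotient\<^esub> ?p c"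
      unfolding l(2) lmc using dich.core_mult_coset[OF mL cL] by simp
    then have "inv\<^bsub>dich.core_quotient\<^esub> ?p m \<otimes>\<^bsub>dich.core_quotient\<^esub> u = ?p c"
      using S.inv_solve_left[OF pm(2) pm(1)] pm S.m_closed by metis
    then have "inv\<^bsub>dich.core_quotient\<^esub> ?p m \<otimes>\<^bsub>dich.core_quotient\<^esub> u \<in> ?Z" using lift(2)[OF cZ] by simp
    moreover have "?p m \<in> M \<inter> ?p ` ?V" using m mL lift(2)[of m M] by blast
    ultimately show "\<exists>x\<in>M \<inter> ?p ` ?V. inv\<^bsub>dich.core_quotient\<^esub> x \<otimes>\<^bsub>dich.core_quotient\<^esub> u \<in> ?Z"
      by (rule bexI)
  qed
  then show ?thesis by (rule product_of_topologically_simple_if_structure)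
qed

end

theorem theorem2p14:
  fixes \<Gamma> :: "('v, 'e) pre_digraph"
    and bar :: "'e \<Rightarrow> 'e"
    and H :: "('v + 'e \<Rightarrow> 'v + 'e) set"
  defines "K \<equiv> top_subgroup (Aut_graph \<Gamma> bar) H"
  defines "Kinf \<equiv> top_subgroup K (cocompact_core K)"
  defines "Q \<equiv> top_quotient Kinf (quasi_center Kinf)"
  assumes "bidirected_digraph \<Gamma> bar"
    and "locally_finite_graph \<Gamma>"
    and "Digraph_Component.connected \<Gamma>"
    and "subgroup H (Aut_graph \<Gamma> bar)"
    and "closedin (topo (Aut_graph \<Gamma> bar)) H"
    and "\<not> discrete_in (Aut_graph \<Gamma> bar) H"
    and "locally_semiprimitive \<Gamma> H"
  shows
    "minimal_in (closed_normal_cocompact K) (cocompact_core K)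
     \<and> (maximal_in (discrete_normal K) (quasi_center K) \<and> \<not> cocompact_in K (quasi_center K))
     \<and> (Q = top_quotient Kinf (quasi_center K \<inter> cocompact_core K)
        \<and> (\<exists>M. minimal_in (nontrivial_closed_normal Q) M)
        \<and> finite {M. minimal_in (nontrivial_closed_normal Q) M}
        \<and> (\<forall>M M'. minimal_in (nontrivial_closed_normal Q) M
              \<and> minimal_in (nontrivial_closed_normal Q) M' \<longrightarrow>
              (\<exists>h\<in>H. M' = (\<lambda>c. h <#\<^bsub>K\<^esub> c #>\<^bsub>K\<^esub> inv\<^bsub>K\<^esub> h) ` M))
        \<and> (\<forall>M. minimal_in (nontrivial_closed_normal Q) M \<longrightarrow>
              topologically_simple (top_subgroup Q M)))
     \<and> (serre_tree \<Gamma> bar \<and> locally_primitive \<Gamma> H \<longrightarrow> product_of_topologically_simple Q)"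
proof -
  have loc: "semiprimitive_group \<Gamma> bar H"
    using assms(4-) by (intro semiprimitive_group.intro graph_group.intro graph_automorphisms.intro
      graph_group_axioms.intro semiprimitive_group_axioms.intro)
  interpret S: semiprimitive_group \<Gamma> bar H by (rule loc)
  have K: "K = S.K" by (simp add: K_def S.K_def)
  have Kinf: "Kinf = S.dich.core_group" by (simp add: Kinf_def K)
  have Q: "Q = S.dich.core_quotient" by (simp add: Q_def Kinf)
  obtain C where "closed_normal_structure S.dich.core_quotient C (S.dich.conjugation ` carrier S.K)"
    using S.dich.closed_normal_structure_core_quotient by (elim exE)
  then interpret M: closed_normal_structure S.dich.core_quotient C "S.dich.conjugation ` carrier S.K" .
  have min: "minimal_in (nontrivial_closed_normal Q) M \<longleftrightarrow> M \<in> M.minimals" for M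
    by (simp add: M.minimals_def Q)
  show ?thesis
    unfolding min
  proof (intro conjI allI impI)
    show "minimal_in (closed_normal_cocompact K) (cocompact_core K)"
      unfolding K by (rule S.dich.cocompact_core_minimal)
    show "maximal_in (discrete_normal K) (quasi_center K)" unfolding K by (rule S.dich.quasi_center_maximal)
    show "\<not> cocompact_in K (quasi_center K)" unfolding K by (rule S.dich.quasi_center_not_cocompact)
    show "Q = top_quotient Kinf (quasi_center K \<inter> cocompact_core K)"
      unfolding Q_def Kinf_def K S.dich.quasi_center_core ..
    show "\<exists>M. M \<in> M.minimals" using M.minimals_exist by (simp add: ex_in_conv)
    show "finite {M. M \<in> M.minimals}" using M.minimals_finite by simp
    show "topologically_simple (top_subgroup Q M)" if "M \<in> M.minimals" for M
      unfolding Q by (rule M.minimals_simple[OF that])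
    show "\<exists>h\<in>H. M' = (\<lambda>c. h <#\<^bsub>K\<^esub> c #>\<^bsub>K\<^esub> inv\<^bsub>K\<^esub> h) ` M" if "M \<in> M.minimals \<and> M' \<in> M.minimals" for M M'
      using M.minimals_conjugate[of M M'] that unfolding K by (simp add: S.dich.conjugation_def)
    assume "serre_tree \<Gamma> bar \<and> locally_primitive \<Gamma> H"
    then have "tree_group \<Gamma> bar H"
      using loc by (intro tree_group.intro tree_group_axioms.intro) (auto simp: serre_tree_def)
    then show "product_of_topologically_simple Q"
      unfolding Q by (rule tree_group.product_of_topologically_simple_core_quotient)
  qed
qed

end
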